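(* For $r\in\mathbb{C}$, let $\mathbf{L}_{r^2}$ denote the projective equivalence class of germs of homogeneous nondegenerate Legendrian curves in $\mathbb{P}^3=\mathbb{P}(\mathbb{C}^4)$ represented by the projectivization of $\gamma(t)=\exp(tA)z$ with $z=(1,1,1,1)^\top$ and $A$ the following matrix: - for $r^2\neq 0,1$: $A=\mathrm{diag}(r,1,-1,-r)$; - for $r^2=1$: $A=\begin{pmatrix}1&1&0&0\\0&1&0&0\\0&0&-1&1\\0&0&0&-1\end{pmatrix}$; - for $r^2=0$: $A=\begin{pmatrix}1&0&0&0\\0&0&1&0\\0&0&0&0\\0&0&0&-1\end{pmatrix}$. Then $\mathbf{L}_{r^2}=\mathbf{L}_{1/r^2}$ for $r\neq0$, and the family $\{\mathbf{L}_{r^2}: r\in\mathbb{C}\}$ covers all projective equivalence classes of germs of homogeneous nondegenerate Legendrian curves $Z\subset\mathbb{P}^3$. Furthermore $\dim\mathfrak{aut}(Z)$, the relative invariant $q_0$ and the absolute invariant $\mathcal{I}$ are as follows: - $\mathbf{L}_9=\mathbf{L}_{1/9}$: $\dim\mathfrak{aut}(Z)=4$, $q_0=0$; - $\mathbf{L}_{r^2}=\mathbf{L}_{1/r^2}$ with $r^2\in\mathbb{C}\setminus\{0,\tfrac19,1,9\}$: $\dim\mathfrak{aut}(Z)=2$, $q_0\neq0$, $\mathcal{I}=\dfrac{(r^2+1)^2}{(r^2-9)(9r^2-1)}$; - $\mathbf{L}_1$: $\dim\mathfrak{aut}(Z)=2$, $q_0\ne0$, $\mathcal{I}=-\tfrac1{16}$;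 - $\mathbf{L}_0$: $\dim\mathfrak{aut}(Z)=2$, $q_0\neq0$, $\mathcal{I}=\tfrac19$. In particular, for $r^2\ne\widetilde r^2\in\mathbb{C}$, one has $\mathbf{L}_{r^2}=\mathbf{L}_{\widetilde r^2}$ if and only if $r^2\widetilde r^2=1$.
   Context: **Legendrian curves.** Let $V\cong\mathbb{C}^4$. A curve $Z\subset\mathbb{P}V$ is a (not necessarily closed) 1-dimensional complex submanifold, with affine cone $\widehat Z\subset V$. It is Legendrian if $\sigma(T_z\widehat Z,T_z\widehat Z)=0$ for all $z\in\widehat Z\setminus0$, for a symplectic form $\sigma$ on $V$ (any symplectic form on $V$ is allowed here). Osculating spaces: $T^{(1)}_z\widehat Z=T_z\widehat Z$, $T^{(i+1)}_z\widehat Z=T^{(i)}_z\widehat Z+\{\gamma^{(i+1)}(0):\gamma\text{ a curve in }\widehat Z,\gamma(0)=z\}$. A point $[z]\in Z$ is nondegenerate if $T^{(3)}_z\widehat Z=V$; $Z$ is nondegenerate if it has a nondegenerate point; germs of nondegenerate curves are taken at nondegenerate points. Let $\mathfrak{csp}(V)$ be the Lie algebra of endomorphisms preserving $\sigma$ up to scale, and $\mathfrak{aut}(Z)=\{u\in\mathfrak{csp}(V):u(z)\in T_z\widehat Z\ \forall z\in\widehat Z\}\supset\mathbb{C}\,\mathrm{Id}_V$. A nondegenerate Legendrian curve $Z$ is homogeneous if $\dim\mathfrak{aut}(Z)\geq2$. Projective equivalence means equivalence of (unparametrized) germs of curves under $Z\mapsto PZ$, $P\in\mathrm{GL}(4)$.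 **Invariants.** If a nondegenerate curve is locally $[u_0(t):u_1(t):u_2(t):u_3(t)]$, there is a unique linear ODE $u^{(4)}+p_3u'''+p_2u''+p_1u'+p_0u=0$ with $u_0,\dots,u_3$ as fundamental solutions; it is considered up to transformations $(\widetilde t,\widetilde u)=(\lambda(t),\mu(t)u)$. For a Legendrian curve the ODE can be brought by such a transformation to the Laguerre–Forsyth form $u^{(4)}+q_0(t)u=0$, and the residual transformations preserving this form are $(\widetilde t,\widetilde u)=\left(\frac{at+b}{ct+d},\frac{e}{(ct+d)^3}u\right)$, $a,b,c,d,e\in\mathbb{C}$. Under these, $q_0$ is a relative invariant (it is multiplied by $(\lambda')^{-4}$, $\lambda=\frac{at+b}{ct+d}$), so vanishing or not of the function $q_0$ is well defined ("$q_0\neq0$" means not identically zero). When $q_0\neq0$, set $\mathcal{R}=8q_0q_0''-9(q_0')^2$ and let $\mathcal{I}=-\dfrac{\mathcal{R}^2}{4096\,q_0^5}$, which is an absolute invariant (unchanged by the residual transformations). *)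

theory Defs
  imports "HOL-Complex_Analysis.Complex_Analysis"
begin

type_synonym cvec = "complex ^ 4"
type_synonym cmat = "complex ^ 4 ^ 4"

text \<open>Holomorphy and iterated complex derivatives of vector-valued functions, taken componentwise.\<close>

definition vholomorphic_on :: "(complex \<Rightarrow> cvec) \<Rightarrow> complex set \<Rightarrow> bool" where
  "vholomorphic_on \<gamma> T \<longleftrightarrow> (\<forall>i. (\<lambda>t. \<gamma> t $ i) holomorphic_on T)"

definition vderiv :: "nat \<Rightarrow> (complex \<Rightarrow> cvec) \<Rightarrow> complex \<Rightarrow> cvec" where
  "vderiv k \<gamma> t = (\<chi> i. (deriv ^^ k) (\<lambda>s. \<gamma> s $ i) t)"

definition mat_scale :: "complex \<Rightarrow> cmat \<Rightarrow> cmat" where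
  "mat_scale c A = (\<chi> i j. c * A $ i $ j)"

lemma vector_space_mat_scale: "vector_space mat_scale"
  by unfold_locales (simp_all add: mat_scale_def vec_eq_iff algebra_simps)

definition mat_dim :: "cmat set \<Rightarrow> nat" where
  "mat_dim S = vector_space.dim mat_scale S"

primrec mat_pow :: "cmat \<Rightarrow> nat \<Rightarrow> cmat" where
  "mat_pow A 0 = mat 1"
| "mat_pow A (Suc n) = A ** mat_pow A n"

definition mat_exp :: "cmat \<Rightarrow> cmat" where
  "mat_exp A = (\<Sum>n. mat_scale (1 / fact n) (mat_pow A n))"


text \<open>
  A subset of the projective space of lines in \<open>\<complex>\<^sup>4\<close> is represented by its punctured affine
  cone: a set \<open>Z\<close> of nonzero vectors closed under multiplication by nonzero scalars.  Open sets of
  the projective space are then the open sets of nonzero vectors with the same closure property.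
\<close>

definition is_cone :: "cvec set \<Rightarrow> bool" where
  "is_cone Z \<longleftrightarrow> (\<forall>c z. c \<noteq> 0 \<longrightarrow> z \<in> Z \<longrightarrow> c *s z \<in> Z)"

definition cone_over :: "(complex \<Rightarrow> cvec) \<Rightarrow> complex set \<Rightarrow> cvec set" where
  "cone_over \<gamma> T = {c *s \<gamma> t |c t. c \<noteq> 0 \<and> t \<in> T}"

text \<open>
  A 1-dimensional complex submanifold of the projective space: near each of its points it is
  the image of a holomorphic embedding \<open>t \<mapsto> [\<gamma> t]\<close>.  The map being an immersion means that
  \<open>\<gamma> t\<close> and \<open>\<gamma>' t\<close> are linearly independent; it being a homeomorphism onto its image is expressed
  on the level of cones by the map \<open>(c, t) \<mapsto> c \<gamma>(t)\<close>.
\<close>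

definition curve :: "cvec set \<Rightarrow> bool" where
  "curve Z \<longleftrightarrow> 0 \<notin> Z \<and> is_cone Z \<and>
     (\<forall>z\<in>Z. \<exists>U T \<gamma> g. open U \<and> is_cone U \<and> z \<in> U \<and> open T \<and> vholomorphic_on \<gamma> T \<and>
        (\<forall>t\<in>T. \<forall>a b. a *s \<gamma> t + b *s vderiv 1 \<gamma> t = 0 \<longrightarrow> a = 0 \<and> b = 0) \<and>
        homeomorphism ((- {0}) \<times> T) (Z \<inter> U) (\<lambda>(c, t). c *s \<gamma> t) g)"

text \<open>\<open>\<gamma>\<close> is a (germ at \<open>0\<close> of a) holomorphic curve, not necessarily immersed, in the cone \<open>Z\<close>
  with \<open>\<gamma> 0 = z\<close>.\<close>

definition arc_in :: "cvec set \<Rightarrow> cvec \<Rightarrow> (complex \<Rightarrow> cvec) \<Rightarrow> bool" where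
  "arc_in Z z \<gamma> \<longleftrightarrow> \<gamma> 0 = z \<and> (\<exists>e>0. vholomorphic_on \<gamma> (ball 0 e) \<and> \<gamma> ` ball 0 e \<subseteq> Z)"

definition tangent :: "cvec set \<Rightarrow> cvec \<Rightarrow> cvec set" where
  "tangent Z z = {vderiv 1 \<gamma> 0 |\<gamma>. arc_in Z z \<gamma>}"

text \<open>\<open>osculating Z z i\<close> is the osculating space of index \<open>i + 1\<close>.\<close>

primrec osculating :: "cvec set \<Rightarrow> cvec \<Rightarrow> nat \<Rightarrow> cvec set" where
  "osculating Z z 0 = tangent Z z"
| "osculating Z z (Suc i) =
     {v + vderiv (i + 2) \<gamma> 0 |v \<gamma>. v \<in> osculating Z z i \<and> arc_in Z z \<gamma>}"

definition nondegenerate_at :: "cvec set \<Rightarrow> cvec \<Rightarrow> bool" where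
  "nondegenerate_at Z z \<longleftrightarrow> z \<in> Z \<and> osculating Z z 2 = UNIV"


definition symplectic_form :: "(cvec \<Rightarrow> cvec \<Rightarrow> complex) \<Rightarrow> bool" where
  "symplectic_form \<sigma> \<longleftrightarrow>
     (\<forall>v. Vector_Spaces.linear (*s) (*) (\<sigma> v)) \<and>
     (\<forall>w. Vector_Spaces.linear (*s) (*) (\<lambda>v. \<sigma> v w)) \<and>
     (\<forall>v. \<sigma> v v = 0) \<and>
     (\<forall>v. (\<forall>w. \<sigma> v w = 0) \<longrightarrow> v = 0)"

definition legendrian :: "(cvec \<Rightarrow> cvec \<Rightarrow> complex) \<Rightarrow> cvec set \<Rightarrow> bool" where
  "legendrian \<sigma> Z \<longleftrightarrow> symplectic_form \<sigma> \<and> curve Z \<and>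
     (\<forall>z\<in>Z. \<forall>v\<in>tangent Z z. \<forall>w\<in>tangent Z z. \<sigma> v w = 0)"

definition csp :: "(cvec \<Rightarrow> cvec \<Rightarrow> complex) \<Rightarrow> cmat set" where
  "csp \<sigma> = {u. \<exists>c. \<forall>v w. \<sigma> (u *v v) w + \<sigma> v (u *v w) = c * \<sigma> v w}"

text \<open>
  Elements of \<open>aut \<sigma> Z\<close> are tangent to all of \<open>Z\<close>.  Hence only for connected \<open>Z\<close> is it determined by
  the germ of \<open>Z\<close> at one point; on a disconnected curve it may be smaller than for a component.
\<close>

definition aut :: "(cvec \<Rightarrow> cvec \<Rightarrow> complex) \<Rightarrow> cvec set \<Rightarrow> cmat set" where
  "aut \<sigma> Z = {u \<in> csp \<sigma>. \<forall>z\<in>Z. u *v z \<in> tangent Z z}"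

definition homogeneous :: "cvec set \<Rightarrow> bool" where
  "homogeneous Z \<longleftrightarrow> (\<exists>z. nondegenerate_at Z z) \<and> (\<exists>\<sigma>. legendrian \<sigma> Z \<and> 2 \<le> mat_dim (aut \<sigma> Z))"

text \<open>The pair \<open>(Z, z)\<close> stands for the germ of the curve \<open>Z\<close> at the point \<open>[z]\<close>.\<close>

definition homogeneous_germs :: "(cvec set \<times> cvec) set" where
  "homogeneous_germs = {(Z, z). homogeneous Z \<and> nondegenerate_at Z z}"

text \<open>
  Two germs are projectively equivalent if some \<open>P \<in> GL(4)\<close> maps the one to the other.
  Requiring \<open>P z = w\<close> instead of \<open>[P z] = [w]\<close> is no restriction, as \<open>P\<close> may be rescaled; and two
  cones that agree on a neighbourhood of the vector \<open>w\<close> agree on a neighbourhood of the line \<open>[w]\<close>.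
\<close>

definition proj_equiv :: "cvec set \<times> cvec \<Rightarrow> cvec set \<times> cvec \<Rightarrow> bool" where
  "proj_equiv = (\<lambda>(Z, z) (W, w). \<exists>P :: cmat. invertible P \<and> P *v z = w \<and>
     (\<exists>U. open U \<and> w \<in> U \<and> ((*v) P ` Z) \<inter> U = W \<inter> U))"


definition gen_mat :: "complex \<Rightarrow> cmat" where
  "gen_mat r =
    (if r\<^sup>2 = 1 then
       vector [vector [1, 1, 0, 0],
               vector [0, 1, 0, 0],
               vector [0, 0, -1, 1],
               vector [0, 0, 0, -1]]
     else if r\<^sup>2 = 0 then
       vector [vector [1, 0, 0, 0],
               vector [0, 0, 1, 0],
               vector [0, 0, 0, 0],
               vector [0, 0, 0, -1]]
     else
       vector [vector [r, 0, 0, 0],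
               vector [0, 1, 0, 0],
               vector [0, 0, -1, 0],
               vector [0, 0, 0, -r]])"

definition base_vec :: cvec where
  "base_vec = vector [1, 1, 1, 1]"

text \<open>
  The projectivized orbit is an embedded submanifold only locally in \<open>t\<close>.  For every \<open>r\<close>, one of the
  homogeneous coordinate ratios of \<open>exp(tA) z\<close> is \<open>exp (2 t)\<close> or \<open>1 + t\<close>, hence injective on the unit
  disc, which is therefore small enough.
\<close>

definition model_germ :: "complex \<Rightarrow> cvec set \<times> cvec" where
  "model_germ r =
     (cone_over (\<lambda>t. mat_exp (mat_scale t (gen_mat r)) *v base_vec) (ball 0 1), base_vec)"

text \<open>\<open>L_class r\<close> is the class \<open>\<^bold>L\<close> with index \<open>r\<^sup>2\<close>.\<close>

definition L_class :: "complex \<Rightarrow> (cvec set \<times> cvec) set" where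
  "L_class r = {g \<in> homogeneous_germs. proj_equiv (model_germ r) g}"


text \<open>
  The coordinates of \<open>u\<close> are a fundamental system of solutions on \<open>T\<close> of the linear ODE
  \<open>u'''' + p\<^sub>3 u''' + p\<^sub>2 u'' + p\<^sub>1 u' + p\<^sub>0 u = 0\<close>.
\<close>

definition fundamental_solutions ::
    "complex set \<Rightarrow> (nat \<Rightarrow> complex \<Rightarrow> complex) \<Rightarrow> (complex \<Rightarrow> cvec) \<Rightarrow> bool" where
  "fundamental_solutions T p u \<longleftrightarrow>
     (\<forall>k<4. p k holomorphic_on T) \<and> vholomorphic_on u T \<and>
     (\<forall>t\<in>T. vderiv 4 u t + (\<Sum>k<4. p k t *s vderiv k u t) = 0) \<and>
     (\<forall>c. (\<forall>t\<in>T. (\<Sum>i\<in>UNIV. c i * u t $ i) = 0) \<longrightarrow> (\<forall>i. c i = 0))"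

text \<open>
  \<open>p\<close> is the ODE on \<open>T\<close> of a local representation \<open>[u\<^sub>0 : u\<^sub>1 : u\<^sub>2 : u\<^sub>3]\<close> of the germ of \<open>Z\<close> at \<open>[z]\<close>.
  Any two representations of the germ differ by a transformation
  \<open>(t, u) \<mapsto> (\<lambda> t, \<mu> t u)\<close>, so the ODEs of the germ form one class under these transformations.
  That \<open>t \<mapsto> [u t]\<close> is an immersion follows from the Wronskian having no zeros.
\<close>

definition curve_ode ::
    "cvec set \<times> cvec \<Rightarrow> complex set \<Rightarrow> (nat \<Rightarrow> complex \<Rightarrow> complex) \<Rightarrow> bool" where
  "curve_ode = (\<lambda>(Z, z) T p. open T \<and> connected T \<and>
     (\<exists>u. fundamental_solutions T p u \<and> u ` T \<subseteq> Z \<and> (\<exists>t0\<in>T. \<exists>c. c \<noteq> 0 \<and> u t0 = c *s z)))"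

text \<open>The Laguerre--Forsyth forms \<open>u'''' + q u = 0\<close> of the germ, each with its domain.\<close>

definition laguerre_forsyth :: "cvec set \<times> cvec \<Rightarrow> (complex set \<times> (complex \<Rightarrow> complex)) set" where
  "laguerre_forsyth g = {(T, q). curve_ode g T (\<lambda>k. if k = 0 then q else (\<lambda>t. 0))}"

definition rel_inv_zero :: "cvec set \<times> cvec \<Rightarrow> bool" where
  "rel_inv_zero g \<longleftrightarrow> (\<forall>(T, q) \<in> laguerre_forsyth g. \<forall>t\<in>T. q t = 0)"

definition rel_inv_nonzero :: "cvec set \<times> cvec \<Rightarrow> bool" where
  "rel_inv_nonzero g \<longleftrightarrow> (\<forall>(T, q) \<in> laguerre_forsyth g. \<exists>t\<in>T. q t \<noteq> 0)"

definition R_fun :: "(complex \<Rightarrow> complex) \<Rightarrow> complex \<Rightarrow> complex" where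
  "R_fun q t = 8 * q t * (deriv ^^ 2) q t - 9 * (deriv q t)\<^sup>2"

definition I_fun :: "(complex \<Rightarrow> complex) \<Rightarrow> complex \<Rightarrow> complex" where
  "I_fun q t = - ((R_fun q t)\<^sup>2 / (4096 * (q t) ^ 5))"

text \<open>The absolute invariant of \<open>g\<close> is constant with value \<open>v\<close>; it is defined off the zeros of \<open>q\<close>.\<close>

definition abs_inv_is :: "cvec set \<times> cvec \<Rightarrow> complex \<Rightarrow> bool" where
  "abs_inv_is g v \<longleftrightarrow> (\<forall>(T, q) \<in> laguerre_forsyth g. \<forall>t\<in>T. q t \<noteq> 0 \<longrightarrow> I_fun q t = v)"

end

theory Submission
  imports Defs
begin

text \<open>A non-scalar infinitesimal automorphism \<open>u\<close> of a Legendrian curve restricts to a vector field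
  \<open>f + g d/dt\<close> on the cone. Where \<open>g\<close> does not vanish, rescaling and reparametrizing along its flow
  turns the curve into an orbit \<open>\<delta>' = u \<delta>\<close>; as \<open>u\<close> may be taken to preserve the symplectic form, its
  characteristic polynomial is even, so \<open>\<delta>'''' = p \<delta>'' + q \<delta>\<close> with constants that rescaling of \<open>t\<close>
  brings to \<open>p = 1 + r\<^sup>2\<close>, \<open>q = - r\<^sup>2\<close>. Where \<open>g\<close> vanishes, the Jordan type of \<open>u\<close> shows that the curve is
  a twisted cubic. Solutions of the same equation are projectively equivalent, which gives the list.
  The Laguerre-Forsyth forms of the equation are \<open>- (q + 9 p\<^sup>2/100) y\<^sup>4\<close> with \<open>y' = \<eta> y\<close> and
  \<open>\<eta>' = \<eta>\<^sup>2/2 + p y\<^sup>2/5\<close>, which gives the invariants, and the determining equations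
  \<open>f' = - 3/2 g''\<close>, \<open>g''' = (2p/5) g'\<close>, \<open>(9 p\<^sup>2 + 100 q) g' = 0\<close> give the dimension.\<close>

text \<open>Homogeneity provides a non-scalar field that may vanish at the very point where the germ
  is taken. No flow box is available there, so the zeros need an argument of their own; the twisted
  cubic that results has other fields, which move the point.

  The pair (p, q) matters only up to (p/k^2, q/k^4). It encodes the unordered pair of squared
  eigenvalues A, B with p = A + B and q = - A B. Scaling one of them to 1 leaves r^2 as the
  quotient, and exchanging them replaces r^2 by 1/r^2. The nilpotent pair (0, 0) escapes this
  normalization, but it belongs to the twisted cubic, which in another parameter has the pair (10,
  -9) with eigenvalues 1, -1, 3, -3.

  The number 9 p^2 + 100 q is at once the obstruction to symmetries beyond scalars and flow, and the
  constant in the Laguerre-Forsyth form. For p = 1 + r^2, q = - r^2 it equals (r^2 - 9)(9 r^2 - 1),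
  which singles out 9 and 1/9.

  Elements of \<open>aut\<close> are tangent to all of Z, whereas the equation is known near one
  point only. For dimension 4, linear fields found on a disc are therefore spread over a connected
  Z.\<close>

no_notation fps_nth (infixl \<open>$\<close> 75)

section \<open>Complex calculus for curves in \<complex>^4\<close>

text \<open>A relation between function, value and point, so that the rules for sums, products and
  compositions can be chained; iterated derivatives are read off from it through
  \<open>vderiv_Suc_eq\<close>.\<close>

definition has_vderiv :: "(complex \<Rightarrow> cvec) \<Rightarrow> cvec \<Rightarrow> complex \<Rightarrow> bool" where
  "has_vderiv \<gamma> d t \<longleftrightarrow> (\<forall>i. ((\<lambda>s. \<gamma> s $ i) has_field_derivative d $ i) (at t))"

lemma has_vderiv_add:
  "has_vderiv \<gamma> d t \<Longrightarrow> has_vderiv \<delta> e t \<Longrightarrow> has_vderiv (\<lambda>s. \<gamma> s + \<delta> s) (d + e) t"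
  unfolding has_vderiv_def by (auto intro!: derivative_eq_intros)

lemma has_vderiv_scale:
  "(a has_field_derivative a') (at t) \<Longrightarrow> has_vderiv \<gamma> d t \<Longrightarrow>
   has_vderiv (\<lambda>s. a s *s \<gamma> s) (a' *s \<gamma> t + a t *s d) t"
  unfolding has_vderiv_def by (auto intro!: derivative_eq_intros)

lemma has_vderiv_cmult: "has_vderiv \<gamma> d t \<Longrightarrow> has_vderiv (\<lambda>s. a *s \<gamma> s) (a *s d) t"
  using has_vderiv_scale[of "\<lambda>_. a" 0] by simp

lemma has_vderiv_matrix:
  "has_vderiv \<gamma> d t \<Longrightarrow> has_vderiv (\<lambda>s. P *v \<gamma> s) (P *v d) t"
  unfolding has_vderiv_def matrix_vector_mult_def
  by (auto intro!: derivative_eq_intros sum.cong simp: mult.commute)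

lemma has_vderiv_compose:
  assumes "has_vderiv \<gamma> d (l t)" "(l has_field_derivative l') (at t)"
  shows "has_vderiv (\<lambda>s. \<gamma> (l s)) (l' *s d) t"
  unfolding has_vderiv_def
proof
  fix i
  have "((\<lambda>s. \<gamma> s $ i) has_field_derivative d $ i) (at (l t))"
    using assms by (auto simp: has_vderiv_def)
  from DERIV_chain2[OF this assms(2)]
  show "((\<lambda>s. \<gamma> (l s) $ i) has_field_derivative (l' *s d) $ i) (at t)"
    by (simp add: mult.commute)
qed

lemma has_vderiv_unique: "has_vderiv \<gamma> d t \<Longrightarrow> has_vderiv \<gamma> e t \<Longrightarrow> d = e"
  unfolding has_vderiv_def vec_eq_iff using DERIV_unique by blast

lemma has_vderiv_transform:
  assumes "has_vderiv \<gamma> d t" "open T" "t \<in> T" "\<And>s. s \<in> T \<Longrightarrow> \<delta> s = \<gamma> s"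
  shows "has_vderiv \<delta> d t"
  unfolding has_vderiv_def
proof
  fix i show "((\<lambda>s. \<delta> s $ i) has_field_derivative d $ i) (at t)"
    by (rule has_field_derivative_transform_within_open[of "\<lambda>s. \<gamma> s $ i" _ _ T])
       (use assms in \<open>auto simp: has_vderiv_def\<close>)
qed

lemma vderiv_0 [simp]: "vderiv 0 \<gamma> = \<gamma>"
  by (auto simp: vderiv_def vec_eq_iff)

lemma vholomorphic_vderiv:
  assumes "vholomorphic_on \<gamma> T" "open T"
  shows "vholomorphic_on (vderiv k \<gamma>) T"
  using assms unfolding vholomorphic_on_def vderiv_def
  by (auto intro!: holomorphic_higher_deriv)

lemma has_vderiv_vderiv:
  assumes "vholomorphic_on \<gamma> T" "open T" "t \<in> T"
  shows "has_vderiv (vderiv k \<gamma>) (vderiv (Suc k) \<gamma> t) t"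
  unfolding has_vderiv_def
proof
  fix i
  have "(deriv ^^ k) (\<lambda>s. \<gamma> s $ i) holomorphic_on T"
    using assms by (auto intro!: holomorphic_higher_deriv simp: vholomorphic_on_def)
  from holomorphic_derivI[OF this assms(2,3)]
  show "((\<lambda>s. vderiv k \<gamma> s $ i) has_field_derivative vderiv (Suc k) \<gamma> t $ i) (at t)"
    by (simp add: vderiv_def)
qed

text \<open>The induction step behind the explicit computations of higher derivatives: a closed form
  for order \<open>k\<close> has to hold on an open set, and differentiating it at a point gives the
  next order there.\<close>

lemma vderiv_Suc_eq:
  assumes "open T" "t \<in> T" "\<And>s. s \<in> T \<Longrightarrow> vderiv k \<gamma> s = \<eta> s" "has_vderiv \<eta> d t"
  shows "vderiv (Suc k) \<gamma> t = d"
proof -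
  have "has_vderiv (vderiv k \<gamma>) d t"
    by (rule has_vderiv_transform[OF assms(4,1,2)]) (use assms(3) in auto)
  then have "deriv (\<lambda>s. vderiv k \<gamma> s $ i) t = d $ i" for i
    by (auto simp: has_vderiv_def intro!: DERIV_imp_deriv)
  then show ?thesis
    by (simp add: vec_eq_iff vderiv_def)
qed

lemma vderiv_1_eq: "has_vderiv \<gamma> d t \<Longrightarrow> vderiv 1 \<gamma> t = d"
  using vderiv_Suc_eq[of UNIV t 0 \<gamma> \<gamma> d] by simp

lemma vholomorphic_onI:
  assumes "\<And>t. t \<in> T \<Longrightarrow> has_vderiv \<gamma> (d t) t"
  shows "vholomorphic_on \<gamma> T"
  unfolding vholomorphic_on_def holomorphic_on_def
  using assms unfolding has_vderiv_def
  by (meson field_differentiable_at_within field_differentiable_def)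

lemma vderiv_cong_open:
  assumes "open T" "t \<in> T" "\<And>s. s \<in> T \<Longrightarrow> \<gamma> s = \<delta> s"
  shows "vderiv k \<gamma> t = vderiv k \<delta> t"
proof -
  have "(deriv ^^ k) (\<lambda>s. \<gamma> s $ i) t = (deriv ^^ k) (\<lambda>s. \<delta> s $ i) t" for i
    by (rule higher_deriv_cong_ev)
       (use assms eventually_nhds in \<open>auto intro!: eventually_nhds_in_open[THEN eventually_mono, of T]\<close>)
  then show ?thesis by (simp add: vderiv_def)
qed

lemma vholomorphic_subset: "vholomorphic_on \<gamma> T \<Longrightarrow> S \<subseteq> T \<Longrightarrow> vholomorphic_on \<gamma> S"
  unfolding vholomorphic_on_def using holomorphic_on_subset by blast

lemma vholomorphic_matrix: "vholomorphic_on \<gamma> T \<Longrightarrow> vholomorphic_on (\<lambda>t. P *v \<gamma> t) T"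
  unfolding vholomorphic_on_def matrix_vector_mult_def
  by (auto intro!: holomorphic_intros)

lemma vholomorphic_add:
  "vholomorphic_on \<gamma> T \<Longrightarrow> vholomorphic_on \<delta> T \<Longrightarrow> vholomorphic_on (\<lambda>t. \<gamma> t + \<delta> t) T"
  unfolding vholomorphic_on_def by (auto intro!: holomorphic_intros)

lemma vholomorphic_scale:
  "f holomorphic_on T \<Longrightarrow> vholomorphic_on \<gamma> T \<Longrightarrow> vholomorphic_on (\<lambda>t. f t *s \<gamma> t) T"
  unfolding vholomorphic_on_def by (auto intro!: holomorphic_intros)

lemma vholomorphic_compose:
  "vholomorphic_on \<gamma> T \<Longrightarrow> l holomorphic_on S \<Longrightarrow> l ` S \<subseteq> T \<Longrightarrow> vholomorphic_on (\<lambda>s. \<gamma> (l s)) S"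
  unfolding vholomorphic_on_def
  using holomorphic_on_compose_gen[of l S _ T, unfolded o_def] by blast

lemma vderiv_matrix:
  assumes "vholomorphic_on \<gamma> T" "open T" "t \<in> T"
  shows "vderiv k (\<lambda>s. P *v \<gamma> s) t = P *v vderiv k \<gamma> t"
  using assms(3)
proof (induction k arbitrary: t)
  case (Suc k)
  show ?case
    by (rule vderiv_Suc_eq[OF assms(2) Suc.prems Suc.IH])
       (auto intro!: has_vderiv_matrix has_vderiv_vderiv[OF assms(1,2)] Suc.prems)
qed simp

lemma continuous_on_vholomorphic: "vholomorphic_on \<gamma> T \<Longrightarrow> continuous_on T \<gamma>"
  unfolding vholomorphic_on_def continuous_on_def
  using holomorphic_on_imp_continuous_on[unfolded continuous_on_def]
  by (blast intro!: vec_tendstoI)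

lemma vholomorphic_eq_on_connected:
  assumes "vholomorphic_on \<gamma> T" "vholomorphic_on \<delta> T" "open T" "connected T" "t0 \<in> T"
    and "\<And>k. vderiv k \<gamma> t0 = vderiv k \<delta> t0" "t \<in> T"
  shows "\<gamma> t = \<delta> t"
proof -
  have "\<gamma> t $ i = \<delta> t $ i" for i
    by (rule holomorphic_fun_eq_on_connected[where S=T and z=t0])
       (use assms in \<open>auto simp: vholomorphic_on_def vderiv_def vec_eq_iff\<close>)
  then show ?thesis by (simp add: vec_eq_iff)
qed

lemma vholomorphic_eq_on_open:
  assumes "vholomorphic_on \<gamma> T" "vholomorphic_on \<delta> T" "open T" "connected T"
    and "open V" "V \<noteq> {}" "V \<subseteq> T" "\<And>t. t \<in> V \<Longrightarrow> \<gamma> t = \<delta> t" "t \<in> T"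
  shows "\<gamma> t = \<delta> t"
proof -
  obtain t0 where "t0 \<in> V" using assms by auto
  then show ?thesis
    using vholomorphic_eq_on_connected[OF assms(1-4), of t0 t] vderiv_cong_open[OF assms(5)] assms
    by blast
qed

subsection \<open>Bases\<close>

text \<open>Written with explicit coefficients, so that comparing coefficients in a vector equation
  is mere instantiation. That four such vectors also span is \<open>basis4_span\<close>.\<close>

definition basis4 :: "cvec \<Rightarrow> cvec \<Rightarrow> cvec \<Rightarrow> cvec \<Rightarrow> bool" where
  "basis4 e0 e1 e2 e3 \<longleftrightarrow>
     (\<forall>a b c d. a *s e0 + b *s e1 + c *s e2 + d *s e3 = 0 \<longrightarrow> a = 0 \<and> b = 0 \<and> c = 0 \<and> d = 0)"

definition cols4 :: "cvec \<Rightarrow> cvec \<Rightarrow> cvec \<Rightarrow> cvec \<Rightarrow> cmat" where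
  "cols4 e0 e1 e2 e3 = (\<chi> i. vector [e0 $ i, e1 $ i, e2 $ i, e3 $ i])"

lemma neq_4: "(1::4) \<noteq> 2" "(1::4) \<noteq> 3" "(1::4) \<noteq> 4" "(2::4) \<noteq> 3" "(2::4) \<noteq> 4" "(3::4) \<noteq> 4"
  and plus_4: "(1::4) + 1 = 2" "(2::4) + 1 = 3" "(3::4) + 1 = 4"
  by simp_all

lemma vector_4_nth [simp]:
  "(vector [a, b, c, d] :: 'a::zero ^ 4) $ 1 = a" "(vector [a, b, c, d] :: 'a::zero ^ 4) $ 2 = b"
  "(vector [a, b, c, d] :: 'a::zero ^ 4) $ 3 = c" "(vector [a, b, c, d] :: 'a::zero ^ 4) $ 4 = d"
  unfolding vector_def
  by (simp_all only: vec_lambda_beta foldr.simps o_apply id_apply fun_upd_apply plus_4 neq_4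
      neq_4[symmetric] if_True if_False refl simp_thms)

lemma cols4_mult: "cols4 e0 e1 e2 e3 *v x = x $ 1 *s e0 + x $ 2 *s e1 + x $ 3 *s e2 + x $ 4 *s e3"
  by (simp add: vec_eq_iff matrix_vector_mult_def cols4_def sum_4 mult.commute)

text \<open>For a square matrix a trivial kernel gives a left inverse, and that is already a
  two-sided one.\<close>

lemma basis4_invertible: "basis4 e0 e1 e2 e3 \<longleftrightarrow> invertible (cols4 e0 e1 e2 e3)"
proof -
  have "basis4 e0 e1 e2 e3 \<longleftrightarrow> (\<forall>x. cols4 e0 e1 e2 e3 *v x = 0 \<longrightarrow> x = 0)"
  proof
    assume "basis4 e0 e1 e2 e3"
    then have "x $ 1 = 0 \<and> x $ 2 = 0 \<and> x $ 3 = 0 \<and> x $ 4 = 0" if "cols4 e0 e1 e2 e3 *v x = 0" for x :: cvec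
      using that unfolding basis4_def cols4_mult by blast
    then show "\<forall>x. cols4 e0 e1 e2 e3 *v x = 0 \<longrightarrow> x = 0"
      by (metis vec_eq_iff exhaust_4 zero_index)
  next
    assume R: "\<forall>x. cols4 e0 e1 e2 e3 *v x = 0 \<longrightarrow> x = 0"
    show "basis4 e0 e1 e2 e3"
      unfolding basis4_def
    proof (intro allI impI)
      fix a b c d assume "a *s e0 + b *s e1 + c *s e2 + d *s e3 = 0"
      then have "cols4 e0 e1 e2 e3 *v vector [a, b, c, d] = 0" by (simp add: cols4_mult)
      with R have "vector [a, b, c, d] = (0::cvec)" by blast
      then show "a = 0 \<and> b = 0 \<and> c = 0 \<and> d = 0" by (simp add: vec_eq_iff forall_4)
    qed
  qed
  then show ?thesis
    by (metis matrix_left_invertible_ker invertible_left_inverse)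
qed

lemma basis4_span:
  assumes "basis4 e0 e1 e2 e3"
  obtains a b c d where "v = a *s e0 + b *s e1 + c *s e2 + d *s e3"
proof -
  obtain E' where "cols4 e0 e1 e2 e3 ** E' = mat 1"
    using assms unfolding basis4_invertible invertible_def by blast
  then have "v = cols4 e0 e1 e2 e3 *v (E' *v v)"
    by (simp add: matrix_vector_mul_assoc)
  then show ?thesis using that unfolding cols4_mult by blast
qed

lemma basis4_matrix_eq:
  assumes "basis4 e0 e1 e2 e3" "P *v e0 = Q *v e0" "P *v e1 = Q *v e1" "P *v e2 = Q *v e2" "P *v e3 = Q *v e3"
  shows "P = (Q :: cmat)"
proof -
  have "P *v v = Q *v v" for v
    by (rule basis4_span[OF assms(1), of v]) 
       (simp add: assms matrix_vector_right_distrib matrix_vector_mult_scaleR vector_scalar_commute)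
  then show ?thesis by (simp add: matrix_eq)
qed

lemma basis4_matrix_exists:
  assumes "basis4 e0 e1 e2 e3"
  obtains P :: cmat where "P *v e0 = d0" "P *v e1 = d1" "P *v e2 = d2" "P *v e3 = d3"
proof -
  define E where "E = cols4 e0 e1 e2 e3"
  define D where "D = cols4 d0 d1 d2 d3"
  obtain E' where inv: "E' ** E = mat 1"
    using assms unfolding basis4_invertible E_def invertible_def by blast
  have ax: "(axis 1 1 :: cvec) = vector [1,0,0,0]" "(axis 2 1 :: cvec) = vector [0,1,0,0]"
    "(axis 3 1 :: cvec) = vector [0,0,1,0]" "(axis 4 1 :: cvec) = vector [0,0,0,1]"
    by (simp_all add: vec_eq_iff forall_4 axis_def)
  have e: "E *v axis 1 1 = e0" "E *v axis 2 1 = e1" "E *v axis 3 1 = e2" "E *v axis 4 1 = e3"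
    unfolding ax E_def cols4_mult by simp_all
  have d: "D *v axis 1 1 = d0" "D *v axis 2 1 = d1" "D *v axis 3 1 = d2" "D *v axis 4 1 = d3"
    unfolding ax D_def cols4_mult by simp_all
  \<comment> \<open>The matrix sought is D E^(-1): the columns of E are the given vectors, those of
    D their prescribed images.\<close>
  have "(D ** E') *v (E *v x) = D *v x" for x
    by (metis inv matrix_mul_assoc matrix_mul_rid matrix_vector_mul_assoc)
  then show ?thesis using that[of "D ** E'"] e d by metis
qed

lemma basis4_image:
  assumes "basis4 e0 e1 e2 e3" "invertible (P :: cmat)"
  shows "basis4 (P *v e0) (P *v e1) (P *v e2) (P *v e3)"
  unfolding basis4_def
proof (intro allI impI)
  fix a b c d assume "a *s (P *v e0) + b *s (P *v e1) + c *s (P *v e2) + d *s (P *v e3) = 0"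
  then have "P *v (a *s e0 + b *s e1 + c *s e2 + d *s e3) = 0"
    by (simp add: matrix_vector_right_distrib vector_scalar_commute)
  then have "a *s e0 + b *s e1 + c *s e2 + d *s e3 = 0"
    using assms(2) by (metis invertible_left_inverse matrix_left_invertible_ker)
  then show "a = 0 \<and> b = 0 \<and> c = 0 \<and> d = 0" using assms(1) unfolding basis4_def by blast
qed

lemma basis4_invertible_image:
  assumes "basis4 (P *v e0) (P *v e1) (P *v e2) (P *v e3)" "basis4 e0 e1 e2 e3"
  shows "invertible (P :: cmat)"
proof -
  have "x = 0" if "P *v x = 0" for x
  proof (rule basis4_span[OF assms(2), of x])
    fix a b c d assume x: "x = a *s e0 + b *s e1 + c *s e2 + d *s e3"
    then have "a *s (P *v e0) + b *s (P *v e1) + c *s (P *v e2) + d *s (P *v e3) = 0"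
      using that by (simp add: matrix_vector_right_distrib vector_scalar_commute)
    then show "x = 0" using assms(1) x unfolding basis4_def by fastforce
  qed
  then show ?thesis by (metis invertible_left_inverse matrix_left_invertible_ker)
qed

section \<open>Linear functionals and nondegenerate parameters\<close>

text \<open>The bilinear pairing, without complex conjugation, so that pairing with a fixed covector
  preserves holomorphy.\<close>

definition fdot :: "cvec \<Rightarrow> cvec \<Rightarrow> complex" where
  "fdot \<phi> v = (\<Sum>i\<in>UNIV. \<phi> $ i * v $ i)"

lemma fdot_add: "fdot \<phi> (v + w) = fdot \<phi> v + fdot \<phi> w"
  and fdot_diff: "fdot \<phi> (v - w) = fdot \<phi> v - fdot \<phi> w"
  and fdot_scale: "fdot \<phi> (a *s v) = a * fdot \<phi> v"
  and fdot_zero [simp]: "fdot \<phi> 0 = 0" "fdot 0 v = 0"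
  and fdot_add_left: "fdot (\<phi> + \<psi>) v = fdot \<phi> v + fdot \<psi> v"
  and fdot_diff_left: "fdot (\<phi> - \<psi>) v = fdot \<phi> v - fdot \<psi> v"
  and fdot_scale_left: "fdot (a *s \<phi>) v = a * fdot \<phi> v"
  by (simp_all add: fdot_def sum.distrib sum_subtractf sum_distrib_left algebra_simps)

lemma fdot_matrix: "fdot \<phi> (P *v v) = fdot (\<phi> v* P) v"
  unfolding fdot_def matrix_vector_mult_def vector_matrix_mult_def
  by (simp add: sum_4 algebra_simps)

lemma fdot_axis: "fdot \<phi> (axis i 1) = \<phi> $ i"
  by (simp add: fdot_def axis_def if_distrib cong: if_cong)

lemma fdot_eqI: "(\<And>v. fdot \<phi> v = fdot \<psi> v) \<Longrightarrow> \<phi> = \<psi>"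
  by (metis fdot_axis vec_eq_iff)

lemma basis4_fdot:
  assumes "basis4 e0 e1 e2 e3" "fdot \<phi> e0 = 0" "fdot \<phi> e1 = 0" "fdot \<phi> e2 = 0" "fdot \<phi> e3 = 0"
  shows "\<phi> = 0"
proof (rule fdot_eqI)
  fix v
  obtain a b c d where "v = a *s e0 + b *s e1 + c *s e2 + d *s e3"
    using basis4_span[OF assms(1)] .
  then show "fdot \<phi> v = fdot 0 v" by (simp add: assms fdot_add fdot_scale)
qed

lemma has_vderiv_fdot:
  "has_vderiv \<gamma> d t \<Longrightarrow> ((\<lambda>s. fdot \<phi> (\<gamma> s)) has_field_derivative fdot \<phi> d) (at t)"
  unfolding has_vderiv_def fdot_def
  by (auto intro!: derivative_eq_intros sum.cong simp: mult.commute)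

lemma holomorphic_fdot: "vholomorphic_on \<gamma> T \<Longrightarrow> (\<lambda>t. fdot \<phi> (\<gamma> t)) holomorphic_on T"
  unfolding vholomorphic_on_def fdot_def by (auto intro!: holomorphic_intros)

text \<open>Nonvanishing of the Wronskian at \<open>t\<close>. For a chart this agrees with
  \<open>nondegenerate_at\<close>, by \<open>nondegenerate_at_chart\<close>.\<close>

definition nondeg :: "(complex \<Rightarrow> cvec) \<Rightarrow> complex \<Rightarrow> bool" where
  "nondeg \<gamma> t \<longleftrightarrow> basis4 (\<gamma> t) (vderiv 1 \<gamma> t) (vderiv 2 \<gamma> t) (vderiv 3 \<gamma> t)"

lemma nondeg_matrix:
  assumes "nondeg \<gamma> t" "invertible P" "vholomorphic_on \<gamma> T" "open T" "t \<in> T"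
  shows "nondeg (\<lambda>s. P *v \<gamma> s) t"
  using assms basis4_image by (simp add: nondeg_def vderiv_matrix)

text \<open>A functional vanishing along the curve vanishes on all its derivatives, and at a
  nondegenerate parameter four of them form a basis. Geometrically, the curve lies in no
  hyperplane.\<close>

lemma nondeg_functional:
  assumes "nondeg \<gamma> t" "open T" "t \<in> T" "\<And>s. s \<in> T \<Longrightarrow> fdot \<phi> (\<gamma> s) = 0" "vholomorphic_on \<gamma> T"
  shows "\<phi> = 0"
proof -
  have "fdot \<phi> (vderiv k \<gamma> s) = 0" if "s \<in> T" for k s
    using that
  proof (induction k arbitrary: s)
    case (Suc k)
    have "((\<lambda>s. fdot \<phi> (vderiv k \<gamma> s)) has_field_derivative 0) (at s)"
      by (rule has_field_derivative_transform_within_open[OF DERIV_const assms(2) Suc.prems])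
         (use Suc in auto)
    moreover have "((\<lambda>s. fdot \<phi> (vderiv k \<gamma> s)) has_field_derivative fdot \<phi> (vderiv (Suc k) \<gamma> s)) (at s)"
      using has_vderiv_fdot[OF has_vderiv_vderiv[OF assms(5,2) Suc.prems]] .
    ultimately show ?case using DERIV_unique by blast
  qed (use assms in auto)
  from this[OF assms(3)] this[OF assms(3), of 0] show ?thesis
    using assms(1) unfolding nondeg_def
    by (intro basis4_fdot[of "\<gamma> t" "vderiv 1 \<gamma> t" "vderiv 2 \<gamma> t" "vderiv 3 \<gamma> t"]) auto
qed

lemma continuous_on_det_cmat:
  assumes "\<And>i j. continuous_on T (\<lambda>t. (M t :: cmat) $ i $ j)"
  shows "continuous_on T (\<lambda>t. det (M t))"
  unfolding det_def
  by (rule continuous_on_sum, rule continuous_on_mult, rule continuous_on_const,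
      rule continuous_on_prod, rule assms)

lemma open_nonzero:
  assumes "continuous_on T (D::complex \<Rightarrow> complex)" "open T"
  shows "open {t\<in>T. D t \<noteq> 0}"
proof -
  have "open (T \<inter> D -` (-{0}))"
    by (rule continuous_open_preimage[OF assms]) (rule open_Compl, rule closed_singleton)
  also have "T \<inter> D -` (-{0}) = {t\<in>T. D t \<noteq> 0}" by auto
  finally show ?thesis .
qed

text \<open>The Wronskian determinant depends continuously on the parameter, so its being nonzero is
  an open condition.\<close>

lemma nondeg_near:
  assumes "nondeg \<gamma> t0" "vholomorphic_on \<gamma> T" "open T" "t0 \<in> T"
  obtains e where "e > 0" "ball t0 e \<subseteq> T" "\<And>t. t \<in> ball t0 e \<Longrightarrow> nondeg \<gamma> t"
proof -
  define D where "D t = det (cols4 (\<gamma> t) (vderiv 1 \<gamma> t) (vderiv 2 \<gamma> t) (vderiv 3 \<gamma> t))" for t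
  have c: "continuous_on T (\<lambda>t. vderiv k \<gamma> t $ i)" for k i
    using vholomorphic_vderiv[OF assms(2,3)] by (auto simp: vholomorphic_on_def intro: holomorphic_on_imp_continuous_on)
  have ent: "continuous_on T (\<lambda>t. cols4 (vderiv 0 \<gamma> t) (vderiv 1 \<gamma> t) (vderiv 2 \<gamma> t) (vderiv 3 \<gamma> t) $ i $ j)" for i j
    using exhaust_4[of j] c c[of 0] by (auto simp: cols4_def)
  have D: "continuous_on T D"
    unfolding D_def by (rule continuous_on_det_cmat) (rule ent[unfolded vderiv_0])
  have iff: "nondeg \<gamma> t \<longleftrightarrow> D t \<noteq> 0" for t
    unfolding nondeg_def basis4_invertible D_def by (simp add: invertible_det_nz)
  have "open {t\<in>T. D t \<noteq> 0}"
    using open_nonzero[OF D assms(3)] .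
  moreover have "t0 \<in> {t\<in>T. D t \<noteq> 0}" using assms(1,4) iff by simp
  ultimately obtain e where "e > 0" "ball t0 e \<subseteq> {t\<in>T. D t \<noteq> 0}"
    by (meson open_contains_ball)
  then show ?thesis using that iff by blast
qed

section \<open>Charts of curves\<close>

definition lin_indep2 :: "cvec \<Rightarrow> cvec \<Rightarrow> bool" where
  "lin_indep2 v w \<longleftrightarrow> (\<forall>a b. a *s v + b *s w = 0 \<longrightarrow> a = 0 \<and> b = 0)"

text \<open>The last clause stands in for the homeomorphism: near \<open>\<gamma> t\<close> the set
  Z contains only multiples of values of \<gamma> at parameters close to t. In this local form the
  notion passes to smaller domains, to reparametrizations and to linear images.\<close>

definition chart :: "cvec set \<Rightarrow> (complex \<Rightarrow> cvec) \<Rightarrow> complex set \<Rightarrow> bool" where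
  "chart Z \<gamma> T \<longleftrightarrow> open T \<and> vholomorphic_on \<gamma> T \<and>
     (\<forall>t\<in>T. lin_indep2 (\<gamma> t) (vderiv 1 \<gamma> t)) \<and> cone_over \<gamma> T \<subseteq> Z \<and>
     (\<forall>t\<in>T. \<forall>T'. open T' \<longrightarrow> t \<in> T' \<longrightarrow>
        (\<exists>U. open U \<and> \<gamma> t \<in> U \<and> Z \<inter> U \<subseteq> cone_over \<gamma> T'))"

lemma cone_overI: "c \<noteq> 0 \<Longrightarrow> t \<in> T \<Longrightarrow> c *s \<gamma> t \<in> cone_over \<gamma> T"
  unfolding cone_over_def by blast

lemma cone_overI1: "t \<in> T \<Longrightarrow> \<gamma> t \<in> cone_over \<gamma> T"
  using cone_overI[of 1] by simp

lemma cone_overE: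
  assumes "v \<in> cone_over \<gamma> T"
  obtains c t where "c \<noteq> 0" "t \<in> T" "v = c *s \<gamma> t"
  using assms unfolding cone_over_def by blast

lemma cone_over_mono: "S \<subseteq> T \<Longrightarrow> cone_over \<gamma> S \<subseteq> cone_over \<gamma> T"
  unfolding cone_over_def by blast

lemma is_coneD: "is_cone Z \<Longrightarrow> c \<noteq> 0 \<Longrightarrow> z \<in> Z \<Longrightarrow> c *s z \<in> Z"
  unfolding is_cone_def by blast

lemma is_cone_scale_iff:
  assumes "is_cone Z" "c \<noteq> 0"
  shows "c *s z \<in> Z \<longleftrightarrow> z \<in> Z"
  using is_coneD[OF assms] is_coneD[OF assms(1), of "1/c" "c *s z"] assms(2) by auto

lemma is_cone_cone_over: "is_cone (cone_over \<gamma> T)"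
  unfolding is_cone_def
proof (intro allI impI)
  fix c :: complex and z assume "c \<noteq> 0" "z \<in> cone_over \<gamma> T"
  then obtain d t where "d \<noteq> 0" "t \<in> T" "z = d *s \<gamma> t" by (auto elim: cone_overE)
  then show "c *s z \<in> cone_over \<gamma> T"
    using cone_overI[of "c * d" t T \<gamma>] \<open>c \<noteq> 0\<close> by simp
qed

lemma curveD: "curve Z \<Longrightarrow> is_cone Z" "curve Z \<Longrightarrow> 0 \<notin> Z"
  unfolding curve_def by auto

lemma chartD:
  assumes "chart Z \<gamma> T"
  shows "open T" "vholomorphic_on \<gamma> T" "\<And>t. t \<in> T \<Longrightarrow> lin_indep2 (\<gamma> t) (vderiv 1 \<gamma> t)"
    "cone_over \<gamma> T \<subseteq> Z"
    "\<And>t T'. t \<in> T \<Longrightarrow> open T' \<Longrightarrow> t \<in> T' \<Longrightarrow> \<exists>U. open U \<and> \<gamma> t \<in> U \<and> Z \<inter> U \<subseteq> cone_over \<gamma> T'"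
  using assms unfolding chart_def by blast+

lemma chart_in: "chart Z \<gamma> T \<Longrightarrow> t \<in> T \<Longrightarrow> \<gamma> t \<in> Z"
  using chartD(4) cone_overI1 by blast

lemma chart_subset: "chart Z \<gamma> T \<Longrightarrow> open S \<Longrightarrow> S \<subseteq> T \<Longrightarrow> chart Z \<gamma> S"
  unfolding chart_def using cone_over_mono vholomorphic_subset by (meson subset_iff)

lemma continuous_scale: "continuous_on UNIV (\<lambda>v :: cvec. c *s v)"
  unfolding continuous_on_def
proof (intro ballI vec_tendstoI)
  fix x :: cvec and i
  show "((\<lambda>v. (c *s v) $ i) \<longlongrightarrow> (c *s x) $ i) (at x within UNIV)"
    unfolding vector_smult_component
    by (rule tendsto_mult[OF tendsto_const tendsto_vec_nth[OF tendsto_ident_at]])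
qed

lemma open_scale_vimage: "open U \<Longrightarrow> open {v :: cvec. c *s v \<in> U}"
  using open_vimage[OF _ continuous_scale[of c]] by (simp add: vimage_def)

lemma chart_nbhd:
  assumes "chart Z \<gamma> T" "is_cone Z" "t \<in> T" "open T'" "t \<in> T'" "c \<noteq> 0"
  obtains U where "open U" "c *s \<gamma> t \<in> U" "Z \<inter> U \<subseteq> cone_over \<gamma> T'"
proof -
  obtain V where V: "open V" "\<gamma> t \<in> V" "Z \<inter> V \<subseteq> cone_over \<gamma> T'"
    using chartD(5)[OF assms(1,3,4,5)] by blast
  let ?U = "{v. (1 / c) *s v \<in> V}"
  have "Z \<inter> ?U \<subseteq> cone_over \<gamma> T'"
  proof
    fix v assume v: "v \<in> Z \<inter> ?U"
    then have "(1 / c) *s v \<in> Z \<inter> V" using is_coneD[OF assms(2)] assms(6) by simp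
    then have "(1 / c) *s v \<in> cone_over \<gamma> T'" using V(3) by blast
    then show "v \<in> cone_over \<gamma> T'"
      using is_cone_scale_iff[OF is_cone_cone_over, of "1 / c"] assms(6) by simp
  qed
  moreover have "open ?U" "c *s \<gamma> t \<in> ?U"
    using V assms(6) open_scale_vimage by auto
  ultimately show ?thesis using that by blast
qed

text \<open>A homeomorphism onto \<open>Z \<inter> U\<close> is an open map, so the cone over a
  small set of parameters is relatively open in \<open>Z \<inter> U\<close>; this is the last clause
  of \<open>chart\<close>.\<close>

lemma homeomorphism_chart:
  assumes U: "open U" "open T" "vholomorphic_on \<gamma> T" "\<And>t. t \<in> T \<Longrightarrow> lin_indep2 (\<gamma> t) (vderiv 1 \<gamma> t)"
    and h: "homeomorphism ((- {0}) \<times> T) (Z \<inter> U) (\<lambda>(c, t). c *s \<gamma> t) g"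
  shows "chart Z \<gamma> T" "cone_over \<gamma> T = Z \<inter> U"
proof -
  have im: "(\<lambda>(c, t). c *s \<gamma> t) ` ((- {0}) \<times> S) = cone_over \<gamma> S" for S
    unfolding cone_over_def by auto
  show cT: "cone_over \<gamma> T = Z \<inter> U"
    using homeomorphism_image1[OF h] im by simp
  show "chart Z \<gamma> T"
    unfolding chart_def
  proof (intro conjI ballI allI impI)
    fix t T' assume t: "t \<in> T" and T': "open T'" "t \<in> T'"
    have "openin (top_of_set ((- {0 :: complex}) \<times> T)) ((- {0}) \<times> (T \<inter> T'))"
    proof (rule open_subset)
      have "open (- {0 :: complex})" by (rule open_Compl, rule closed_singleton)
      then show "open ((- {0 :: complex}) \<times> (T \<inter> T'))"
        by (rule open_Times) (use T' U(2) in auto)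
    qed auto
    from homeomorphism_imp_open_map[OF h this]
    have "openin (top_of_set (Z \<inter> U)) (cone_over \<gamma> (T \<inter> T'))" unfolding im .
    then obtain V where V: "open V" "cone_over \<gamma> (T \<inter> T') = (Z \<inter> U) \<inter> V"
      by (auto simp: openin_open)
    have "\<gamma> t \<in> (Z \<inter> U) \<inter> V" using V t T' cone_overI1[of t "T \<inter> T'" \<gamma>] by blast
    moreover have "Z \<inter> (U \<inter> V) \<subseteq> cone_over \<gamma> T'"
      using V cone_over_mono[of "T \<inter> T'" T' \<gamma>] by blast
    ultimately show "\<exists>U. open U \<and> \<gamma> t \<in> U \<and> Z \<inter> U \<subseteq> cone_over \<gamma> T'"
      using U(1) V(1) by (intro exI[of _ "U \<inter> V"]) auto
  qed (use U cT in auto)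
qed

lemma curve_chart:
  assumes "curve Z" "z \<in> Z"
  obtains \<gamma> T t c where "chart Z \<gamma> T" "t \<in> T" "c \<noteq> 0" "z = c *s \<gamma> t"
proof -
  obtain U T \<gamma> g where U: "open U" "z \<in> U" "open T" "vholomorphic_on \<gamma> T"
    "\<forall>t\<in>T. \<forall>a b. a *s \<gamma> t + b *s vderiv 1 \<gamma> t = 0 \<longrightarrow> a = 0 \<and> b = 0"
    and h: "homeomorphism ((- {0}) \<times> T) (Z \<inter> U) (\<lambda>(c, t). c *s \<gamma> t) g"
    using assms unfolding curve_def by blast
  have "lin_indep2 (\<gamma> t) (vderiv 1 \<gamma> t)" if "t \<in> T" for t
    using U(5) that unfolding lin_indep2_def by blast
  from homeomorphism_chart[OF U(1,3,4) this h]
  have "chart Z \<gamma> T" "z \<in> cone_over \<gamma> T" using assms(2) U(2) by auto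
  then show ?thesis using that unfolding cone_over_def by blast
qed

text \<open>If all minors with a fixed row i, \<open>v $ i \<noteq> 0\<close>, vanished, then w
  would be a multiple of v. For v = \<gamma> and w = \<gamma>' the minor is, up to a nonzero square,
  the derivative of the quotient of two coordinates.\<close>

lemma lin_indep2_coords:
  fixes v w :: cvec
  assumes "lin_indep2 v w"
  obtains i j :: 4 where "v $ i \<noteq> 0" "v $ i * w $ j - v $ j * w $ i \<noteq> 0"
proof -
  have "v \<noteq> 0"
  proof
    assume "v = 0"
    then have "1 *s v + 0 *s w = 0" by simp
    then show False using assms unfolding lin_indep2_def by (metis zero_neq_one)
  qed
  then obtain i where i: "v $ i \<noteq> 0" by (auto simp: vec_eq_iff)
  have "\<exists>j. v $ i * w $ j - v $ j * w $ i \<noteq> 0"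
  proof (rule ccontr)
    assume "\<not> ?thesis"
    then have "(- w $ i) *s v + v $ i *s w = 0" by (simp add: vec_eq_iff mult.commute)
    then show False using assms i unfolding lin_indep2_def by blast
  qed
  then show ?thesis using that i by blast
qed

lemma has_field_derivative_vnth: "has_vderiv \<gamma> d t \<Longrightarrow> ((\<lambda>s. \<gamma> s $ i) has_field_derivative d $ i) (at t)"
  unfolding has_vderiv_def by blast

lemma has_vderiv_1:
  assumes "vholomorphic_on \<gamma> T" "open T" "t \<in> T"
  shows "has_vderiv \<gamma> (vderiv 1 \<gamma> t) t"
  using has_vderiv_vderiv[OF assms, of 0] by simp

lemma holomorphic_vnth: "vholomorphic_on \<gamma> T \<Longrightarrow> (\<lambda>t. \<gamma> t $ i) holomorphic_on T"
  unfolding vholomorphic_on_def by blast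

text \<open>The quotient \<open>\<gamma>\<^sub>j / \<gamma>\<^sub>i\<close> of two suitable coordinates is a local coordinate of the curve.\<close>

lemma chart_local_coordinate:
  fixes \<gamma> :: "complex \<Rightarrow> cvec"
  assumes "vholomorphic_on \<gamma> T" "open T" "t0 \<in> T" "lin_indep2 (\<gamma> t0) (vderiv 1 \<gamma> t0)"
  obtains e i j g where "e > 0" "ball t0 e \<subseteq> T" "\<And>t. t \<in> ball t0 e \<Longrightarrow> \<gamma> t $ i \<noteq> 0"
    "g holomorphic_on ((\<lambda>t. \<gamma> t $ j / \<gamma> t $ i) ` ball t0 e)"
    "\<And>t. t \<in> ball t0 e \<Longrightarrow> g (\<gamma> t $ j / \<gamma> t $ i) = t"
proof -
  obtain i j where ij: "\<gamma> t0 $ i \<noteq> 0"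
    "\<gamma> t0 $ i * vderiv 1 \<gamma> t0 $ j - \<gamma> t0 $ j * vderiv 1 \<gamma> t0 $ i \<noteq> 0"
    using lin_indep2_coords[OF assms(4)] .
  define h where "h = (\<lambda>t. \<gamma> t $ j / \<gamma> t $ i)"
  have "continuous_on T (\<lambda>t. \<gamma> t $ i)"
    using holomorphic_vnth[OF assms(1)] holomorphic_on_imp_continuous_on by blast
  then have "open {t\<in>T. \<gamma> t $ i \<noteq> 0}"
    using open_nonzero assms(2) by blast
  then obtain e0 where e0: "e0 > 0" "ball t0 e0 \<subseteq> {t\<in>T. \<gamma> t $ i \<noteq> 0}"
    using assms(3) ij(1) by (auto simp: open_contains_ball)
  have hol: "h holomorphic_on ball t0 e0"
    unfolding h_def using e0 holomorphic_vnth[OF assms(1)]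
    by (intro holomorphic_intros) (auto intro: holomorphic_on_subset)
  have "(h has_field_derivative (vderiv 1 \<gamma> t0 $ j * \<gamma> t0 $ i - \<gamma> t0 $ j * vderiv 1 \<gamma> t0 $ i) / (\<gamma> t0 $ i * \<gamma> t0 $ i)) (at t0)"
    unfolding h_def using has_vderiv_1[OF assms(1-3)] ij(1)
    by (intro DERIV_divide has_field_derivative_vnth)
  then have "deriv h t0 \<noteq> 0"
    using ij by (simp add: DERIV_imp_deriv mult.commute)
  then obtain e1 where e1: "e1 > 0" "ball t0 e1 \<subseteq> ball t0 e0" "inj_on h (ball t0 e1)"
    using has_complex_derivative_locally_injective[OF hol _ _ ] e0 by (metis centre_in_ball open_ball)
  have hol1: "h holomorphic_on ball t0 e1" using hol e1 holomorphic_on_subset by blast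
  obtain g where g: "g holomorphic_on (h ` ball t0 e1)" "\<And>t. t \<in> ball t0 e1 \<Longrightarrow> g (h t) = t"
    using holomorphic_has_inverse[OF hol1 open_ball e1(3)] by metis
  show ?thesis
  proof (rule that[of e1 i g j])
    show "ball t0 e1 \<subseteq> T" using e0 e1 by blast
    show "\<gamma> t $ i \<noteq> 0" if "t \<in> ball t0 e1" for t using that e0 e1 by blast
  qed (use e1 g h_def in auto)
qed

text \<open>The last clause of \<open>chart\<close> yields a factor and a parameter for each point
  of the arc, without any regularity. Holomorphy comes from recovering them: the quotient of two
  coordinates forgets the factor and determines the parameter through the local coordinate, and one
  nonvanishing coordinate then determines the factor.\<close>

lemma arc_in_chart:
  assumes ch: "chart Z \<gamma> T" and cone: "is_cone Z" and t0: "t0 \<in> T" and c0: "c0 \<noteq> 0"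
    and \<alpha>: "vholomorphic_on \<alpha> S" "open S" "s0 \<in> S" "\<alpha> ` S \<subseteq> Z" "\<alpha> s0 = c0 *s \<gamma> t0"
  obtains e c l where "e > 0" "ball s0 e \<subseteq> S" "c holomorphic_on ball s0 e" "l holomorphic_on ball s0 e"
    "c s0 = c0" "l s0 = t0" "l ` ball s0 e \<subseteq> T"
    "\<And>s. s \<in> ball s0 e \<Longrightarrow> c s \<noteq> 0 \<and> \<alpha> s = c s *s \<gamma> (l s)"
proof -
  note chD = chartD[OF ch]
  obtain e i j g where h': "e > 0" "ball t0 e \<subseteq> T" "\<And>t. t \<in> ball t0 e \<Longrightarrow> \<gamma> t $ i \<noteq> 0"
    "g holomorphic_on ((\<lambda>t. \<gamma> t $ j / \<gamma> t $ i) ` ball t0 e)"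
    "\<And>t. t \<in> ball t0 e \<Longrightarrow> g (\<gamma> t $ j / \<gamma> t $ i) = t"
    apply (rule chart_local_coordinate[OF chD(2,1) t0 chD(3)[OF t0]])
    subgoal premises p for e i j g
      using p(1)[OF p(2) p(3) p(4) p(5) p(6)] .
    done
  define h where "h = (\<lambda>t. \<gamma> t $ j / \<gamma> t $ i)"
  note h = h'(1-3) h_def h'(4,5)[folded h_def]
  obtain U where U: "open U" "c0 *s \<gamma> t0 \<in> U" "Z \<inter> U \<subseteq> cone_over \<gamma> (ball t0 e)"
    using chart_nbhd[OF ch cone t0 open_ball _ c0, of t0 e] h(1) by auto
  have "open (S \<inter> \<alpha> -` U)"
    using continuous_open_preimage[OF continuous_on_vholomorphic[OF \<alpha>(1)] \<alpha>(2) U(1)] by simp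
  then obtain e' where e': "e' > 0" "ball s0 e' \<subseteq> S \<inter> \<alpha> -` U"
    using \<alpha>(3,5) U(2) by (metis IntI open_contains_ball vimageI)
  have ex: "\<exists>d t. d \<noteq> 0 \<and> t \<in> ball t0 e \<and> \<alpha> s = d *s \<gamma> t" if "s \<in> ball s0 e'" for s
  proof -
    have "\<alpha> s \<in> Z \<inter> U" using that e'(2) \<alpha>(4) by blast
    then have "\<alpha> s \<in> cone_over \<gamma> (ball t0 e)" using U(3) by blast
    then show ?thesis unfolding cone_over_def by blast
  qed
  define l where "l s = g (\<alpha> s $ j / \<alpha> s $ i)" for s
  define c where "c s = \<alpha> s $ i / \<gamma> (l s) $ i" for s
  have key: "\<alpha> s $ i \<noteq> 0 \<and> \<alpha> s $ j / \<alpha> s $ i \<in> h ` ball t0 e \<and> l s = t \<and> c s = d"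
    if "d \<noteq> 0" "t \<in> ball t0 e" "\<alpha> s = d *s \<gamma> t" for s d t
  proof -
    have q': "\<alpha> s $ j / \<alpha> s $ i = \<gamma> t $ j / \<gamma> t $ i" using that h(3) by simp
    then have q: "\<alpha> s $ j / \<alpha> s $ i = h t" by (simp add: h_def)
    have "l s = t" unfolding l_def q' using h'(5) that by blast
    then show ?thesis unfolding c_def using q that h(3) by auto
  qed
  have l_in: "l s \<in> ball t0 e" "\<alpha> s $ i \<noteq> 0" "\<alpha> s $ j / \<alpha> s $ i \<in> h ` ball t0 e"
     "c s \<noteq> 0 \<and> \<alpha> s = c s *s \<gamma> (l s)"
    if s: "s \<in> ball s0 e'" for s
  proof -
    obtain d t where dt: "d \<noteq> 0" "t \<in> ball t0 e" "\<alpha> s = d *s \<gamma> t" using ex[OF s] by blast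
    from key[OF this] dt
    show "l s \<in> ball t0 e" "\<alpha> s $ i \<noteq> 0" "\<alpha> s $ j / \<alpha> s $ i \<in> h ` ball t0 e"
      "c s \<noteq> 0 \<and> \<alpha> s = c s *s \<gamma> (l s)" by auto
  qed
  have \<alpha>hol: "(\<lambda>s. \<alpha> s $ k) holomorphic_on ball s0 e'" for k
    using holomorphic_vnth[OF \<alpha>(1)] e' holomorphic_on_subset by blast
  have q: "(\<lambda>s. \<alpha> s $ j / \<alpha> s $ i) holomorphic_on ball s0 e'"
    using \<alpha>hol l_in by (intro holomorphic_intros) auto
  have lhol: "l holomorphic_on ball s0 e'"
    unfolding l_def using l_in(3)
    by (intro holomorphic_on_compose_gen[OF q h(5), unfolded o_def]) blast
  have "(\<lambda>s. \<gamma> (l s) $ i) holomorphic_on ball s0 e'"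
    using l_in(1) h(2)
    by (intro holomorphic_on_compose_gen[OF lhol holomorphic_vnth[OF chD(2)], unfolded o_def]) blast
  then have chol: "c holomorphic_on ball s0 e'"
    unfolding c_def using \<alpha>hol l_in h(3) by (intro holomorphic_intros) auto
  show ?thesis
  proof (rule that[of e' c l])
    show "ball s0 e' \<subseteq> S" "l ` ball s0 e' \<subseteq> T" using e' l_in(1) h(2) by auto
    show "c s0 = c0" "l s0 = t0" using key[OF c0 _ \<alpha>(5)] h(1) by auto
  qed (use e' chol lhol l_in(4) in auto)
qed

section \<open>Derivatives under change of scale and parameter\<close>

lemma reparam_step:
  assumes "vholomorphic_on \<gamma> T" "open T" "l s \<in> T"
    "(a has_field_derivative a') (at s)" "(l has_field_derivative l') (at s)"
  shows "has_vderiv (\<lambda>s. a s *s vderiv j \<gamma> (l s))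
    (a' *s vderiv j \<gamma> (l s) + (a s * l') *s vderiv (Suc j) \<gamma> (l s)) s"
  using has_vderiv_scale[OF assms(4) has_vderiv_compose[OF has_vderiv_vderiv[OF assms(1-3), of j] assms(5)]]
  by (simp add: vector_smult_assoc)

text \<open>The combined Leibniz and chain rule up to order four. The derivatives of c and l enter
  as functions of their own, so that explicit closed forms can be supplied as well as iterated
  \<open>deriv\<close>.\<close>

lemma reparam_derivs:
  assumes \<gamma>: "vholomorphic_on \<gamma> T" "open T" "l ` S \<subseteq> T" and S: "open S"
    and c: "\<And>s. s \<in> S \<Longrightarrow> (c has_field_derivative c1 s) (at s)"
      "\<And>s. s \<in> S \<Longrightarrow> (c1 has_field_derivative c2 s) (at s)"
      "\<And>s. s \<in> S \<Longrightarrow> (c2 has_field_derivative c3 s) (at s)"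
      "\<And>s. s \<in> S \<Longrightarrow> (c3 has_field_derivative c4 s) (at s)"
    and l: "\<And>s. s \<in> S \<Longrightarrow> (l has_field_derivative l1 s) (at s)"
      "\<And>s. s \<in> S \<Longrightarrow> (l1 has_field_derivative l2 s) (at s)"
      "\<And>s. s \<in> S \<Longrightarrow> (l2 has_field_derivative l3 s) (at s)"
      "\<And>s. s \<in> S \<Longrightarrow> (l3 has_field_derivative l4 s) (at s)"
    and s: "s \<in> S"
  shows "vderiv 1 (\<lambda>s. c s *s \<gamma> (l s)) s = c1 s *s \<gamma> (l s) + (c s * l1 s) *s vderiv 1 \<gamma> (l s)"
    "vderiv 2 (\<lambda>s. c s *s \<gamma> (l s)) s = c2 s *s \<gamma> (l s) +
       (2 * c1 s * l1 s + c s * l2 s) *s vderiv 1 \<gamma> (l s) + (c s * (l1 s)\<^sup>2) *s vderiv 2 \<gamma> (l s)"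
    "vderiv 3 (\<lambda>s. c s *s \<gamma> (l s)) s = c3 s *s \<gamma> (l s) +
       (3 * c2 s * l1 s + 3 * c1 s * l2 s + c s * l3 s) *s vderiv 1 \<gamma> (l s) +
       (3 * c1 s * (l1 s)\<^sup>2 + 3 * c s * l1 s * l2 s) *s vderiv 2 \<gamma> (l s) +
       (c s * (l1 s) ^ 3) *s vderiv 3 \<gamma> (l s)"
    "vderiv 4 (\<lambda>s. c s *s \<gamma> (l s)) s = c4 s *s \<gamma> (l s) +
       (4 * c3 s * l1 s + 6 * c2 s * l2 s + 4 * c1 s * l3 s + c s * l4 s) *s vderiv 1 \<gamma> (l s) +
       (6 * c2 s * (l1 s)\<^sup>2 + 12 * c1 s * l1 s * l2 s + c s * (3 * (l2 s)\<^sup>2 + 4 * l1 s * l3 s)) *s vderiv 2 \<gamma> (l s) +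
       (4 * c1 s * (l1 s) ^ 3 + 6 * c s * (l1 s)\<^sup>2 * l2 s) *s vderiv 3 \<gamma> (l s) +
       (c s * (l1 s) ^ 4) *s vderiv 4 \<gamma> (l s)"
proof -
  let ?u = "\<lambda>s. c s *s \<gamma> (l s)"
  have st: "has_vderiv (\<lambda>s. a s *s vderiv j \<gamma> (l s))
    (a' *s vderiv j \<gamma> (l s) + (a s * l1 s) *s vderiv (Suc j) \<gamma> (l s)) s"
    if "s \<in> S" "(a has_field_derivative a') (at s)" for s a a' j
    using reparam_step[OF \<gamma>(1,2) _ that(2) l(1)[OF that(1)]] \<gamma>(3) that(1) by blast
  have st0: "has_vderiv (\<lambda>s. a s *s \<gamma> (l s)) (a' *s \<gamma> (l s) + (a s * l1 s) *s vderiv 1 \<gamma> (l s)) s"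
    if "s \<in> S" "(a has_field_derivative a') (at s)" for s a a'
    using st[OF that, of 0] by simp
  have e1: "vderiv (Suc 0) ?u s = c1 s *s \<gamma> (l s) + (c s * l1 s) *s vderiv 1 \<gamma> (l s)" if "s \<in> S" for s
    by (rule vderiv_Suc_eq[OF S that vderiv_0[THEN fun_cong] st0[OF that c(1)[OF that]]])
  have e2: "vderiv (Suc (Suc 0)) ?u s = c2 s *s \<gamma> (l s) +
       (2 * c1 s * l1 s + c s * l2 s) *s vderiv 1 \<gamma> (l s) + (c s * (l1 s)\<^sup>2) *s vderiv (Suc 1) \<gamma> (l s)" if "s \<in> S" for s
  proof (rule vderiv_Suc_eq[OF S that e1], assumption)
    have "((\<lambda>s. c s * l1 s) has_field_derivative c1 s * l1 s + l2 s * c s) (at s)"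
      by (rule DERIV_mult[OF c(1) l(2)]) (use that in auto)
    from has_vderiv_add[OF st0[OF that c(2)[OF that]] st[OF that this, of 1]]
    show "has_vderiv (\<lambda>s. c1 s *s \<gamma> (l s) + (c s * l1 s) *s vderiv 1 \<gamma> (l s)) (c2 s *s \<gamma> (l s) +
       (2 * c1 s * l1 s + c s * l2 s) *s vderiv 1 \<gamma> (l s) + (c s * (l1 s)\<^sup>2) *s vderiv (Suc 1) \<gamma> (l s)) s"
      by (simp add: vec_eq_iff power2_eq_square algebra_simps cong: conj_cong)
        (simp add: has_vderiv_def algebra_simps)
  qed
  show "vderiv 1 ?u s = c1 s *s \<gamma> (l s) + (c s * l1 s) *s vderiv 1 \<gamma> (l s)"
    using e1[OF s] by simp
  show "vderiv 2 ?u s = c2 s *s \<gamma> (l s) +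
       (2 * c1 s * l1 s + c s * l2 s) *s vderiv 1 \<gamma> (l s) + (c s * (l1 s)\<^sup>2) *s vderiv 2 \<gamma> (l s)"
    using e2[OF s] by (simp add: numeral_2_eq_2)
  have e3: "vderiv (Suc (Suc (Suc 0))) ?u s = c3 s *s \<gamma> (l s) +
       (3 * c2 s * l1 s + 3 * c1 s * l2 s + c s * l3 s) *s vderiv 1 \<gamma> (l s) +
       (3 * c1 s * (l1 s)\<^sup>2 + 3 * c s * l1 s * l2 s) *s vderiv (Suc 1) \<gamma> (l s) +
       (c s * (l1 s) ^ 3) *s vderiv (Suc (Suc 1)) \<gamma> (l s)" if "s \<in> S" for s
  proof (rule vderiv_Suc_eq[OF S that e2], assumption)
    have d1: "((\<lambda>s. 2 * c1 s * l1 s + c s * l2 s) has_field_derivative 2 * c2 s * l1 s + 3 * c1 s * l2 s + c s * l3 s) (at s)"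
      by (rule derivative_eq_intros c l that refl | simp add: algebra_simps)+
    have d2: "((\<lambda>s. c s * (l1 s)\<^sup>2) has_field_derivative c1 s * (l1 s)\<^sup>2 + 2 * c s * l1 s * l2 s) (at s)"
      by (rule derivative_eq_intros c l that refl | simp add: algebra_simps)+
    \<comment> \<open>The left-hand side has the shape in which the product rule delivers the
      derivative, one bracket per summand; the goal is rewritten backwards into this shape. Order
      four proceeds in the same way.\<close>
    have eq: "(c3 s *s \<gamma> (l s) + (c2 s * l1 s) *s vderiv 1 \<gamma> (l s)) +
      ((2 * c2 s * l1 s + 3 * c1 s * l2 s + c s * l3 s) *s vderiv 1 \<gamma> (l s) + ((2 * c1 s * l1 s + c s * l2 s) * l1 s) *s vderiv (Suc 1) \<gamma> (l s)) +
      ((c1 s * (l1 s)\<^sup>2 + 2 * c s * l1 s * l2 s) *s vderiv (Suc 1) \<gamma> (l s) + (c s * (l1 s)\<^sup>2 * l1 s) *s vderiv (Suc (Suc 1)) \<gamma> (l s)) =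
       c3 s *s \<gamma> (l s) +
       (3 * c2 s * l1 s + 3 * c1 s * l2 s + c s * l3 s) *s vderiv 1 \<gamma> (l s) +
       (3 * c1 s * (l1 s)\<^sup>2 + 3 * c s * l1 s * l2 s) *s vderiv (Suc 1) \<gamma> (l s) +
       (c s * (l1 s) ^ 3) *s vderiv (Suc (Suc 1)) \<gamma> (l s)"
      by (simp add: vec_eq_iff power2_eq_square power3_eq_cube algebra_simps)
    show "has_vderiv (\<lambda>s. c2 s *s \<gamma> (l s) +
       (2 * c1 s * l1 s + c s * l2 s) *s vderiv 1 \<gamma> (l s) + (c s * (l1 s)\<^sup>2) *s vderiv (Suc 1) \<gamma> (l s))
       (c3 s *s \<gamma> (l s) +
       (3 * c2 s * l1 s + 3 * c1 s * l2 s + c s * l3 s) *s vderiv 1 \<gamma> (l s) +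
       (3 * c1 s * (l1 s)\<^sup>2 + 3 * c s * l1 s * l2 s) *s vderiv (Suc 1) \<gamma> (l s) +
       (c s * (l1 s) ^ 3) *s vderiv (Suc (Suc 1)) \<gamma> (l s)) s"
      unfolding eq[symmetric]
      by (intro has_vderiv_add st0 st d1 d2 c(3) that)
  qed
  show "vderiv 3 ?u s = c3 s *s \<gamma> (l s) +
       (3 * c2 s * l1 s + 3 * c1 s * l2 s + c s * l3 s) *s vderiv 1 \<gamma> (l s) +
       (3 * c1 s * (l1 s)\<^sup>2 + 3 * c s * l1 s * l2 s) *s vderiv 2 \<gamma> (l s) +
       (c s * (l1 s) ^ 3) *s vderiv 3 \<gamma> (l s)"
    using e3[OF s] by (simp add: eval_nat_numeral)
  have "vderiv (Suc (Suc (Suc (Suc 0)))) ?u s = c4 s *s \<gamma> (l s) +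
       (4 * c3 s * l1 s + 6 * c2 s * l2 s + 4 * c1 s * l3 s + c s * l4 s) *s vderiv 1 \<gamma> (l s) +
       (6 * c2 s * (l1 s)\<^sup>2 + 12 * c1 s * l1 s * l2 s + c s * (3 * (l2 s)\<^sup>2 + 4 * l1 s * l3 s)) *s vderiv (Suc 1) \<gamma> (l s) +
       (4 * c1 s * (l1 s) ^ 3 + 6 * c s * (l1 s)\<^sup>2 * l2 s) *s vderiv (Suc (Suc 1)) \<gamma> (l s) +
       (c s * (l1 s) ^ 4) *s vderiv (Suc (Suc (Suc 1))) \<gamma> (l s)"
  proof (rule vderiv_Suc_eq[OF S s e3], assumption)
    have d1: "((\<lambda>s. 3 * c2 s * l1 s + 3 * c1 s * l2 s + c s * l3 s) has_field_derivative 3 * c3 s * l1 s + 6 * c2 s * l2 s + 4 * c1 s * l3 s + c s * l4 s) (at s)"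
      by (rule derivative_eq_intros c l s refl | simp add: algebra_simps)+
    have d2: "((\<lambda>s. 3 * c1 s * (l1 s)\<^sup>2 + 3 * c s * l1 s * l2 s) has_field_derivative
       3 * c2 s * (l1 s)\<^sup>2 + 9 * c1 s * l1 s * l2 s + 3 * c s * (l2 s)\<^sup>2 + 3 * c s * l1 s * l3 s) (at s)"
      by (rule derivative_eq_intros c l s refl | simp add: algebra_simps power2_eq_square)+
    have d3: "((\<lambda>s. c s * (l1 s) ^ 3) has_field_derivative c1 s * (l1 s) ^ 3 + 3 * c s * (l1 s)\<^sup>2 * l2 s) (at s)"
      by (rule derivative_eq_intros c l s refl | simp add: algebra_simps power2_eq_square)+
    have eq: "(c4 s *s \<gamma> (l s) + (c3 s * l1 s) *s vderiv 1 \<gamma> (l s)) +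
      ((3 * c3 s * l1 s + 6 * c2 s * l2 s + 4 * c1 s * l3 s + c s * l4 s) *s vderiv 1 \<gamma> (l s) +
         ((3 * c2 s * l1 s + 3 * c1 s * l2 s + c s * l3 s) * l1 s) *s vderiv (Suc 1) \<gamma> (l s)) +
      ((3 * c2 s * (l1 s)\<^sup>2 + 9 * c1 s * l1 s * l2 s + 3 * c s * (l2 s)\<^sup>2 + 3 * c s * l1 s * l3 s) *s vderiv (Suc 1) \<gamma> (l s) +
        ((3 * c1 s * (l1 s)\<^sup>2 + 3 * c s * l1 s * l2 s) * l1 s) *s vderiv (Suc (Suc 1)) \<gamma> (l s)) +
      ((c1 s * (l1 s) ^ 3 + 3 * c s * (l1 s)\<^sup>2 * l2 s) *s vderiv (Suc (Suc 1)) \<gamma> (l s) + (c s * (l1 s) ^ 3 * l1 s) *s vderiv (Suc (Suc (Suc 1))) \<gamma> (l s)) =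
      c4 s *s \<gamma> (l s) +
       (4 * c3 s * l1 s + 6 * c2 s * l2 s + 4 * c1 s * l3 s + c s * l4 s) *s vderiv 1 \<gamma> (l s) +
       (6 * c2 s * (l1 s)\<^sup>2 + 12 * c1 s * l1 s * l2 s + c s * (3 * (l2 s)\<^sup>2 + 4 * l1 s * l3 s)) *s vderiv (Suc 1) \<gamma> (l s) +
       (4 * c1 s * (l1 s) ^ 3 + 6 * c s * (l1 s)\<^sup>2 * l2 s) *s vderiv (Suc (Suc 1)) \<gamma> (l s) +
       (c s * (l1 s) ^ 4) *s vderiv (Suc (Suc (Suc 1))) \<gamma> (l s)"
      by (simp add: vec_eq_iff power2_eq_square power3_eq_cube power4_eq_xxxx algebra_simps)
    show "has_vderiv (\<lambda>s. c3 s *s \<gamma> (l s) +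
       (3 * c2 s * l1 s + 3 * c1 s * l2 s + c s * l3 s) *s vderiv 1 \<gamma> (l s) +
       (3 * c1 s * (l1 s)\<^sup>2 + 3 * c s * l1 s * l2 s) *s vderiv (Suc 1) \<gamma> (l s) +
       (c s * (l1 s) ^ 3) *s vderiv (Suc (Suc 1)) \<gamma> (l s)) (c4 s *s \<gamma> (l s) +
       (4 * c3 s * l1 s + 6 * c2 s * l2 s + 4 * c1 s * l3 s + c s * l4 s) *s vderiv 1 \<gamma> (l s) +
       (6 * c2 s * (l1 s)\<^sup>2 + 12 * c1 s * l1 s * l2 s + c s * (3 * (l2 s)\<^sup>2 + 4 * l1 s * l3 s)) *s vderiv (Suc 1) \<gamma> (l s) +
       (4 * c1 s * (l1 s) ^ 3 + 6 * c s * (l1 s)\<^sup>2 * l2 s) *s vderiv (Suc (Suc 1)) \<gamma> (l s) +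
       (c s * (l1 s) ^ 4) *s vderiv (Suc (Suc (Suc 1))) \<gamma> (l s)) s"
      unfolding eq[symmetric]
      by (intro has_vderiv_add st0 st d1 d2 d3 c(4) s)
  qed
  then show "vderiv 4 ?u s = c4 s *s \<gamma> (l s) +
       (4 * c3 s * l1 s + 6 * c2 s * l2 s + 4 * c1 s * l3 s + c s * l4 s) *s vderiv 1 \<gamma> (l s) +
       (6 * c2 s * (l1 s)\<^sup>2 + 12 * c1 s * l1 s * l2 s + c s * (3 * (l2 s)\<^sup>2 + 4 * l1 s * l3 s)) *s vderiv 2 \<gamma> (l s) +
       (4 * c1 s * (l1 s) ^ 3 + 6 * c s * (l1 s)\<^sup>2 * l2 s) *s vderiv 3 \<gamma> (l s) +
       (c s * (l1 s) ^ 4) *s vderiv 4 \<gamma> (l s)"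
    by (simp add: eval_nat_numeral)
qed

lemma holomorphic_higher_DERIV:
  assumes "f holomorphic_on S" "open S" "s \<in> S"
  shows "((deriv ^^ k) f has_field_derivative (deriv ^^ Suc k) f s) (at s)"
  using holomorphic_derivI[OF holomorphic_higher_deriv[OF assms(1,2)] assms(2,3), of k] by simp

lemma holomorphic_DERIVs:
  assumes "f holomorphic_on S" "open S" "s \<in> S"
  shows "(f has_field_derivative (deriv ^^ 1) f s) (at s)"
    "((deriv ^^ 1) f has_field_derivative (deriv ^^ 2) f s) (at s)"
    "((deriv ^^ 2) f has_field_derivative (deriv ^^ 3) f s) (at s)"
    "((deriv ^^ 3) f has_field_derivative (deriv ^^ 4) f s) (at s)"
  using holomorphic_higher_DERIV[OF assms, of 0] holomorphic_higher_DERIV[OF assms, of 1]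
    holomorphic_higher_DERIV[OF assms, of 2] holomorphic_higher_DERIV[OF assms, of 3]
  by (simp_all add: eval_nat_numeral)

lemma reparam_derivs_holomorphic:
  assumes "vholomorphic_on \<gamma> T" "open T" "l ` S \<subseteq> T" "open S"
    "c holomorphic_on S" "l holomorphic_on S" "s \<in> S"
  shows "vderiv 1 (\<lambda>s. c s *s \<gamma> (l s)) s = (deriv ^^ 1) c s *s \<gamma> (l s) + (c s * (deriv ^^ 1) l s) *s vderiv 1 \<gamma> (l s)"
    "vderiv 2 (\<lambda>s. c s *s \<gamma> (l s)) s = (deriv ^^ 2) c s *s \<gamma> (l s) +
       (2 * (deriv ^^ 1) c s * (deriv ^^ 1) l s + c s * (deriv ^^ 2) l s) *s vderiv 1 \<gamma> (l s) + (c s * ((deriv ^^ 1) l s)\<^sup>2) *s vderiv 2 \<gamma> (l s)"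
    "vderiv 3 (\<lambda>s. c s *s \<gamma> (l s)) s = (deriv ^^ 3) c s *s \<gamma> (l s) +
       (3 * (deriv ^^ 2) c s * (deriv ^^ 1) l s + 3 * (deriv ^^ 1) c s * (deriv ^^ 2) l s + c s * (deriv ^^ 3) l s) *s vderiv 1 \<gamma> (l s) +
       (3 * (deriv ^^ 1) c s * ((deriv ^^ 1) l s)\<^sup>2 + 3 * c s * (deriv ^^ 1) l s * (deriv ^^ 2) l s) *s vderiv 2 \<gamma> (l s) +
       (c s * ((deriv ^^ 1) l s) ^ 3) *s vderiv 3 \<gamma> (l s)"
    "vderiv 4 (\<lambda>s. c s *s \<gamma> (l s)) s = (deriv ^^ 4) c s *s \<gamma> (l s) +
       (4 * (deriv ^^ 3) c s * (deriv ^^ 1) l s + 6 * (deriv ^^ 2) c s * (deriv ^^ 2) l s + 4 * (deriv ^^ 1) c s * (deriv ^^ 3) l s + c s * (deriv ^^ 4) l s) *s vderiv 1 \<gamma> (l s) +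
       (6 * (deriv ^^ 2) c s * ((deriv ^^ 1) l s)\<^sup>2 + 12 * (deriv ^^ 1) c s * (deriv ^^ 1) l s * (deriv ^^ 2) l s + c s * (3 * ((deriv ^^ 2) l s)\<^sup>2 + 4 * (deriv ^^ 1) l s * (deriv ^^ 3) l s)) *s vderiv 2 \<gamma> (l s) +
       (4 * (deriv ^^ 1) c s * ((deriv ^^ 1) l s) ^ 3 + 6 * c s * ((deriv ^^ 1) l s)\<^sup>2 * (deriv ^^ 2) l s) *s vderiv 3 \<gamma> (l s) +
       (c s * ((deriv ^^ 1) l s) ^ 4) *s vderiv 4 \<gamma> (l s)"
  by (rule reparam_derivs[OF assms(1-4) _ _ _ _ _ _ _ _ assms(7)]; rule holomorphic_DERIVs[OF _ assms(4)],
      rule assms, assumption)+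

lemma vderiv_1_reparam:
  assumes "vholomorphic_on \<gamma> T" "open T" "l s \<in> T" "c holomorphic_on S" "l holomorphic_on S" "open S" "s \<in> S"
  shows "vderiv 1 (\<lambda>s. c s *s \<gamma> (l s)) s = deriv c s *s \<gamma> (l s) + (c s * deriv l s) *s vderiv 1 \<gamma> (l s)"
  using vderiv_1_eq[OF reparam_step[OF assms(1-3) holomorphic_derivI[OF assms(4,6,7)]
        holomorphic_derivI[OF assms(5,6,7)], of 0]] by simp

text \<open>These arcs realize all tangent and osculating vectors.\<close>

lemma affine_arc:
  assumes ch: "chart Z \<gamma> T" and cone: "is_cone Z" and t: "t \<in> T" and c: "c \<noteq> 0"
  shows "arc_in Z (c *s \<gamma> t) (\<lambda>s. (c + a * s) *s \<gamma> (t + k * s))"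
    and "vderiv 1 (\<lambda>s. (c + a * s) *s \<gamma> (t + k * s)) 0 = a *s \<gamma> t + (c * k) *s vderiv 1 \<gamma> t"
    and "vderiv 2 (\<lambda>s. (c + a * s) *s \<gamma> (t + k * s)) 0 = (2 * a * k) *s vderiv 1 \<gamma> t + (c * k\<^sup>2) *s vderiv 2 \<gamma> t"
    and "vderiv 3 (\<lambda>s. (c + a * s) *s \<gamma> (t + k * s)) 0 = (3 * a * k\<^sup>2) *s vderiv 2 \<gamma> t + (c * k ^ 3) *s vderiv 3 \<gamma> t"
proof -
  note chD = chartD[OF ch]
  have c1: "continuous_on UNIV (\<lambda>s. t + k * s)" and c2: "continuous_on UNIV (\<lambda>s. c + a * s)"
    by (intro continuous_intros)+
  have "open {s. t + k * s \<in> T}" using open_vimage[OF chD(1) c1] by (simp add: vimage_def)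
  moreover have "open {s\<in>UNIV. c + a * s \<noteq> 0}" by (rule open_nonzero[OF c2 open_UNIV])
  ultimately have o: "open ({s. t + k * s \<in> T} \<inter> {s\<in>UNIV. c + a * s \<noteq> 0})" by (rule open_Int)
  have "0 \<in> {s. t + k * s \<in> T} \<inter> {s\<in>UNIV. c + a * s \<noteq> 0}" using t c by simp
  then obtain e where e: "e > 0" "ball 0 e \<subseteq> {s. t + k * s \<in> T} \<inter> {s\<in>UNIV. c + a * s \<noteq> 0}"
    using o by (meson open_contains_ball)
  have im: "(\<lambda>s. t + k * s) ` ball 0 e \<subseteq> T" using e by blast
  have "vholomorphic_on (\<lambda>s. (c + a * s) *s \<gamma> (t + k * s)) (ball 0 e)"
    by (intro vholomorphic_scale vholomorphic_compose[OF chD(2) _ im] holomorphic_intros)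
  moreover have "(\<lambda>s. (c + a * s) *s \<gamma> (t + k * s)) ` ball 0 e \<subseteq> Z"
    using e(2) chart_in[OF ch] is_coneD[OF cone] by blast
  ultimately show "arc_in Z (c *s \<gamma> t) (\<lambda>s. (c + a * s) *s \<gamma> (t + k * s))"
    unfolding arc_in_def using e(1) by auto
  have dc: "((\<lambda>s. c + a * s) has_field_derivative a) (at s)"
    "((\<lambda>s. t + k * s) has_field_derivative k) (at s)" for s
    by (auto intro!: derivative_eq_intros)
  note d = reparam_derivs[OF chD(2,1) im open_ball dc(1) DERIV_const DERIV_const DERIV_const
     dc(2) DERIV_const DERIV_const DERIV_const, of 0]
  show "vderiv 1 (\<lambda>s. (c + a * s) *s \<gamma> (t + k * s)) 0 = a *s \<gamma> t + (c * k) *s vderiv 1 \<gamma> t"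
    "vderiv 2 (\<lambda>s. (c + a * s) *s \<gamma> (t + k * s)) 0 = (2 * a * k) *s vderiv 1 \<gamma> t + (c * k\<^sup>2) *s vderiv 2 \<gamma> t"
    "vderiv 3 (\<lambda>s. (c + a * s) *s \<gamma> (t + k * s)) 0 = (3 * a * k\<^sup>2) *s vderiv 2 \<gamma> t + (c * k ^ 3) *s vderiv 3 \<gamma> t"
    using d e(1) by simp_all
qed

section \<open>Tangent and osculating spaces in a chart\<close>

lemma arc_in_chart':
  assumes "chart Z \<gamma> T" "is_cone Z" "t \<in> T" "c0 \<noteq> 0" "arc_in Z (c0 *s \<gamma> t) \<alpha>"
  obtains e c l where "e > 0" "c holomorphic_on ball 0 e" "l holomorphic_on ball 0 e"
    "c 0 = c0" "l 0 = t" "l ` ball 0 e \<subseteq> T"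
    "\<And>s. s \<in> ball 0 e \<Longrightarrow> c s \<noteq> 0 \<and> \<alpha> s = c s *s \<gamma> (l s)"
proof -
  obtain e where e: "e > 0" "vholomorphic_on \<alpha> (ball 0 e)" "\<alpha> ` ball 0 e \<subseteq> Z" "\<alpha> 0 = c0 *s \<gamma> t"
    using assms(5) unfolding arc_in_def by blast
  show ?thesis
    by (rule arc_in_chart[OF assms(1-4) e(2) open_ball _ e(3,4)])
      (use e(1) that in auto)
qed

text \<open>Arcs factor through the chart, so their velocities lie in the plane spanned by \<gamma>
  and \<gamma>'; affine arcs reach every vector of it. In particular the set \<open>tangent\<close>
  is a linear space, which its definition does not make evident.\<close>

lemma tangent_chart:
  assumes ch: "chart Z \<gamma> T" and cone: "is_cone Z" and t: "t \<in> T" and c0: "c0 \<noteq> 0"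
  shows "tangent Z (c0 *s \<gamma> t) = {a *s \<gamma> t + b *s vderiv 1 \<gamma> t |a b. True}"
proof (intro set_eqI iffI)
  fix v assume "v \<in> tangent Z (c0 *s \<gamma> t)"
  then obtain \<alpha> where \<alpha>: "arc_in Z (c0 *s \<gamma> t) \<alpha>" "v = vderiv 1 \<alpha> 0"
    unfolding tangent_def by blast
  obtain e c l where l: "e > 0" "c holomorphic_on ball 0 e" "l holomorphic_on ball 0 e"
    "c 0 = c0" "l 0 = t" "l ` ball 0 e \<subseteq> T"
    "\<And>s. s \<in> ball 0 e \<Longrightarrow> c s \<noteq> 0 \<and> \<alpha> s = c s *s \<gamma> (l s)"
    by (rule arc_in_chart'[OF assms \<alpha>(1)]) (rule that)
  have "v = vderiv 1 (\<lambda>s. c s *s \<gamma> (l s)) 0"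
    unfolding \<alpha>(2) by (rule vderiv_cong_open[of "ball 0 e"]) (use l in auto)
  also have "\<dots> = deriv c 0 *s \<gamma> t + (c0 * deriv l 0) *s vderiv 1 \<gamma> t"
    using vderiv_1_reparam[OF chartD(2,1)[OF ch] _ l(2,3) open_ball, of 0] t l by simp
  finally show "v \<in> {a *s \<gamma> t + b *s vderiv 1 \<gamma> t |a b. True}" by blast
next
  fix v assume "v \<in> {a *s \<gamma> t + b *s vderiv 1 \<gamma> t |a b. True}"
  then obtain a b where v: "v = a *s \<gamma> t + b *s vderiv 1 \<gamma> t" by blast
  have "v = vderiv 1 (\<lambda>s. (c0 + a * s) *s \<gamma> (t + (b / c0) * s)) 0"
    using affine_arc(2)[OF assms, of a "b / c0"] c0 v by simp
  then show "v \<in> tangent Z (c0 *s \<gamma> t)"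
    unfolding tangent_def using affine_arc(1)[OF assms, of a "b / c0"] by blast
qed

lemma spanning_basis4:
  assumes "\<And>v. \<exists>a b c d. v = a *s e0 + b *s e1 + c *s e2 + d *s e3"
  shows "basis4 e0 e1 e2 e3"
proof -
  have "surj (\<lambda>x. cols4 e0 e1 e2 e3 *v x)"
  proof (rule surjI)
    fix v
    show "cols4 e0 e1 e2 e3 *v (SOME x. cols4 e0 e1 e2 e3 *v x = v) = v"
    proof (rule someI_ex)
      obtain a b c d where "v = a *s e0 + b *s e1 + c *s e2 + d *s e3" using assms by blast
      then have "cols4 e0 e1 e2 e3 *v vector [a, b, c, d] = v" by (simp add: cols4_mult)
      then show "\<exists>x. cols4 e0 e1 e2 e3 *v x = v" by blast
    qed
  qed
  then show ?thesis
    unfolding basis4_invertible invertible_right_inverse matrix_right_invertible_surjective .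
qed

lemma osculating_1:
  "osculating Z z 1 = {v + vderiv 2 \<gamma> 0 |v \<gamma>. v \<in> tangent Z z \<and> arc_in Z z \<gamma>}"
proof -
  have "(0::nat) + 2 = 2" by simp
  then show ?thesis unfolding One_nat_def osculating.simps by (simp only:)
qed

lemma osculating_2:
  "osculating Z z 2 = {v + vderiv 3 \<gamma> 0 |v \<gamma>. v \<in> osculating Z z 1 \<and> arc_in Z z \<gamma>}"
proof -
  have "(1::nat) + 2 = 3" "(2::nat) = Suc 1" by simp_all
  then show ?thesis using osculating.simps(2)[of Z z 1] by (simp only:)
qed

lemma osculatingI:
  "v \<in> tangent Z z \<Longrightarrow> arc_in Z z \<alpha> \<Longrightarrow> vderiv 2 \<alpha> 0 = w \<Longrightarrow> v + w \<in> osculating Z z 1"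
  "v \<in> osculating Z z 1 \<Longrightarrow> arc_in Z z \<alpha> \<Longrightarrow> vderiv 3 \<alpha> 0 = w \<Longrightarrow> v + w \<in> osculating Z z 2"
  unfolding osculating_1 osculating_2 by blast+

text \<open>By the chain rule the i-th derivative of an arc lies in the span of the derivatives of
  \<gamma> up to order i, so the osculating spaces are contained in these spans. For the converse,
  affine arcs produce each missing direction.\<close>

lemma nondegenerate_at_chart:
  assumes ch: "chart Z \<gamma> T" and cone: "is_cone Z" and t: "t \<in> T" and c0: "c0 \<noteq> 0"
  shows "nondegenerate_at Z (c0 *s \<gamma> t) \<longleftrightarrow> nondeg \<gamma> t"
proof
  let ?z = "c0 *s \<gamma> t"
  let ?S2 = "{a *s \<gamma> t + b *s vderiv 1 \<gamma> t + c *s vderiv 2 \<gamma> t |a b c. True}"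
  note chD = chartD[OF ch]
  assume nd: "nondegenerate_at Z ?z"
  have arc: "\<exists>a b c. vderiv 2 \<alpha> 0 = a *s \<gamma> t + b *s vderiv 1 \<gamma> t + c *s vderiv 2 \<gamma> t"
    "\<exists>a b c d. vderiv 3 \<alpha> 0 = a *s \<gamma> t + b *s vderiv 1 \<gamma> t + c *s vderiv 2 \<gamma> t + d *s vderiv 3 \<gamma> t"
    if "arc_in Z ?z \<alpha>" for \<alpha>
  proof -
    obtain e c l where l: "e > 0" "c holomorphic_on ball 0 e" "l holomorphic_on ball 0 e"
      "c 0 = c0" "l 0 = t" "l ` ball 0 e \<subseteq> T"
      "\<And>s. s \<in> ball 0 e \<Longrightarrow> c s \<noteq> 0 \<and> \<alpha> s = c s *s \<gamma> (l s)"
      by (rule arc_in_chart'[OF assms \<open>arc_in Z ?z \<alpha>\<close>]) (rule that)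
    have eq: "vderiv k \<alpha> 0 = vderiv k (\<lambda>s. c s *s \<gamma> (l s)) 0" for k
      by (rule vderiv_cong_open[of "ball 0 e"]) (use l in auto)
    have 0: "0 \<in> ball (0::complex) e" using l by simp
    note d = reparam_derivs_holomorphic[OF chD(2,1) l(6) open_ball l(2,3) 0]
    show "\<exists>a b c. vderiv 2 \<alpha> 0 = a *s \<gamma> t + b *s vderiv 1 \<gamma> t + c *s vderiv 2 \<gamma> t"
      unfolding eq d(2) l(5) by (intro exI) (rule refl)
    show "\<exists>a b c d. vderiv 3 \<alpha> 0 = a *s \<gamma> t + b *s vderiv 1 \<gamma> t + c *s vderiv 2 \<gamma> t + d *s vderiv 3 \<gamma> t"
      unfolding eq d(3) l(5) by (intro exI) (rule refl)
  qed
  have o1: "\<exists>a b c. v = a *s \<gamma> t + b *s vderiv 1 \<gamma> t + c *s vderiv 2 \<gamma> t" if "v \<in> osculating Z ?z 1" for v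
  proof -
    from that obtain w \<alpha> where w: "w \<in> tangent Z ?z" "arc_in Z ?z \<alpha>" "v = w + vderiv 2 \<alpha> 0"
      unfolding osculating_1 by blast
    obtain a b where "w = a *s \<gamma> t + b *s vderiv 1 \<gamma> t" using w(1) unfolding tangent_chart[OF assms] by blast
    moreover obtain a' b' c' where "vderiv 2 \<alpha> 0 = a' *s \<gamma> t + b' *s vderiv 1 \<gamma> t + c' *s vderiv 2 \<gamma> t"
      using arc(1)[OF w(2)] by blast
    ultimately have "v = (a + a') *s \<gamma> t + (b + b') *s vderiv 1 \<gamma> t + c' *s vderiv 2 \<gamma> t"
      using w(3) by (simp add: vec_eq_iff algebra_simps)
    then show ?thesis by blast
  qed
  have "\<exists>a b c d. v = a *s \<gamma> t + b *s vderiv 1 \<gamma> t + c *s vderiv 2 \<gamma> t + d *s vderiv 3 \<gamma> t" for v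
  proof -
    have "v \<in> osculating Z ?z 2" using nd unfolding nondegenerate_at_def by blast
    then obtain w \<alpha> where w: "w \<in> osculating Z ?z 1" "arc_in Z ?z \<alpha>" "v = w + vderiv 3 \<alpha> 0"
      unfolding osculating_2 by blast
    obtain a b c where "w = a *s \<gamma> t + b *s vderiv 1 \<gamma> t + c *s vderiv 2 \<gamma> t" using o1[OF w(1)] by blast
    moreover obtain a' b' c' d' where
      "vderiv 3 \<alpha> 0 = a' *s \<gamma> t + b' *s vderiv 1 \<gamma> t + c' *s vderiv 2 \<gamma> t + d' *s vderiv 3 \<gamma> t"
      using arc(2)[OF w(2)] by blast
    ultimately have "v = (a + a') *s \<gamma> t + (b + b') *s vderiv 1 \<gamma> t + (c + c') *s vderiv 2 \<gamma> t + d' *s vderiv 3 \<gamma> t"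
      using w(3) by (simp add: vec_eq_iff algebra_simps)
    then show ?thesis by blast
  qed
  then show "nondeg \<gamma> t" unfolding nondeg_def by (rule spanning_basis4)
next
  let ?z = "c0 *s \<gamma> t"
  assume nd: "nondeg \<gamma> t"
  have o1: "a *s \<gamma> t + b *s vderiv 1 \<gamma> t + d *s vderiv 2 \<gamma> t \<in> osculating Z ?z 1" for a b d
  proof -
    \<comment> \<open>The second derivatives of arcs are not closed under scaling by definition. The
      arc of speed k contributes c0 k^2 times \<gamma>'', so a square root hits the prescribed
      coefficient; in order three a cube root does the same.\<close>
    obtain k where "k\<^sup>2 = d / c0" by (metis exists_complex_root zero_neq_numeral)
    then have "d *s vderiv 2 \<gamma> t = vderiv 2 (\<lambda>s. (c0 + 0 * s) *s \<gamma> (t + k * s)) 0"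
      using affine_arc(3)[OF assms, of 0 k] c0 by simp
    moreover have "a *s \<gamma> t + b *s vderiv 1 \<gamma> t \<in> tangent Z ?z"
      unfolding tangent_chart[OF assms] by blast
    ultimately show ?thesis
      using osculatingI(1)[OF _ affine_arc(1)[OF assms, of 0 k]] by metis
  qed
  have "v \<in> osculating Z ?z 2" for v
  proof -
    obtain a b c d where v: "v = a *s \<gamma> t + b *s vderiv 1 \<gamma> t + c *s vderiv 2 \<gamma> t + d *s vderiv 3 \<gamma> t"
      using basis4_span[OF nd[unfolded nondeg_def]] .
    obtain k where "k ^ 3 = d / c0" by (metis exists_complex_root zero_neq_numeral)
    then have "d *s vderiv 3 \<gamma> t = vderiv 3 (\<lambda>s. (c0 + 0 * s) *s \<gamma> (t + k * s)) 0"
      using affine_arc(4)[OF assms, of 0 k] c0 by simp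
    then show ?thesis
      unfolding v using osculatingI(2)[OF o1[of a b c] affine_arc(1)[OF assms, of 0 k]] by metis
  qed
  moreover have "?z \<in> Z" using chart_in[OF ch t] is_coneD[OF cone c0] by blast
  ultimately show "nondegenerate_at Z ?z"
    unfolding nondegenerate_at_def by blast
qed

text \<open>Where its derivative does not vanish, l is locally injective and hence open, so l maps
  small discs to neighbourhoods and the last clause of \<open>chart\<close> is inherited.\<close>

lemma chart_reparam:
  assumes ch: "chart Z \<gamma> T" and cone: "is_cone Z" and S: "open S"
    and c: "c holomorphic_on S" and l: "l holomorphic_on S" "l ` S \<subseteq> T"
    and nz: "\<And>s. s \<in> S \<Longrightarrow> c s \<noteq> 0" "\<And>s. s \<in> S \<Longrightarrow> deriv l s \<noteq> 0"
  shows "chart Z (\<lambda>s. c s *s \<gamma> (l s)) S"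
  unfolding chart_def
proof (intro conjI ballI allI impI)
  note chD = chartD[OF ch]
  show "vholomorphic_on (\<lambda>s. c s *s \<gamma> (l s)) S"
    by (intro vholomorphic_scale c vholomorphic_compose[OF chD(2) l])
  show "cone_over (\<lambda>s. c s *s \<gamma> (l s)) S \<subseteq> Z"
    using chart_in[OF ch] l(2) nz(1) is_coneD[OF cone] by (fastforce simp: cone_over_def)
  fix s assume s: "s \<in> S"
  then have ls: "l s \<in> T" using l(2) by blast
  show "lin_indep2 (c s *s \<gamma> (l s)) (vderiv 1 (\<lambda>s. c s *s \<gamma> (l s)) s)"
    unfolding lin_indep2_def vderiv_1_reparam[where S=S, OF chD(2,1) ls c l(1) S s]
  proof (intro allI impI)
    fix a b assume *: "a *s (c s *s \<gamma> (l s)) + b *s (deriv c s *s \<gamma> (l s) + (c s * deriv l s) *s vderiv 1 \<gamma> (l s)) = 0"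
    have "(a * c s + b * deriv c s) *s \<gamma> (l s) + (b * (c s * deriv l s)) *s vderiv 1 \<gamma> (l s) = 0"
      unfolding *[symmetric] by (simp add: vec_eq_iff algebra_simps)
    then have "a * c s + b * deriv c s = 0 \<and> b * (c s * deriv l s) = 0"
      using chD(3)[OF ls] unfolding lin_indep2_def by blast
    then show "a = 0 \<and> b = 0" using nz[OF s] by auto
  qed
  fix T' assume T': "open T'" "s \<in> T'"
  obtain r where r: "r > 0" "ball s r \<subseteq> S \<inter> T'" "inj_on l (ball s r)"
  proof (rule has_complex_derivative_locally_injective[of l "S \<inter> T'" s])
    show "l holomorphic_on S \<inter> T'" using l(1) holomorphic_on_subset by blast
  qed (use s T' S nz in auto)
  have "l holomorphic_on ball s r" using l(1) r(2) holomorphic_on_subset by blast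
  then have "open (l ` ball s r)" using open_mapping_thm3 r(3) by blast
  then obtain U where U: "open U" "c s *s \<gamma> (l s) \<in> U" "Z \<inter> U \<subseteq> cone_over \<gamma> (l ` ball s r)"
    using chart_nbhd[OF ch cone ls _ _ nz(1)[OF s], of "l ` ball s r"] r(1) by auto
  have "cone_over \<gamma> (l ` ball s r) \<subseteq> cone_over (\<lambda>s. c s *s \<gamma> (l s)) T'"
  proof
    fix v assume "v \<in> cone_over \<gamma> (l ` ball s r)"
    then obtain d x where d: "d \<noteq> 0" "x \<in> ball s r" "v = d *s \<gamma> (l x)"
      unfolding cone_over_def by blast
    have x: "x \<in> S" "x \<in> T'" using d(2) r(2) by auto
    then have "v = (d / c x) *s (c x *s \<gamma> (l x))" using d(3) nz(1) by simp
    then show "v \<in> cone_over (\<lambda>s. c s *s \<gamma> (l s)) T'"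
      unfolding cone_over_def using x d(1) nz(1)[OF x(1)] by (intro CollectI exI[of _ "d / c x"] exI[of _ x]) simp
  qed
  then show "\<exists>U. open U \<and> c s *s \<gamma> (l s) \<in> U \<and> Z \<inter> U \<subseteq> cone_over (\<lambda>s. c s *s \<gamma> (l s)) T'"
    using U by blast
qed (rule S)

section \<open>Germs satisfying a linear equation with constant coefficients\<close>

lemma continuous_on_cvecI:
  fixes f :: "'a::topological_space \<Rightarrow> cvec"
  assumes "\<And>i. continuous_on S (\<lambda>x. f x $ i)"
  shows "continuous_on S f"
  unfolding continuous_on_def
  by (intro ballI vec_tendstoI) (use assms in \<open>auto simp: continuous_on_def\<close>)

lemma continuous_on_matrix: "continuous_on UNIV (\<lambda>v. (Q :: cmat) *v v)"
  by (rule continuous_on_cvecI)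
    (auto simp: matrix_vector_mult_def intro!: continuous_on_sum continuous_on_mult continuous_on_const
        continuous_on_component)

lemma open_matrix_vimage: "open U \<Longrightarrow> open {v. (Q :: cmat) *v v \<in> U}"
  using open_vimage[OF _ continuous_on_matrix[of Q]] by (simp add: vimage_def)

lemma basis4_triangular:
  assumes "basis4 e0 e1 e2 e3" "a0 \<noteq> 0" "b1 \<noteq> 0" "c2 \<noteq> 0" "d3 \<noteq> 0"
  shows "basis4 (a0 *s e0) (b0 *s e0 + b1 *s e1) (c0 *s e0 + c1 *s e1 + c2 *s e2)
     (d0 *s e0 + d1 *s e1 + d2 *s e2 + d3 *s e3)"
  unfolding basis4_def
proof (intro allI impI)
  fix x y z w
  assume *: "x *s (a0 *s e0) + y *s (b0 *s e0 + b1 *s e1) + z *s (c0 *s e0 + c1 *s e1 + c2 *s e2) +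
    w *s (d0 *s e0 + d1 *s e1 + d2 *s e2 + d3 *s e3) = 0"
  have "(x * a0 + y * b0 + z * c0 + w * d0) *s e0 + (y * b1 + z * c1 + w * d1) *s e1 +
    (z * c2 + w * d2) *s e2 + (w * d3) *s e3 = 0"
    unfolding *[symmetric] by (simp add: vec_eq_iff algebra_simps)
  then have "x * a0 + y * b0 + z * c0 + w * d0 = 0" "y * b1 + z * c1 + w * d1 = 0" "z * c2 + w * d2 = 0" "w * d3 = 0"
    using assms(1) unfolding basis4_def by blast+
  then show "x = 0 \<and> y = 0 \<and> z = 0 \<and> w = 0" using assms(2-) by auto
qed

text \<open>In the frame of \<gamma> the derivatives of the new curve form a triangular matrix with
  diagonal c, c l', c l'^2, c l'^3.\<close>

lemma nondeg_reparam:
  assumes "nondeg \<gamma> (l s)" "vholomorphic_on \<gamma> T" "open T" "l ` S \<subseteq> T" "open S"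
    "c holomorphic_on S" "l holomorphic_on S" "s \<in> S" "c s \<noteq> 0" "deriv l s \<noteq> 0"
  shows "nondeg (\<lambda>s. c s *s \<gamma> (l s)) s"
  unfolding nondeg_def reparam_derivs_holomorphic[OF assms(2-8)]
  by (rule basis4_triangular[OF assms(1)[unfolded nondeg_def]]) (use assms(9,10) in auto)

lemma nondeg_lin_indep2: "nondeg \<gamma> t \<Longrightarrow> lin_indep2 (\<gamma> t) (vderiv 1 \<gamma> t)"
  unfolding nondeg_def basis4_def lin_indep2_def
proof (intro allI impI)
  fix a b
  assume b: "\<forall>a b c d. a *s \<gamma> t + b *s vderiv 1 \<gamma> t + c *s vderiv 2 \<gamma> t + d *s vderiv 3 \<gamma> t = 0
            \<longrightarrow> a = 0 \<and> b = 0 \<and> c = 0 \<and> d = 0"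
    and "a *s \<gamma> t + b *s vderiv 1 \<gamma> t = 0"
  then have "a *s \<gamma> t + b *s vderiv 1 \<gamma> t + 0 *s vderiv 2 \<gamma> t + 0 *s vderiv 3 \<gamma> t = 0" by simp
  then show "a = 0 \<and> b = 0" using b by blast
qed

text \<open>With these signs the exponents \<lambda> of exponential solutions satisfy \<lambda>^4 =
  p \<lambda>^2 + q: the squares of the exponents have sum p and product - q.\<close>

definition const_ode :: "complex \<Rightarrow> complex \<Rightarrow> (complex \<Rightarrow> cvec) \<Rightarrow> complex set \<Rightarrow> bool" where
  "const_ode p q \<gamma> T \<longleftrightarrow> (\<forall>t\<in>T. vderiv 4 \<gamma> t = p *s vderiv 2 \<gamma> t + q *s \<gamma> t)"

lemma const_odeD: "const_ode p q \<gamma> T \<Longrightarrow> t \<in> T \<Longrightarrow> vderiv 4 \<gamma> t = p *s vderiv 2 \<gamma> t + q *s \<gamma> t"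
  unfolding const_ode_def by blast

lemma const_ode_subset: "const_ode p q \<gamma> T \<Longrightarrow> S \<subseteq> T \<Longrightarrow> const_ode p q \<gamma> S"
  unfolding const_ode_def by blast

lemma const_ode_vderiv:
  assumes "const_ode p q \<gamma> T" "vholomorphic_on \<gamma> T" "open T" "t \<in> T"
  shows "vderiv (k + 4) \<gamma> t = p *s vderiv (k + 2) \<gamma> t + q *s vderiv k \<gamma> t"
  using assms(4)
proof (induction k arbitrary: t)
  case 0
  then show ?case using const_odeD[OF assms(1)] by (simp only: add_0 vderiv_0)
next
  case (Suc k)
  have "has_vderiv (\<lambda>t. p *s vderiv (k + 2) \<gamma> t + q *s vderiv k \<gamma> t)
     (p *s vderiv (Suc (k + 2)) \<gamma> t + q *s vderiv (Suc k) \<gamma> t) t"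
    by (intro has_vderiv_add has_vderiv_cmult has_vderiv_vderiv[OF assms(2,3)] Suc.prems)
  from vderiv_Suc_eq[OF assms(3) Suc.prems Suc.IH this] show ?case by simp
qed

text \<open>The equation expresses every derivative of order k + 4 through those of orders k + 2 and
  k, so the first four determine the Taylor series at \<open>t0\<close>.\<close>

lemma const_ode_unique:
  assumes "const_ode p q \<gamma> T" "vholomorphic_on \<gamma> T" "const_ode p q \<delta> T" "vholomorphic_on \<delta> T"
    and T: "open T" "connected T" "t0 \<in> T"
    and "\<gamma> t0 = \<delta> t0" "vderiv 1 \<gamma> t0 = vderiv 1 \<delta> t0" "vderiv 2 \<gamma> t0 = vderiv 2 \<delta> t0" "vderiv 3 \<gamma> t0 = vderiv 3 \<delta> t0"
    and t: "t \<in> T"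
  shows "\<gamma> t = \<delta> t"
proof (rule vholomorphic_eq_on_connected[OF assms(2,4) T _ t])
  fix k show "vderiv k \<gamma> t0 = vderiv k \<delta> t0"
  proof (induction k rule: less_induct)
    case (less k)
    show ?case
    proof (cases "k < 4")
      case True
      then have "k = 0 \<or> k = 1 \<or> k = 2 \<or> k = 3" by auto
      then show ?thesis using assms(8-11) by auto
    next
      case False
      then obtain m where k: "k = m + 4" by (metis add.commute le_iff_add not_less)
      show ?thesis
        unfolding k const_ode_vderiv[OF assms(1,2) T(1,3)] const_ode_vderiv[OF assms(3,4) T(1,3)]
        using less[of "m + 2"] less[of m] k by simp
    qed
  qed
qed

lemma const_ode_matrix_image:
  assumes "const_ode p q \<gamma> T" "vholomorphic_on \<gamma> T" "open T"
  shows "const_ode p q (\<lambda>t. P *v \<gamma> t) T"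
  using assms
  by (auto simp: const_ode_def vderiv_matrix matrix_vector_right_distrib vector_scalar_commute)

text \<open>Take the matrix that carries the frame of \<gamma> at \<open>t0\<close> to the
  derivatives of \<delta> there; the image of \<gamma> solves the same equation with the same
  initial values as \<delta>. As \<delta> may be degenerate, this also turns tangential fields along
  \<gamma> that solve the equation into linear ones.\<close>

lemma const_ode_matrix:
  assumes "const_ode p q \<gamma> T" "vholomorphic_on \<gamma> T" "const_ode p q \<delta> T" "vholomorphic_on \<delta> T"
    and T: "open T" "connected T" "t0 \<in> T" and nd: "nondeg \<gamma> t0"
  shows "\<exists>P :: cmat. (\<forall>t\<in>T. P *v \<gamma> t = \<delta> t) \<and> (nondeg \<delta> t0 \<longrightarrow> invertible P)"
proof -
  obtain P :: cmat where P: "P *v \<gamma> t0 = \<delta> t0" "P *v vderiv 1 \<gamma> t0 = vderiv 1 \<delta> t0"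
    "P *v vderiv 2 \<gamma> t0 = vderiv 2 \<delta> t0" "P *v vderiv 3 \<gamma> t0 = vderiv 3 \<delta> t0"
    using basis4_matrix_exists[OF nd[unfolded nondeg_def]] by blast
  have "P *v \<gamma> t = \<delta> t" if "t \<in> T" for t
    by (rule const_ode_unique[OF const_ode_matrix_image[OF assms(1,2) T(1)] vholomorphic_matrix[OF assms(2)]
          assms(3,4) T _ _ _ _ that])
       (use P vderiv_matrix[OF assms(2) T(1,3)] in auto)
  moreover have "invertible P" if "nondeg \<delta> t0"
    using basis4_invertible_image[of P "\<gamma> t0" "vderiv 1 \<gamma> t0" "vderiv 2 \<gamma> t0" "vderiv 3 \<gamma> t0"] P nd that
    by (simp add: nondeg_def)
  ultimately show ?thesis by blast
qed

section \<open>Germs and projective equivalence\<close>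

text \<open>Parameter 0 goes to the vector z itself and not just to its line, in accordance with
  \<open>proj_equiv\<close>, where P maps representatives to representatives.\<close>

definition ode_germ :: "complex \<Rightarrow> complex \<Rightarrow> cvec set \<Rightarrow> cvec \<Rightarrow> (complex \<Rightarrow> cvec) \<Rightarrow> real \<Rightarrow> bool" where
  "ode_germ p q Z z \<gamma> e \<longleftrightarrow> e > 0 \<and> is_cone Z \<and> chart Z \<gamma> (ball 0 e) \<and> \<gamma> 0 = z \<and>
     const_ode p q \<gamma> (ball 0 e) \<and> nondeg \<gamma> 0"

lemma ode_germD:
  assumes "ode_germ p q Z z \<gamma> e"
  shows "e > 0" "is_cone Z" "chart Z \<gamma> (ball 0 e)" "\<gamma> 0 = z" "const_ode p q \<gamma> (ball 0 e)" "nondeg \<gamma> 0"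
    "vholomorphic_on \<gamma> (ball 0 e)"
  using assms chartD(2) unfolding ode_germ_def by auto

lemma ode_germ_subset:
  assumes "ode_germ p q Z z \<gamma> e" "0 < e'" "e' \<le> e"
  shows "ode_germ p q Z z \<gamma> e'"
  using assms chart_subset[OF _ open_ball subset_ball[OF assms(3)]] const_ode_subset[OF _ subset_ball[OF assms(3)]]
  unfolding ode_germ_def by blast

text \<open>Near the base points the two sets coincide with the cones over the charts, and P maps
  one cone onto the other. The neighbourhood intersects that of the second curve with the image of
  that of the first, written as a preimage under the inverse Q.\<close>

lemma proj_equivI:
  assumes "chart Z \<gamma> T" "chart W \<delta> T" "t \<in> T" "invertible P" "\<And>t. t \<in> T \<Longrightarrow> P *v \<gamma> t = \<delta> t"
  shows "proj_equiv (Z, \<gamma> t) (W, \<delta> t)"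
proof -
  obtain Q where Q: "P ** Q = mat 1" "Q ** P = mat 1" using assms(4) unfolding invertible_def by blast
  have QP: "Q *v (P *v v) = v" "P *v (Q *v v) = v" for v using Q by (simp_all add: matrix_vector_mul_assoc)
  have T: "open T" using chartD(1)[OF assms(1)] .
  obtain U where U: "open U" "\<gamma> t \<in> U" "Z \<inter> U \<subseteq> cone_over \<gamma> T"
    using chartD(5)[OF assms(1,3) T assms(3)] by blast
  obtain V where V: "open V" "\<delta> t \<in> V" "W \<inter> V \<subseteq> cone_over \<delta> T"
    using chartD(5)[OF assms(2,3) T assms(3)] by blast
  let ?U = "V \<inter> {v. Q *v v \<in> U}"
  have "open ?U" using V(1) open_matrix_vimage[OF U(1)] by (rule open_Int)
  moreover have "\<delta> t \<in> ?U" using V(2) U(2) assms(5)[OF assms(3)] QP by (metis IntI mem_Collect_eq)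
  moreover have "((*v) P ` Z) \<inter> ?U = W \<inter> ?U"
  proof (intro set_eqI iffI)
    fix x assume x: "x \<in> ((*v) P ` Z) \<inter> ?U"
    then obtain y where y: "y \<in> Z" "x = P *v y" by blast
    then have "y \<in> Z \<inter> U" using x QP by auto
    then obtain c s where "c \<noteq> 0" "s \<in> T" "y = c *s \<gamma> s" using U(3) by (auto simp: cone_over_def)
    then have "x = c *s \<delta> s" "c *s \<delta> s \<in> cone_over \<delta> T"
      using y assms(5) by (auto simp: vector_scalar_commute intro: cone_overI)
    then show "x \<in> W \<inter> ?U" using x chartD(4)[OF assms(2)] by auto
  next
    fix x assume x: "x \<in> W \<inter> ?U"
    then obtain c s where *: "c \<noteq> 0" "s \<in> T" "x = c *s \<delta> s" using V(3) by (auto simp: cone_over_def)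
    then have "x = P *v (c *s \<gamma> s)" using assms(5) by (simp add: vector_scalar_commute)
    moreover have "c *s \<gamma> s \<in> Z" using * chartD(4)[OF assms(1)] cone_overI by blast
    ultimately show "x \<in> ((*v) P ` Z) \<inter> ?U" using x by blast
  qed
  ultimately show ?thesis
    unfolding proj_equiv_def using assms(3,4,5) by auto
qed

text \<open>The constants of the equation determine the germ: on a common disc the matrix between
  two nondegenerate solutions is invertible.\<close>

lemma ode_germ_proj_equiv:
  assumes "ode_germ p q Z z \<gamma> e" "ode_germ p q W w \<delta> e'"
  shows "proj_equiv (Z, z) (W, w)"
proof -
  define d where "d = min e e'"
  have "ode_germ p q Z z \<gamma> d" "ode_germ p q W w \<delta> d"
    by (rule ode_germ_subset[OF assms(1)] ode_germ_subset[OF assms(2)];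
        use ode_germD(1)[OF assms(1)] ode_germD(1)[OF assms(2)] in \<open>simp add: d_def\<close>)+
  note g = ode_germD[OF this(1)] and h = ode_germD[OF this(2)]
  have 0: "0 \<in> ball (0::complex) d" using g(1) by simp
  obtain P :: cmat where "\<forall>t\<in>ball 0 d. P *v \<gamma> t = \<delta> t" "nondeg \<delta> 0 \<longrightarrow> invertible P"
    using const_ode_matrix[OF g(5,7) h(5,7) open_ball connected_ball 0 g(6)] by blast
  then show ?thesis using proj_equivI[OF g(3) h(3), of 0 P] g h by simp
qed

text \<open>The equivalence compares the two sets only inside U, so the transported chart is
  restricted to a disc that \<gamma>, followed by P, maps into U.\<close>

lemma proj_equiv_chart:
  assumes eq: "proj_equiv (Z, \<gamma> t0) (W, w)" and cone: "is_cone W" and ch: "chart Z \<gamma> T" and t0: "t0 \<in> T"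
  shows "\<exists>(P :: cmat) e. invertible P \<and> e > 0 \<and> ball t0 e \<subseteq> T \<and> chart W (\<lambda>t. P *v \<gamma> t) (ball t0 e) \<and>
    P *v \<gamma> t0 = w"
proof -
  note chD = chartD[OF ch]
  obtain P :: cmat and U where P: "invertible P" "P *v \<gamma> t0 = w" "open U" "w \<in> U" "((*v) P ` Z) \<inter> U = W \<inter> U"
    using eq unfolding proj_equiv_def by auto
  obtain Q where Q: "P ** Q = mat 1" "Q ** P = mat 1" using P(1) unfolding invertible_def by blast
  have QP: "Q *v (P *v v) = v" "P *v (Q *v v) = v" for v using Q by (simp_all add: matrix_vector_mul_assoc)
  let ?\<delta> = "\<lambda>t. P *v \<gamma> t"
  have hol: "vholomorphic_on ?\<delta> T" using vholomorphic_matrix[OF chD(2)] .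
  have "open (T \<inter> ?\<delta> -` U)"
    using continuous_open_preimage[OF continuous_on_vholomorphic[OF hol] chD(1) P(3)] .
  moreover have "t0 \<in> T \<inter> ?\<delta> -` U" using t0 P by simp
  ultimately obtain e where e: "e > 0" "ball t0 e \<subseteq> T \<inter> ?\<delta> -` U" by (meson open_contains_ball)
  have "chart W ?\<delta> (ball t0 e)"
    unfolding chart_def
  proof (intro conjI ballI allI impI)
    show "vholomorphic_on ?\<delta> (ball t0 e)" using hol e(2) vholomorphic_subset by blast
    have "?\<delta> t \<in> W" if "t \<in> ball t0 e" for t
      using P(5) that e(2) chart_in[OF ch, of t] by blast
    then show "cone_over ?\<delta> (ball t0 e) \<subseteq> W"
      using is_coneD[OF cone] by (auto simp: cone_over_def)
    fix t assume "t \<in> ball t0 e"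
    then have t: "t \<in> T" "?\<delta> t \<in> U" using e(2) by auto
    show "lin_indep2 (?\<delta> t) (vderiv 1 ?\<delta> t)"
      unfolding lin_indep2_def vderiv_matrix[OF chD(2,1) t(1)]
    proof (intro allI impI)
      fix a b assume "a *s (P *v \<gamma> t) + b *s (P *v vderiv 1 \<gamma> t) = 0"
      then have "P *v (a *s \<gamma> t + b *s vderiv 1 \<gamma> t) = 0"
        by (simp add: matrix_vector_right_distrib vector_scalar_commute)
      then have "a *s \<gamma> t + b *s vderiv 1 \<gamma> t = 0" using QP by (metis matrix_vector_mult_0_right)
      then show "a = 0 \<and> b = 0" using chD(3)[OF t(1)] unfolding lin_indep2_def by blast
    qed
    fix T' assume T': "open T'" "t \<in> T'"
    obtain V where V: "open V" "\<gamma> t \<in> V" "Z \<inter> V \<subseteq> cone_over \<gamma> T'" using chD(5)[OF t(1) T'] by blast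
    let ?U = "U \<inter> {v. Q *v v \<in> V}"
    have "W \<inter> ?U \<subseteq> cone_over ?\<delta> T'"
    proof
      fix x assume x: "x \<in> W \<inter> ?U"
      then obtain y where y: "y \<in> Z" "x = P *v y" using P(5) by blast
      then have "y \<in> cone_over \<gamma> T'" using x V(3) QP by auto
      then obtain c s where "c \<noteq> 0" "s \<in> T'" "y = c *s \<gamma> s" unfolding cone_over_def by blast
      then show "x \<in> cone_over ?\<delta> T'" using y cone_overI[of c s T' ?\<delta>] by (simp add: vector_scalar_commute)
    qed
    moreover have "open ?U" using P(3) open_matrix_vimage[OF V(1)] by (rule open_Int)
    moreover have "?\<delta> t \<in> ?U" using t V QP by auto
    ultimately show "\<exists>U. open U \<and> ?\<delta> t \<in> U \<and> W \<inter> U \<subseteq> cone_over ?\<delta> T'" by blast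
  qed simp
  then show ?thesis using P(1,2) e by blast
qed

lemma ode_germ_transport:
  assumes "ode_germ p q Z z \<gamma> e" "proj_equiv (Z, z) (W, w)" "is_cone W"
  obtains \<delta> d where "ode_germ p q W w \<delta> d"
proof -
  note g = ode_germD[OF assms(1)]
  have eq: "proj_equiv (Z, \<gamma> 0) (W, w)" and 0: "0 \<in> ball (0::complex) e" using assms(2) g(1,4) by auto
  obtain P :: cmat and d :: real where P: "invertible P" "d > 0" "ball (0::complex) d \<subseteq> ball 0 e"
     "chart W (\<lambda>t. P *v \<gamma> t) (ball 0 d)" "P *v \<gamma> 0 = w"
    using proj_equiv_chart[OF eq assms(3) g(3) 0] by blast
  have "const_ode p q (\<lambda>t. P *v \<gamma> t) (ball 0 d)"
    using const_ode_subset[OF const_ode_matrix_image[OF g(5,7) open_ball] P(3)] .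
  moreover have "nondeg (\<lambda>t. P *v \<gamma> t) 0"
    by (rule nondeg_matrix[OF g(6) P(1) g(7)]) (use g in auto)
  ultimately have "ode_germ p q W w (\<lambda>t. P *v \<gamma> t) d"
    unfolding ode_germ_def using P assms(3) by blast
  then show ?thesis using that by blast
qed

lemma proj_equiv_refl: "proj_equiv (Z, z) (Z, z)"
proof -
  have "invertible (mat 1 :: cmat)" by (auto simp: invertible_def intro!: exI[of _ "mat 1"])
  then show ?thesis unfolding proj_equiv_def by (auto intro!: exI[of _ "mat 1"] exI[of _ UNIV])
qed

lemma proj_equiv_sym:
  assumes "proj_equiv (Z, z) (W, w)"
  shows "proj_equiv (W, w) (Z, z)"
proof -
  obtain P :: cmat and U where P: "invertible P" "P *v z = w" "open U" "w \<in> U" "((*v) P ` Z) \<inter> U = W \<inter> U"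
    using assms unfolding proj_equiv_def by auto
  obtain Q where Q: "P ** Q = mat 1" "Q ** P = mat 1" using P(1) unfolding invertible_def by blast
  have QP: "Q *v (P *v v) = v" "P *v (Q *v v) = v" for v using Q by (simp_all add: matrix_vector_mul_assoc)
  have "((*v) Q ` W) \<inter> {v. P *v v \<in> U} = Z \<inter> {v. P *v v \<in> U}"
  proof (intro set_eqI iffI)
    fix x assume x: "x \<in> ((*v) Q ` W) \<inter> {v. P *v v \<in> U}"
    then have "P *v x \<in> W \<inter> U" using QP by auto
    then obtain y where "y \<in> Z" "P *v x = P *v y" using P(5) by blast
    then have "x \<in> Z" using QP by metis
    then show "x \<in> Z \<inter> {v. P *v v \<in> U}" using x by blast
  next
    fix x assume x: "x \<in> Z \<inter> {v. P *v v \<in> U}"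
    then have "P *v x \<in> W" using P(5) by blast
    then have "x \<in> (*v) Q ` W" using QP(1)[of x] by (metis image_eqI)
    then show "x \<in> ((*v) Q ` W) \<inter> {v. P *v v \<in> U}" using x by blast
  qed
  moreover have "invertible Q" using Q unfolding invertible_def by blast
  moreover have "Q *v w = z" using P(2) QP by blast
  moreover have "z \<in> {v. P *v v \<in> U}" using P(2,4) by simp
  ultimately show ?thesis
    unfolding proj_equiv_def split_conv using open_matrix_vimage[OF P(3), of P] by blast
qed

lemma proj_equiv_trans:
  assumes "proj_equiv (Z, z) (W, w)" "proj_equiv (W, w) (X, x)"
  shows "proj_equiv (Z, z) (X, x)"
proof -
  obtain P :: cmat and U where P: "invertible P" "P *v z = w" "open U" "w \<in> U" "((*v) P ` Z) \<inter> U = W \<inter> U"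
    using assms unfolding proj_equiv_def by auto
  obtain P' :: cmat and U' where P': "invertible P'" "P' *v w = x" "open U'" "x \<in> U'" "((*v) P' ` W) \<inter> U' = X \<inter> U'"
    using assms unfolding proj_equiv_def by auto
  obtain Q where Q: "P' ** Q = mat 1" "Q ** P' = mat 1" using P'(1) unfolding invertible_def by blast
  have QP: "Q *v (P' *v v) = v" "P' *v (Q *v v) = v" for v using Q by (simp_all add: matrix_vector_mul_assoc)
  let ?U = "U' \<inter> {v. Q *v v \<in> U}"
  have "((*v) (P' ** P) ` Z) \<inter> ?U = X \<inter> ?U"
  proof (intro set_eqI iffI)
    fix v assume v: "v \<in> ((*v) (P' ** P) ` Z) \<inter> ?U"
    then obtain y where y: "y \<in> Z" "v = P' *v (P *v y)" by (auto simp: matrix_vector_mul_assoc)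
    then have "P *v y \<in> U" using v QP by auto
    then have "P *v y \<in> W" using y P(5) by blast
    then have "v \<in> X" using P'(5) v y by blast
    then show "v \<in> X \<inter> ?U" using v by blast
  next
    fix v assume v: "v \<in> X \<inter> ?U"
    then obtain y where y: "y \<in> W" "v = P' *v y" using P'(5) by blast
    then have "y \<in> U" using v QP by auto
    then obtain y' where "y' \<in> Z" "y = P *v y'" using P(5) y by blast
    then have "v \<in> (*v) (P' ** P) ` Z" using y by (auto simp: matrix_vector_mul_assoc)
    then show "v \<in> ((*v) (P' ** P) ` Z) \<inter> ?U" using v by blast
  qed
  moreover have "open ?U" using P'(3) open_matrix_vimage[OF P(3)] by (rule open_Int)
  moreover have "x \<in> ?U" using P' P QP by auto
  moreover have "invertible (P' ** P)" using P P' by (simp add: invertible_mult)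
  moreover have "(P' ** P) *v z = x" using P P' by (metis matrix_vector_mul_assoc)
  ultimately show ?thesis unfolding proj_equiv_def by blast
qed

section \<open>Infinitesimal automorphisms\<close>

text \<open>Degenerate forms are included: besides a symplectic form the notion has to cover its
  derivative along an endomorphism, which may even be zero.\<close>

definition alternating_form :: "(cvec \<Rightarrow> cvec \<Rightarrow> complex) \<Rightarrow> bool" where
  "alternating_form \<sigma> \<longleftrightarrow>
     (\<forall>v w x. \<sigma> v (w + x) = \<sigma> v w + \<sigma> v x) \<and> (\<forall>v w x. \<sigma> (w + x) v = \<sigma> w v + \<sigma> x v) \<and>
     (\<forall>c v w. \<sigma> v (c *s w) = c * \<sigma> v w) \<and> (\<forall>c v w. \<sigma> (c *s v) w = c * \<sigma> v w) \<and> (\<forall>v. \<sigma> v v = 0)"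

lemma alternating_formD:
  assumes "alternating_form \<sigma>"
  shows "\<sigma> v (w + x) = \<sigma> v w + \<sigma> v x" "\<sigma> (w + x) v = \<sigma> w v + \<sigma> x v"
    "\<sigma> v (c *s w) = c * \<sigma> v w" "\<sigma> (c *s v) w = c * \<sigma> v w" "\<sigma> v v = 0"
  using assms unfolding alternating_form_def by blast+

lemma alternating_form_antisym:
  assumes "alternating_form \<sigma>"
  shows "\<sigma> w v = - \<sigma> v w"
proof -
  have "\<sigma> (v + w) (v + w) = \<sigma> v v + \<sigma> v w + (\<sigma> w v + \<sigma> w w)"
    by (simp only: alternating_formD(1,2)[OF assms]) (simp add: algebra_simps)
  then have "\<sigma> v w + \<sigma> w v = 0" by (simp only: alternating_formD(5)[OF assms]) simp
  then show ?thesis by (simp add: eq_neg_iff_add_eq_0 add.commute)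
qed

lemma symplectic_alternating:
  assumes "symplectic_form \<sigma>"
  shows "alternating_form \<sigma>"
proof -
  have l: "Vector_Spaces.linear (*s) (*) (\<sigma> v)" "Vector_Spaces.linear (*s) (*) (\<lambda>v. \<sigma> v w)" "\<sigma> v v = 0" for v w
    using assms unfolding symplectic_form_def by blast+
  have m: "module_hom (*s) (*) (\<sigma> v)" "module_hom (*s) (*) (\<lambda>v. \<sigma> v w)" for v w
    using l unfolding Vector_Spaces.linear_def by blast+
  show ?thesis
    unfolding alternating_form_def
    using module_hom.add[OF m(1)] module_hom.add[OF m(2)] module_hom.scale[OF m(1)] module_hom.scale[OF m(2)] l(3)
    by blast
qed

lemma alternating_form_lincomb:
  assumes "alternating_form \<sigma>"
  shows "\<sigma> (a0 *s e0 + a1 *s e1 + a2 *s e2 + a3 *s e3) (b0 *s e0 + b1 *s e1 + b2 *s e2 + b3 *s e3) =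
    (a0 * b1 - a1 * b0) * \<sigma> e0 e1 + (a0 * b2 - a2 * b0) * \<sigma> e0 e2 + (a0 * b3 - a3 * b0) * \<sigma> e0 e3 +
    (a1 * b2 - a2 * b1) * \<sigma> e1 e2 + (a1 * b3 - a3 * b1) * \<sigma> e1 e3 + (a2 * b3 - a3 * b2) * \<sigma> e2 e3"
proof -
  note D = alternating_formD[OF assms]
  have an: "\<sigma> e1 e0 = - \<sigma> e0 e1" "\<sigma> e2 e0 = - \<sigma> e0 e2" "\<sigma> e3 e0 = - \<sigma> e0 e3" "\<sigma> e2 e1 = - \<sigma> e1 e2"
    "\<sigma> e3 e1 = - \<sigma> e1 e3" "\<sigma> e3 e2 = - \<sigma> e2 e3"
    using alternating_form_antisym[OF assms] by blast+
  show ?thesis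
    by (simp only: D an) (simp add: algebra_simps)
qed

lemma vec4_axis: "(v :: cvec) = v $ 1 *s axis 1 1 + v $ 2 *s axis 2 1 + v $ 3 *s axis 3 1 + v $ 4 *s axis 4 1"
  by (simp add: vec_eq_iff forall_4 axis_def)

lemma alternating_form_axis:
  assumes "alternating_form \<sigma>"
  shows "\<sigma> v w =
    (v$1 * w$2 - v$2 * w$1) * \<sigma> (axis 1 1) (axis 2 1) + (v$1 * w$3 - v$3 * w$1) * \<sigma> (axis 1 1) (axis 3 1) +
    (v$1 * w$4 - v$4 * w$1) * \<sigma> (axis 1 1) (axis 4 1) + (v$2 * w$3 - v$3 * w$2) * \<sigma> (axis 2 1) (axis 3 1) +
    (v$2 * w$4 - v$4 * w$2) * \<sigma> (axis 2 1) (axis 4 1) + (v$3 * w$4 - v$4 * w$3) * \<sigma> (axis 3 1) (axis 4 1)"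
  using alternating_form_lincomb[OF assms, of "v $ 1" "axis 1 1" "v $ 2" "axis 2 1" "v $ 3" "axis 3 1"
      "v $ 4" "axis 4 1" "w $ 1" "w $ 2" "w $ 3" "w $ 4"]
  by (simp only: vec4_axis[symmetric])

text \<open>On coordinates the form is a fixed combination of the six 2 by 2 minors of the pair, so
  the product rule for each minor suffices.\<close>

lemma DERIV_alternating_form:
  assumes \<sigma>: "alternating_form \<sigma>" and "has_vderiv \<alpha> a t" "has_vderiv \<beta> b t"
  shows "((\<lambda>t. \<sigma> (\<alpha> t) (\<beta> t)) has_field_derivative \<sigma> a (\<beta> t) + \<sigma> (\<alpha> t) b) (at t)"
proof -
  have d: "((\<lambda>s. \<alpha> s $ i) has_field_derivative a $ i) (at t)" "((\<lambda>s. \<beta> s $ i) has_field_derivative b $ i) (at t)" for i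
    using assms unfolding has_vderiv_def by auto
  have e: "((\<lambda>s. (\<alpha> s $ i * \<beta> s $ j - \<alpha> s $ j * \<beta> s $ i) * c) has_field_derivative
     ((a $ i * \<beta> t $ j - a $ j * \<beta> t $ i) * c + (\<alpha> t $ i * b $ j - \<alpha> t $ j * b $ i) * c)) (at t)" for i j c
    by (rule derivative_eq_intros d refl)+ (simp add: algebra_simps)
  have eq: "\<sigma> a (\<beta> t) + \<sigma> (\<alpha> t) b =
    ((a $ 1 * \<beta> t $ 2 - a $ 2 * \<beta> t $ 1) * \<sigma> (axis 1 1) (axis 2 1) + (\<alpha> t $ 1 * b $ 2 - \<alpha> t $ 2 * b $ 1) * \<sigma> (axis 1 1) (axis 2 1)) +
    ((a $ 1 * \<beta> t $ 3 - a $ 3 * \<beta> t $ 1) * \<sigma> (axis 1 1) (axis 3 1) + (\<alpha> t $ 1 * b $ 3 - \<alpha> t $ 3 * b $ 1) * \<sigma> (axis 1 1) (axis 3 1)) +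
    ((a $ 1 * \<beta> t $ 4 - a $ 4 * \<beta> t $ 1) * \<sigma> (axis 1 1) (axis 4 1) + (\<alpha> t $ 1 * b $ 4 - \<alpha> t $ 4 * b $ 1) * \<sigma> (axis 1 1) (axis 4 1)) +
    ((a $ 2 * \<beta> t $ 3 - a $ 3 * \<beta> t $ 2) * \<sigma> (axis 2 1) (axis 3 1) + (\<alpha> t $ 2 * b $ 3 - \<alpha> t $ 3 * b $ 2) * \<sigma> (axis 2 1) (axis 3 1)) +
    ((a $ 2 * \<beta> t $ 4 - a $ 4 * \<beta> t $ 2) * \<sigma> (axis 2 1) (axis 4 1) + (\<alpha> t $ 2 * b $ 4 - \<alpha> t $ 4 * b $ 2) * \<sigma> (axis 2 1) (axis 4 1)) +
    ((a $ 3 * \<beta> t $ 4 - a $ 4 * \<beta> t $ 3) * \<sigma> (axis 3 1) (axis 4 1) + (\<alpha> t $ 3 * b $ 4 - \<alpha> t $ 4 * b $ 3) * \<sigma> (axis 3 1) (axis 4 1))"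
    unfolding alternating_form_axis[OF \<sigma>, of a] alternating_form_axis[OF \<sigma>, of "\<alpha> t" b]
    by (simp only: add_ac)
  show ?thesis
    unfolding eq alternating_form_axis[OF \<sigma>, of "\<alpha> _" "\<beta> _"]
    by (intro DERIV_add e)
qed

text \<open>The form is determined on the frame \<open>\<gamma>, \<gamma>', \<gamma>'', \<gamma>'''\<close> by its value on \<open>(\<gamma>', \<gamma>'')\<close>: differentiate
  \<open>\<sigma>(\<gamma>, \<gamma>') = 0\<close> four times.\<close>

lemma const_ode_form_relations:
  assumes \<sigma>: "alternating_form \<sigma>" and ode: "const_ode p q \<gamma> T" and hol: "vholomorphic_on \<gamma> T" and T: "open T"
    and z: "\<And>t. t \<in> T \<Longrightarrow> \<sigma> (\<gamma> t) (vderiv 1 \<gamma> t) = 0" and t: "t \<in> T"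
  shows "\<sigma> (\<gamma> t) (vderiv 2 \<gamma> t) = 0" "\<sigma> (\<gamma> t) (vderiv 3 \<gamma> t) = - \<sigma> (vderiv 1 \<gamma> t) (vderiv 2 \<gamma> t)"
    "\<sigma> (vderiv 1 \<gamma> t) (vderiv 3 \<gamma> t) = 0" "\<sigma> (vderiv 2 \<gamma> t) (vderiv 3 \<gamma> t) = - p * \<sigma> (vderiv 1 \<gamma> t) (vderiv 2 \<gamma> t)"
proof -
  note D = alternating_formD[OF \<sigma>]
  define s where "s j k t = \<sigma> (vderiv j \<gamma> t) (vderiv k \<gamma> t)" for j k t
  have ds: "(s j k has_field_derivative s (Suc j) k t + s j (Suc k) t) (at t)" if "t \<in> T" for j k t
    unfolding s_def
    by (rule DERIV_alternating_form[OF \<sigma> has_vderiv_vderiv[OF hol T that] has_vderiv_vderiv[OF hol T that]])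
  have zero: "d = 0" if "(f has_field_derivative d) (at t)" "\<And>t. t \<in> T \<Longrightarrow> f t = 0" "t \<in> T" for f :: "complex \<Rightarrow> complex" and d t
    using has_field_derivative_transform_within_open[OF that(1) T that(3), of "\<lambda>_. 0"] that(2)
    by (metis DERIV_const DERIV_unique)
  have ss: "s k k t = 0" for k t by (simp add: s_def D(5))
  have s01: "s 0 1 t = 0" if "t \<in> T" for t using z[OF that] by (simp add: s_def)
  have s02: "s 0 2 t = 0" if "t \<in> T" for t
    using zero[OF ds[OF that, of 0 1] s01 that] ss by (simp add: numeral_2_eq_2)
  have s03: "s 1 2 t + s 0 3 t = 0" if "t \<in> T" for t
    using zero[OF ds[OF that, of 0 2] s02 that] by (simp add: numeral_3_eq_3)
  \<comment> \<open>Here the equation enters: the value on (\<gamma>, \<gamma>'''') is p times that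
    on (\<gamma>, \<gamma>'') plus q times that on (\<gamma>, \<gamma>), and both vanish.\<close>
  have s04: "s 0 4 t = 0" if "t \<in> T" for t
    using s02[OF that] by (simp add: s_def const_odeD[OF ode that] D)
  have s13: "s 1 3 t = 0" if "t \<in> T" for t
  proof -
    have "(s 2 2 t + s 1 3 t) + (s 1 3 t + s 0 4 t) = 0"
      using zero[OF DERIV_add[OF ds[OF that, of 1 2] ds[OF that, of 0 3]] s03 that] by (simp add: eval_nat_numeral)
    then show ?thesis using ss s04[OF that] by simp
  qed
  have s14: "s 1 4 t = p * s 1 2 t" if "t \<in> T" for t
    using s01[OF that] alternating_form_antisym[OF \<sigma>, of "vderiv 1 \<gamma> t" "\<gamma> t"]
    by (simp add: s_def const_odeD[OF ode that] D)
  have s23: "s 2 3 t + s 1 4 t = 0" if "t \<in> T" for t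
    using zero[OF ds[OF that, of 1 3] s13 that] by (simp add: eval_nat_numeral)
  show "\<sigma> (\<gamma> t) (vderiv 2 \<gamma> t) = 0" "\<sigma> (vderiv 1 \<gamma> t) (vderiv 3 \<gamma> t) = 0"
    using s02[OF t] s13[OF t] by (simp_all add: s_def)
  show "\<sigma> (\<gamma> t) (vderiv 3 \<gamma> t) = - \<sigma> (vderiv 1 \<gamma> t) (vderiv 2 \<gamma> t)"
    using s03[OF t] by (simp add: s_def eq_neg_iff_add_eq_0 add.commute)
  show "\<sigma> (vderiv 2 \<gamma> t) (vderiv 3 \<gamma> t) = - p * \<sigma> (vderiv 1 \<gamma> t) (vderiv 2 \<gamma> t)"
    using s23[OF t] s14[OF t] by (simp add: s_def eq_neg_iff_add_eq_0)
qed

text \<open>On the frame both forms are multiples of their values on (\<gamma>', \<gamma>''), with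
  the same factors. For \<sigma> this value is nonzero, because otherwise \<sigma> would vanish
  altogether.\<close>

lemma const_ode_form_unique:
  assumes \<sigma>: "symplectic_form \<sigma>" and \<tau>: "alternating_form \<tau>" and ode: "const_ode p q \<gamma> T"
    and hol: "vholomorphic_on \<gamma> T" and T: "open T"
    and z\<sigma>: "\<And>t. t \<in> T \<Longrightarrow> \<sigma> (\<gamma> t) (vderiv 1 \<gamma> t) = 0" and z\<tau>: "\<And>t. t \<in> T \<Longrightarrow> \<tau> (\<gamma> t) (vderiv 1 \<gamma> t) = 0"
    and t: "t \<in> T" and nd: "nondeg \<gamma> t"
  shows "\<exists>c. \<forall>v w. \<tau> v w = c * \<sigma> v w"
proof -
  let ?e0 = "\<gamma> t" and ?e1 = "vderiv 1 \<gamma> t" and ?e2 = "vderiv 2 \<gamma> t" and ?e3 = "vderiv 3 \<gamma> t"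
  note a\<sigma> = symplectic_alternating[OF \<sigma>]
  note r\<sigma> = z\<sigma>[OF t] const_ode_form_relations[OF a\<sigma> ode hol T z\<sigma> t]
  note r\<tau> = z\<tau>[OF t] const_ode_form_relations[OF \<tau> ode hol T z\<tau> t]
  \<comment> \<open>The order of quantifiers is essential: the factor k depends on the arguments v
    and w only and serves every form satisfying the relations.\<close>
  have e\<sigma>: "\<exists>k. \<forall>\<rho>. alternating_form \<rho> \<longrightarrow> (\<rho> ?e0 ?e1 = 0 \<and> \<rho> ?e0 ?e2 = 0 \<and> \<rho> ?e0 ?e3 = - \<rho> ?e1 ?e2 \<and>
      \<rho> ?e1 ?e3 = 0 \<and> \<rho> ?e2 ?e3 = - p * \<rho> ?e1 ?e2) \<longrightarrow> \<rho> v w = k * \<rho> ?e1 ?e2" for v w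
  proof -
    obtain a0 a1 a2 a3 where v: "v = a0 *s ?e0 + a1 *s ?e1 + a2 *s ?e2 + a3 *s ?e3"
      using basis4_span[OF nd[unfolded nondeg_def]] .
    obtain b0 b1 b2 b3 where w: "w = b0 *s ?e0 + b1 *s ?e1 + b2 *s ?e2 + b3 *s ?e3"
      using basis4_span[OF nd[unfolded nondeg_def]] .
    show ?thesis
    proof (intro exI allI impI)
      fix \<rho> assume "alternating_form \<rho>" and r: "\<rho> ?e0 ?e1 = 0 \<and> \<rho> ?e0 ?e2 = 0 \<and> \<rho> ?e0 ?e3 = - \<rho> ?e1 ?e2 \<and>
        \<rho> ?e1 ?e3 = 0 \<and> \<rho> ?e2 ?e3 = - p * \<rho> ?e1 ?e2"
      show "\<rho> v w = (- (a0 * b3 - a3 * b0) + (a1 * b2 - a2 * b1) - p * (a2 * b3 - a3 * b2)) * \<rho> ?e1 ?e2"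
        unfolding v w alternating_form_lincomb[OF \<open>alternating_form \<rho>\<close>] using r by (simp add: algebra_simps)
    qed
  qed
  have nz: "\<sigma> ?e1 ?e2 \<noteq> 0"
  proof
    assume "\<sigma> ?e1 ?e2 = 0"
    then have "\<sigma> v w = 0" for v w using e\<sigma>[of v w] a\<sigma> r\<sigma> by auto
    then have "?e0 = 0" using \<sigma> unfolding symplectic_form_def by blast
    then show False using nondeg_lin_indep2[OF nd] unfolding lin_indep2_def
      by (metis add.right_neutral vector_smult_lzero vector_smult_rzero zero_neq_one)
  qed
  show ?thesis
  proof (intro exI allI)
    fix v w
    obtain k where k: "\<forall>\<rho>. alternating_form \<rho> \<longrightarrow> (\<rho> ?e0 ?e1 = 0 \<and> \<rho> ?e0 ?e2 = 0 \<and> \<rho> ?e0 ?e3 = - \<rho> ?e1 ?e2 \<and>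
      \<rho> ?e1 ?e3 = 0 \<and> \<rho> ?e2 ?e3 = - p * \<rho> ?e1 ?e2) \<longrightarrow> \<rho> v w = k * \<rho> ?e1 ?e2" using e\<sigma> by blast
    have "\<sigma> v w = k * \<sigma> ?e1 ?e2" "\<tau> v w = k * \<tau> ?e1 ?e2"
      using k[rule_format, OF a\<sigma>] k[rule_format, OF \<tau>] r\<sigma> r\<tau> by auto
    then show "\<tau> v w = (\<tau> ?e1 ?e2 / \<sigma> ?e1 ?e2) * \<sigma> v w" using nz by simp
  qed
qed

section \<open>Tangential fields along a curve\<close>

lemma tangent_coefficients:
  assumes hol: "vholomorphic_on \<gamma> T" and T: "open T" and t0: "t0 \<in> T" and ind: "lin_indep2 (\<gamma> t0) (vderiv 1 \<gamma> t0)"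
  obtains e i j where "e > 0" "ball t0 e \<subseteq> T"
    "\<And>t. t \<in> ball t0 e \<Longrightarrow> \<gamma> t $ i * vderiv 1 \<gamma> t $ j - \<gamma> t $ j * vderiv 1 \<gamma> t $ i \<noteq> 0"
proof -
  obtain i j where ij: "\<gamma> t0 $ i * vderiv 1 \<gamma> t0 $ j - \<gamma> t0 $ j * vderiv 1 \<gamma> t0 $ i \<noteq> 0"
    using lin_indep2_coords[OF ind] .
  define W where "W t = \<gamma> t $ i * vderiv 1 \<gamma> t $ j - \<gamma> t $ j * vderiv 1 \<gamma> t $ i" for t
  have "W holomorphic_on T"
    unfolding W_def using holomorphic_vnth[OF hol] holomorphic_vnth[OF vholomorphic_vderiv[OF hol T]]
    by (intro holomorphic_intros)
  then have "open {t\<in>T. W t \<noteq> 0}" using open_nonzero[OF holomorphic_on_imp_continuous_on T] by blast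
  moreover have "t0 \<in> {t\<in>T. W t \<noteq> 0}" using t0 ij by (simp add: W_def)
  ultimately obtain e where "e > 0" "ball t0 e \<subseteq> {t\<in>T. W t \<noteq> 0}" by (meson open_contains_ball)
  then show ?thesis using that[of e i j] unfolding W_def by blast
qed

text \<open>The coefficients of a tangent field are quotients of holomorphic functions, and the
  decomposition extends from V by the identity theorem. The radius e is chosen before u and V: one
  disc serves all automorphisms, and tangency on any part of it yields tangency on all of
  it.\<close>

lemma tangent_decomposition:
  assumes ch: "chart Z \<gamma> T" and cone: "is_cone Z" and t0: "t0 \<in> T"
  shows "\<exists>e>0. ball t0 e \<subseteq> T \<and> (\<forall>u V. open V \<longrightarrow> V \<noteq> {} \<longrightarrow> V \<subseteq> ball t0 e \<longrightarrow>
       (\<forall>t\<in>V. u *v \<gamma> t \<in> tangent Z (\<gamma> t)) \<longrightarrow>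
       (\<exists>f g. f holomorphic_on ball t0 e \<and> g holomorphic_on ball t0 e \<and>
         (\<forall>t\<in>ball t0 e. u *v \<gamma> t = f t *s \<gamma> t + g t *s vderiv 1 \<gamma> t)))"
proof -
  note chD = chartD[OF ch]
  obtain e i j where e: "e > 0" "ball t0 e \<subseteq> T"
    and W: "\<And>t. t \<in> ball t0 e \<Longrightarrow> \<gamma> t $ i * vderiv 1 \<gamma> t $ j - \<gamma> t $ j * vderiv 1 \<gamma> t $ i \<noteq> 0"
    using tangent_coefficients[OF chD(2,1) t0 chD(3)[OF t0]] by metis
  have h1: "(\<lambda>t. \<gamma> t $ k) holomorphic_on ball t0 e" "(\<lambda>t. vderiv 1 \<gamma> t $ k) holomorphic_on ball t0 e" for k
    using holomorphic_vnth[OF chD(2)] holomorphic_vnth[OF vholomorphic_vderiv[OF chD(2,1)]] e(2) holomorphic_on_subset by blast+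
  have "\<exists>f g. f holomorphic_on ball t0 e \<and> g holomorphic_on ball t0 e \<and>
         (\<forall>t\<in>ball t0 e. u *v \<gamma> t = f t *s \<gamma> t + g t *s vderiv 1 \<gamma> t)"
    if V: "open V" "V \<noteq> {}" "V \<subseteq> ball t0 e" and tan: "\<forall>t\<in>V. u *v \<gamma> t \<in> tangent Z (\<gamma> t)" for u V
  proof -
    \<comment> \<open>Cramer's rule, applied to the two coordinates whose minor does not vanish on
      the disc.\<close>
    define f where "f t = ((u *v \<gamma> t) $ i * vderiv 1 \<gamma> t $ j - (u *v \<gamma> t) $ j * vderiv 1 \<gamma> t $ i) /
       (\<gamma> t $ i * vderiv 1 \<gamma> t $ j - \<gamma> t $ j * vderiv 1 \<gamma> t $ i)" for t
    define g where "g t = (\<gamma> t $ i * (u *v \<gamma> t) $ j - \<gamma> t $ j * (u *v \<gamma> t) $ i) /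
       (\<gamma> t $ i * vderiv 1 \<gamma> t $ j - \<gamma> t $ j * vderiv 1 \<gamma> t $ i)" for t
    have hu: "(\<lambda>t. (u *v \<gamma> t) $ k) holomorphic_on ball t0 e" for k
      using holomorphic_vnth[OF vholomorphic_matrix[OF chD(2)]] e(2) holomorphic_on_subset by blast
    have fh: "f holomorphic_on ball t0 e" and gh: "g holomorphic_on ball t0 e"
      unfolding f_def g_def using h1 hu W by (auto intro!: holomorphic_intros)
    have eqV: "u *v \<gamma> t = f t *s \<gamma> t + g t *s vderiv 1 \<gamma> t" if tV: "t \<in> V" for t
    proof -
      have t: "t \<in> ball t0 e" "t \<in> T" using tV V(3) e(2) by auto
      obtain a b where ab: "u *v \<gamma> t = a *s \<gamma> t + b *s vderiv 1 \<gamma> t"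
        using tan[rule_format, OF tV] tangent_chart[OF ch cone t(2), of 1] by auto
      have "f t = a" "g t = b" unfolding f_def g_def ab using W[OF t(1)] by (simp_all add: field_simps)
      then show ?thesis using ab by simp
    qed
    have "u *v \<gamma> t = f t *s \<gamma> t + g t *s vderiv 1 \<gamma> t" if "t \<in> ball t0 e" for t
    proof (rule vholomorphic_eq_on_open[OF _ _ open_ball connected_ball V eqV that])
      show "vholomorphic_on (\<lambda>t. u *v \<gamma> t) (ball t0 e)"
        using vholomorphic_matrix[OF chD(2)] vholomorphic_subset e(2) by blast
      show "vholomorphic_on (\<lambda>t. f t *s \<gamma> t + g t *s vderiv 1 \<gamma> t) (ball t0 e)"
        using vholomorphic_subset[OF chD(2) e(2)] vholomorphic_subset[OF vholomorphic_vderiv[OF chD(2,1)] e(2)] fh gh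
        by (intro vholomorphic_add vholomorphic_scale)
    qed
    then show ?thesis using fh gh by blast
  qed
  then show ?thesis using e by blast
qed

lemma has_vderiv_tangent_combination:
  assumes "vholomorphic_on \<gamma> T" "open T" "t \<in> T"
    "(f has_field_derivative f') (at t)" "(g has_field_derivative g') (at t)"
  shows "has_vderiv (\<lambda>t. f t *s \<gamma> t + g t *s vderiv 1 \<gamma> t)
    (f' *s \<gamma> t + (f t + g') *s vderiv 1 \<gamma> t + g t *s vderiv 2 \<gamma> t) t"
proof -
  have "has_vderiv (\<lambda>t. f t *s \<gamma> t + g t *s vderiv 1 \<gamma> t)
    ((f' *s \<gamma> t + f t *s vderiv 1 \<gamma> t) + (g' *s vderiv 1 \<gamma> t + g t *s vderiv 2 \<gamma> t)) t"
    by (intro has_vderiv_add has_vderiv_scale assms(4,5) has_vderiv_1[OF assms(1-3)]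
        has_vderiv_vderiv[OF assms(1-3), of 1, unfolded Suc_1])
  moreover have "(f' *s \<gamma> t + f t *s vderiv 1 \<gamma> t) + (g' *s vderiv 1 \<gamma> t + g t *s vderiv 2 \<gamma> t) =
     f' *s \<gamma> t + (f t + g') *s vderiv 1 \<gamma> t + g t *s vderiv 2 \<gamma> t"
    by (simp add: vec_eq_iff algebra_simps)
  ultimately show ?thesis by (simp only:)
qed

text \<open>Preserving the form up to scale is automatic, since the forms for which the curve is Legendrian
  are unique up to scale.\<close>

lemma tangent_imp_csp:
  assumes \<sigma>: "symplectic_form \<sigma>" and ode: "const_ode p q \<gamma> T"
    and hol: "vholomorphic_on \<gamma> T" and T: "open T"
    and z\<sigma>: "\<And>t. t \<in> T \<Longrightarrow> \<sigma> (\<gamma> t) (vderiv 1 \<gamma> t) = 0"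
    and t: "t \<in> T" and nd: "nondeg \<gamma> t"
    and fg: "f holomorphic_on T" "g holomorphic_on T"
    and u: "\<And>t. t \<in> T \<Longrightarrow> u *v \<gamma> t = f t *s \<gamma> t + g t *s vderiv 1 \<gamma> t"
  shows "u \<in> csp \<sigma>"
proof -
  \<comment> \<open>The derivative of \<sigma> along u. It vanishes on (\<gamma>, \<gamma>') because
    u maps \<gamma> and \<gamma>' into the span of \<gamma>, \<gamma>', \<gamma>'', while \<sigma>
    vanishes on (\<gamma>, \<gamma>') and on (\<gamma>, \<gamma>''). Uniqueness of the form then
    makes it a multiple of \<sigma>.\<close>
  define \<tau> where "\<tau> v w = \<sigma> (u *v v) w + \<sigma> v (u *v w)" for v w
  note a\<sigma> = symplectic_alternating[OF \<sigma>]
  note D = alternating_formD[OF a\<sigma>]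
  have "\<tau> v v = 0" for v unfolding \<tau>_def using alternating_form_antisym[OF a\<sigma>, of v "u *v v"] by simp
  then have "alternating_form \<tau>"
    unfolding alternating_form_def
    by (auto simp: \<tau>_def matrix_vector_right_distrib vector_scalar_commute D algebra_simps)
  moreover have "\<tau> (\<gamma> t) (vderiv 1 \<gamma> t) = 0" if t: "t \<in> T" for t
  proof -
    have "has_vderiv (\<lambda>t. u *v \<gamma> t) (u *v vderiv 1 \<gamma> t) t"
      by (intro has_vderiv_matrix has_vderiv_1[OF hol T t])
    moreover have "has_vderiv (\<lambda>t. u *v \<gamma> t) (deriv f t *s \<gamma> t + (f t + deriv g t) *s vderiv 1 \<gamma> t + g t *s vderiv 2 \<gamma> t) t"
      by (rule has_vderiv_transform[OF has_vderiv_tangent_combination[OF hol T t] T t u])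
         (use holomorphic_derivI fg T t in blast)+
    ultimately have "u *v vderiv 1 \<gamma> t = deriv f t *s \<gamma> t + (f t + deriv g t) *s vderiv 1 \<gamma> t + g t *s vderiv 2 \<gamma> t"
      by (rule has_vderiv_unique)
    then show ?thesis
      unfolding \<tau>_def using z\<sigma>[OF t] const_ode_form_relations(1)[OF a\<sigma> ode hol T z\<sigma> t]
      by (simp add: u[OF t] D)
  qed
  ultimately show ?thesis
    using const_ode_form_unique[OF \<sigma> _ ode hol T z\<sigma> _ t nd, of \<tau>] unfolding csp_def \<tau>_def by blast
qed

lemma DERIV_eq_on_open:
  fixes F G :: "complex \<Rightarrow> complex"
  assumes "open T" "t \<in> T" "\<And>s. s \<in> T \<Longrightarrow> F s = G s" "(F has_field_derivative F') (at t)" "(G has_field_derivative G') (at t)"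
  shows "F' = G'"
  using has_field_derivative_transform_within_open[OF assms(4,1,2), of G] assms(3,5) DERIV_unique by blast

lemma vderiv_vderiv_1: "vderiv k (vderiv 1 \<gamma>) t = vderiv (Suc k) \<gamma> t"
  by (simp add: vderiv_def funpow_swap1 del: funpow.simps(2)) (simp add: funpow_swap1 vec_eq_iff)

lemma vderiv_add:
  assumes "vholomorphic_on \<alpha> T" "vholomorphic_on \<beta> T" "open T" "t \<in> T"
  shows "vderiv k (\<lambda>t. \<alpha> t + \<beta> t) t = vderiv k \<alpha> t + vderiv k \<beta> t"
  using assms(4)
proof (induction k arbitrary: t)
  case (Suc k)
  show ?case
    by (rule vderiv_Suc_eq[OF assms(3) Suc.prems Suc.IH has_vderiv_add[OF has_vderiv_vderiv has_vderiv_vderiv]])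
       (use assms Suc.prems in auto)
qed simp

lemma leibniz_derivs:
  assumes "vholomorphic_on \<gamma> T" "open T" "f holomorphic_on T" "t \<in> T"
  shows "vderiv 2 (\<lambda>s. f s *s \<gamma> s) t = (deriv ^^ 2) f t *s \<gamma> t + (2 * (deriv ^^ 1) f t) *s vderiv 1 \<gamma> t + f t *s vderiv 2 \<gamma> t"
    "vderiv 4 (\<lambda>s. f s *s \<gamma> s) t = (deriv ^^ 4) f t *s \<gamma> t + (4 * (deriv ^^ 3) f t) *s vderiv 1 \<gamma> t +
      (6 * (deriv ^^ 2) f t) *s vderiv 2 \<gamma> t + (4 * (deriv ^^ 1) f t) *s vderiv 3 \<gamma> t + f t *s vderiv 4 \<gamma> t"
proof -
  have l: "(\<lambda>s::complex. s) ` T \<subseteq> T" by auto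
  have D: "((deriv ^^ 1) f has_field_derivative (deriv ^^ 2) f s) (at s)" "(f has_field_derivative (deriv ^^ 1) f s) (at s)"
     "((deriv ^^ 2) f has_field_derivative (deriv ^^ 3) f s) (at s)" "((deriv ^^ 3) f has_field_derivative (deriv ^^ 4) f s) (at s)"
    if "s \<in> T" for s
    using holomorphic_DERIVs[OF assms(3,2) that] by blast+
  have I: "((\<lambda>s. s) has_field_derivative 1) (at s)" "((\<lambda>_. 1) has_field_derivative 0) (at s)"
    "((\<lambda>_. 0) has_field_derivative 0) (at s)" for s :: complex by (auto intro!: derivative_eq_intros)
  note R = reparam_derivs[where l = "\<lambda>s. s" and T = T and S = T and ?l1.0 = "\<lambda>_. 1" and ?l2.0 = "\<lambda>_. 0" and ?l3.0 = "\<lambda>_. 0" and ?l4.0 = "\<lambda>_. 0",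
    OF assms(1,2) l assms(2) D(2) D(1) D(3) D(4) I(1) I(2) I(3) I(3) assms(4)]
  show "vderiv 2 (\<lambda>s. f s *s \<gamma> s) t = (deriv ^^ 2) f t *s \<gamma> t + (2 * (deriv ^^ 1) f t) *s vderiv 1 \<gamma> t + f t *s vderiv 2 \<gamma> t"
    using R(2) by simp
  show "vderiv 4 (\<lambda>s. f s *s \<gamma> s) t = (deriv ^^ 4) f t *s \<gamma> t + (4 * (deriv ^^ 3) f t) *s vderiv 1 \<gamma> t +
      (6 * (deriv ^^ 2) f t) *s vderiv 2 \<gamma> t + (4 * (deriv ^^ 1) f t) *s vderiv 3 \<gamma> t + f t *s vderiv 4 \<gamma> t"
    using R(4) by simp
qed

text \<open>The operator of the equation applied to a tangential field, with the fourth and fifth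
  derivatives of \<gamma> eliminated by the equation. The four coefficients are the determining
  equations for infinitesimal symmetries.\<close>

lemma tangent_field_ode:
  assumes ode: "const_ode p q \<gamma> T" and hol: "vholomorphic_on \<gamma> T" and T: "open T"
    and f: "f holomorphic_on T" and g: "g holomorphic_on T" and t: "t \<in> T"
  defines "w \<equiv> \<lambda>t. f t *s \<gamma> t + g t *s vderiv 1 \<gamma> t"
  shows "vderiv 4 w t - (p *s vderiv 2 w t + q *s w t) =
    ((deriv ^^ 4) f t - p * (deriv ^^ 2) f t + 4 * q * (deriv ^^ 1) g t) *s \<gamma> t +
    (4 * (deriv ^^ 3) f t + (deriv ^^ 4) g t - 2 * p * (deriv ^^ 1) f t - p * (deriv ^^ 2) g t) *s vderiv 1 \<gamma> t +
    (6 * (deriv ^^ 2) f t + 4 * (deriv ^^ 3) g t + 2 * p * (deriv ^^ 1) g t) *s vderiv 2 \<gamma> t +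
    (4 * (deriv ^^ 1) f t + 6 * (deriv ^^ 2) g t) *s vderiv 3 \<gamma> t"
proof -
  have hol1: "vholomorphic_on (vderiv 1 \<gamma>) T" using vholomorphic_vderiv[OF hol T] .
  have e: "Suc 1 = 2" "Suc 2 = 3" "Suc 3 = 4" "Suc 4 = 1 + 4" "1 + 2 = (3::nat)" by simp_all
  have add: "vderiv k w t = vderiv k (\<lambda>t. f t *s \<gamma> t) t + vderiv k (\<lambda>t. g t *s vderiv 1 \<gamma> t) t" for k
    unfolding w_def by (intro vderiv_add[OF _ _ T t] vholomorphic_scale f g hol hol1)
  have w2: "vderiv 2 w t = ((deriv ^^ 2) f t *s \<gamma> t + (2 * (deriv ^^ 1) f t) *s vderiv 1 \<gamma> t + f t *s vderiv 2 \<gamma> t) +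
     ((deriv ^^ 2) g t *s vderiv 1 \<gamma> t + (2 * (deriv ^^ 1) g t) *s vderiv 2 \<gamma> t + g t *s vderiv 3 \<gamma> t)"
    unfolding add leibniz_derivs[OF hol T f t] leibniz_derivs[OF hol1 T g t] vderiv_vderiv_1 e ..
  have w4: "vderiv 4 w t = ((deriv ^^ 4) f t *s \<gamma> t + (4 * (deriv ^^ 3) f t) *s vderiv 1 \<gamma> t +
      (6 * (deriv ^^ 2) f t) *s vderiv 2 \<gamma> t + (4 * (deriv ^^ 1) f t) *s vderiv 3 \<gamma> t + f t *s (p *s vderiv 2 \<gamma> t + q *s \<gamma> t)) +
     ((deriv ^^ 4) g t *s vderiv 1 \<gamma> t + (4 * (deriv ^^ 3) g t) *s vderiv 2 \<gamma> t +
      (6 * (deriv ^^ 2) g t) *s vderiv 3 \<gamma> t + (4 * (deriv ^^ 1) g t) *s (p *s vderiv 2 \<gamma> t + q *s \<gamma> t) +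
      g t *s (p *s vderiv 3 \<gamma> t + q *s vderiv 1 \<gamma> t))"
    unfolding add leibniz_derivs[OF hol T f t] leibniz_derivs[OF hol1 T g t] vderiv_vderiv_1 e
      const_ode_vderiv[OF ode hol T t] const_odeD[OF ode t] ..
  show ?thesis
    unfolding w2 w4 unfolding w_def
    by (simp add: vec_eq_iff algebra_simps del: funpow.simps(2))
qed

text \<open>Since u is constant, \<open>u *v \<gamma> t\<close> solves the equation of \<gamma>, so
  the coefficients in the frame vanish. The one at \<gamma>''' expresses f' through g'', the one at
  \<gamma>'' then becomes an equation for g alone, and the one at \<gamma> turns into an algebraic
  condition.\<close>

lemma tangent_field_equations:
  assumes ode: "const_ode p q \<gamma> T" and hol: "vholomorphic_on \<gamma> T" and T: "open T"
    and f: "f holomorphic_on T" and g: "g holomorphic_on T" and nd: "\<forall>t\<in>T. nondeg \<gamma> t"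
    and u: "\<forall>t\<in>T. u *v \<gamma> t = f t *s \<gamma> t + g t *s vderiv 1 \<gamma> t" and t: "t \<in> T"
  shows "(deriv ^^ 1) f t = - 3 / 2 * (deriv ^^ 2) g t" "(deriv ^^ 3) g t = 2 * p / 5 * (deriv ^^ 1) g t"
    "(9 * p\<^sup>2 + 100 * q) * (deriv ^^ 1) g t = 0"
proof -
  define w where "w = (\<lambda>t. f t *s \<gamma> t + g t *s vderiv 1 \<gamma> t)"
  have E: "((deriv ^^ 4) f t - p * (deriv ^^ 2) f t + 4 * q * (deriv ^^ 1) g t) = 0"
    "(6 * (deriv ^^ 2) f t + 4 * (deriv ^^ 3) g t + 2 * p * (deriv ^^ 1) g t) = 0"
    "(4 * (deriv ^^ 1) f t + 6 * (deriv ^^ 2) g t) = 0" if t: "t \<in> T" for t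
  proof -
    have weq: "vderiv k w t = u *v vderiv k \<gamma> t" for k
      using vderiv_cong_open[OF T t, of w "\<lambda>t. u *v \<gamma> t" k] u vderiv_matrix[OF hol T t, of k u] by (simp add: w_def)
    have "vderiv 4 w t - (p *s vderiv 2 w t + q *s w t) = 0"
      unfolding weq const_odeD[OF ode t] weq[of 0, unfolded vderiv_0]
      by (simp add: matrix_vector_right_distrib vector_scalar_commute)
    then show "((deriv ^^ 4) f t - p * (deriv ^^ 2) f t + 4 * q * (deriv ^^ 1) g t) = 0"
      "(6 * (deriv ^^ 2) f t + 4 * (deriv ^^ 3) g t + 2 * p * (deriv ^^ 1) g t) = 0"
      "(4 * (deriv ^^ 1) f t + 6 * (deriv ^^ 2) g t) = 0"
      using nd[rule_format, OF t] unfolding w_def tangent_field_ode[OF ode hol T f g t] nondeg_def basis4_def by blast+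
  qed
  note DF = holomorphic_DERIVs[OF f T] holomorphic_higher_DERIV[OF f T, of _ 4]
  note DG = holomorphic_DERIVs[OF g T] holomorphic_higher_DERIV[OF g T, of _ 4]
  have f1: "(deriv ^^ 1) f t = - 3 / 2 * (deriv ^^ 2) g t" if "t \<in> T" for t
  proof -
    have "4 * (deriv ^^ 1) f t = - (6 * (deriv ^^ 2) g t)" using E(3)[OF that] by (simp only: eq_neg_iff_add_eq_0)
    then show ?thesis by (simp add: field_simps del: funpow.simps)
  qed
  have f2: "(deriv ^^ 2) f t = - 3 / 2 * (deriv ^^ 3) g t" if "t \<in> T" for t
    by (rule DERIV_eq_on_open[OF T that f1 DF(2)[OF that] DERIV_cmult[OF DG(3)[OF that]]])
  have f3: "(deriv ^^ 3) f t = - 3 / 2 * (deriv ^^ 4) g t" if "t \<in> T" for t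
    by (rule DERIV_eq_on_open[OF T that f2 DF(3)[OF that] DERIV_cmult[OF DG(4)[OF that]]])
  have f4: "(deriv ^^ 4) f t = - 3 / 2 * (deriv ^^ Suc 4) g t" if "t \<in> T" for t
    by (rule DERIV_eq_on_open[OF T that f3 DF(4)[OF that] DERIV_cmult[OF DG(5)[OF that]]])
  have g3: "(deriv ^^ 3) g t = 2 * p / 5 * (deriv ^^ 1) g t" if "t \<in> T" for t
    using E(2)[OF that] unfolding f2[OF that] by (simp add: field_simps del: funpow.simps(2))
  have g4: "(deriv ^^ 4) g t = 2 * p / 5 * (deriv ^^ 2) g t" if "t \<in> T" for t
    by (rule DERIV_eq_on_open[OF T that g3 DG(4)[OF that] DERIV_cmult[OF DG(2)[OF that]]])
  have g5: "(deriv ^^ Suc 4) g t = 2 * p / 5 * (deriv ^^ 3) g t" if "t \<in> T" for t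
    by (rule DERIV_eq_on_open[OF T that g4 DG(5)[OF that] DERIV_cmult[OF DG(3)[OF that]]])
  show "(deriv ^^ 1) f t = - 3 / 2 * (deriv ^^ 2) g t" "(deriv ^^ 3) g t = 2 * p / 5 * (deriv ^^ 1) g t"
    using f1 g3 t by blast+
  \<comment> \<open>What remains is (9 p^2/25 + 4 q) g' = 0; the factor 25 introduced next clears
    the denominator.\<close>
  have "- 3 / 2 * (2 * p / 5 * (2 * p / 5 * (deriv ^^ 1) g t)) - p * (- 3 / 2 * (2 * p / 5 * (deriv ^^ 1) g t)) + 4 * q * (deriv ^^ 1) g t = 0"
    using E(1)[OF t] unfolding f4[OF t] f2[OF t] g5[OF t] g3[OF t] .
  then have "25 * (- 3 / 2 * (2 * p / 5 * (2 * p / 5 * (deriv ^^ 1) g t)) - p * (- 3 / 2 * (2 * p / 5 * (deriv ^^ 1) g t)) + 4 * q * (deriv ^^ 1) g t) = 0"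
    by (simp only: mult_zero_right)
  moreover have "25 * (- 3 / 2 * (2 * p / 5 * (2 * p / 5 * x)) - p * (- 3 / 2 * (2 * p / 5 * x)) + 4 * q * x) = (9 * p\<^sup>2 + 100 * q) * x" for x
    by (simp add: field_simps power2_eq_square)
  ultimately show "(9 * p\<^sup>2 + 100 * q) * (deriv ^^ 1) g t = 0" by (simp only:)
qed

section \<open>Dimension of the automorphism algebra\<close>

interpretation mats: vector_space mat_scale
  by (rule vector_space_mat_scale)

lemma mat_scale_mult: "mat_scale c A *v v = c *s (A *v v)"
  by (simp add: vec_eq_iff mat_scale_def matrix_vector_mult_def sum_distrib_left mult.assoc)

lemma mat_dim_le: "V \<subseteq> mats.span W \<Longrightarrow> finite W \<Longrightarrow> mat_dim V \<le> card W"
  unfolding mat_dim_def by (rule mats.dim_le_card)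

text \<open>An independent set bounds the dimension from below once the surrounding space is known
  to be finite-dimensional; the matrix units supply the finite spanning set.\<close>

lemma mat_dim_ge:
  assumes "mats.independent S" "S \<subseteq> V"
  shows "card S \<le> mat_dim V"
proof -
  let ?E = "range (\<lambda>(i, j). axis i (axis j 1)) :: cmat set"
  obtain B where B: "B \<subseteq> ?E" "mats.independent B" "?E \<subseteq> mats.span B"
    using mats.maximal_independent_subset by blast
  have "A \<in> mats.span ?E" for A :: cmat
  proof -
    have "A = (\<Sum>i\<in>UNIV. \<Sum>j\<in>UNIV. mat_scale (A $ i $ j) (axis i (axis j 1)))"
      by (simp add: vec_eq_iff forall_4 sum_4 mat_scale_def axis_def)
    also have "\<dots> \<in> mats.span ?E"
      by (intro mats.span_sum mats.span_scale mats.span_base) (auto intro!: image_eqI[of _ _ "(_, _)"])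
    finally show ?thesis .
  qed
  then have sp: "mats.span B = UNIV" using B(3) mats.span_minimal[OF B(3) mats.subspace_span] by blast
  interpret fd: finite_dimensional_vector_space mat_scale B
    by unfold_locales (use B sp finite_subset[OF B(1)] in auto)
  show ?thesis unfolding mat_dim_def by (rule fd.independent_card_le_dim[OF assms(2,1)])
qed

text \<open>Equality along the curve passes to all derivatives, hence to a basis at a nondegenerate
  parameter.\<close>

lemma matrix_eq_on_curve:
  assumes "vholomorphic_on \<gamma> T" "open T" "t \<in> T" "nondeg \<gamma> t" "\<And>t. t \<in> T \<Longrightarrow> P *v \<gamma> t = Q *v \<gamma> t"
  shows "P = (Q :: cmat)"
proof -
  have "P *v vderiv k \<gamma> t = Q *v vderiv k \<gamma> t" for k
    using vderiv_cong_open[OF assms(2,3), of "\<lambda>t. P *v \<gamma> t" "\<lambda>t. Q *v \<gamma> t" k] assms(5)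
      vderiv_matrix[OF assms(1-3)] by simp
  from basis4_matrix_eq[OF assms(4)[unfolded nondeg_def] assms(5)[OF assms(3)] this this this]
  show ?thesis .
qed

lemma legendrian_chart:
  assumes "legendrian \<sigma> Z" "chart Z \<gamma> T" "t \<in> T"
  shows "\<sigma> (\<gamma> t) (vderiv 1 \<gamma> t) = 0"
proof -
  have c: "curve Z" and s: "\<forall>z\<in>Z. \<forall>v\<in>tangent Z z. \<forall>w\<in>tangent Z z. \<sigma> v w = 0"
    using assms(1) unfolding legendrian_def by blast+
  have tan: "tangent Z (\<gamma> t) = {a *s \<gamma> t + b *s vderiv 1 \<gamma> t |a b. True}"
    using tangent_chart[OF assms(2) curveD(1)[OF c] assms(3), of 1] by simp
  have "\<gamma> t = 1 *s \<gamma> t + 0 *s vderiv 1 \<gamma> t" "vderiv 1 \<gamma> t = 0 *s \<gamma> t + 1 *s vderiv 1 \<gamma> t" by simp_all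
  then have "\<gamma> t \<in> tangent Z (\<gamma> t)" "vderiv 1 \<gamma> t \<in> tangent Z (\<gamma> t)" unfolding tan by blast+
  then show ?thesis using s chart_in[OF assms(2,3)] by blast
qed

lemma ode_germ_nondeg:
  assumes "ode_germ p q Z z \<gamma> e"
  obtains d where "0 < d" "d \<le> e" "ode_germ p q Z z \<gamma> d" "\<And>t. t \<in> ball 0 d \<Longrightarrow> nondeg \<gamma> t"
proof -
  note g = ode_germD[OF assms]
  have 0: "0 \<in> ball (0::complex) e" using g(1) by simp
  obtain d where d: "d > 0" "ball (0::complex) d \<subseteq> ball 0 e" "\<And>t. t \<in> ball 0 d \<Longrightarrow> nondeg \<gamma> t"
    using nondeg_near[OF g(6,7) open_ball 0] by blast
  show ?thesis
  proof (rule that[of "min d e"])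
    show "ode_germ p q Z z \<gamma> (min d e)" by (rule ode_germ_subset[OF assms]) (use d g in auto)
  qed (use d g(1) in auto)
qed

lemma aut_tangent_field:
  assumes og: "ode_germ p q Z z \<gamma> e"
  shows "\<exists>d. 0 < d \<and> d \<le> e \<and> ode_germ p q Z z \<gamma> d \<and> (\<forall>t\<in>ball 0 d. nondeg \<gamma> t) \<and>
    (\<forall>\<sigma>. \<forall>u\<in>aut \<sigma> Z. \<exists>f g. f holomorphic_on ball 0 d \<and> g holomorphic_on ball 0 d \<and>
        (\<forall>t\<in>ball 0 d. u *v \<gamma> t = f t *s \<gamma> t + g t *s vderiv 1 \<gamma> t))"
proof -
  obtain d where d: "0 < d" "d \<le> e" "ode_germ p q Z z \<gamma> d" "\<And>t. t \<in> ball 0 d \<Longrightarrow> nondeg \<gamma> t"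
    using ode_germ_nondeg[OF og] by metis
  note g = ode_germD[OF d(3)]
  have 0: "0 \<in> ball (0::complex) d" using d by simp
  obtain c where c: "c > 0" "ball (0::complex) c \<subseteq> ball 0 d"
    and dec: "\<forall>u V. open V \<longrightarrow> V \<noteq> {} \<longrightarrow> V \<subseteq> ball 0 c \<longrightarrow> (\<forall>t\<in>V. u *v \<gamma> t \<in> tangent Z (\<gamma> t)) \<longrightarrow>
       (\<exists>f g. f holomorphic_on ball 0 c \<and> g holomorphic_on ball 0 c \<and>
         (\<forall>t\<in>ball 0 c. u *v \<gamma> t = f t *s \<gamma> t + g t *s vderiv 1 \<gamma> t))"
    using tangent_decomposition[OF g(3,2) 0] by blast
  show ?thesis
  proof (intro exI[of _ "min c d"] conjI allI ballI)
    show "ode_germ p q Z z \<gamma> (min c d)" by (rule ode_germ_subset[OF d(3)]) (use d c in auto)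
    fix u \<sigma> assume u: "u \<in> aut \<sigma> Z"
    have "\<exists>f g. f holomorphic_on ball 0 c \<and> g holomorphic_on ball 0 c \<and>
         (\<forall>t\<in>ball 0 c. u *v \<gamma> t = f t *s \<gamma> t + g t *s vderiv 1 \<gamma> t)"
    proof (rule dec[rule_format, OF open_ball])
      show "u *v \<gamma> t \<in> tangent Z (\<gamma> t)" if "t \<in> ball 0 c" for t
        using u chart_in[OF g(3), of t] that c(2) unfolding aut_def by blast
    qed (use c in auto)
    then obtain f h where "f holomorphic_on ball 0 c" "h holomorphic_on ball 0 c"
       and eq: "\<And>t. t \<in> ball 0 c \<Longrightarrow> u *v \<gamma> t = f t *s \<gamma> t + h t *s vderiv 1 \<gamma> t" by blast
    then have "f holomorphic_on ball 0 (min c d)" "h holomorphic_on ball 0 (min c d)"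
      using holomorphic_on_subset[of _ "ball 0 c" "ball 0 (min c d)"] by auto
    then show "\<exists>f g. f holomorphic_on ball 0 (min c d) \<and> g holomorphic_on ball 0 (min c d) \<and>
        (\<forall>t\<in>ball 0 (min c d). u *v \<gamma> t = f t *s \<gamma> t + g t *s vderiv 1 \<gamma> t)"
      using eq by (intro exI[of _ f] exI[of _ h]) auto
  qed (use d c in auto)
qed

lemma holomorphic_zero_deriv_const:
  assumes "\<And>t. t \<in> ball (0::complex) d \<Longrightarrow> (f has_field_derivative 0) (at t)" "t \<in> ball 0 d"
  shows "f t = f 0"
proof -
  have "\<exists>c. \<forall>x\<in>ball 0 d. f x = c"
    by (rule has_field_derivative_zero_constant[OF convex_ball]) (use assms in \<open>auto intro: has_field_derivative_at_within\<close>)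
  moreover have "0 \<in> ball (0::complex) d" using assms(2) by (metis centre_in_ball dist_commute le_less_trans mem_ball zero_le_dist)
  ultimately show ?thesis using assms(2) by metis
qed

lemma const_ode_vderiv_1:
  assumes "const_ode p q \<gamma> T" "vholomorphic_on \<gamma> T" "open T"
  shows "const_ode p q (vderiv 1 \<gamma>) T"
  unfolding const_ode_def vderiv_vderiv_1
proof
  fix t assume "t \<in> T"
  have "1 + 4 = Suc 4" "1 + 2 = Suc 2" by simp_all
  with const_ode_vderiv[OF assms \<open>t \<in> T\<close>, of 1]
  show "vderiv (Suc 4) \<gamma> t = p *s vderiv (Suc 2) \<gamma> t + q *s vderiv 1 \<gamma> t" by (simp only:)
qed

text \<open>The condition on p and q forces g' = 0 and thereby f' = 0. Every automorphism is then a
  constant combination of the scaling field and of the translation of the parameter.\<close>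

lemma mat_dim_aut_le_2:
  assumes og: "ode_germ p q Z z \<gamma> e" and K: "9 * p\<^sup>2 + 100 * q \<noteq> 0"
  shows "mat_dim (aut \<sigma> Z) \<le> 2"
proof -
  obtain d where d: "0 < d" "d \<le> e" "ode_germ p q Z z \<gamma> d" "\<forall>t\<in>ball 0 d. nondeg \<gamma> t"
    and au: "\<forall>\<sigma>. \<forall>u\<in>aut \<sigma> Z. \<exists>f g. f holomorphic_on ball 0 d \<and> g holomorphic_on ball 0 d \<and>
        (\<forall>t\<in>ball 0 d. u *v \<gamma> t = f t *s \<gamma> t + g t *s vderiv 1 \<gamma> t)"
    using aut_tangent_field[OF og] by blast
  note g = ode_germD[OF d(3)]
  have 0: "0 \<in> ball (0::complex) d" using d by simp
  \<comment> \<open>As \<gamma>' solves the equation of \<gamma>, the translation field is given by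
    a matrix.\<close>
  obtain B :: cmat where B: "\<forall>t\<in>ball 0 d. B *v \<gamma> t = vderiv 1 \<gamma> t"
    using const_ode_matrix[OF g(5,7) const_ode_vderiv_1[OF g(5,7) open_ball] vholomorphic_vderiv[OF g(7) open_ball]
        open_ball connected_ball 0 g(6)] by blast
  have "aut \<sigma> Z \<subseteq> mats.span {mat 1, B}"
  proof
    fix u assume "u \<in> aut \<sigma> Z"
    then obtain f h where fh: "f holomorphic_on ball 0 d" "h holomorphic_on ball 0 d"
      and u: "\<forall>t\<in>ball 0 d. u *v \<gamma> t = f t *s \<gamma> t + h t *s vderiv 1 \<gamma> t" using au by blast
    note E = tangent_field_equations[OF g(5,7) open_ball fh d(4) u]
    have h1: "(deriv ^^ 1) h t = 0" if "t \<in> ball 0 d" for t using E(3)[OF that] K by simp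
    have h2: "(deriv ^^ 2) h t = 0" if "t \<in> ball 0 d" for t
      by (rule DERIV_eq_on_open[OF open_ball that h1 holomorphic_DERIVs(2)[OF fh(2) open_ball that] DERIV_const])
    have f1: "(deriv ^^ 1) f t = 0" if "t \<in> ball 0 d" for t using E(1)[OF that] h2[OF that] by simp
    have c: "f t = f 0" "h t = h 0" if "t \<in> ball 0 d" for t
      using holomorphic_DERIVs(1)[OF fh(1) open_ball] holomorphic_DERIVs(1)[OF fh(2) open_ball] f1 h1 that
      by (auto intro!: holomorphic_zero_deriv_const[of d])
    have "u = mat_scale (f 0) (mat 1) + mat_scale (h 0) B"
    proof (rule matrix_eq_on_curve[OF g(7) open_ball 0 g(6)])
      fix t :: complex assume t: "t \<in> ball 0 d"
      then show "u *v \<gamma> t = (mat_scale (f 0) (mat 1) + mat_scale (h 0) B) *v \<gamma> t"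
        using u[rule_format, OF t] c[OF t] B by (simp add: matrix_vector_mult_add_rdistrib mat_scale_mult)
    qed
    then show "u \<in> mats.span {mat 1, B}"
      by (simp add: mats.span_add mats.span_scale mats.span_base)
  qed
  then have "mat_dim (aut \<sigma> Z) \<le> card {mat 1, B}" by (intro mat_dim_le) auto
  also have "\<dots> \<le> 2" using card_insert_le_m1[of 2 "{B}" "mat 1"] by simp
  finally show ?thesis .
qed

lemma tangent_scale:
  assumes ch: "chart Z \<gamma> T" and cone: "is_cone Z" and t: "t \<in> T" and c: "c \<noteq> 0" "d \<noteq> 0"
  shows "u *v (c *s \<gamma> t) \<in> tangent Z (c *s \<gamma> t) \<longleftrightarrow> u *v (d *s \<gamma> t) \<in> tangent Z (d *s \<gamma> t)"
proof -
  have "u *v (d *s \<gamma> t) \<in> tangent Z (d *s \<gamma> t)"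
    if u: "u *v (c *s \<gamma> t) \<in> tangent Z (c *s \<gamma> t)" and c: "c \<noteq> 0" "d \<noteq> 0" for c d
  proof -
    obtain a b where ab: "u *v (c *s \<gamma> t) = a *s \<gamma> t + b *s vderiv 1 \<gamma> t"
      using u unfolding tangent_chart[OF ch cone t c(1)] by blast
    have "u *v (d *s \<gamma> t) = (d / c) *s (u *v (c *s \<gamma> t))" using c by (simp add: vector_scalar_commute)
    also have "\<dots> = (d / c * a) *s \<gamma> t + (d / c * b) *s vderiv 1 \<gamma> t"
      unfolding ab by (simp add: vec_eq_iff algebra_simps)
    finally show ?thesis unfolding tangent_chart[OF ch cone t c(2)] by blast
  qed
  then show ?thesis using c by blast
qed

text \<open>Tangency of \<open>u\<close> propagates along \<open>Z\<close> by the identity theorem.\<close>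

lemma tangent_connected:
  assumes Z: "curve Z" "connected Z" and V: "open V" "z0 \<in> Z \<inter> V" "\<forall>w\<in>Z \<inter> V. u *v w \<in> tangent Z w"
    and w: "w \<in> Z"
  shows "u *v w \<in> tangent Z w"
proof -
  \<comment> \<open>This set is relatively open by construction; the work lies in showing its
    complement open.\<close>
  define G where "G = {w\<in>Z. \<exists>U. open U \<and> w \<in> U \<and> (\<forall>x\<in>Z \<inter> U. u *v x \<in> tangent Z x)}"
  have cone: "is_cone Z" using curveD Z by blast
  have "openin (top_of_set Z) G"
  proof (subst openin_subopen, intro ballI)
    fix x assume "x \<in> G"
    then obtain U where U: "x \<in> Z" "open U" "x \<in> U" "\<forall>x\<in>Z \<inter> U. u *v x \<in> tangent Z x" unfolding G_def by blast
    then have "Z \<inter> U \<subseteq> G" unfolding G_def by blast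
    then show "\<exists>T. openin (top_of_set Z) T \<and> x \<in> T \<and> T \<subseteq> G"
      using U by (intro exI[of _ "Z \<inter> U"]) (auto intro: openin_open_Int)
  qed
  moreover have "openin (top_of_set Z) (Z - G)"
  proof (subst openin_subopen, intro ballI)
    fix x assume x: "x \<in> Z - G"
    then obtain \<gamma> T t0 c where ch: "chart Z \<gamma> T" "t0 \<in> T" "c \<noteq> 0" "x = c *s \<gamma> t0"
      using curve_chart[OF Z(1), of x] by blast
    note chD = chartD[OF ch(1)]
    obtain e where e: "e > 0" "ball t0 e \<subseteq> T"
      and dec: "\<forall>u V. open V \<longrightarrow> V \<noteq> {} \<longrightarrow> V \<subseteq> ball t0 e \<longrightarrow> (\<forall>t\<in>V. u *v \<gamma> t \<in> tangent Z (\<gamma> t)) \<longrightarrow>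
       (\<exists>f g. f holomorphic_on ball t0 e \<and> g holomorphic_on ball t0 e \<and>
         (\<forall>t\<in>ball t0 e. u *v \<gamma> t = f t *s \<gamma> t + g t *s vderiv 1 \<gamma> t))"
      using tangent_decomposition[OF ch(1) cone ch(2)] by blast
    have t0: "t0 \<in> ball t0 e" using e by simp
    obtain U where U: "open U" "x \<in> U" "Z \<inter> U \<subseteq> cone_over \<gamma> (ball t0 e)"
      using chart_nbhd[OF ch(1) cone ch(2) open_ball t0 ch(3)] ch(4) by blast
    \<comment> \<open>If U met this set, tangency would hold on some open set of parameters and
      thus, by the uniform radius of \<open>tangent_decomposition\<close>, on the whole disc around
      the parameter of x. Then x itself would belong to the set.\<close>
    have "Z \<inter> U \<inter> G = {}"
    proof (rule ccontr)
      assume "Z \<inter> U \<inter> G \<noteq> {}"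
      then obtain y where y: "y \<in> Z \<inter> U" "y \<in> G" by blast
      then obtain d t1 where t1: "d \<noteq> 0" "t1 \<in> ball t0 e" "y = d *s \<gamma> t1" using U(3) unfolding cone_over_def by blast
      obtain U' where U': "open U'" "y \<in> U'" "\<forall>x\<in>Z \<inter> U'. u *v x \<in> tangent Z x" using y unfolding G_def by blast
      have "continuous_on (ball t0 e) (\<lambda>t. d *s \<gamma> t)"
        using continuous_on_vholomorphic[OF vholomorphic_subset[OF vholomorphic_scale[OF _ chD(2)] e(2)], of "\<lambda>_. d"] by simp
      then have o: "open (ball t0 e \<inter> (\<lambda>t. d *s \<gamma> t) -` U')"
        using continuous_open_preimage[OF _ open_ball U'(1)] by blast
      have ne: "ball t0 e \<inter> (\<lambda>t. d *s \<gamma> t) -` U' \<noteq> {}" using t1 U'(2) by blast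
      have tan: "\<forall>t\<in>ball t0 e \<inter> (\<lambda>t. d *s \<gamma> t) -` U'. u *v \<gamma> t \<in> tangent Z (\<gamma> t)"
      proof
        fix t assume t: "t \<in> ball t0 e \<inter> (\<lambda>t. d *s \<gamma> t) -` U'"
        then have tT: "t \<in> T" using e(2) by blast
        have "d *s \<gamma> t \<in> Z \<inter> U'" using chart_in[OF ch(1) tT] is_coneD[OF cone t1(1)] t by auto
        then have "u *v (d *s \<gamma> t) \<in> tangent Z (d *s \<gamma> t)" using U'(3) by blast
        then show "u *v \<gamma> t \<in> tangent Z (\<gamma> t)"
          using tangent_scale[OF ch(1) cone tT t1(1), of 1] by simp
      qed
      obtain f g where fg: "\<forall>t\<in>ball t0 e. u *v \<gamma> t = f t *s \<gamma> t + g t *s vderiv 1 \<gamma> t"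
        using dec[rule_format, OF o ne _ ] tan by (metis Int_lower1)
      have "u *v x' \<in> tangent Z x'" if "x' \<in> Z \<inter> U" for x'
      proof -
        obtain k t where k: "k \<noteq> 0" "t \<in> ball t0 e" "x' = k *s \<gamma> t" using \<open>x' \<in> Z \<inter> U\<close> U(3) unfolding cone_over_def by blast
        have tT: "t \<in> T" using k(2) e(2) by blast
        have "u *v (1 *s \<gamma> t) \<in> tangent Z (1 *s \<gamma> t)"
          using tangent_chart[OF ch(1) cone tT, of 1] fg[rule_format, OF k(2)] by auto
        then show ?thesis unfolding k(3) using tangent_scale[OF ch(1) cone tT k(1), of 1] by simp
      qed
      then have "x \<in> G" using x U unfolding G_def by blast
      then show False using x by blast
    qed
    then have "Z \<inter> U \<subseteq> Z - G" by blast
    then show "\<exists>T. openin (top_of_set Z) T \<and> x \<in> T \<and> T \<subseteq> Z - G"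
      using U x by (intro exI[of _ "Z \<inter> U"]) (auto intro: openin_open_Int)
  qed
  moreover have "G \<subseteq> Z" unfolding G_def by blast
  ultimately have "G = {} \<or> G = Z"
    using Z(2) unfolding connected_clopen closedin_def by (metis topspace_euclidean_subtopology)
  moreover have "z0 \<in> G" using V unfolding G_def by blast
  ultimately have "w \<in> G" using w by blast
  then show ?thesis unfolding G_def by blast
qed

text \<open>The equation is g''' = (2p/5) g' for p = 10. It has the first integrals (g'' + 2 g')
  e^(-2t) and (g'' - 2 g') e^(2t), from which g' and then g are recovered.\<close>

lemma third_order_ode_solution:
  assumes g: "g holomorphic_on ball 0 d" and eq: "\<forall>t\<in>ball 0 d. (deriv ^^ 3) g t = 4 * (deriv ^^ 1) g t"
  shows "\<exists>a b c. \<forall>t\<in>ball 0 d. g t = a + b * exp (2 * t) + c * exp (- 2 * t) \<and>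
      (deriv ^^ 1) g t = 2 * b * exp (2 * t) - 2 * c * exp (- 2 * t)"
proof -
  note D = holomorphic_DERIVs[OF g open_ball]
  have ex: "exp (2 * t) * exp (- 2 * t) = (1 :: complex)" for t by (simp add: exp_minus)
  define A where "A t = ((deriv ^^ 2) g t + 2 * (deriv ^^ 1) g t) * exp (- 2 * t)" for t
  define B where "B t = ((deriv ^^ 2) g t - 2 * (deriv ^^ 1) g t) * exp (2 * t)" for t
  have A: "A t = A 0" if "t \<in> ball 0 d" for t
  proof (rule holomorphic_zero_deriv_const[OF _ that])
    fix t :: complex assume t: "t \<in> ball 0 d"
    show "(A has_field_derivative 0) (at t)"
      unfolding A_def
      by (rule derivative_eq_intros D[OF t] refl)+ (simp add: eq[rule_format, OF t] algebra_simps del: funpow.simps)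
  qed
  have B: "B t = B 0" if "t \<in> ball 0 d" for t
  proof (rule holomorphic_zero_deriv_const[OF _ that])
    fix t :: complex assume t: "t \<in> ball 0 d"
    show "(B has_field_derivative 0) (at t)"
      unfolding B_def
      by (rule derivative_eq_intros D[OF t] refl)+ (simp add: eq[rule_format, OF t] algebra_simps del: funpow.simps)
  qed
  have g1: "(deriv ^^ 1) g t = 2 * (A 0 / 8) * exp (2 * t) - 2 * (B 0 / 8) * exp (- 2 * t)" if "t \<in> ball 0 d" for t
  proof -
    have "A 0 * exp (2 * t) - B 0 * exp (- 2 * t) =
       ((deriv ^^ 2) g t + 2 * (deriv ^^ 1) g t) * (exp (2 * t) * exp (- 2 * t)) -
       ((deriv ^^ 2) g t - 2 * (deriv ^^ 1) g t) * (exp (2 * t) * exp (- 2 * t))"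
      unfolding A[OF that, symmetric] B[OF that, symmetric] unfolding A_def B_def by (simp add: algebra_simps del: funpow.simps)
    also have "\<dots> = 4 * (deriv ^^ 1) g t" unfolding ex by (simp add: algebra_simps del: funpow.simps)
    finally have "4 * (deriv ^^ 1) g t = A 0 * exp (2 * t) - B 0 * exp (- 2 * t)" ..
    then show ?thesis by (simp add: field_simps del: funpow.simps)
  qed
  define C where "C t = g t - A 0 / 8 * exp (2 * t) - B 0 / 8 * exp (- 2 * t)" for t
  have C: "C t = C 0" if "t \<in> ball 0 d" for t
  proof (rule holomorphic_zero_deriv_const[OF _ that])
    fix t :: complex assume t: "t \<in> ball 0 d"
    show "(C has_field_derivative 0) (at t)"
      unfolding C_def
      by (rule derivative_eq_intros D(1)[OF t] refl)+ (simp only: g1[OF t], simp add: algebra_simps)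
  qed
  have "g t = C 0 + A 0 / 8 * exp (2 * t) + B 0 / 8 * exp (- 2 * t)" if "t \<in> ball 0 d" for t
    using C[OF that] unfolding C_def[of t] by (simp add: algebra_simps)
  then show ?thesis using g1 by blast
qed

text \<open>The converse of the determining equations: if all four hold, the field solves the
  equation of \<gamma>, and solutions are linear images of \<gamma>.\<close>

lemma tangent_field_matrix:
  assumes ode: "const_ode p q \<gamma> T" and hol: "vholomorphic_on \<gamma> T" and T: "open T" "connected T" "t0 \<in> T" and nd: "nondeg \<gamma> t0"
    and f: "f holomorphic_on T" and g: "g holomorphic_on T"
    and E: "\<And>t. t \<in> T \<Longrightarrow> (deriv ^^ 4) f t - p * (deriv ^^ 2) f t + 4 * q * (deriv ^^ 1) g t = 0"
      "\<And>t. t \<in> T \<Longrightarrow> 4 * (deriv ^^ 3) f t + (deriv ^^ 4) g t - 2 * p * (deriv ^^ 1) f t - p * (deriv ^^ 2) g t = 0"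
      "\<And>t. t \<in> T \<Longrightarrow> 6 * (deriv ^^ 2) f t + 4 * (deriv ^^ 3) g t + 2 * p * (deriv ^^ 1) g t = 0"
      "\<And>t. t \<in> T \<Longrightarrow> 4 * (deriv ^^ 1) f t + 6 * (deriv ^^ 2) g t = 0"
  shows "\<exists>B :: cmat. \<forall>t\<in>T. B *v \<gamma> t = f t *s \<gamma> t + g t *s vderiv 1 \<gamma> t"
proof -
  have "const_ode p q (\<lambda>t. f t *s \<gamma> t + g t *s vderiv 1 \<gamma> t) T"
    unfolding const_ode_def
  proof
    fix t assume t: "t \<in> T"
    show "vderiv 4 (\<lambda>t. f t *s \<gamma> t + g t *s vderiv 1 \<gamma> t) t =
      p *s vderiv 2 (\<lambda>t. f t *s \<gamma> t + g t *s vderiv 1 \<gamma> t) t + q *s (f t *s \<gamma> t + g t *s vderiv 1 \<gamma> t)"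
      using tangent_field_ode[OF ode hol T(1) f g t] unfolding E(1)[OF t] E(2)[OF t] E(3)[OF t] E(4)[OF t] by simp
  qed
  moreover have "vholomorphic_on (\<lambda>t. f t *s \<gamma> t + g t *s vderiv 1 \<gamma> t) T"
    by (intro vholomorphic_add vholomorphic_scale f g hol vholomorphic_vderiv[OF hol T(1)])
  ultimately show ?thesis using const_ode_matrix[OF ode hol _ _ T nd] by blast
qed

lemma higher_deriv_exp:
  "(deriv ^^ n) (\<lambda>t. a * exp (k * t)) = (\<lambda>t :: complex. a * k ^ n * exp (k * t))"
proof (induction n)
  case (Suc n)
  have "deriv (\<lambda>t. a * k ^ n * exp (k * t)) t = a * k ^ Suc n * exp (k * t)" for t
    by (rule DERIV_imp_deriv) (auto intro!: derivative_eq_intros)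
  then show ?case using Suc by auto
qed simp

text \<open>For p = 10 and q = -9 the obstruction 9 p^2 + 100 q vanishes, and the determining
  equations leave g in the span of 1, e^(2t), e^(-2t), and f determined by g up to a constant: four
  parameters. Connectedness is what carries the fields from the chart to all of Z.\<close>

lemma aut_twisted_cubic:
  assumes og: "ode_germ 10 (- 9) Z z \<gamma> e" and leg: "legendrian \<sigma> Z" and conn: "connected Z"
  shows "mat_dim (aut \<sigma> Z) = 4"
proof -
  obtain d where d: "0 < d" "d \<le> e" "ode_germ 10 (- 9) Z z \<gamma> d" "\<forall>t\<in>ball 0 d. nondeg \<gamma> t"
    and au: "\<forall>\<sigma>. \<forall>u\<in>aut \<sigma> Z. \<exists>f g. f holomorphic_on ball 0 d \<and> g holomorphic_on ball 0 d \<and>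
        (\<forall>t\<in>ball 0 d. u *v \<gamma> t = f t *s \<gamma> t + g t *s vderiv 1 \<gamma> t)"
    using aut_tangent_field[OF og] by blast
  note g = ode_germD[OF d(3)]
  have cur: "curve Z" and symp: "symplectic_form \<sigma>" using leg unfolding legendrian_def by blast+
  have 0: "0 \<in> ball (0::complex) d" using d by simp
  \<comment> \<open>The premises are the four determining equations for f and g proportional to the
    same exponential e^(kt).\<close>
  have m: "\<exists>B :: cmat. \<forall>t\<in>ball 0 d. B *v \<gamma> t = (a * exp (k * t)) *s \<gamma> t + (b * exp (k * t)) *s vderiv 1 \<gamma> t"
    if "a * k ^ 4 - 10 * a * k\<^sup>2 - 36 * b * k = 0" "4 * a * k ^ 3 + b * k ^ 4 - 20 * a * k - 10 * b * k\<^sup>2 = 0"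
     "6 * a * k\<^sup>2 + 4 * b * k ^ 3 + 20 * b * k = 0" "4 * a * k + 6 * b * k\<^sup>2 = 0" for a b k
  proof (rule tangent_field_matrix[OF g(5,7) open_ball connected_ball 0 g(6)])
    show "(\<lambda>t. a * exp (k * t)) holomorphic_on ball 0 d" "(\<lambda>t. b * exp (k * t)) holomorphic_on ball 0 d"
      by (intro holomorphic_intros)+
    fix t
    have "(a * k ^ 4 - 10 * a * k\<^sup>2 - 36 * b * k) * exp (k * t) = 0" "(4 * a * k ^ 3 + b * k ^ 4 - 20 * a * k - 10 * b * k\<^sup>2) * exp (k * t) = 0"
     "(6 * a * k\<^sup>2 + 4 * b * k ^ 3 + 20 * b * k) * exp (k * t) = 0" "(4 * a * k + 6 * b * k\<^sup>2) * exp (k * t) = 0"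
      unfolding that by simp_all
    then show "(deriv ^^ 4) (\<lambda>t. a * exp (k * t)) t - 10 * (deriv ^^ 2) (\<lambda>t. a * exp (k * t)) t + 4 * - 9 * (deriv ^^ 1) (\<lambda>t. b * exp (k * t)) t = 0"
      "4 * (deriv ^^ 3) (\<lambda>t. a * exp (k * t)) t + (deriv ^^ 4) (\<lambda>t. b * exp (k * t)) t - 2 * 10 * (deriv ^^ 1) (\<lambda>t. a * exp (k * t)) t - 10 * (deriv ^^ 2) (\<lambda>t. b * exp (k * t)) t = 0"
      "6 * (deriv ^^ 2) (\<lambda>t. a * exp (k * t)) t + 4 * (deriv ^^ 3) (\<lambda>t. b * exp (k * t)) t + 2 * 10 * (deriv ^^ 1) (\<lambda>t. b * exp (k * t)) t = 0"
      "4 * (deriv ^^ 1) (\<lambda>t. a * exp (k * t)) t + 6 * (deriv ^^ 2) (\<lambda>t. b * exp (k * t)) t = 0"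
      unfolding higher_deriv_exp by (simp_all add: algebra_simps)
  qed
  \<comment> \<open>The choices g = 1, e^(2t), e^(-2t) with f = - 3/2 g'. Together with the scalars
    these matrices form gl(2) acting on binary cubics.\<close>
  obtain B1 B2 B3 :: cmat where B1: "\<forall>t\<in>ball 0 d. B1 *v \<gamma> t = (0 * exp (0 * t)) *s \<gamma> t + (1 * exp (0 * t)) *s vderiv 1 \<gamma> t"
    and B2: "\<forall>t\<in>ball 0 d. B2 *v \<gamma> t = (- 3 * exp (2 * t)) *s \<gamma> t + (1 * exp (2 * t)) *s vderiv 1 \<gamma> t"
    and B3: "\<forall>t\<in>ball 0 d. B3 *v \<gamma> t = (3 * exp (- 2 * t)) *s \<gamma> t + (1 * exp (- 2 * t)) *s vderiv 1 \<gamma> t"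
    using m[of 0 0 1] m[of "- 3" 2 1] m[of 3 "- 2" 1] by auto
  have z\<sigma>: "\<sigma> (\<gamma> t) (vderiv 1 \<gamma> t) = 0" if "t \<in> ball 0 d" for t using legendrian_chart[OF leg g(3) that] .
  have in_aut: "B \<in> aut \<sigma> Z" if f: "f holomorphic_on ball 0 d" "h holomorphic_on ball 0 d"
    and B: "\<forall>t\<in>ball 0 d. B *v \<gamma> t = f t *s \<gamma> t + h t *s vderiv 1 \<gamma> t" for B f h
  proof -
    have "B \<in> csp \<sigma>" by (rule tangent_imp_csp[OF symp g(5,7) open_ball z\<sigma> 0 g(6) f]) (use B in auto)
    moreover have "B *v w \<in> tangent Z w" if w: "w \<in> Z" for w
    proof -
      obtain U where U: "open U" "\<gamma> 0 \<in> U" "Z \<inter> U \<subseteq> cone_over \<gamma> (ball 0 d)"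
        using chartD(5)[OF g(3) 0 open_ball 0] by blast
      have "\<forall>w\<in>Z \<inter> U. B *v w \<in> tangent Z w"
      proof
        fix w assume "w \<in> Z \<inter> U"
        then obtain k t where k: "k \<noteq> 0" "t \<in> ball 0 d" "w = k *s \<gamma> t" using U(3) unfolding cone_over_def by blast
        have "B *v (1 *s \<gamma> t) \<in> tangent Z (1 *s \<gamma> t)"
          using tangent_chart[OF g(3,2) k(2), of 1] B[rule_format, OF k(2)] by auto
        then show "B *v w \<in> tangent Z w" unfolding k(3) using tangent_scale[OF g(3,2) k(2,1), of 1] by simp
      qed
      moreover have "\<gamma> 0 \<in> Z \<inter> U" using U(2) chart_in[OF g(3) 0] by blast
      ultimately show ?thesis using tangent_connected[OF cur conn U(1) _ _ w] by blast
    qed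
    ultimately show ?thesis unfolding aut_def by blast
  qed
  let ?S = "{B3, B2, B1, mat 1}"
  have sub: "?S \<subseteq> aut \<sigma> Z"
  proof -
    have "mat 1 \<in> aut \<sigma> Z" by (rule in_aut[of "\<lambda>_. 1" "\<lambda>_. 0"]) auto
    moreover have "B1 \<in> aut \<sigma> Z" "B2 \<in> aut \<sigma> Z" "B3 \<in> aut \<sigma> Z"
      by (rule in_aut[OF _ _ B1], intro holomorphic_intros, intro holomorphic_intros)
         (rule in_aut[OF _ _ B2], intro holomorphic_intros, intro holomorphic_intros,
          rule in_aut[OF _ _ B3], intro holomorphic_intros, intro holomorphic_intros)
    ultimately show ?thesis by blast
  qed
  have lin: "a = 0 \<and> k1 = 0 \<and> k2 = 0 \<and> k3 = 0"
    if eq: "mat_scale a (mat 1) + mat_scale k1 B1 + mat_scale k2 B2 + mat_scale k3 B3 = 0" for a k1 k2 k3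
  proof -
    have E: "(a - 3 * k2 * exp (2 * t) + 3 * k3 * exp (- 2 * t)) = 0 \<and> (k1 + k2 * exp (2 * t) + k3 * exp (- 2 * t)) = 0"
      if t: "t \<in> ball 0 d" for t
    proof -
      have "(a - 3 * k2 * exp (2 * t) + 3 * k3 * exp (- 2 * t)) *s \<gamma> t + (k1 + k2 * exp (2 * t) + k3 * exp (- 2 * t)) *s vderiv 1 \<gamma> t =
        (mat_scale a (mat 1) + mat_scale k1 B1 + mat_scale k2 B2 + mat_scale k3 B3) *v \<gamma> t"
        unfolding matrix_vector_mult_add_rdistrib mat_scale_mult B1[rule_format, OF t] B2[rule_format, OF t] B3[rule_format, OF t]
        by (simp add: vec_eq_iff algebra_simps)
      then have "(a - 3 * k2 * exp (2 * t) + 3 * k3 * exp (- 2 * t)) *s \<gamma> t + (k1 + k2 * exp (2 * t) + k3 * exp (- 2 * t)) *s vderiv 1 \<gamma> t = 0"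
        unfolding eq by simp
      then show ?thesis using chartD(3)[OF g(3) t] unfolding lin_indep2_def by blast
    qed
    \<comment> \<open>The two coefficient equations hold on a disc, so they may be differentiated;
      their values and derivatives at 0 give enough linear equations for the four constants.\<close>
    have "(- 6 * k2 * exp (2 * t) - 6 * k3 * exp (- 2 * t)) = 0" if "t \<in> ball 0 d" for t
    proof (rule DERIV_eq_on_open[OF open_ball that])
      show "a - 3 * k2 * exp (2 * t) + 3 * k3 * exp (- 2 * t) = 0" if "t \<in> ball 0 d" for t using E[OF that] by blast
    qed (auto intro!: derivative_eq_intros)
    from this[OF 0] have "- 6 * (k2 + k3) = 0" by (simp add: algebra_simps)
    then have "k2 + k3 = 0" by (auto simp: add_eq_0_iff)
    moreover from E[OF 0] have "k1 + k2 + k3 = 0" "a - 3 * k2 + 3 * k3 = 0" by simp_all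
    moreover have "2 * k2 * exp (2 * t) - 2 * k3 * exp (- 2 * t) = 0" if "t \<in> ball 0 d" for t
    proof (rule DERIV_eq_on_open[OF open_ball that])
      show "k1 + k2 * exp (2 * t) + k3 * exp (- 2 * t) = 0" if "t \<in> ball 0 d" for t using E[OF that] by blast
    qed (auto intro!: derivative_eq_intros)
    from this[OF 0] have "k2 = k3" by simp
    ultimately show ?thesis by auto
  qed
  have ni: "mat 1 \<noteq> (0 :: cmat)" "B1 \<notin> mats.span {mat 1}" "B2 \<notin> mats.span {B1, mat 1}" "B3 \<notin> mats.span {B2, B1, mat 1}"
  proof -
    show "mat 1 \<noteq> (0 :: cmat)" using lin[of 1 0 0 0] by auto
    show "B1 \<notin> mats.span {mat 1}"
    proof
      assume "B1 \<in> mats.span {mat 1}"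
      then obtain k where "B1 - mat_scale k (mat 1) = 0" by (auto simp: mats.span_insert)
      then show False using lin[of "- k" 1 0 0] by (simp add: algebra_simps)
    qed
    show "B2 \<notin> mats.span {B1, mat 1}"
    proof
      assume "B2 \<in> mats.span {B1, mat 1}"
      then obtain k l where "B2 - mat_scale k B1 - mat_scale l (mat 1) = 0" by (auto simp: mats.span_insert)
      then show False using lin[of "- l" "- k" 1 0] by (simp add: algebra_simps)
    qed
    show "B3 \<notin> mats.span {B2, B1, mat 1}"
    proof
      assume "B3 \<in> mats.span {B2, B1, mat 1}"
      then obtain k l m where "B3 - mat_scale k B2 - mat_scale l B1 - mat_scale m (mat 1) = 0" by (auto simp: mats.span_insert)
      then show False using lin[of "- m" "- l" "- k" 1] by (simp add: algebra_simps)
    qed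
  qed
  then have ind: "mats.independent ?S"
    by (simp add: mats.independent_insert mats.span_base)
  have card: "card ?S = 4"
  proof -
    have "B1 \<notin> {mat 1}" "B2 \<notin> {B1, mat 1}" "B3 \<notin> {B2, B1, mat 1}"
      using ni(2-4) mats.span_base[of B1 "{mat 1}"] mats.span_base[of B2 "{B1, mat 1}"]
        mats.span_base[of B3 "{B2, B1, mat 1}"] by (meson, meson, meson)
    then show ?thesis by (simp add: card_insert_if)
  qed
  have "aut \<sigma> Z \<subseteq> mats.span ?S"
  proof
    fix u assume "u \<in> aut \<sigma> Z"
    then obtain f h where fh: "f holomorphic_on ball 0 d" "h holomorphic_on ball 0 d"
      and u: "\<forall>t\<in>ball 0 d. u *v \<gamma> t = f t *s \<gamma> t + h t *s vderiv 1 \<gamma> t" using au by blast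
    note E = tangent_field_equations[OF g(5,7) open_ball fh d(4) u]
    have "\<forall>t\<in>ball 0 d. (deriv ^^ 3) h t = 4 * (deriv ^^ 1) h t" using E(2) by simp
    then obtain a b c where h: "\<forall>t\<in>ball 0 d. h t = a + b * exp (2 * t) + c * exp (- 2 * t) \<and>
      (deriv ^^ 1) h t = 2 * b * exp (2 * t) - 2 * c * exp (- 2 * t)"
      using third_order_ode_solution[OF fh(2)] by blast
    \<comment> \<open>Subtracting from f the part that h forces, by f' = - 3/2 h'', leaves a
      constant, the scalar part of u.\<close>
    define F where "F t = f t + 3 * b * exp (2 * t) - 3 * c * exp (- 2 * t)" for t
    have F: "F t = F 0" if "t \<in> ball 0 d" for t
    proof (rule holomorphic_zero_deriv_const[OF _ that])
      fix t :: complex assume t: "t \<in> ball 0 d"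
      have h2: "(deriv ^^ 2) h t = 4 * b * exp (2 * t) + 4 * c * exp (- 2 * t)"
      proof (rule DERIV_eq_on_open[OF open_ball t _ holomorphic_DERIVs(2)[OF fh(2) open_ball t]])
        show "(deriv ^^ 1) h t = 2 * b * exp (2 * t) - 2 * c * exp (- 2 * t)" if "t \<in> ball 0 d" for t using h that by blast
      qed (auto intro!: derivative_eq_intros)
      show "(F has_field_derivative 0) (at t)"
        unfolding F_def
        by (rule derivative_eq_intros holomorphic_DERIVs(1)[OF fh(1) open_ball t] refl)+
           (simp only: E(1)[OF t] h2, simp add: algebra_simps)
    qed
    have "u = mat_scale (F 0) (mat 1) + mat_scale a B1 + mat_scale b B2 + mat_scale c B3"
    proof (rule matrix_eq_on_curve[OF g(7) open_ball 0 g(6)])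
      fix t :: complex assume t: "t \<in> ball 0 d"
      have f: "f t = F 0 - 3 * b * exp (2 * t) + 3 * c * exp (- 2 * t)" using F[OF t] unfolding F_def[of t] by (simp add: algebra_simps)
      show "u *v \<gamma> t = (mat_scale (F 0) (mat 1) + mat_scale a B1 + mat_scale b B2 + mat_scale c B3) *v \<gamma> t"
        unfolding matrix_vector_mult_add_rdistrib mat_scale_mult B1[rule_format, OF t] B2[rule_format, OF t] B3[rule_format, OF t]
          u[rule_format, OF t] f conjunct1[OF h[rule_format, OF t]]
        by (simp add: vec_eq_iff algebra_simps)
    qed
    then show "u \<in> mats.span ?S"
      by (simp add: mats.span_add mats.span_scale mats.span_base)
  qed
  then have "mat_dim (aut \<sigma> Z) \<le> 4" using mat_dim_le[of _ ?S] card by simp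
  moreover have "4 \<le> mat_dim (aut \<sigma> Z)" using mat_dim_ge[OF ind sub] card by simp
  ultimately show ?thesis by simp
qed

section \<open>The model curves\<close>

text \<open>The sum of the moduli of all entries dominates every row sum, so each further factor A
  contributes at most this number.\<close>

lemma mat_pow_bound:
  "norm (mat_pow A n $ i $ j) \<le> (\<Sum>k\<in>UNIV. \<Sum>l\<in>UNIV. norm (A $ k $ l)) ^ n"
proof (induction n arbitrary: i j)
  case 0
  then show ?case by (simp add: mat_def)
next
  case (Suc n)
  let ?M = "\<Sum>k\<in>UNIV. \<Sum>l\<in>UNIV. norm (A $ k $ l)"
  have M: "0 \<le> ?M" by (intro sum_nonneg) auto
  have "norm (mat_pow A (Suc n) $ i $ j) \<le> (\<Sum>k\<in>UNIV. norm (A $ i $ k) * norm (mat_pow A n $ k $ j))"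
    by (simp add: matrix_matrix_mult_def) (rule order_trans[OF norm_sum], simp add: norm_mult)
  also have "\<dots> \<le> (\<Sum>k\<in>UNIV. norm (A $ i $ k) * ?M ^ n)"
    by (intro sum_mono mult_left_mono Suc.IH) auto
  also have "\<dots> = (\<Sum>k\<in>UNIV. norm (A $ i $ k)) * ?M ^ n" by (simp add: sum_distrib_right)
  also have "\<dots> \<le> ?M * ?M ^ n"
  proof (intro mult_right_mono zero_le_power M)
    show "(\<Sum>k\<in>UNIV. norm (A $ i $ k)) \<le> ?M"
      using member_le_sum[of i UNIV "\<lambda>k. \<Sum>l\<in>UNIV. norm (A $ k $ l)"] by (simp add: sum_nonneg)
  qed
  finally show ?case by simp
qed

text \<open>Each entry series is dominated by an exponential series. Convergence in the matrix space
  is convergence of the entries, so \<open>mat_exp\<close> is the matrix of the entrywise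
  sums.\<close>

lemma mat_exp_nth_sums: "(\<lambda>n. 1 / fact n * mat_pow A n $ i $ j) sums (mat_exp A $ i $ j)"
proof -
  let ?M = "\<Sum>k\<in>UNIV. \<Sum>l\<in>UNIV. norm (A $ k $ l)"
  have s: "summable (\<lambda>n. 1 / fact n * mat_pow A n $ i $ j)" for i j
  proof (rule summable_comparison_test[OF _ summable_exp[of ?M]], intro exI allI impI)
    fix n show "norm (1 / fact n * mat_pow A n $ i $ j) \<le> inverse (fact n) * ?M ^ n"
      using mat_pow_bound[of A n i j] by (simp add: norm_mult divide_inverse norm_inverse mult_left_mono)
  qed
  let ?E = "\<chi> i j. \<Sum>n. 1 / fact n * mat_pow A n $ i $ j"
  have "(\<lambda>n. mat_scale (1 / fact n) (mat_pow A n)) sums ?E"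
    unfolding sums_def
  proof (intro vec_tendstoI)
    fix i j
    have "(\<lambda>n. \<Sum>m<n. 1 / fact m * mat_pow A m $ i $ j) \<longlonglongrightarrow> ?E $ i $ j"
      using summable_LIMSEQ[OF s[of i j]] by simp
    then show "(\<lambda>n. (\<Sum>m<n. mat_scale (1 / fact m) (mat_pow A m)) $ i $ j) \<longlonglongrightarrow> ?E $ i $ j"
      by (simp add: sum_component mat_scale_def)
  qed
  then have "mat_exp A = ?E" unfolding mat_exp_def by (rule sums_unique[symmetric])
  then show ?thesis using summable_sums[OF s[of i j]] by simp
qed

definition exp_curve :: "cmat \<Rightarrow> cvec \<Rightarrow> complex \<Rightarrow> cvec" where
  "exp_curve A v t = mat_exp (mat_scale t A) *v v"

lemma mat_pow_scale: "mat_pow (mat_scale t A) n = mat_scale (t ^ n) (mat_pow A n)"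
proof (induction n)
  case 0
  then show ?case by (simp add: mat_scale_def vec_eq_iff)
next
  case (Suc n)
  have "mat_scale t A ** mat_scale (t ^ n) B = mat_scale (t ^ Suc n) (A ** B)" for B
    by (simp add: vec_eq_iff mat_scale_def matrix_matrix_mult_def sum_distrib_left algebra_simps)
  then show ?case using Suc by simp
qed

lemma exp_curve_sums: "(\<lambda>n. ((mat_pow A n *v v) $ i / fact n) * t ^ n) sums (exp_curve A v t $ i)"
proof -
  have "(\<lambda>n. \<Sum>j\<in>UNIV. 1 / fact n * mat_pow (mat_scale t A) n $ i $ j * v $ j) sums
     (\<Sum>j\<in>UNIV. mat_exp (mat_scale t A) $ i $ j * v $ j)"
    by (intro sums_sum sums_mult2 mat_exp_nth_sums)
  moreover have "(\<Sum>j\<in>UNIV. 1 / fact n * mat_pow (mat_scale t A) n $ i $ j * v $ j) = ((mat_pow A n *v v) $ i / fact n) * t ^ n" for n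
    unfolding mat_pow_scale by (simp add: mat_scale_def matrix_vector_mult_def sum_4 algebra_simps add_divide_distrib)
  ultimately show ?thesis by (simp add: exp_curve_def matrix_vector_mult_def)
qed

lemma exp_curve_0: "exp_curve A v 0 = v"
proof -
  have "exp_curve A v 0 $ i = v $ i" for i
    using sums_unique2[OF exp_curve_sums[of A v i 0] powser_sums_zero] by simp
  then show ?thesis by (simp add: vec_eq_iff)
qed

text \<open>Power series may be differentiated termwise, and the shifted coefficients are those
  obtained by applying A to the whole series.\<close>

lemma has_vderiv_exp_curve: "has_vderiv (exp_curve A v) (A *v exp_curve A v t) t"
  unfolding has_vderiv_def
proof
  fix i
  define c where "c n = (mat_pow A n *v v) $ i / fact n" for n
  have f: "exp_curve A v t $ i = (\<Sum>n. c n * t ^ n)" for t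
    using sums_unique[OF exp_curve_sums] unfolding c_def .
  have "diffs c n * t ^ n = (\<Sum>k\<in>UNIV. A $ i $ k * (((mat_pow A n *v v) $ k / fact n) * t ^ n))" for n
  proof -
    have "diffs c n = (mat_pow A (Suc n) *v v) $ i / fact n"
      unfolding diffs_def c_def fact_Suc using of_nat_neq_0[of n, where 'a = complex]
      by (simp del: of_nat_Suc mat_pow.simps)
    also have "\<dots> = (A *v (mat_pow A n *v v)) $ i / fact n" by (simp add: matrix_vector_mul_assoc)
    finally show ?thesis by (simp add: matrix_vector_mult_def[of A] sum_4 algebra_simps add_divide_distrib)
  qed
  moreover have "(\<lambda>n. \<Sum>k\<in>UNIV. A $ i $ k * (((mat_pow A n *v v) $ k / fact n) * t ^ n)) sums
     (\<Sum>k\<in>UNIV. A $ i $ k * exp_curve A v t $ k)"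
    by (intro sums_sum sums_mult exp_curve_sums)
  ultimately have s: "(\<Sum>n. diffs c n * t ^ n) = (A *v exp_curve A v t) $ i"
    by (simp add: sums_unique[symmetric] matrix_vector_mult_def)
  have "((\<lambda>t. \<Sum>n. c n * t ^ n) has_field_derivative (\<Sum>n. diffs c n * t ^ n)) (at t)"
  proof (rule termdiffs_strong_converges_everywhere)
    show "summable (\<lambda>n. c n * y ^ n)" for y
      using sums_summable[OF exp_curve_sums] unfolding c_def .
  qed
  then show "((\<lambda>s. exp_curve A v s $ i) has_field_derivative (A *v exp_curve A v t) $ i) (at t)"
    unfolding f s .
qed

lemma vholomorphic_exp_curve: "vholomorphic_on (exp_curve A v) T"
  by (rule vholomorphic_onI) (rule has_vderiv_exp_curve)

lemma mat_pow_commute: "mat_pow A k ** A = A ** mat_pow A k"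
  by (induction k) (simp_all add: matrix_mul_assoc[symmetric])

lemma vderiv_exp_curve: "vderiv k (exp_curve A v) t = mat_pow A k *v exp_curve A v t"
proof (induction k arbitrary: t)
  case (Suc k)
  have "has_vderiv (\<lambda>t. mat_pow A k *v exp_curve A v t) (mat_pow A k *v (A *v exp_curve A v t)) t"
    by (intro has_vderiv_matrix has_vderiv_exp_curve)
  moreover have "mat_pow A k *v (A *v exp_curve A v t) = mat_pow A (Suc k) *v exp_curve A v t"
    by (simp add: matrix_vector_mul_assoc mat_pow_commute)
  ultimately show ?case
    using vderiv_Suc_eq[OF open_UNIV UNIV_I Suc.IH] by simp
qed simp

lemma mat_pow_vec:
  "mat_pow A 1 *v v = A *v v" "mat_pow A 2 *v v = A *v (A *v v)" "mat_pow A 3 *v v = A *v (A *v (A *v v))"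
  "mat_pow A 4 *v v = A *v (A *v (A *v (A *v v)))"
  by (simp_all add: eval_nat_numeral matrix_vector_mul_assoc)

section \<open>The model matrices and their symplectic forms\<close>

lemma gen_mat_mult:
  "r\<^sup>2 = 1 \<Longrightarrow> gen_mat r *v v = vector [v $ 1 + v $ 2, v $ 2, - v $ 3 + v $ 4, - v $ 4]"
  "r\<^sup>2 = 0 \<Longrightarrow> gen_mat r *v v = vector [v $ 1, v $ 3, 0, - v $ 4]"
  "r\<^sup>2 \<noteq> 1 \<Longrightarrow> r\<^sup>2 \<noteq> 0 \<Longrightarrow> gen_mat r *v v = vector [r * v $ 1, v $ 2, - v $ 3, - r * v $ 4]"
  by (simp_all add: vec_eq_iff forall_4 matrix_vector_mult_def sum_4 gen_mat_def)

text \<open>Cayley-Hamilton: in all three cases the characteristic polynomial is (x^2 - 1)(x^2 -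
  r^2). This identity unites the diagonal and the two non-diagonalizable matrices into one
  family.\<close>

lemma gen_mat_char:
  "gen_mat r *v (gen_mat r *v (gen_mat r *v (gen_mat r *v v))) = (1 + r\<^sup>2) *s (gen_mat r *v (gen_mat r *v v)) + (- r\<^sup>2) *s v"
proof -
  consider "r\<^sup>2 = 1" | "r\<^sup>2 = 0" | "r\<^sup>2 \<noteq> 1" "r\<^sup>2 \<noteq> 0" by blast
  then show ?thesis
  proof cases
    case 1
    show ?thesis unfolding gen_mat_mult(1)[OF 1] unfolding 1 by (simp add: vec_eq_iff forall_4)
  next
    case 2
    show ?thesis unfolding gen_mat_mult(2)[OF 2] unfolding 2 by (simp add: vec_eq_iff forall_4)
  next
    case 3
    show ?thesis unfolding gen_mat_mult(3)[OF 3] by (simp add: vec_eq_iff forall_4 power2_eq_square algebra_simps)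
  qed
qed

text \<open>Whatever r is, two coordinates of the orbit evolve as e^t and e^(-t). Their quotient
  e^(2t) is a coordinate on every model curve.\<close>

lemma gen_mat_eigen:
  "\<exists>i j. \<forall>v. (gen_mat r *v v) $ i = v $ i \<and> (gen_mat r *v v) $ j = - v $ j"
proof -
  consider "r\<^sup>2 = 1" | "r\<^sup>2 = 0" | "r\<^sup>2 \<noteq> 1" "r\<^sup>2 \<noteq> 0" by blast
  then show ?thesis
  proof cases
    case 1
    show ?thesis unfolding gen_mat_mult(1)[OF 1] by (intro exI[of _ 2] exI[of _ 4]) simp
  next
    case 2
    show ?thesis unfolding gen_mat_mult(2)[OF 2] by (intro exI[of _ 1] exI[of _ 4]) simp
  next
    case 3
    show ?thesis unfolding gen_mat_mult(3)[OF 3] by (intro exI[of _ 2] exI[of _ 3]) simp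
  qed
qed

lemma base_vec_nth [simp]: "base_vec $ i = 1"
  using exhaust_4[of i] by (auto simp: base_vec_def)

text \<open>Each eigenvalue has a single Jordan block, and \<open>base_vec\<close> has a nonzero
  last component in every block, so it is a cyclic vector.\<close>

lemma gen_mat_cyclic:
  "basis4 base_vec (gen_mat r *v base_vec) (gen_mat r *v (gen_mat r *v base_vec)) (gen_mat r *v (gen_mat r *v (gen_mat r *v base_vec)))"
  unfolding basis4_def
proof (intro allI impI)
  fix a b c d
  assume eq: "a *s base_vec + b *s (gen_mat r *v base_vec) + c *s (gen_mat r *v (gen_mat r *v base_vec)) +
     d *s (gen_mat r *v (gen_mat r *v (gen_mat r *v base_vec))) = 0"
  consider "r\<^sup>2 = 1" | "r\<^sup>2 = 0" | "r\<^sup>2 \<noteq> 1" "r\<^sup>2 \<noteq> 0" by blast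
  then show "a = 0 \<and> b = 0 \<and> c = 0 \<and> d = 0"
  proof cases
    case 1
    have E: "a + 2 * b + 3 * c + 4 * d = 0" "a + b + c + d = 0" "a - c + 2 * d = 0" "a - b + c - d = 0"
      using eq unfolding gen_mat_mult(1)[OF 1] by (simp_all add: vec_eq_iff forall_4 algebra_simps)
    have "4 * c = 0 \<and> 4 * d = 0 \<and> 4 * a = 0 \<and> 4 * b = 0" using E by algebra
    then show ?thesis by simp
  next
    case 2
    have E: "a + b + c + d = 0" "a + b = 0" "a = 0" "a - b + c - d = 0"
      using eq unfolding gen_mat_mult(2)[OF 2] by (auto simp: vec_eq_iff forall_4 algebra_simps)
    have "2 * c = 0 \<and> 2 * d = 0" using E by algebra
    then show ?thesis using E by simp
  next
    case 3
    have E: "a + b * r + c * r\<^sup>2 + d * r ^ 3 = 0" "a + b + c + d = 0" "a - b + c - d = 0" "a - b * r + c * r\<^sup>2 - d * r ^ 3 = 0"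
      using eq unfolding gen_mat_mult(3)[OF 3] by (simp_all add: vec_eq_iff forall_4 algebra_simps power2_eq_square power3_eq_cube)
    have "2 * ((1 - r\<^sup>2) * c) = 0" "2 * (r * (1 - r\<^sup>2) * d) = 0" using E by algebra+
    moreover have "1 - r\<^sup>2 \<noteq> 0" "r \<noteq> 0" using 3 by auto
    ultimately have cd: "c = 0" "d = 0" by auto
    have "2 * a = 0" "2 * b = 0" using E(2,3) unfolding cd by algebra+
    then show ?thesis using cd by simp
  qed
qed

lemma symplectic_form_example:
  assumes "k14 \<noteq> 0" "k23 \<noteq> 0"
    and \<sigma>: "\<And>v w. \<sigma> v w = k14 * (v $ 1 * w $ 4 - v $ 4 * w $ 1) + k23 * (v $ 2 * w $ 3 - v $ 3 * w $ 2) + k24 * (v $ 2 * w $ 4 - v $ 4 * w $ 2)"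
  shows "symplectic_form \<sigma>"
  unfolding symplectic_form_def
proof (intro conjI allI impI)
  show "Vector_Spaces.linear (*s) (*) (\<sigma> v)" "Vector_Spaces.linear (*s) (*) (\<lambda>w. \<sigma> w v)" for v
    unfolding \<sigma> by unfold_locales (simp_all add: algebra_simps)
  show "\<sigma> v v = 0" for v by (simp add: \<sigma>)
  fix v assume z: "\<forall>w. \<sigma> v w = 0"
  have "v $ 4 = 0" using z[rule_format, of "axis 1 1"] assms(1) by (simp add: \<sigma> axis_def)
  moreover have "v $ 2 = 0" using z[rule_format, of "axis 3 1"] assms(2) by (simp add: \<sigma> axis_def)
  moreover have "v $ 3 = 0" using z[rule_format, of "axis 2 1"] assms(2) calculation by (simp add: \<sigma> axis_def)
  moreover have "v $ 1 = 0" using z[rule_format, of "axis 4 1"] assms(1) calculation by (simp add: \<sigma> axis_def)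
  ultimately show "v = 0" by (simp add: vec_eq_iff forall_4)
qed

text \<open>Invariance pairs opposite eigenvalues; the remaining ratio of coefficients is fixed by
  the Legendrian condition at \<open>base_vec\<close>. For the diagonal matrices that condition
  reads k23 = - r k14, for r^2 = 0 it reads k23 = - 2 k14. For r^2 = 1 invariance itself gives k23 =
  - k14, and the condition at \<open>base_vec\<close> determines k24.\<close>

lemma gen_mat_symplectic:
  "\<exists>\<sigma>. symplectic_form \<sigma> \<and> (\<forall>v w. \<sigma> (gen_mat r *v v) w + \<sigma> v (gen_mat r *v w) = 0) \<and> \<sigma> base_vec (gen_mat r *v base_vec) = 0"
proof -
  define \<sigma> where "\<sigma> k14 k23 k24 v w = k14 * (v $ 1 * w $ 4 - v $ 4 * w $ 1) + k23 * (v $ 2 * w $ 3 - v $ 3 * w $ 2) +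
    k24 * (v $ 2 * w $ 4 - v $ 4 * w $ 2)" for k14 k23 k24 :: complex and v w :: cvec
  have s: "symplectic_form (\<sigma> k14 k23 k24)" if "k14 \<noteq> 0" "k23 \<noteq> 0" for k14 k23 k24
    by (rule symplectic_form_example[OF that, of "\<sigma> k14 k23 k24" k24]) (simp add: \<sigma>_def)
  consider "r\<^sup>2 = 1" | "r\<^sup>2 = 0" | "r\<^sup>2 \<noteq> 1" "r\<^sup>2 \<noteq> 0" by blast
  then show ?thesis
  proof cases
    case 1
    show ?thesis unfolding gen_mat_mult(1)[OF 1]
      by (intro exI[of _ "\<sigma> 1 (- 1) (- 1)"] conjI s) (simp_all add: \<sigma>_def algebra_simps)
  next
    case 2
    show ?thesis unfolding gen_mat_mult(2)[OF 2]
      by (intro exI[of _ "\<sigma> 1 (- 2) 0"] conjI s) (simp_all add: \<sigma>_def algebra_simps)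
  next
    case 3
    then have "r \<noteq> 0" by auto
    then show ?thesis unfolding gen_mat_mult(3)[OF 3]
      by (intro exI[of _ "\<sigma> 1 (- r) 0"] conjI s) (simp_all add: \<sigma>_def algebra_simps)
  qed
qed

section \<open>The model germs\<close>

abbreviation model_curve :: "complex \<Rightarrow> complex \<Rightarrow> cvec" where
  "model_curve r \<equiv> exp_curve (gen_mat r) base_vec"

lemma model_germ_eq: "model_germ r = (cone_over (model_curve r) (ball 0 1), base_vec)"
  by (simp add: model_germ_def exp_curve_def[abs_def])

lemma model_curve_coords:
  "\<exists>i j. \<forall>t\<in>ball 0 1. model_curve r t $ i = exp t \<and> model_curve r t $ j = exp (- t) \<and>
     vderiv 1 (model_curve r) t $ i = exp t \<and> vderiv 1 (model_curve r) t $ j = - exp (- t)"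
proof -
  obtain i j where ij: "\<And>v. (gen_mat r *v v) $ i = v $ i" "\<And>v. (gen_mat r *v v) $ j = - v $ j"
    using gen_mat_eigen by metis
  let ?g = "model_curve r"
  have d: "((\<lambda>t. ?g t $ i) has_field_derivative ?g t $ i) (at t)" "((\<lambda>t. ?g t $ j) has_field_derivative - ?g t $ j) (at t)" for t
    using has_field_derivative_vnth[OF has_vderiv_exp_curve[of "gen_mat r" base_vec t]] ij by metis+
  have i: "?g t $ i = exp t" if "t \<in> ball 0 1" for t
  proof -
    have "?g t $ i * exp (- t) = ?g 0 $ i * exp (- 0)"
      by (rule holomorphic_zero_deriv_const[OF _ that]) (rule derivative_eq_intros d refl | simp)+
    then show ?thesis by (simp add: exp_curve_0 exp_minus field_simps)
  qed
  have j: "?g t $ j = exp (- t)" if "t \<in> ball 0 1" for t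
  proof -
    have "?g t $ j * exp t = ?g 0 $ j * exp 0"
      by (rule holomorphic_zero_deriv_const[OF _ that]) (rule derivative_eq_intros d refl | simp)+
    then show ?thesis by (simp add: exp_curve_0 exp_minus field_simps)
  qed
  have "vderiv 1 ?g t = gen_mat r *v ?g t" for t by (rule vderiv_1_eq[OF has_vderiv_exp_curve])
  then show ?thesis using i j ij by (intro exI[of _ i] exI[of _ j]) simp
qed

text \<open>On the unit disc the imaginary part of 2t is less than 2 < pi in modulus, which keeps
  e^(2t) off the cut of the logarithm.\<close>

lemma exp_double_inverse:
  assumes "t \<in> ball (0::complex) 1"
  shows "Ln (exp (2 * t)) = 2 * t" "exp (2 * t) \<notin> \<real>\<^sub>\<le>\<^sub>0"
proof -
  have "\<bar>Im t\<bar> \<le> norm t" by (rule abs_Im_le_cmod)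
  then have im: "\<bar>Im t\<bar> < 1" using assms by simp
  have "pi > 2" using pi_gt3 by simp
  then have b: "- pi < Im (2 * t)" "Im (2 * t) < pi" using im by auto
  then show ln: "Ln (exp (2 * t)) = 2 * t" by simp
  show "exp (2 * t) \<notin> \<real>\<^sub>\<le>\<^sub>0"
  proof
    assume "exp (2 * t) \<in> \<real>\<^sub>\<le>\<^sub>0"
    then have "Re (exp (2 * t)) \<le> 0" "Im (exp (2 * t)) = 0" by (auto simp: complex_nonpos_Reals_iff)
    moreover have "exp (2 * t) \<noteq> 0" by simp
    ultimately have "Re (exp (2 * t)) < 0 \<and> Im (exp (2 * t)) = 0"
      by (metis complex_eq_iff less_eq_real_def zero_complex.simps)
    then have "Im (Ln (exp (2 * t))) = pi" using Im_Ln_eq_pi[of "exp (2 * t)"] by simp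
    then show False using b unfolding ln by simp
  qed
qed

text \<open>The inverse reads the parameter off half the logarithm of the quotient of the two
  exponential coordinates, and then the factor off the coordinate that equals c e^t.\<close>

lemma model_homeomorphism:
  "\<exists>g. homeomorphism ((- {0}) \<times> ball 0 1) (cone_over (model_curve r) (ball 0 1)) (\<lambda>(c, t). c *s model_curve r t) g"
proof -
  let ?\<gamma> = "model_curve r" and ?Z = "cone_over (model_curve r) (ball 0 1)"
  obtain i j where ij: "\<And>t. t \<in> ball 0 1 \<Longrightarrow> ?\<gamma> t $ i = exp t" "\<And>t. t \<in> ball 0 1 \<Longrightarrow> ?\<gamma> t $ j = exp (- t)"
    using model_curve_coords[of r] by blast
  define \<tau> where "\<tau> v = Ln (v $ i / v $ j) / 2" for v :: cvec
  have q: "(c *s ?\<gamma> t) $ i / (c *s ?\<gamma> t) $ j = exp (2 * t)" if "c \<noteq> 0" "t \<in> ball 0 1" for c t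
    using that by (simp add: ij[OF that(2)] exp_minus field_simps flip: exp_add mult_2)
  have \<tau>: "\<tau> (c *s ?\<gamma> t) = t" if "c \<noteq> 0" "t \<in> ball 0 1" for c t
    unfolding \<tau>_def q[OF that] exp_double_inverse(1)[OF that(2)] by simp
  define g where "g v = (v $ i * exp (- \<tau> v), \<tau> v)" for v
  have gf: "g (c *s ?\<gamma> t) = (c, t)" if "c \<noteq> 0" "t \<in> ball 0 1" for c t
    unfolding g_def \<tau>[OF that] by (simp add: ij[OF that(2)] exp_minus)
  have cn: "continuous_on ?Z (\<lambda>v. v $ k)" for k by (intro continuous_intros)
  have nz: "v $ j \<noteq> 0" if "v \<in> ?Z" for v using that ij by (auto simp: cone_over_def)
  have cq: "continuous_on ?Z (\<lambda>v. v $ i / v $ j)"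
    using nz by (intro continuous_on_divide cn) auto
  have nn: "v $ i / v $ j \<notin> \<real>\<^sub>\<le>\<^sub>0" if "v \<in> ?Z" for v
  proof -
    obtain c t where ct: "c \<noteq> 0" "t \<in> ball 0 1" "v = c *s ?\<gamma> t" using \<open>v \<in> ?Z\<close> unfolding cone_over_def by blast
    show ?thesis unfolding ct(3) q[OF ct(1,2)] by (rule exp_double_inverse(2)[OF ct(2)])
  qed
  have "continuous_on ((\<lambda>v. v $ i / v $ j) ` ?Z) Ln"
    by (intro holomorphic_on_imp_continuous_on holomorphic_on_Ln) (use nn in auto)
  from continuous_on_compose2[OF this cq order_refl]
  have "continuous_on ?Z (\<lambda>v. Ln (v $ i / v $ j))" .
  then have "continuous_on ?Z \<tau>"
    unfolding \<tau>_def by (intro continuous_on_divide continuous_on_const) auto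
  then have "continuous_on ?Z g" unfolding g_def by (intro continuous_intros cn)
  moreover have "continuous_on ((- {0}) \<times> ball 0 1) (\<lambda>(c, t). c *s ?\<gamma> t)"
  proof (rule continuous_on_cvecI)
    fix k
    have "continuous_on (ball 0 1) (\<lambda>t. ?\<gamma> t $ k)"
      using holomorphic_vnth[OF vholomorphic_exp_curve] holomorphic_on_imp_continuous_on by blast
    then have "continuous_on ((- {0}) \<times> ball 0 1) (\<lambda>p. fst p * ?\<gamma> (snd p) $ k)"
      by (intro continuous_on_mult continuous_on_fst continuous_on_id continuous_on_compose2[OF _ continuous_on_snd[OF continuous_on_id]]) auto
    then show "continuous_on ((- {0}) \<times> ball 0 1) (\<lambda>x. (case x of (c, t) \<Rightarrow> c *s ?\<gamma> t) $ k)"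
      by (simp add: case_prod_beta)
  qed
  moreover have "(\<lambda>(c, t). c *s \<delta> t) ` ((- {0}) \<times> S) = cone_over \<delta> S" for \<delta> S unfolding cone_over_def by auto
  then have "(\<lambda>(c, t). c *s ?\<gamma> t) ` ((- {0}) \<times> ball 0 1) = ?Z" .
  moreover have "g ` ?Z = (- {0}) \<times> ball 0 1"
  proof (intro equalityI subsetI)
    fix p assume "p \<in> g ` ?Z"
    then obtain v where v: "v \<in> ?Z" "p = g v" by blast
    then obtain c t where ct: "c \<noteq> 0" "t \<in> ball 0 1" "v = c *s ?\<gamma> t" unfolding cone_over_def by blast
    show "p \<in> (- {0}) \<times> ball 0 1" unfolding v(2) ct(3) gf[OF ct(1,2)] using ct(1,2) by simp
  next
    fix p :: "complex \<times> complex" assume "p \<in> (- {0}) \<times> ball 0 1"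
    then have p: "fst p \<noteq> 0" "snd p \<in> ball 0 1" by auto
    then have "p = g (fst p *s ?\<gamma> (snd p))" "fst p *s ?\<gamma> (snd p) \<in> ?Z"
      unfolding gf[OF p] by (simp_all add: cone_overI[OF p])
    then show "p \<in> g ` ?Z" by blast
  qed
  moreover have "\<forall>p\<in>(- {0}) \<times> ball 0 1. g (case p of (c, t) \<Rightarrow> c *s ?\<gamma> t) = p"
  proof
    fix p :: "complex \<times> complex" assume "p \<in> (- {0}) \<times> ball 0 1"
    then have "fst p \<noteq> 0" "snd p \<in> ball 0 1" by auto
    from gf[OF this] show "g (case p of (c, t) \<Rightarrow> c *s ?\<gamma> t) = p" by (simp add: case_prod_beta)
  qed
  moreover have "\<forall>v\<in>?Z. (case g v of (c, t) \<Rightarrow> c *s ?\<gamma> t) = v"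
  proof
    fix v assume "v \<in> ?Z"
    then obtain c t where ct: "c \<noteq> 0" "t \<in> ball 0 1" "v = c *s ?\<gamma> t" unfolding cone_over_def by blast
    show "(case g v of (c, t) \<Rightarrow> c *s ?\<gamma> t) = v" unfolding ct(3) gf[OF ct(1,2)] by simp
  qed
  ultimately have "homeomorphism ((- {0}) \<times> ball 0 1) ?Z (\<lambda>(c, t). c *s ?\<gamma> t) g"
    unfolding homeomorphism_def by blast
  then show ?thesis by blast
qed

lemma model_lin_indep2:
  assumes "t \<in> ball 0 1"
  shows "lin_indep2 (model_curve r t) (vderiv 1 (model_curve r) t)"
  unfolding lin_indep2_def
proof (intro allI impI)
  fix a b assume eq: "a *s model_curve r t + b *s vderiv 1 (model_curve r) t = 0"
  obtain i j where ij: "model_curve r t $ i = exp t" "model_curve r t $ j = exp (- t)"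
     "vderiv 1 (model_curve r) t $ i = exp t" "vderiv 1 (model_curve r) t $ j = - exp (- t)"
    using model_curve_coords[of r] assms by blast
  have "(a + b) * exp t = 0" "(a - b) * exp (- t) = 0"
    using arg_cong[OF eq, of "\<lambda>v. v $ i"] arg_cong[OF eq, of "\<lambda>v. v $ j"] ij by (simp_all add: algebra_simps)
  then show "a = 0 \<and> b = 0" by auto
qed

lemma model_chart: "chart (cone_over (model_curve r) (ball 0 1)) (model_curve r) (ball 0 1)"
proof -
  obtain g where h: "homeomorphism ((- {0}) \<times> ball 0 1) (cone_over (model_curve r) (ball 0 1)) (\<lambda>(c, t). c *s model_curve r t) g"
    using model_homeomorphism by blast
  show ?thesis
    by (rule homeomorphism_chart(1)[OF open_UNIV open_ball vholomorphic_exp_curve])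
       (erule model_lin_indep2, unfold Int_UNIV_right, rule h)
qed

lemma model_is_curve: "curve (cone_over (model_curve r) (ball 0 1))"
  unfolding curve_def
proof (intro conjI ballI)
  let ?Z = "cone_over (model_curve r) (ball 0 1)"
  show "is_cone ?Z" by (rule is_cone_cone_over)
  show "0 \<notin> ?Z"
  proof
    assume "0 \<in> ?Z"
    then obtain c t where "c \<noteq> 0" "t \<in> ball 0 1" "0 = c *s model_curve r t" unfolding cone_over_def by blast
    then have "1 *s model_curve r t + 0 *s vderiv 1 (model_curve r) t = 0" by auto
    then show False using model_lin_indep2[OF \<open>t \<in> ball 0 1\<close>] unfolding lin_indep2_def by (metis zero_neq_one)
  qed
  obtain g where h: "homeomorphism ((- {0}) \<times> ball 0 1) ?Z (\<lambda>(c, t). c *s model_curve r t) g"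
    using model_homeomorphism by blast
  fix z
  show "\<exists>U T \<gamma> g. open U \<and> is_cone U \<and> z \<in> U \<and> open T \<and> vholomorphic_on \<gamma> T \<and>
        (\<forall>t\<in>T. \<forall>a b. a *s \<gamma> t + b *s vderiv 1 \<gamma> t = 0 \<longrightarrow> a = 0 \<and> b = 0) \<and>
        homeomorphism ((- {0}) \<times> T) (?Z \<inter> U) (\<lambda>(c, t). c *s \<gamma> t) g"
    using h model_lin_indep2 unfolding lin_indep2_def
    by (intro exI[of _ UNIV] exI[of _ "ball 0 1"] exI[of _ "model_curve r"] exI[of _ g])
       (auto simp: is_cone_def vholomorphic_exp_curve)
qed

lemma model_ode_germ:
  "ode_germ (1 + r\<^sup>2) (- r\<^sup>2) (cone_over (model_curve r) (ball 0 1)) base_vec (model_curve r) 1"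
proof -
  have "const_ode (1 + r\<^sup>2) (- r\<^sup>2) (model_curve r) (ball 0 1)"
    unfolding const_ode_def vderiv_exp_curve mat_pow_vec using gen_mat_char by blast
  moreover have "nondeg (model_curve r) 0"
    using gen_mat_cyclic unfolding nondeg_def vderiv_exp_curve mat_pow_vec exp_curve_0 .
  ultimately show ?thesis
    unfolding ode_germ_def using model_chart by (simp add: exp_curve_0 is_cone_cone_over)
qed

text \<open>By invariance the derivative of \<sigma>(\<gamma>, A \<gamma>) is zero, so the
  Legendrian condition spreads from the base point along the orbit. The identity and A are tangent
  to the orbit, and A is not a scalar because it has a cyclic vector.\<close>

lemma model_homogeneous: "model_germ r \<in> homogeneous_germs"
proof -
  let ?Z = "cone_over (model_curve r) (ball 0 1)" and ?A = "gen_mat r" and ?\<gamma> = "model_curve r"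
  note g = ode_germD[OF model_ode_germ[of r]]
  have 0: "(0::complex) \<in> ball 0 1" by simp
  have nd: "nondegenerate_at ?Z base_vec"
    using nondegenerate_at_chart[OF g(3,2) 0, of 1] g(4,6) by simp
  obtain \<sigma> where \<sigma>: "symplectic_form \<sigma>" "\<And>v w. \<sigma> (?A *v v) w + \<sigma> v (?A *v w) = 0" "\<sigma> base_vec (?A *v base_vec) = 0"
    using gen_mat_symplectic by blast
  note a\<sigma> = symplectic_alternating[OF \<sigma>(1)] note D = alternating_formD[OF a\<sigma>]
  have A: "vderiv 1 ?\<gamma> t = ?A *v ?\<gamma> t" for t by (rule vderiv_1_eq[OF has_vderiv_exp_curve])
  have z: "\<sigma> (?\<gamma> t) (vderiv 1 ?\<gamma> t) = 0" if "t \<in> ball 0 1" for t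
  proof -
    have "\<sigma> (?\<gamma> t) (?A *v ?\<gamma> t) = \<sigma> (?\<gamma> 0) (?A *v ?\<gamma> 0)"
    proof (rule holomorphic_zero_deriv_const[OF _ that])
      fix t :: complex
      have "((\<lambda>t. \<sigma> (?\<gamma> t) (?A *v ?\<gamma> t)) has_field_derivative
          \<sigma> (?A *v ?\<gamma> t) (?A *v ?\<gamma> t) + \<sigma> (?\<gamma> t) (?A *v (?A *v ?\<gamma> t))) (at t)"
        by (rule DERIV_alternating_form[OF a\<sigma> has_vderiv_exp_curve has_vderiv_matrix[OF has_vderiv_exp_curve]])
      then show "((\<lambda>t. \<sigma> (?\<gamma> t) (?A *v ?\<gamma> t)) has_field_derivative 0) (at t)" unfolding \<sigma>(2) .
    qed
    then show ?thesis using \<sigma>(3) unfolding A exp_curve_0 by simp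
  qed
  have leg: "legendrian \<sigma> ?Z"
    unfolding legendrian_def
  proof (intro conjI ballI)
    fix x v w assume x: "x \<in> ?Z" and vw: "v \<in> tangent ?Z x" "w \<in> tangent ?Z x"
    obtain c t where ct: "c \<noteq> 0" "t \<in> ball 0 1" "x = c *s ?\<gamma> t" using x unfolding cone_over_def by blast
    obtain a b a' b' where "v = a *s ?\<gamma> t + b *s vderiv 1 ?\<gamma> t" "w = a' *s ?\<gamma> t + b' *s vderiv 1 ?\<gamma> t"
      using vw unfolding ct(3) tangent_chart[OF g(3,2) ct(2,1)] by blast
    then show "\<sigma> v w = 0"
      using z[OF ct(2)] alternating_form_antisym[OF a\<sigma>, of "vderiv 1 ?\<gamma> t" "?\<gamma> t"] by (simp add: D)
  qed (use \<sigma>(1) model_is_curve in auto)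
  have in_aut: "u \<in> aut \<sigma> ?Z" if u: "\<And>t. t \<in> ball 0 1 \<Longrightarrow> u *v ?\<gamma> t = a *s ?\<gamma> t + b *s vderiv 1 ?\<gamma> t" for u a b
  proof -
    have "u \<in> csp \<sigma>"
      by (rule tangent_imp_csp[OF \<sigma>(1) g(5,7) open_ball z 0 g(6), of "\<lambda>_. a" "\<lambda>_. b"]) (use u in auto)
    moreover have "u *v x \<in> tangent ?Z x" if "x \<in> ?Z" for x
    proof -
      obtain c t where ct: "c \<noteq> 0" "t \<in> ball 0 1" "x = c *s ?\<gamma> t" using \<open>x \<in> ?Z\<close> unfolding cone_over_def by blast
      have "u *v (1 *s ?\<gamma> t) \<in> tangent ?Z (1 *s ?\<gamma> t)"
        using tangent_chart[OF g(3,2) ct(2), of 1] u[OF ct(2)] by auto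
      then show ?thesis unfolding ct(3) using tangent_scale[OF g(3,2) ct(2,1), of 1] by simp
    qed
    ultimately show ?thesis unfolding aut_def by blast
  qed
  have "mat 1 \<in> aut \<sigma> ?Z" by (rule in_aut[of _ 1 0]) simp
  moreover have "?A \<in> aut \<sigma> ?Z" by (rule in_aut[of _ 0 1]) (simp add: A[unfolded One_nat_def])
  moreover have ns: "?A \<notin> mats.span {mat 1}"
  proof
    assume "?A \<in> mats.span {mat 1}"
    then obtain k where "?A - mat_scale k (mat 1) = 0" by (auto simp: mats.span_insert)
    then have "?A = mat_scale k (mat 1)" by simp
    then have "?A *v base_vec = k *s base_vec" by (simp add: mat_scale_mult)
    then have "k *s base_vec + (- 1) *s (?A *v base_vec) + 0 *s (?A *v (?A *v base_vec)) + 0 *s (?A *v (?A *v (?A *v base_vec))) = 0"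
      by (simp add: vec_eq_iff)
    then show False using gen_mat_cyclic[of r] unfolding basis4_def by (metis neg_equal_0_iff_equal zero_neq_one)
  qed
  moreover have "mat 1 \<noteq> (0 :: cmat)" by (simp add: vec_eq_iff mat_def)
  then have "mats.independent {?A, mat 1}" using ns by (simp add: mats.independent_insert)
  moreover have "card {?A, mat 1} = 2" using ns mats.span_base[of ?A "{mat 1}"] by (auto simp: card_insert_if)
  ultimately have "2 \<le> mat_dim (aut \<sigma> ?Z)" using mat_dim_ge[of "{?A, mat 1}" "aut \<sigma> ?Z"] by simp
  then show ?thesis
    unfolding homogeneous_germs_def homogeneous_def model_germ_eq using nd leg by auto
qed

section \<open>Laguerre-Forsyth forms\<close>

text \<open>Four dependent vectors do not span; the annihilating functional is a kernel vector of
  the transposed matrix.\<close>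

lemma not_basis4_functional:
  assumes "\<not> basis4 e0 e1 e2 e3"
  shows "\<exists>\<phi>. \<phi> \<noteq> 0 \<and> fdot \<phi> e0 = 0 \<and> fdot \<phi> e1 = 0 \<and> fdot \<phi> e2 = 0 \<and> fdot \<phi> e3 = 0"
proof -
  let ?M = "transpose (cols4 e0 e1 e2 e3)"
  have "\<not> invertible ?M"
    using assms by (simp add: basis4_invertible invertible_det_nz det_transpose)
  then obtain \<phi> where \<phi>: "\<phi> \<noteq> 0" "?M *v \<phi> = 0"
    using matrix_left_invertible_ker[of ?M] invertible_left_inverse[of ?M] by blast
  have "(?M *v \<phi>) $ 1 = fdot \<phi> e0" "(?M *v \<phi>) $ 2 = fdot \<phi> e1" "(?M *v \<phi>) $ 3 = fdot \<phi> e2" "(?M *v \<phi>) $ 4 = fdot \<phi> e3"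
    by (simp_all add: matrix_vector_mult_def fdot_def transpose_def cols4_def mult.commute)
  then show ?thesis using \<phi> by auto
qed

text \<open>By the Leibniz rule the derivative of order m + 4 is a combination of those of order at
  most m, so vanishing initial data make the whole Taylor series vanish.\<close>

lemma scalar_ode_unique:
  assumes w: "w holomorphic_on T" "Q holomorphic_on T" "open T" "connected T" "t0 \<in> T"
    and ode: "\<And>t. t \<in> T \<Longrightarrow> (deriv ^^ 4) w t = - Q t * w t"
    and init: "w t0 = 0" "(deriv ^^ 1) w t0 = 0" "(deriv ^^ 2) w t0 = 0" "(deriv ^^ 3) w t0 = 0"
    and t: "t \<in> T"
  shows "w t = 0"
proof (rule holomorphic_fun_eq_0_on_connected[OF w(1,3,4) _ w(5) t])
  have Qm: "(\<lambda>t. - Q t) holomorphic_on T" using w(2) by (intro holomorphic_intros)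
  fix n show "(deriv ^^ n) w t0 = 0"
  proof (induction n rule: less_induct)
    case (less n)
    show ?case
    proof (cases "n < 4")
      case True
      then have "n = 0 \<or> n = 1 \<or> n = 2 \<or> n = 3" by auto
      then show ?thesis using init by (elim disjE) (simp_all only: funpow_0)
    next
      case False
      then obtain m where n: "n = m + 4" by (metis add.commute le_iff_add not_less)
      have "(deriv ^^ n) w t0 = (deriv ^^ m) ((deriv ^^ 4) w) t0" unfolding n by (simp only: funpow_add o_apply)
      also have "\<dots> = (deriv ^^ m) (\<lambda>t. - Q t * w t) t0"
        by (rule higher_deriv_cong_ev[OF _ refl])
           (use ode w in \<open>auto intro!: eventually_nhds_in_open[THEN eventually_mono, of T] simp del: funpow.simps\<close>)
      also have "\<dots> = (\<Sum>i=0..m. of_nat (m choose i) * (deriv ^^ i) (\<lambda>t. - Q t) t0 * (deriv ^^ (m - i)) w t0)"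
        by (rule higher_deriv_mult[OF Qm w(1,3,5)])
      also have "\<dots> = 0"
        by (intro sum.neutral ballI) (simp add: less n)
      finally show ?thesis .
    qed
  qed
qed

lemma deriv_fdot:
  assumes "vholomorphic_on u T" "open T" "t \<in> T"
  shows "(deriv ^^ k) (\<lambda>t. fdot \<phi> (u t)) t = fdot \<phi> (vderiv k u t)"
  using assms(3)
proof (induction k arbitrary: t)
  case (Suc k)
  have "((\<lambda>t. fdot \<phi> (vderiv k u t)) has_field_derivative fdot \<phi> (vderiv (Suc k) u t)) (at t)"
    by (rule has_vderiv_fdot[OF has_vderiv_vderiv[OF assms(1,2) Suc.prems]])
  then have "((deriv ^^ k) (\<lambda>t. fdot \<phi> (u t)) has_field_derivative fdot \<phi> (vderiv (Suc k) u t)) (at t)"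
    by (rule has_field_derivative_transform_within_open[OF _ assms(2) Suc.prems]) (simp add: Suc.IH)
  then show ?case by (simp add: DERIV_imp_deriv)
qed simp

text \<open>\<open>fundamental_solutions\<close> demands only linear independence on T. If the
  Wronskian vanished at \<open>t0\<close>, a nonzero functional would kill the derivatives of u up
  to order three there; paired with u it would be a solution with zero initial data, hence zero,
  against independence.\<close>

lemma laguerre_forsythD:
  assumes "(T, Q) \<in> laguerre_forsyth (Z, z)"
  obtains u t0 c where "open T" "connected T" "Q holomorphic_on T" "vholomorphic_on u T"
    "\<And>t. t \<in> T \<Longrightarrow> vderiv 4 u t = (- Q t) *s u t" "u ` T \<subseteq> Z" "t0 \<in> T" "c \<noteq> 0" "u t0 = c *s z"
    "nondeg u t0"
proof -
  obtain u t0 c where T: "open T" "connected T"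
    and fs: "fundamental_solutions T (\<lambda>k. if k = 0 then Q else (\<lambda>t. 0)) u"
    and u: "u ` T \<subseteq> Z" "t0 \<in> T" "c \<noteq> 0" "u t0 = c *s z"
    using assms unfolding laguerre_forsyth_def curve_ode_def by auto
  have hol: "vholomorphic_on u T" and Q: "Q holomorphic_on T"
    using fs unfolding fundamental_solutions_def by (blast, force)
  have indep: "\<And>c. (\<forall>t\<in>T. (\<Sum>i\<in>UNIV. c i * u t $ i) = 0) \<Longrightarrow> \<forall>i. c i = 0"
    using fs unfolding fundamental_solutions_def by blast
  have ode: "vderiv 4 u t = (- Q t) *s u t" if "t \<in> T" for t
  proof -
    have "{..<4::nat} = insert 0 {1..<4}" by auto
    then have S: "(\<Sum>k<4. (if k = 0 then Q else (\<lambda>t. 0)) t *s vderiv k u t) = Q t *s u t" by simp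
    have "\<forall>t\<in>T. vderiv 4 u t + (\<Sum>k<4. (if k = 0 then Q else (\<lambda>t. 0)) t *s vderiv k u t) = 0"
      using fs unfolding fundamental_solutions_def by blast
    from this[rule_format, OF that] have "vderiv 4 u t + Q t *s u t = 0" unfolding S .
    then show ?thesis by (simp add: add_eq_0_iff2 vec_eq_iff)
  qed
  have "nondeg u t0"
  proof (rule ccontr)
    assume "\<not> nondeg u t0"
    then obtain \<phi> where \<phi>: "\<phi> \<noteq> 0" "fdot \<phi> (u t0) = 0" "fdot \<phi> (vderiv 1 u t0) = 0" "fdot \<phi> (vderiv 2 u t0) = 0" "fdot \<phi> (vderiv 3 u t0) = 0"
      using not_basis4_functional unfolding nondeg_def by blast
    have "fdot \<phi> (u t) = 0" if "t \<in> T" for t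
    proof (rule scalar_ode_unique[OF holomorphic_fdot[OF hol] Q T u(2) _ _ _ _ _ that])
      show "(deriv ^^ 4) (\<lambda>t. fdot \<phi> (u t)) t = - Q t * fdot \<phi> (u t)" if "t \<in> T" for t
        unfolding deriv_fdot[OF hol T(1) that] ode[OF that] fdot_scale ..
    qed (simp_all only: deriv_fdot[OF hol T(1) u(2)] \<phi>)
    then have "\<forall>i. \<phi> $ i = 0" by (intro indep) (auto simp: fdot_def)
    then show False using \<phi>(1) by (simp add: vec_eq_iff)
  qed
  then show ?thesis using that T Q hol ode u by blast
qed

text \<open>On a curve with \<open>\<gamma>'''' = p \<gamma>'' + q \<gamma>\<close>, a Laguerre-Forsyth form \<open>Q\<close> is
  obtained by a change of parameter whose derivative \<open>y\<close> has \<open>\<eta> = y'/y\<close> solving the Riccati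
  equation below.\<close>

lemma laguerre_forsyth_local:
  assumes og: "ode_germ p q Z z \<gamma> e" and LF: "(T, Q) \<in> laguerre_forsyth (Z, z)"
  shows "\<exists>t0 d y \<eta>. d > 0 \<and> ball t0 d \<subseteq> T \<and> (\<forall>t\<in>ball t0 d. y t \<noteq> 0 \<and>
    (y has_field_derivative \<eta> t * y t) (at t) \<and> (\<eta> has_field_derivative (\<eta> t)\<^sup>2 / 2 + p * (y t)\<^sup>2 / 5) (at t) \<and>
    Q t = - (q + 9 * p\<^sup>2 / 100) * (y t) ^ 4)"
proof -
  obtain e1 where e1: "0 < e1" "e1 \<le> e" "ode_germ p q Z z \<gamma> e1" "\<And>t. t \<in> ball 0 e1 \<Longrightarrow> nondeg \<gamma> t"
    using ode_germ_nondeg[OF og] by metis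
  note g = ode_germD[OF e1(3)]
  have 0: "0 \<in> ball (0::complex) e1" using e1 by simp
  obtain u t0 c0 where u: "open T" "connected T" "Q holomorphic_on T" "vholomorphic_on u T"
    "\<And>t. t \<in> T \<Longrightarrow> vderiv 4 u t = (- Q t) *s u t" "u ` T \<subseteq> Z" "t0 \<in> T" "c0 \<noteq> 0" "u t0 = c0 *s z" "nondeg u t0"
    using laguerre_forsythD[OF LF] by metis
  have ut0: "u t0 = c0 *s \<gamma> 0" using u(9) g(4) by simp
  obtain e2 c l where l: "e2 > 0" "ball t0 e2 \<subseteq> T" "c holomorphic_on ball t0 e2" "l holomorphic_on ball t0 e2"
    "c t0 = c0" "l t0 = 0" "l ` ball t0 e2 \<subseteq> ball 0 e1"
    "\<And>s. s \<in> ball t0 e2 \<Longrightarrow> c s \<noteq> 0 \<and> u s = c s *s \<gamma> (l s)"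
    by (rule arc_in_chart[OF g(3,2) 0 u(8,4,1,7,6) ut0]) (rule that)
  have t02: "t0 \<in> ball t0 e2" using l(1) by simp
  have ucong: "vderiv k u s = vderiv k (\<lambda>s. c s *s \<gamma> (l s)) s" if "s \<in> ball t0 e2" for k s
    by (rule vderiv_cong_open[OF open_ball that]) (use l(8) in auto)
  note RD = reparam_derivs_holomorphic[OF g(7) open_ball l(7) open_ball l(3,4)]
  \<comment> \<open>Otherwise u' would be a multiple of u at \<open>t0\<close>, although u is
    nondegenerate there.\<close>
  have "(deriv ^^ 1) l t0 \<noteq> 0"
  proof
    assume "(deriv ^^ 1) l t0 = 0"
    then have "vderiv 1 u t0 = (deriv ^^ 1) c t0 *s \<gamma> 0" unfolding ucong[OF t02] RD(1)[OF t02] l(6) by (simp del: funpow.simps)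
    then have "((deriv ^^ 1) c t0 / c0) *s u t0 + (- 1) *s vderiv 1 u t0 = 0" unfolding ut0 using u(8) by (simp add: vec_eq_iff)
    then show False using nondeg_lin_indep2[OF u(10)] unfolding lin_indep2_def by (metis neg_equal_0_iff_equal zero_neq_one)
  qed
  moreover have "continuous_on (ball t0 e2) ((deriv ^^ 1) l)"
    by (intro holomorphic_on_imp_continuous_on holomorphic_higher_deriv l(4) open_ball)
  ultimately have "open {t\<in>ball t0 e2. (deriv ^^ 1) l t \<noteq> 0}" "t0 \<in> {t\<in>ball t0 e2. (deriv ^^ 1) l t \<noteq> 0}"
    using open_nonzero open_ball t02 by blast+
  then obtain d where d: "d > 0" "ball t0 d \<subseteq> {t\<in>ball t0 e2. (deriv ^^ 1) l t \<noteq> 0}" by (meson open_contains_ball)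
  define y where "y = (deriv ^^ 1) l"
  define \<eta> where "\<eta> t = (deriv ^^ 2) l t / y t" for t
  have inb: "t \<in> ball t0 e2" "y t \<noteq> 0" "c t \<noteq> 0" if "t \<in> ball t0 d" for t
    using d(2) that l(8) unfolding y_def by blast+
  define c1 c2 c3 c4 l2 l3 where defs: "c1 = (deriv ^^ 1) c" "c2 = (deriv ^^ 2) c" "c3 = (deriv ^^ 3) c" "c4 = (deriv ^^ 4) c"
    "l2 = (deriv ^^ 2) l" "l3 = (deriv ^^ 3) l"
  have D: "(c has_field_derivative c1 t) (at t)" "(c1 has_field_derivative c2 t) (at t)" "(c2 has_field_derivative c3 t) (at t)"
    "(c3 has_field_derivative c4 t) (at t)" "(y has_field_derivative l2 t) (at t)" "(l2 has_field_derivative l3 t) (at t)"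
    if "t \<in> ball t0 d" for t
    using holomorphic_DERIVs[OF l(3) open_ball inb(1)[OF that]] holomorphic_DERIVs[OF l(4) open_ball inb(1)[OF that]]
    unfolding defs y_def by blast+
  \<comment> \<open>Coefficients of \<gamma>''', \<gamma>'' and \<gamma> in u'''' + Q u = 0 after
    elimination of \<gamma>''''. They yield, in this order, c'/c = - 3/2 \<eta>, the Riccati
    equation, and Q.\<close>
  have E: "4 * c1 t * (y t) ^ 3 + 6 * c t * (y t)\<^sup>2 * l2 t = 0"
    "6 * c2 t * (y t)\<^sup>2 + 12 * c1 t * y t * l2 t + c t * (3 * (l2 t)\<^sup>2 + 4 * y t * l3 t) + c t * (y t) ^ 4 * p = 0"
    "c4 t + c t * (y t) ^ 4 * q + Q t * c t = 0" if t: "t \<in> ball t0 d" for t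
  proof -
    have lt: "l t \<in> ball 0 e1" using l(7) inb(1)[OF t] by blast
    have "vderiv 4 u t + Q t *s u t = 0" using u(5)[of t] inb(1)[OF t] l(2) by (auto simp: vec_eq_iff)
    then have "vderiv 4 (\<lambda>s. c s *s \<gamma> (l s)) t + Q t *s (c t *s \<gamma> (l t)) = 0"
      unfolding ucong[OF inb(1)[OF t]] using l(8)[OF inb(1)[OF t]] by simp
    then have "(c4 t + c t * (y t) ^ 4 * q + Q t * c t) *s \<gamma> (l t) +
       (4 * c3 t * y t + 6 * c2 t * l2 t + 4 * c1 t * l3 t + c t * (deriv ^^ 4) l t) *s vderiv 1 \<gamma> (l t) +
       (6 * c2 t * (y t)\<^sup>2 + 12 * c1 t * y t * l2 t + c t * (3 * (l2 t)\<^sup>2 + 4 * y t * l3 t) + c t * (y t) ^ 4 * p) *s vderiv 2 \<gamma> (l t) +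
       (4 * c1 t * (y t) ^ 3 + 6 * c t * (y t)\<^sup>2 * l2 t) *s vderiv 3 \<gamma> (l t) = 0"
      unfolding RD(4)[OF inb(1)[OF t]] const_odeD[OF g(5) lt] defs y_def
      by (simp add: vec_eq_iff algebra_simps del: funpow.simps)
    then show "4 * c1 t * (y t) ^ 3 + 6 * c t * (y t)\<^sup>2 * l2 t = 0"
     "6 * c2 t * (y t)\<^sup>2 + 12 * c1 t * y t * l2 t + c t * (3 * (l2 t)\<^sup>2 + 4 * y t * l3 t) + c t * (y t) ^ 4 * p = 0"
     "c4 t + c t * (y t) ^ 4 * q + Q t * c t = 0"
      using e1(4)[OF lt] unfolding nondeg_def basis4_def by blast+
  qed
  have l2: "l2 t = \<eta> t * y t" if "t \<in> ball t0 d" for t unfolding \<eta>_def defs using inb[OF that] by simp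
  \<comment> \<open>The derivative of \<eta>, written through l'' and l''' so that the coefficient
    equations become algebraic in it.\<close>
  define \<eta>1 where "\<eta>1 t = l3 t / y t - (\<eta> t)\<^sup>2" for t
  have l3: "l3 t = (\<eta>1 t + (\<eta> t)\<^sup>2) * y t" if "t \<in> ball t0 d" for t unfolding \<eta>1_def using inb[OF that] by simp
  have D\<eta>: "(\<eta> has_field_derivative \<eta>1 t) (at t)" if "t \<in> ball t0 d" for t
  proof -
    have "((\<lambda>t. l2 t / y t) has_field_derivative \<eta>1 t) (at t)"
      by (rule derivative_eq_intros D[OF that] refl inb(2)[OF that])+
         (use inb(2)[OF that] in \<open>simp add: \<eta>1_def l2[OF that] field_simps power2_eq_square\<close>)
    then show ?thesis unfolding \<eta>_def[abs_def] defs .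
  qed
  have Dy: "(y has_field_derivative \<eta> t * y t) (at t)" if "t \<in> ball t0 d" for t using D(5)[OF that] l2[OF that] by simp
  have c1: "c1 t = - 3 / 2 * (\<eta> t * c t)" if "t \<in> ball t0 d" for t
  proof -
    have "(y t) ^ 3 * (4 * c1 t + 6 * (\<eta> t * c t)) = 0"
      using E(1)[OF that] unfolding l2[OF that] by (simp add: power2_eq_square power3_eq_cube algebra_simps)
    then have "4 * c1 t = - (6 * (\<eta> t * c t))" using inb(2)[OF that] by (simp add: eq_neg_iff_add_eq_0)
    then show ?thesis by (simp add: field_simps)
  qed
  have c2': "c2 t = - 3 / 2 * (\<eta>1 t * c t + c1 t * \<eta> t)" if "t \<in> ball t0 d" for t
  proof (rule DERIV_eq_on_open[OF open_ball that c1 D(2)[OF that]], assumption)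
    show "((\<lambda>t. - 3 / 2 * (\<eta> t * c t)) has_field_derivative - 3 / 2 * (\<eta>1 t * c t + c1 t * \<eta> t)) (at t)"
      by (rule derivative_eq_intros D\<eta>[OF that] D(1)[OF that] refl)+ (simp add: algebra_simps)
  qed
  have \<eta>1: "\<eta>1 t = (\<eta> t)\<^sup>2 / 2 + p * (y t)\<^sup>2 / 5" if "t \<in> ball t0 d" for t
  proof -
    have "c t * (y t)\<^sup>2 * (- 5 * \<eta>1 t + 5 / 2 * (\<eta> t)\<^sup>2 + p * (y t)\<^sup>2) = 0"
      using E(2)[OF that] unfolding l2[OF that] l3[OF that] c2'[OF that] c1[OF that]
      by (simp add: power2_eq_square power4_eq_xxxx algebra_simps)
    then have "- 5 * \<eta>1 t + 5 / 2 * (\<eta> t)\<^sup>2 + p * (y t)\<^sup>2 = 0" using inb[OF that] by simp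
    then have "5 * \<eta>1 t = 5 / 2 * (\<eta> t)\<^sup>2 + p * (y t)\<^sup>2" by (simp add: algebra_simps add_eq_0_iff)
    then show ?thesis by (simp add: field_simps)
  qed
  have D\<eta>': "(\<eta> has_field_derivative (\<eta> t)\<^sup>2 / 2 + p * (y t)\<^sup>2 / 5) (at t)" if "t \<in> ball t0 d" for t
    using D\<eta>[OF that] unfolding \<eta>1[OF that] .
  have D1: "(c has_field_derivative - 3 / 2 * (\<eta> t * c t)) (at t)" if "t \<in> ball t0 d" for t
    using D(1)[OF that] unfolding c1[OF that] .
  have c2: "c2 t = (3 / 2 * (\<eta> t)\<^sup>2 - 3 / 10 * p * (y t)\<^sup>2) * c t" if "t \<in> ball t0 d" for t
    unfolding c2'[OF that] c1[OF that] \<eta>1[OF that] by (simp add: field_simps power2_eq_square)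
  have c3: "c3 t = (- 3 / 4 * (\<eta> t) ^ 3 + 9 / 20 * p * \<eta> t * (y t)\<^sup>2) * c t" if "t \<in> ball t0 d" for t
  proof (rule DERIV_eq_on_open[OF open_ball that c2 D(3)[OF that]], assumption)
    show "((\<lambda>t. (3 / 2 * (\<eta> t)\<^sup>2 - 3 / 10 * p * (y t)\<^sup>2) * c t) has_field_derivative
       (- 3 / 4 * (\<eta> t) ^ 3 + 9 / 20 * p * \<eta> t * (y t)\<^sup>2) * c t) (at t)"
      by (rule derivative_eq_intros D\<eta>'[OF that] Dy[OF that] D1[OF that] refl)+
         (simp add: field_simps power2_eq_square power3_eq_cube)
  qed
  \<comment> \<open>With the Riccati equation all powers of \<eta> cancel in c'''', leaving a
    multiple of y^4; the constant 9/100 in Q originates here.\<close>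
  have c4: "c4 t = 9 / 100 * p\<^sup>2 * (y t) ^ 4 * c t" if "t \<in> ball t0 d" for t
  proof (rule DERIV_eq_on_open[OF open_ball that c3 D(4)[OF that]], assumption)
    show "((\<lambda>t. (- 3 / 4 * (\<eta> t) ^ 3 + 9 / 20 * p * \<eta> t * (y t)\<^sup>2) * c t) has_field_derivative
       9 / 100 * p\<^sup>2 * (y t) ^ 4 * c t) (at t)"
      by (rule derivative_eq_intros D\<eta>'[OF that] Dy[OF that] D1[OF that] refl)+
         (simp add: field_simps power2_eq_square power3_eq_cube power4_eq_xxxx)
  qed
  have Q: "Q t = - (q + 9 * p\<^sup>2 / 100) * (y t) ^ 4" if "t \<in> ball t0 d" for t
  proof -
    have "c t * (Q t + (q + 9 * p\<^sup>2 / 100) * (y t) ^ 4) = 0"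
      using E(3)[OF that] unfolding c4[OF that] by (simp add: algebra_simps)
    then have "Q t + (q + 9 * p\<^sup>2 / 100) * (y t) ^ 4 = 0" using inb(3)[OF that] by simp
    then have "Q t = - ((q + 9 * p\<^sup>2 / 100) * (y t) ^ 4)" by (simp only: eq_neg_iff_add_eq_0)
    then show ?thesis by (simp only: minus_mult_left)
  qed
  show ?thesis
  proof (intro exI conjI ballI)
    show "d > 0" by (rule d(1))
    show "ball t0 d \<subseteq> T" using inb(1) l(2) by blast
    fix t assume t: "t \<in> ball t0 d"
    show "y t \<noteq> 0" "(y has_field_derivative \<eta> t * y t) (at t)"
      "(\<eta> has_field_derivative (\<eta> t)\<^sup>2 / 2 + p * (y t)\<^sup>2 / 5) (at t)"
      "Q t = - (q + 9 * p\<^sup>2 / 100) * (y t) ^ 4"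
      by (rule inb(2)[OF t] Dy[OF t] D\<eta>'[OF t] Q[OF t])+
  qed
qed

section \<open>Values of the invariants\<close>

lemma holomorphic_zero_propagates:
  assumes "f holomorphic_on T" "open T" "connected T" "d > 0" "ball t0 d \<subseteq> T" "\<And>t. t \<in> ball t0 d \<Longrightarrow> f t = 0" "t \<in> T"
  shows "f t = 0"
proof (rule holomorphic_fun_eq_0_on_connected[OF assms(1-3) _ _ assms(7)])
  show "t0 \<in> T" using assms(4,5) by auto
  show "(deriv ^^ n) f t0 = 0" for n
  proof -
    have "(deriv ^^ n) f t0 = (deriv ^^ n) (\<lambda>_. 0) t0"
      by (rule higher_deriv_cong_ev[OF _ refl])
         (use assms(4,6) in \<open>auto intro!: eventually_nhds_in_open[THEN eventually_mono, of "ball t0 d"]\<close>)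
    then show ?thesis by simp
  qed
qed

lemma laguerre_forsyth_basic:
  assumes "(T, Q) \<in> laguerre_forsyth (Z, z)"
  shows "open T" "connected T" "Q holomorphic_on T"
  using laguerre_forsythD[OF assms] by metis+

lemma rel_inv_zeroI:
  assumes og: "ode_germ p q Z z \<gamma> e" and K: "9 * p\<^sup>2 + 100 * q = 0"
  shows "rel_inv_zero (Z, z)"
  unfolding rel_inv_zero_def
proof (intro ballI, clarify)
  fix T Q t assume LF: "(T, Q) \<in> laguerre_forsyth (Z, z)" and t: "t \<in> T"
  obtain t0 d y where d: "d > 0" "ball t0 d \<subseteq> T" "\<forall>t\<in>ball t0 d. Q t = - (q + 9 * p\<^sup>2 / 100) * (y t) ^ 4"
    using laguerre_forsyth_local[OF og LF] by blast
  have "q + 9 * p\<^sup>2 / 100 = 0" using K by (simp add: field_simps)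
  then show "Q t = 0"
    using holomorphic_zero_propagates[OF laguerre_forsyth_basic(3,1,2)[OF LF] d(1,2) _ t] d(3) by simp
qed

lemma K_nonzero: "9 * p\<^sup>2 + 100 * q \<noteq> 0 \<Longrightarrow> q + 9 * p\<^sup>2 / 100 \<noteq> (0 :: complex)"
  by (simp add: field_simps)

lemma rel_inv_nonzeroI:
  assumes og: "ode_germ p q Z z \<gamma> e" and K: "9 * p\<^sup>2 + 100 * q \<noteq> 0"
  shows "rel_inv_nonzero (Z, z)"
  unfolding rel_inv_nonzero_def
proof (intro ballI, clarify)
  fix T Q assume LF: "(T, Q) \<in> laguerre_forsyth (Z, z)"
  obtain t0 d y where d: "d > 0" "ball t0 d \<subseteq> T" "\<forall>t\<in>ball t0 d. y t \<noteq> 0 \<and> Q t = - (q + 9 * p\<^sup>2 / 100) * (y t) ^ 4"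
    using laguerre_forsyth_local[OF og LF] by blast
  have t0: "t0 \<in> ball t0 d" using d(1) by simp
  then have "Q t0 = - (q + 9 * p\<^sup>2 / 100) * (y t0) ^ 4" "y t0 \<noteq> 0" using d(3) by blast+
  then have "Q t0 \<noteq> 0" using K_nonzero[OF K] by (metis mult_eq_0_iff neg_equal_0_iff_equal power_not_zero)
  then show "\<exists>t\<in>T. Q t \<noteq> 0" using t0 d(2) by blast
qed

text \<open>Put Q = k y^4. In 8 Q Q'' - 9 Q'^2 the terms with \<eta>^2 cancel, since 8 * 4 * 9/2 = 9
  * 16, and (32/5) p y^2 Q^2 remains. Its square is a constant times y^4 Q^4, that is, a constant
  times Q^5.\<close>

lemma abs_inv_isI:
  assumes og: "ode_germ p q Z z \<gamma> e" and K: "9 * p\<^sup>2 + 100 * q \<noteq> 0"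
  shows "abs_inv_is (Z, z) (p\<^sup>2 / (9 * p\<^sup>2 + 100 * q))"
  unfolding abs_inv_is_def
proof (intro ballI, clarify)
  fix T Q t assume LF: "(T, Q) \<in> laguerre_forsyth (Z, z)" and t: "t \<in> T" "Q t \<noteq> 0"
  note B = laguerre_forsyth_basic[OF LF]
  define v where "v = p\<^sup>2 / (9 * p\<^sup>2 + 100 * q)"
  define k where "k = - (q + 9 * p\<^sup>2 / 100)"
  have vk: "v * k = - p\<^sup>2 / 100" 
  proof -
    have "k = - (9 * p\<^sup>2 + 100 * q) / 100" unfolding k_def by (simp add: field_simps)
    moreover have "p\<^sup>2 / X * (- X / 100) = - p\<^sup>2 / 100" if "X \<noteq> 0" for X using that by simp
    ultimately show ?thesis unfolding v_def using K by blast
  qed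
  obtain t0 d y \<eta> where d: "d > 0" "ball t0 d \<subseteq> T" and A: "\<forall>t\<in>ball t0 d. y t \<noteq> 0 \<and>
    (y has_field_derivative \<eta> t * y t) (at t) \<and> (\<eta> has_field_derivative (\<eta> t)\<^sup>2 / 2 + p * (y t)\<^sup>2 / 5) (at t) \<and>
    Q t = k * (y t) ^ 4"
    using laguerre_forsyth_local[OF og LF] unfolding k_def by blast
  have Dy: "(y has_field_derivative \<eta> t * y t) (at t)" and D\<eta>: "(\<eta> has_field_derivative (\<eta> t)\<^sup>2 / 2 + p * (y t)\<^sup>2 / 5) (at t)"
    and Q: "Q t = k * (y t) ^ 4" if "t \<in> ball t0 d" for t using A that by blast+
  have DQ: "(Q has_field_derivative (deriv ^^ 1) Q t) (at t)" "((deriv ^^ 1) Q has_field_derivative (deriv ^^ 2) Q t) (at t)"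
    if "t \<in> ball t0 d" for t using holomorphic_DERIVs[OF B(3,1)] d(2) that by blast+
  have Q1: "(deriv ^^ 1) Q t = 4 * k * \<eta> t * (y t) ^ 4" if "t \<in> ball t0 d" for t
  proof (rule DERIV_eq_on_open[OF open_ball that Q DQ(1)[OF that]], assumption)
    show "((\<lambda>t. k * (y t) ^ 4) has_field_derivative 4 * k * \<eta> t * (y t) ^ 4) (at t)"
      by (rule derivative_eq_intros Dy[OF that] refl)+ (simp add: power3_eq_cube power4_eq_xxxx)
  qed
  have Q2: "(deriv ^^ 2) Q t = 4 * k * (((\<eta> t)\<^sup>2 / 2 + p * (y t)\<^sup>2 / 5) + 4 * (\<eta> t)\<^sup>2) * (y t) ^ 4" if "t \<in> ball t0 d" for t
  proof (rule DERIV_eq_on_open[OF open_ball that Q1 DQ(2)[OF that]], assumption)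
    show "((\<lambda>t. 4 * k * \<eta> t * (y t) ^ 4) has_field_derivative
       4 * k * (((\<eta> t)\<^sup>2 / 2 + p * (y t)\<^sup>2 / 5) + 4 * (\<eta> t)\<^sup>2) * (y t) ^ 4) (at t)"
      by (rule derivative_eq_intros Dy[OF that] D\<eta>[OF that] refl)+
         (simp add: field_simps power2_eq_square power3_eq_cube power4_eq_xxxx)
  qed
  \<comment> \<open>The asserted identity with denominators cleared. It is holomorphic on all of T,
    also at zeros of Q, so it spreads from the disc to T by the identity theorem.\<close>
  define F where "F t = (8 * Q t * (deriv ^^ 2) Q t - 9 * ((deriv ^^ 1) Q t)\<^sup>2)\<^sup>2 + 4096 * v * (Q t) ^ 5" for t
  have "F s = 0" if "s \<in> ball t0 d" for s
  proof -
    have R: "8 * Q s * (deriv ^^ 2) Q s - 9 * ((deriv ^^ 1) Q s)\<^sup>2 = 32 / 5 * p * (y s)\<^sup>2 * (Q s)\<^sup>2"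
      unfolding Q1[OF that] Q2[OF that] Q[OF that] by (simp add: field_simps power2_eq_square power4_eq_xxxx)
    have "4096 * v * (Q s) ^ 5 = 4096 * (v * k) * (y s) ^ 4 * (Q s) ^ 4"
      by (subst power_Suc[of "Q s" 4, simplified]) (simp add: Q[OF that])
    then show ?thesis
      unfolding F_def R vk by (simp add: power_mult_distrib power2_eq_square power4_eq_xxxx)
  qed
  moreover have "F holomorphic_on T"
    unfolding F_def by (intro holomorphic_intros holomorphic_higher_deriv B)
  ultimately have "F t = 0" using holomorphic_zero_propagates[OF _ B(1,2) d _ t(1)] by blast
  then have "(R_fun Q t)\<^sup>2 = - (4096 * v * (Q t) ^ 5)"
    unfolding F_def R_fun_def by (simp add: eq_neg_iff_add_eq_0)
  then show "I_fun Q t = p\<^sup>2 / (9 * p\<^sup>2 + 100 * q)"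
    unfolding I_fun_def v_def[symmetric] using t(2) by simp
qed

section \<open>Existence of Laguerre-Forsyth forms\<close>

lemma laguerre_forsythI:
  assumes T: "open T" "connected T" "t0 \<in> T" and Q: "Q holomorphic_on T" and u: "vholomorphic_on u T"
    and ode: "\<And>t. t \<in> T \<Longrightarrow> vderiv 4 u t = (- Q t) *s u t" and Z: "u ` T \<subseteq> Z" "u t0 = z" and nd: "nondeg u t0"
  shows "(T, Q) \<in> laguerre_forsyth (Z, z)"
proof -
  have fs: "fundamental_solutions T (\<lambda>k. if k = 0 then Q else (\<lambda>t. 0)) u"
    unfolding fundamental_solutions_def
  proof (intro conjI allI impI ballI u)
    show "(if k = 0 then Q else (\<lambda>t. 0)) holomorphic_on T" for k :: nat using Q by simp
    fix t assume t: "t \<in> T"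
    have "{..<4::nat} = insert 0 {1..<4}" by auto
    then have S: "(\<Sum>k<4. (if k = 0 then Q else (\<lambda>t. 0)) t *s vderiv k u t) = Q t *s u t" by simp
    show "vderiv 4 u t + (\<Sum>k<4. (if k = 0 then Q else (\<lambda>t. 0)) t *s vderiv k u t) = 0"
      unfolding S ode[OF t] by (simp add: vec_eq_iff)
  next
    fix c :: "4 \<Rightarrow> complex" and i
    assume "\<forall>t\<in>T. (\<Sum>i\<in>UNIV. c i * u t $ i) = 0"
    then have "(\<chi> i. c i) = 0" by (intro nondeg_functional[OF nd T(1,3) _ u]) (simp add: fdot_def)
    then show "c i = 0" by (simp add: vec_eq_iff)
  qed
  have ex: "\<exists>t0\<in>T. \<exists>c. c \<noteq> 0 \<and> u t0 = c *s z" using T(3) Z(2) by (intro bexI[of _ t0] exI[of _ 1]) auto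
  have "curve_ode (Z, z) T (\<lambda>k. if k = 0 then Q else (\<lambda>t. 0))"
    unfolding curve_ode_def split_conv by (intro conjI exI[of _ u] T(1,2) fs Z(1) ex)
  then show ?thesis unfolding laguerre_forsyth_def by simp
qed

text \<open>The Riccati equation is solved by \<open>\<eta> = - 1/s\<close>, that is, by the parameter \<open>Ln s / k\<close> with
  \<open>k\<^sup>2 = 2p/5\<close>.\<close>

lemma laguerre_forsyth_nonempty:
  assumes og: "ode_germ p q Z z \<gamma> e"
  shows "laguerre_forsyth (Z, z) \<noteq> {}"
proof (cases "p = 0")
  case True
  note g = ode_germD[OF og]
  have "(ball 0 e, \<lambda>_. - q) \<in> laguerre_forsyth (Z, z)"
  proof (rule laguerre_forsythI[OF open_ball connected_ball _ _ g(7) _ _ g(4,6)])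
    show "vderiv 4 \<gamma> t = (- (- q)) *s \<gamma> t" if "t \<in> ball 0 e" for t
      using const_odeD[OF g(5) that] True by simp
    show "\<gamma> ` ball 0 e \<subseteq> Z" using chart_in[OF g(3)] by blast
  qed (use g(1) in auto)
  then show ?thesis by blast
next
  case False
  note g = ode_germD[OF og]
  define k where "k = csqrt (2 * p / 5)"
  have k: "k\<^sup>2 = 2 * p / 5" "k \<noteq> 0" using False by (auto simp: k_def)
  have pk: "p = 5 / 2 * k\<^sup>2" unfolding k(1) by simp
  define l where "l s = Ln s / k" for s
  \<comment> \<open>A square root of s near 1. Since \<eta> = - 1/s, the relation c'/c = - 3/2
    \<eta> asks for c = s^(3/2), which is the cube of this root.\<close>
  define E where "E s = exp (Ln s / 2)" for s
  have cont: "continuous_on (ball 1 1) l"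
    unfolding l_def
  proof (intro continuous_on_divide continuous_on_const continuous_on_Ln)
    fix z :: complex assume "z \<in> ball 1 1"
    then have "\<bar>Re (1 - z)\<bar> < 1" using abs_Re_le_cmod[of "1 - z"] by (simp add: dist_norm)
    then show "z \<notin> \<real>\<^sub>\<le>\<^sub>0" by (auto simp: complex_nonpos_Reals_iff)
  qed (use k in auto)
  have "open (ball 1 1 \<inter> l -` ball 0 e)" by (rule continuous_open_preimage[OF cont open_ball open_ball])
  moreover have "1 \<in> ball 1 1 \<inter> l -` ball 0 e" using g(1) by (simp add: l_def)
  ultimately obtain d where d: "d > 0" "ball (1::complex) d \<subseteq> ball 1 1 \<inter> l -` ball 0 e" by (meson open_contains_ball)
  have nn: "s \<notin> \<real>\<^sub>\<le>\<^sub>0" "s \<noteq> 0" if "s \<in> ball 1 d" for s :: complex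
  proof -
    have "s \<in> ball 1 1" using that d(2) by blast
    then have "\<bar>Re (1 - s)\<bar> < 1" using abs_Re_le_cmod[of "1 - s"] by (simp add: dist_norm)
    then show "s \<notin> \<real>\<^sub>\<le>\<^sub>0" by (auto simp: complex_nonpos_Reals_iff)
    then show "s \<noteq> 0" by auto
  qed
  have E0: "E s \<noteq> 0" for s by (simp add: E_def)
  have E2: "(E s)\<^sup>2 = s" if "s \<in> ball 1 d" for s
    using nn(2)[OF that] by (simp add: E_def power2_eq_square flip: exp_add)
  have dE: "(E has_field_derivative 1 / (2 * E s)) (at s)" if "s \<in> ball 1 d" for s
  proof -
    have "(E has_field_derivative E s * (1 / s / 2)) (at s)"
      unfolding E_def by (rule derivative_eq_intros nn[OF that] refl | simp)+ (simp add: field_simps)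
    moreover have "E s * (1 / s / 2) = 1 / (2 * E s)"
      by (subst (2) E2[OF that, symmetric]) (simp add: E0 power2_eq_square)
    ultimately show ?thesis by simp
  qed
  have dl: "(l has_field_derivative 1 / (k * (E s)\<^sup>2)) (at s)" if "s \<in> ball 1 d" for s
    unfolding l_def E2[OF that] by (rule derivative_eq_intros nn[OF that] k refl | simp)+ (use k(2) in \<open>simp add: field_simps\<close>)
  have im: "l ` ball 1 d \<subseteq> ball 0 e" using d(2) by blast
  define c where "c s = (E s) ^ 3" for s
  define u where "u s = c s *s \<gamma> (l s)" for s
  have eqs: "vderiv 4 u s = (9 / 16 / (E s) ^ 5) *s \<gamma> (l s) + (- 5 / 2 / k\<^sup>2 / (E s) ^ 5) *s vderiv 2 \<gamma> (l s) +
      (1 / k ^ 4 / (E s) ^ 5) *s vderiv 4 \<gamma> (l s)" if s: "s \<in> ball 1 d" for s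
  proof -
    have dc: "(c has_field_derivative 3 / 2 * E s) (at s)" if "s \<in> ball 1 d" for s
      unfolding c_def by (rule derivative_eq_intros dE[OF that] refl)+ (simp add: E0 field_simps power2_eq_square)?
    have dc1: "((\<lambda>s. 3 / 2 * E s) has_field_derivative 3 / 4 / E s) (at s)" if "s \<in> ball 1 d" for s
      by (rule derivative_eq_intros dE[OF that] refl)+ (simp add: E0 field_simps)?
    have dc2: "((\<lambda>s. 3 / 4 / E s) has_field_derivative - 3 / 8 / (E s) ^ 3) (at s)" if "s \<in> ball 1 d" for s
      by (rule derivative_eq_intros dE[OF that] refl E0)+ (simp add: E0 field_simps power3_eq_cube)?
    have dc3: "((\<lambda>s. - 3 / 8 / (E s) ^ 3) has_field_derivative 9 / 16 / (E s) ^ 5) (at s)" if "s \<in> ball 1 d" for s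
      by (rule derivative_eq_intros dE[OF that] refl | simp add: E0)+ (simp add: E0 field_simps eval_nat_numeral)?
    have dl1: "((\<lambda>s. 1 / (k * (E s)\<^sup>2)) has_field_derivative - 1 / (k * (E s) ^ 4)) (at s)" if "s \<in> ball 1 d" for s
      by (rule derivative_eq_intros dE[OF that] refl | simp add: E0 k(2))+ (simp add: E0 k(2) field_simps eval_nat_numeral)?
    have dl2: "((\<lambda>s. - 1 / (k * (E s) ^ 4)) has_field_derivative 2 / (k * (E s) ^ 6)) (at s)" if "s \<in> ball 1 d" for s
      by (rule derivative_eq_intros dE[OF that] refl | simp add: E0 k(2))+ (simp add: E0 k(2) field_simps eval_nat_numeral)?
    have dl3: "((\<lambda>s. 2 / (k * (E s) ^ 6)) has_field_derivative - 6 / (k * (E s) ^ 8)) (at s)" if "s \<in> ball 1 d" for s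
      by (rule derivative_eq_intros dE[OF that] refl | simp add: E0 k(2))+ (simp add: E0 k(2) field_simps eval_nat_numeral)?
    note R = reparam_derivs(4)[OF g(7) open_ball im open_ball dc dc1 dc2 dc3 dl dl1 dl2 dl3 s]
    have a: "4 * (- 3 / 8 / (E s) ^ 3) * (1 / (k * (E s)\<^sup>2)) + 6 * (3 / 4 / E s) * (- 1 / (k * (E s) ^ 4)) +
      4 * (3 / 2 * E s) * (2 / (k * (E s) ^ 6)) + c s * (- 6 / (k * (E s) ^ 8)) = 0"
      unfolding c_def using E0 k(2) by (simp add: field_simps eval_nat_numeral)
    have b: "6 * (3 / 4 / E s) * (1 / (k * (E s)\<^sup>2))\<^sup>2 + 12 * (3 / 2 * E s) * (1 / (k * (E s)\<^sup>2)) * (- 1 / (k * (E s) ^ 4)) +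
      c s * (3 * (- 1 / (k * (E s) ^ 4))\<^sup>2 + 4 * (1 / (k * (E s)\<^sup>2)) * (2 / (k * (E s) ^ 6))) = - 5 / 2 / k\<^sup>2 / (E s) ^ 5"
      unfolding c_def using E0 k(2) by (simp add: field_simps eval_nat_numeral)
    have c': "4 * (3 / 2 * E s) * (1 / (k * (E s)\<^sup>2)) ^ 3 + 6 * c s * (1 / (k * (E s)\<^sup>2))\<^sup>2 * (- 1 / (k * (E s) ^ 4)) = 0"
      unfolding c_def using E0 k(2) by (simp add: field_simps eval_nat_numeral)
    have d': "c s * (1 / (k * (E s)\<^sup>2)) ^ 4 = 1 / k ^ 4 / (E s) ^ 5"
      unfolding c_def using E0 k(2) by (simp add: field_simps eval_nat_numeral)
    show ?thesis using R unfolding a b c' d' u_def[abs_def] by simp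
  qed
  have ch: "c holomorphic_on ball 1 d" "l holomorphic_on ball 1 d"
    unfolding holomorphic_on_open[OF open_ball]
    using dl DERIV_power[OF dE, of _ 3] unfolding c_def by blast+
  \<comment> \<open>This is - (q + 9 p^2/100) y^4 for y = 1/(k s); with p = 5/2 k^2 the second
    summand becomes 9/16. The base point sits at s = 1, where the logarithm vanishes.\<close>
  have "(ball 1 d, \<lambda>s. - (9 / 16 + q / k ^ 4) / s ^ 4) \<in> laguerre_forsyth (Z, z)"
  proof (rule laguerre_forsythI[of "ball 1 d" 1 _ u])
    show "vholomorphic_on u (ball 1 d)"
      unfolding u_def by (intro vholomorphic_scale vholomorphic_compose[OF g(7)] ch im)
    show "(\<lambda>s. - (9 / 16 + q / k ^ 4) / s ^ 4) holomorphic_on ball 1 d"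
      using nn by (intro holomorphic_intros) auto
    show "u ` ball 1 d \<subseteq> Z"
      using chart_in[OF g(3)] is_coneD[OF g(2)] im E0 by (auto simp: u_def c_def image_subset_iff)
    show "u 1 = z" using g(4) by (simp add: u_def c_def E_def l_def)
    have one: "1 \<in> ball (1::complex) d" using d(1) by simp
    show "1 \<in> ball (1::complex) d" by (rule one)
    have "deriv l 1 \<noteq> 0" using DERIV_imp_deriv[OF dl[OF one]] E0 k(2) by simp
    then show "nondeg u 1"
      unfolding u_def using g(6) E0
      by (intro nondeg_reparam[OF _ g(7) open_ball im open_ball ch one]) (simp_all add: l_def c_def)
    fix s :: complex assume s: "s \<in> ball 1 d"
    have ls: "l s \<in> ball 0 e" using im s by blast
    have s4: "s ^ 4 = (E s) ^ 8" using E2[OF s] by (metis power_mult num_double numeral_times_numeral mult_2 numeral_Bit0)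
    have p1: "- 5 / 2 / k\<^sup>2 / (E s) ^ 5 + 1 / k ^ 4 / (E s) ^ 5 * p = 0"
      unfolding pk using E0 k(2) by (simp add: field_simps eval_nat_numeral)
    have p2: "9 / 16 / (E s) ^ 5 + 1 / k ^ 4 / (E s) ^ 5 * q = (9 / 16 + q / k ^ 4) / s ^ 4 * (E s) ^ 3"
      unfolding s4 using E0 k(2) by (simp add: field_simps eval_nat_numeral)
    have "vderiv 4 u s = (9 / 16 / (E s) ^ 5 + 1 / k ^ 4 / (E s) ^ 5 * q) *s \<gamma> (l s) +
       (- 5 / 2 / k\<^sup>2 / (E s) ^ 5 + 1 / k ^ 4 / (E s) ^ 5 * p) *s vderiv 2 \<gamma> (l s)"
      unfolding eqs[OF s] const_odeD[OF g(5) ls] by (simp add: vec_eq_iff algebra_simps)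
    then have "vderiv 4 u s = ((9 / 16 + q / k ^ 4) / s ^ 4) *s u s"
      unfolding p1 p2 unfolding u_def c_def by simp
    moreover have "- (- (9 / 16 + q / k ^ 4) / s ^ 4) = (9 / 16 + q / k ^ 4) / s ^ 4"
      by (simp only: minus_divide_left minus_minus)
    ultimately show "vderiv 4 u s = (- (- (9 / 16 + q / k ^ 4) / s ^ 4)) *s u s" by (simp only:)
  qed simp_all
  then show ?thesis by blast
qed

section \<open>Classification\<close>

text \<open>A solution with vanishing fourth derivative is a cubic polynomial. Substituting a
  variable affine in e^(2s) and multiplying by e^(-3s) turns it into a combination of exponentials
  with exponents -3, -1, 1, 3, and (x^2 - 1)(x^2 - 9) = x^4 - 10 x^2 + 9.\<close>

lemma ode_germ_twisted_cubic:
  assumes og: "ode_germ 0 0 Z z \<delta> e"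
  shows "\<exists>\<gamma> d. ode_germ 10 (- 9) Z z \<gamma> d"
proof -
  note g = ode_germD[OF og]
  define l where "l s = (exp (2 * s) - 1) / 2" for s :: complex
  define c where "c s = exp (- 3 * s)" for s :: complex
  have lh: "l holomorphic_on UNIV" unfolding l_def by (intro holomorphic_intros) auto
  have "open (l -` ball 0 e)" using open_vimage[OF open_ball holomorphic_on_imp_continuous_on[OF lh]] .
  moreover have "0 \<in> l -` ball 0 e" using g(1) by (simp add: l_def)
  ultimately obtain d where d: "d > 0" "ball 0 d \<subseteq> l -` ball 0 e" by (meson open_contains_ball)
  have im: "l ` ball 0 d \<subseteq> ball 0 e" using d(2) by blast
  have dl: "(l has_field_derivative exp (2 * s)) (at s)" "((\<lambda>s. exp (2 * s)) has_field_derivative 2 * exp (2 * s)) (at s)"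
    "((\<lambda>s. 2 * exp (2 * s)) has_field_derivative 4 * exp (2 * s)) (at s)"
    "((\<lambda>s. 4 * exp (2 * s)) has_field_derivative 8 * exp (2 * s)) (at s)" for s
    unfolding l_def by (auto intro!: derivative_eq_intros)
  have dc: "(c has_field_derivative - 3 * c s) (at s)" "((\<lambda>s. - 3 * c s) has_field_derivative 9 * c s) (at s)"
    "((\<lambda>s. 9 * c s) has_field_derivative - 27 * c s) (at s)" "((\<lambda>s. - 27 * c s) has_field_derivative 81 * c s) (at s)" for s
    unfolding c_def by (auto intro!: derivative_eq_intros)
  let ?\<gamma> = "\<lambda>s. c s *s \<delta> (l s)"
  have ch: "c holomorphic_on ball 0 d" "l holomorphic_on ball 0 d"
    using dc(1) dl(1) unfolding holomorphic_on_open[OF open_ball] by blast+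
  have nz: "c s \<noteq> 0" "deriv l s \<noteq> 0" for s using DERIV_imp_deriv[OF dl(1)] by (simp_all add: c_def)
  have "const_ode 10 (- 9) ?\<gamma> (ball 0 d)"
    unfolding const_ode_def
  proof
    fix s :: complex assume s: "s \<in> ball 0 d"
    have ls: "l s \<in> ball 0 e" using im s by blast
    note R = reparam_derivs[OF g(7) open_ball im open_ball dc dl s]
    have d4: "vderiv 4 \<delta> (l s) = 0" using const_odeD[OF g(5) ls] by simp
    define x where "x = exp (2 * s)"
    show "vderiv 4 ?\<gamma> s = 10 *s vderiv 2 ?\<gamma> s + - 9 *s ?\<gamma> s"
      unfolding R(2) R(4) d4 x_def[symmetric]
      by (simp add: vec_eq_iff algebra_simps power2_eq_square power3_eq_cube)
  qed
  moreover have "nondeg ?\<gamma> 0"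
    by (rule nondeg_reparam[OF _ g(7) open_ball im open_ball ch _ nz]) (use g(6) d(1) in \<open>simp_all add: l_def\<close>)
  moreover have "chart Z ?\<gamma> (ball 0 d)"
    by (rule chart_reparam[OF g(3,2) open_ball ch im]) (use nz in auto)
  moreover have "?\<gamma> 0 = z" using g(4) by (simp add: c_def l_def)
  ultimately show ?thesis unfolding ode_germ_def using d(1) g(2) by blast
qed

lemma ode_germ_scale:
  assumes og: "ode_germ p q Z z \<gamma> e" and k: "k \<noteq> 0"
  shows "ode_germ (p / k\<^sup>2) (q / k ^ 4) Z z (\<lambda>s. \<gamma> (s / k)) (e * norm k)"
proof -
  note g = ode_germD[OF og]
  let ?d = "e * norm k" and ?l = "\<lambda>s. s / k"
  have im: "?l ` ball 0 ?d \<subseteq> ball 0 e" using k by (auto simp: norm_divide field_simps)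
  have c: "((\<lambda>_. 1 :: complex) has_field_derivative 0) (at s)" "((\<lambda>_. 0 :: complex) has_field_derivative 0) (at s)"
    "(?l has_field_derivative 1 / k) (at s)" "((\<lambda>_. 1 / k) has_field_derivative 0) (at s)" for s
    using k by (auto intro!: derivative_eq_intros)
  have ch: "(\<lambda>_. 1 :: complex) holomorphic_on ball 0 ?d" "?l holomorphic_on ball 0 ?d"
    using k by (auto intro!: holomorphic_intros)
  have dl: "deriv ?l s \<noteq> 0" for s using DERIV_imp_deriv[OF c(3)] k by simp
  have eq: "(\<lambda>s. \<gamma> (s / k)) = (\<lambda>s. 1 *s \<gamma> (s / k))" by simp
  have "const_ode (p / k\<^sup>2) (q / k ^ 4) (\<lambda>s. 1 *s \<gamma> (s / k)) (ball 0 ?d)"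
    unfolding const_ode_def
  proof
    fix s :: complex assume s: "s \<in> ball 0 ?d"
    have ls: "s / k \<in> ball 0 e" using im s by blast
    note R = reparam_derivs[OF g(7) open_ball im open_ball c(1) c(2) c(2) c(2) c(3) c(4) c(2) c(2) s]
    show "vderiv 4 (\<lambda>s. 1 *s \<gamma> (s / k)) s = (p / k\<^sup>2) *s vderiv 2 (\<lambda>s. 1 *s \<gamma> (s / k)) s + (q / k ^ 4) *s (1 *s \<gamma> (s / k))"
      unfolding R(2) R(4) const_odeD[OF g(5) ls]
      by (simp add: vec_eq_iff field_simps power2_eq_square power4_eq_xxxx k)
  qed
  moreover have 0: "0 \<in> ball (0::complex) ?d" using g(1) k by simp
  have "nondeg (\<lambda>s. 1 *s \<gamma> (s / k)) 0"
    by (rule nondeg_reparam[OF _ g(7) open_ball im open_ball ch 0 _ dl]) (use g(6) in simp_all)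
  moreover have "chart Z (\<lambda>s. 1 *s \<gamma> (s / k)) (ball 0 ?d)"
    by (rule chart_reparam[OF g(3,2) open_ball ch im]) (use dl in auto)
  ultimately show ?thesis unfolding eq ode_germ_def using g k by simp
qed

text \<open>A and B are the roots of x^2 - p x - q, the squares of the exponents. Rescaling the
  parameter by a square root of a nonzero one makes it 1 and the other r^2. If both are zero, the
  germ is a twisted cubic and r = 3 serves.\<close>

lemma ode_germ_normalize:
  assumes og: "ode_germ p q Z z \<gamma> e"
  shows "\<exists>r \<gamma> e. ode_germ (1 + r\<^sup>2) (- r\<^sup>2) Z z \<gamma> e"
proof -
  define A where "A = (p + csqrt (p\<^sup>2 + 4 * q)) / 2"
  define B where "B = p - A"
  have AB: "A + B = p" by (simp add: B_def)
  have "4 * (A * B) = p\<^sup>2 - (csqrt (p\<^sup>2 + 4 * q))\<^sup>2"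
    unfolding A_def B_def by (simp add: field_simps power2_eq_square)
  then have q: "q = - (A * B)" by simp
  have main: "\<exists>r \<gamma> e. ode_germ (1 + r\<^sup>2) (- r\<^sup>2) Z z \<gamma> e" if "B \<noteq> 0" "A + B = p" "q = - (A * B)" for A B
  proof -
    let ?k = "csqrt B" and ?r = "csqrt (A / B)"
    have "?k ^ 4 = (?k\<^sup>2)\<^sup>2" by (simp only: power_mult[symmetric]) simp
    then have k: "?k \<noteq> 0" "?k\<^sup>2 = B" "?k ^ 4 = B\<^sup>2" using that by auto
    have "p / ?k\<^sup>2 = 1 + ?r\<^sup>2" "q / ?k ^ 4 = - ?r\<^sup>2"
      unfolding k(2,3) power2_csqrt using that by (auto simp: field_simps power2_eq_square)
    with ode_germ_scale[OF og k(1)]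
    have "ode_germ (1 + ?r\<^sup>2) (- ?r\<^sup>2) Z z (\<lambda>s. \<gamma> (s / ?k)) (e * norm ?k)" by (simp only:)
    then show ?thesis by blast
  qed
  consider "B \<noteq> 0" | "B = 0" "A \<noteq> 0" | "A = 0" "B = 0" by blast
  then show ?thesis
  proof cases
    case 1
    then show ?thesis using main[OF _ AB q] by blast
  next
    case 2
    then show ?thesis using main[of A B] AB q by (simp add: add.commute)
  next
    case 3
    then have "p = 0" "q = 0" using AB q by auto
    then obtain \<gamma>' d where "ode_germ 10 (- 9) Z z \<gamma>' d" using ode_germ_twisted_cubic og by blast
    then have "ode_germ (1 + 3\<^sup>2) (- (3\<^sup>2)) Z z \<gamma>' d" by simp
    then show ?thesis by blast
  qed
qed

section \<open>From symmetry fields to equations with constant coefficients\<close>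

text \<open>The adjoint of u with respect to \<sigma> is - u, so the relation expressing u^4 through
  lower powers also holds with the signs of its odd terms reversed. Comparing the two on the cyclic
  vector kills the odd coefficients.\<close>

lemma symplectic_cyclic:
  assumes \<sigma>: "symplectic_form \<sigma>" and u: "\<And>v w. \<sigma> (u *v v) w + \<sigma> v (u *v w) = 0"
    and b: "basis4 b (u *v b) (u *v (u *v b)) (u *v (u *v (u *v b)))"
  shows "\<exists>p q. \<forall>v. u *v (u *v (u *v (u *v v))) = p *s (u *v (u *v v)) + q *s v"
proof -
  note a\<sigma> = symplectic_alternating[OF \<sigma>]
  note D = alternating_formD[OF a\<sigma>]
  note L = matrix_vector_right_distrib vector_scalar_commute
  have mv: "\<sigma> (u *v v) w = - \<sigma> v (u *v w)" for v w using u by (simp add: eq_neg_iff_add_eq_0)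
  obtain a0 a1 a2 a3 where a: "u *v (u *v (u *v (u *v b))) = a0 *s b + a1 *s (u *v b) + a2 *s (u *v (u *v b)) + a3 *s (u *v (u *v (u *v b)))"
    using basis4_span[OF b] .
  have ch: "u *v (u *v (u *v (u *v v))) = a0 *s v + a1 *s (u *v v) + a2 *s (u *v (u *v v)) + a3 *s (u *v (u *v (u *v v)))" for v
  proof -
    obtain k0 k1 k2 k3 where v: "v = k0 *s b + k1 *s (u *v b) + k2 *s (u *v (u *v b)) + k3 *s (u *v (u *v (u *v b)))"
      using basis4_span[OF b] .
    show ?thesis unfolding v L a by (simp add: vec_eq_iff algebra_simps)
  qed
  \<comment> \<open>The relation for u moved to the other argument of \<sigma>, where each power of
    u picks up its sign; nondegeneracy removes the form.\<close>
  have ch': "u *v (u *v (u *v (u *v w))) - a0 *s w + a1 *s (u *v w) - a2 *s (u *v (u *v w)) + a3 *s (u *v (u *v (u *v w))) = 0" (is "?x = 0") for w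
  proof -
    have "\<sigma> v ?x = 0" for v
    proof -
      have "\<sigma> (u *v (u *v (u *v (u *v v)))) w = a0 * \<sigma> v w + a1 * \<sigma> (u *v v) w + a2 * \<sigma> (u *v (u *v v)) w + a3 * \<sigma> (u *v (u *v (u *v v))) w"
        unfolding ch[of v] D ..
      then have e: "\<sigma> v (u *v (u *v (u *v (u *v w)))) = a0 * \<sigma> v w - a1 * \<sigma> v (u *v w) + a2 * \<sigma> v (u *v (u *v w)) - a3 * \<sigma> v (u *v (u *v (u *v w)))"
        unfolding mv by simp
      have x: "?x = u *v (u *v (u *v (u *v w))) + (- a0) *s w + a1 *s (u *v w) + (- a2) *s (u *v (u *v w)) + a3 *s (u *v (u *v (u *v w)))"
        by (simp add: vec_eq_iff)
      show ?thesis unfolding x D e by simp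
    qed
    then have "\<sigma> ?x v = 0" for v using alternating_form_antisym[OF a\<sigma>, of v ?x] by simp
    then show "?x = 0" using \<sigma> unfolding symplectic_form_def by blast
  qed
  have "0 *s b + (2 * a1) *s (u *v b) + 0 *s (u *v (u *v b)) + (2 * a3) *s (u *v (u *v (u *v b))) = 0"
    using ch'[of b] unfolding a by (simp add: vec_eq_iff algebra_simps)
  then have "2 * a1 = 0 \<and> 2 * a3 = 0" using b unfolding basis4_def by blast
  then have "u *v (u *v (u *v (u *v v))) = a2 *s (u *v (u *v v)) + a0 *s v" for v
    using ch[of v] by (simp add: vec_eq_iff)
  then show ?thesis by blast
qed

lemma holomorphic_local_inverse:
  assumes G: "G holomorphic_on ball 0 e" and e: "e > 0" and G0: "G 0 = 0" and dG: "deriv G 0 \<noteq> 0"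
  shows "\<exists>d l. d > 0 \<and> l holomorphic_on ball 0 d \<and> l ` ball 0 d \<subseteq> ball 0 e \<and> l 0 = 0 \<and>
    (\<forall>s\<in>ball 0 d. G (l s) = s \<and> deriv G (l s) * deriv l s = 1)"
proof -
  have 0: "0 \<in> ball (0::complex) e" using e by simp
  obtain r where r: "r > 0" "ball (0::complex) r \<subseteq> ball 0 e" "inj_on G (ball 0 r)"
    by (rule has_complex_derivative_locally_injective[OF G 0 open_ball dG])
  have Gr: "G holomorphic_on ball 0 r" using G r(2) holomorphic_on_subset by blast
  obtain l where l: "l holomorphic_on (G ` ball 0 r)" "\<And>z. z \<in> ball 0 r \<Longrightarrow> deriv G z * deriv l (G z) = 1"
    "\<And>z. z \<in> ball 0 r \<Longrightarrow> l (G z) = z"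
    using holomorphic_has_inverse[OF Gr open_ball r(3)] by metis
  have "open (G ` ball 0 r)" using open_mapping_thm3[OF Gr open_ball r(3)] .
  moreover have "0 \<in> G ` ball 0 r" using G0 r(1) by (metis centre_in_ball imageI)
  ultimately obtain d where d: "d > 0" "ball 0 d \<subseteq> G ` ball 0 r" by (meson open_contains_ball)
  have "G (l s) = s \<and> deriv G (l s) * deriv l s = 1 \<and> l s \<in> ball 0 e" if s: "s \<in> ball 0 d" for s
  proof -
    obtain z where z: "z \<in> ball 0 r" "s = G z" using s d(2) by blast
    show ?thesis unfolding z(2) l(3)[OF z(1)] using l(2)[OF z(1)] z(1) r(2) by auto
  qed
  moreover have "l 0 = 0" using l(3)[of 0] G0 r(1) by simp
  moreover have "l holomorphic_on ball 0 d" using l(1) d(2) holomorphic_on_subset by blast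
  ultimately show ?thesis using d(1) by blast
qed

lemma holomorphic_primitive:
  assumes "f holomorphic_on ball (0::complex) e"
  shows "\<exists>F. F 0 = 0 \<and> (\<forall>t\<in>ball 0 e. (F has_field_derivative f t) (at t))"
proof -
  obtain F where F: "\<And>t. t \<in> ball 0 e \<Longrightarrow> (F has_field_derivative f t) (at t within ball 0 e)"
    using holomorphic_convex_primitive'[OF convex_ball open_ball assms] by blast
  have "((\<lambda>t. F t - F 0) has_field_derivative f t) (at t)" if "t \<in> ball 0 e" for t
    using F[OF that] that at_within_open[OF that open_ball] by (auto intro!: derivative_eq_intros)
  then show ?thesis by (intro exI[of _ "\<lambda>t. F t - F 0"]) auto
qed

text \<open>Where the vector field does not vanish, rescaling and reparametrizing along its flow turns the
  curve into an orbit \<open>\<delta>' = u \<delta>\<close>.\<close>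

lemma regular_point_ode_germ:
  assumes \<sigma>: "symplectic_form \<sigma>" and u: "\<And>v w. \<sigma> (u *v v) w + \<sigma> v (u *v w) = 0"
    and cone: "is_cone Z" and ch: "chart Z \<gamma> (ball 0 e)" and e: "e > 0" and nd: "nondeg \<gamma> 0"
    and f: "f holomorphic_on ball 0 e" and g: "g holomorphic_on ball 0 e"
    and eq: "\<forall>t\<in>ball 0 e. u *v \<gamma> t = f t *s \<gamma> t + g t *s vderiv 1 \<gamma> t" and g0: "g 0 \<noteq> 0"
  shows "\<exists>p q \<delta> d. ode_germ p q Z (\<gamma> 0) \<delta> d"
proof -
  note hol = chartD(2)[OF ch]
  have "open {t\<in>ball 0 e. g t \<noteq> 0}" using open_nonzero[OF holomorphic_on_imp_continuous_on[OF g] open_ball] .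
  moreover have "0 \<in> {t\<in>ball 0 e. g t \<noteq> 0}" using g0 e by simp
  ultimately obtain e1 where e1: "e1 > 0" "ball (0::complex) e1 \<subseteq> {t\<in>ball 0 e. g t \<noteq> 0}" by (meson open_contains_ball)
  have gn: "g t \<noteq> 0" "t \<in> ball 0 e" if "t \<in> ball 0 e1" for t using that e1(2) by auto
  have fg1: "f holomorphic_on ball 0 e1" "g holomorphic_on ball 0 e1"
    using f g gn(2) holomorphic_on_subset by blast+
  have hq: "(\<lambda>t. 1 / g t) holomorphic_on ball 0 e1" "(\<lambda>t. f t / g t) holomorphic_on ball 0 e1"
    by (intro holomorphic_intros fg1 gn(1), assumption)+
  \<comment> \<open>G is the time along the flow of g d/dt: its inverse l satisfies l' = g(l).
    Likewise F, composed with l and exponentiated, gives the factor c with c' = f(l) c, and these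
    two rates combine to u applied to c \<gamma>(l).\<close>
  obtain G where G: "G 0 = 0" "\<forall>t\<in>ball 0 e1. (G has_field_derivative 1 / g t) (at t)"
    using holomorphic_primitive[OF hq(1)] by blast
  obtain F where F: "F 0 = 0" "\<forall>t\<in>ball 0 e1. (F has_field_derivative f t / g t) (at t)"
    using holomorphic_primitive[OF hq(2)] by blast
  have Gh: "G holomorphic_on ball 0 e1" "F holomorphic_on ball 0 e1"
    using G(2) F(2) unfolding holomorphic_on_open[OF open_ball] by blast+
  have dG: "deriv G t = 1 / g t" if "t \<in> ball 0 e1" for t using G(2) that DERIV_imp_deriv by blast
  have "deriv G 0 \<noteq> 0" using dG[of 0] gn[of 0] e1(1) by simp
  then obtain d l where l: "d > 0" "l holomorphic_on ball 0 d" "l ` ball 0 d \<subseteq> ball 0 e1" "l 0 = 0"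
    "\<forall>s\<in>ball 0 d. G (l s) = s \<and> deriv G (l s) * deriv l s = 1"
    using holomorphic_local_inverse[OF Gh(1) e1(1) G(1)] by blast
  have lin: "l s \<in> ball 0 e1" "l s \<in> ball 0 e" if "s \<in> ball 0 d" for s using l(3) gn(2) that by blast+
  have dl: "deriv l s = g (l s)" if "s \<in> ball 0 d" for s
    using l(5)[rule_format, OF that] dG[OF lin(1)[OF that]] gn(1)[OF lin(1)[OF that]] by (simp add: field_simps)
  have Dl: "(l has_field_derivative g (l s)) (at s)" if "s \<in> ball 0 d" for s
    using holomorphic_derivI[OF l(2) open_ball that] dl[OF that] by simp
  define c where "c s = exp (F (l s))" for s
  have Dc: "(c has_field_derivative f (l s) * c s) (at s)" if "s \<in> ball 0 d" for s
  proof -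
    have "((\<lambda>s. F (l s)) has_field_derivative f (l s) / g (l s) * g (l s)) (at s)"
      using DERIV_chain2[OF F(2)[rule_format, OF lin(1)[OF that]] Dl[OF that]] .
    then show ?thesis
      unfolding c_def using gn(1)[OF lin(1)[OF that]] by (auto intro!: derivative_eq_intros)
  qed
  have chol: "c holomorphic_on ball 0 d" unfolding holomorphic_on_open[OF open_ball] using Dc by blast
  have im: "l ` ball 0 d \<subseteq> ball 0 e" using lin by blast
  let ?\<delta> = "\<lambda>s. c s *s \<gamma> (l s)"
  have 0: "0 \<in> ball (0::complex) d" using l(1) by simp
  have cn: "c s \<noteq> 0" for s by (simp add: c_def)
  have dln: "deriv l s \<noteq> 0" if "s \<in> ball 0 d" for s using dl[OF that] gn(1)[OF lin(1)[OF that]] by simp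
  have chart: "chart Z ?\<delta> (ball 0 d)"
    by (rule chart_reparam[OF ch cone open_ball chol l(2) im]) (use cn dln in auto)
  have nd': "nondeg ?\<delta> 0"
    by (rule nondeg_reparam[OF _ hol open_ball im open_ball chol l(2) 0 cn dln[OF 0]]) (use nd l(4) in simp)
  have D\<delta>: "has_vderiv ?\<delta> (u *v ?\<delta> s) s" if s: "s \<in> ball 0 d" for s
  proof -
    have "has_vderiv ?\<delta> ((f (l s) * c s) *s \<gamma> (l s) + (c s * g (l s)) *s vderiv 1 \<gamma> (l s)) s"
      using reparam_step[OF hol open_ball lin(2)[OF s] Dc[OF s] Dl[OF s], of 0] by simp
    moreover have "(f (l s) * c s) *s \<gamma> (l s) + (c s * g (l s)) *s vderiv 1 \<gamma> (l s) = u *v ?\<delta> s"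
      unfolding vector_scalar_commute eq[rule_format, OF lin(2)[OF s]] by (simp add: vec_eq_iff algebra_simps)
    ultimately show ?thesis by (simp only:)
  qed
  have V: "vderiv k ?\<delta> s = mat_pow u k *v ?\<delta> s" if "s \<in> ball 0 d" for k s
    using that
  proof (induction k arbitrary: s)
    case (Suc k)
    have "mat_pow u k *v (u *v x) = mat_pow u (Suc k) *v x" for x
      by (simp add: matrix_vector_mul_assoc mat_pow_commute)
    then show ?case
      using vderiv_Suc_eq[OF open_ball Suc.prems Suc.IH has_vderiv_matrix[OF D\<delta>[OF Suc.prems]]] by simp
  qed simp
  have "basis4 (?\<delta> 0) (u *v ?\<delta> 0) (u *v (u *v ?\<delta> 0)) (u *v (u *v (u *v ?\<delta> 0)))"
    using nd' unfolding nondeg_def V[OF 0] mat_pow_vec .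
  then obtain p q where pq: "\<forall>v. u *v (u *v (u *v (u *v v))) = p *s (u *v (u *v v)) + q *s v"
    using symplectic_cyclic[OF \<sigma> u] by blast
  have "const_ode p q ?\<delta> (ball 0 d)"
    unfolding const_ode_def using V pq by (simp add: mat_pow_vec)
  moreover have "?\<delta> 0 = \<gamma> 0" by (simp add: c_def l(4) F(1))
  ultimately have "ode_germ p q Z (\<gamma> 0) ?\<delta> d"
    unfolding ode_germ_def using l(1) cone chart nd' by blast
  then show ?thesis by blast
qed

text \<open>Immersivity makes s a local parameter. In this parameter, and after removing the factor
  y, the curve is a cubic polynomial, whose fourth derivative vanishes.\<close>

lemma cubic_ode_germ:
  assumes cone: "is_cone Z" and ch: "chart Z \<gamma> (ball 0 e)" and e: "e > 0" and nd: "nondeg \<gamma> 0"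
    and y: "y holomorphic_on ball 0 e" "y 0 \<noteq> 0" and s: "s holomorphic_on ball 0 e" "s 0 = 0"
    and eq: "\<forall>t\<in>ball 0 e. \<gamma> t = y t *s (q0 + s t *s q1 + (s t)\<^sup>2 *s q2 + (s t) ^ 3 *s q3)"
  shows "\<exists>\<delta> d. ode_germ 0 0 Z (\<gamma> 0) \<delta> d"
proof -
  note hol = chartD(2)[OF ch]
  have 0: "0 \<in> ball (0::complex) e" using e by simp
  define Q where "Q x = q0 + x *s q1 + x\<^sup>2 *s q2 + x ^ 3 *s q3" for x
  define Q1 where "Q1 x = q1 + (2 * x) *s q2 + (3 * x\<^sup>2) *s q3" for x
  define Q2 where "Q2 x = 2 *s q2 + (6 * x) *s q3" for x
  have dQ: "has_vderiv Q (Q1 x) x" "has_vderiv Q1 (Q2 x) x" "has_vderiv Q2 (6 *s q3) x" "has_vderiv (\<lambda>_. 6 *s q3) 0 x" for x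
    unfolding has_vderiv_def Q_def Q1_def Q2_def by (auto intro!: derivative_eq_intros)
  have \<gamma>Q: "\<gamma> t = y t *s Q (s t)" if "t \<in> ball 0 e" for t using eq that by (simp add: Q_def)
  have ds: "deriv s 0 \<noteq> 0"
  proof
    assume z: "deriv s 0 = 0"
    have "has_vderiv (\<lambda>t. y t *s Q (s t)) (deriv y 0 *s Q (s 0) + y 0 *s (deriv s 0 *s Q1 (s 0))) 0"
      by (intro has_vderiv_scale has_vderiv_compose dQ holomorphic_derivI[OF y(1) open_ball 0] holomorphic_derivI[OF s(1) open_ball 0])
    from has_vderiv_transform[OF this open_ball 0 \<gamma>Q] have "vderiv 1 \<gamma> 0 = deriv y 0 *s Q 0"
      using vderiv_1_eq s(2) z by fastforce
    then have "(deriv y 0 / y 0) *s \<gamma> 0 + (- 1) *s vderiv 1 \<gamma> 0 = 0"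
      using \<gamma>Q[OF 0] s(2) y(2) by (simp add: vec_eq_iff)
    then show False using nondeg_lin_indep2[OF nd] unfolding lin_indep2_def by (metis neg_equal_0_iff_equal zero_neq_one)
  qed
  have "open {t\<in>ball 0 e. y t \<noteq> 0}" using open_nonzero[OF holomorphic_on_imp_continuous_on[OF y(1)] open_ball] .
  moreover have "0 \<in> {t\<in>ball 0 e. y t \<noteq> 0}" using y(2) e by simp
  ultimately obtain e1 where e1: "e1 > 0" "ball (0::complex) e1 \<subseteq> {t\<in>ball 0 e. y t \<noteq> 0}" by (meson open_contains_ball)
  have sub: "ball (0::complex) e1 \<subseteq> ball 0 e" using e1(2) by blast
  have s1: "s holomorphic_on ball 0 e1" using s(1) sub holomorphic_on_subset by blast
  obtain d l where l: "d > 0" "l holomorphic_on ball 0 d" "l ` ball 0 d \<subseteq> ball 0 e1" "l 0 = 0"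
    "\<forall>x\<in>ball 0 d. s (l x) = x \<and> deriv s (l x) * deriv l x = 1"
    using holomorphic_local_inverse[OF s1 e1(1) s(2) ds] by blast
  have im: "l ` ball 0 d \<subseteq> ball 0 e" using l(3) sub by blast
  have yn: "y (l x) \<noteq> 0" "l x \<in> ball 0 e" if "x \<in> ball 0 d" for x using l(3) e1(2) that by blast+
  \<comment> \<open>Dividing by y and multiplying back by its value at 0 keeps the base vector
    itself and not merely its line.\<close>
  define c where "c x = y 0 / y (l x)" for x
  have chol: "c holomorphic_on ball 0 d"
    unfolding c_def using yn holomorphic_on_compose_gen[OF l(2) y(1) im] by (intro holomorphic_intros) (auto simp: o_def)
  have cn: "c x \<noteq> 0" "deriv l x \<noteq> 0" if "x \<in> ball 0 d" for x
    using yn[OF that] y(2) l(5) that unfolding c_def by (simp, metis mult_zero_right zero_neq_one)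
  let ?\<delta> = "\<lambda>x. c x *s \<gamma> (l x)"
  have \<delta>: "?\<delta> x = y 0 *s Q x" if "x \<in> ball 0 d" for x
    using \<gamma>Q[OF yn(2)[OF that]] l(5) that yn(1)[OF that] unfolding c_def by simp
  have 0: "0 \<in> ball (0::complex) d" using l(1) by simp
  have V1: "vderiv (Suc 0) ?\<delta> x = y 0 *s Q1 x" if "x \<in> ball 0 d" for x
    by (rule vderiv_Suc_eq[OF open_ball that, of 0 _ "\<lambda>x. y 0 *s Q x"]) (use \<delta> in \<open>auto intro!: has_vderiv_cmult dQ\<close>)
  have V2: "vderiv (Suc (Suc 0)) ?\<delta> x = y 0 *s Q2 x" if "x \<in> ball 0 d" for x
    by (rule vderiv_Suc_eq[OF open_ball that V1 has_vderiv_cmult[OF dQ(2)]])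
  have V3: "vderiv (Suc (Suc (Suc 0))) ?\<delta> x = y 0 *s (6 *s q3)" if "x \<in> ball 0 d" for x
    by (rule vderiv_Suc_eq[OF open_ball that V2 has_vderiv_cmult[OF dQ(3)]])
  have V4: "vderiv (Suc (Suc (Suc (Suc 0)))) ?\<delta> x = y 0 *s 0" if "x \<in> ball 0 d" for x
    by (rule vderiv_Suc_eq[OF open_ball that V3 has_vderiv_cmult[OF dQ(4)]])
  have "const_ode 0 0 ?\<delta> (ball 0 d)"
    unfolding const_ode_def using V4 by (simp add: eval_nat_numeral)
  moreover have "nondeg ?\<delta> 0"
    by (rule nondeg_reparam[OF _ hol open_ball im open_ball chol l(2) 0 cn[OF 0]]) (use nd l(4) in simp)
  moreover have "chart Z ?\<delta> (ball 0 d)"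
    by (rule chart_reparam[OF ch cone open_ball chol l(2) im]) (use cn in auto)
  moreover have "?\<delta> 0 = \<gamma> 0" using y(2) by (simp add: c_def l(4))
  ultimately have "ode_germ 0 0 Z (\<gamma> 0) ?\<delta> d" unfolding ode_germ_def using l(1) cone by blast
  then show ?thesis by blast
qed

section \<open>Zeros of the symmetry field\<close>

text \<open>As u is constant, it commutes with differentiation. At a zero of g these formulas show
  that u is triangular in the osculating frame, with diagonal entries f + k g' for k = 0, 1, 2,
  3.\<close>

lemma field_on_jets:
  assumes hol: "vholomorphic_on \<gamma> T" and T: "open T" and f: "f holomorphic_on T" and g: "g holomorphic_on T"
    and eq: "\<forall>t\<in>T. u *v \<gamma> t = f t *s \<gamma> t + g t *s vderiv 1 \<gamma> t" and t: "t \<in> T"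
  shows "u *v vderiv 1 \<gamma> t = (deriv ^^ 1) f t *s \<gamma> t + (f t + (deriv ^^ 1) g t) *s vderiv 1 \<gamma> t + g t *s vderiv 2 \<gamma> t"
    "u *v vderiv 2 \<gamma> t = (deriv ^^ 2) f t *s \<gamma> t + (2 * (deriv ^^ 1) f t + (deriv ^^ 2) g t) *s vderiv 1 \<gamma> t +
       (f t + 2 * (deriv ^^ 1) g t) *s vderiv 2 \<gamma> t + g t *s vderiv 3 \<gamma> t"
    "u *v vderiv 3 \<gamma> t = (deriv ^^ 3) f t *s \<gamma> t + (3 * (deriv ^^ 2) f t + (deriv ^^ 3) g t) *s vderiv 1 \<gamma> t +
       (3 * (deriv ^^ 1) f t + 3 * (deriv ^^ 2) g t) *s vderiv 2 \<gamma> t + (f t + 3 * (deriv ^^ 1) g t) *s vderiv 3 \<gamma> t + g t *s vderiv 4 \<gamma> t"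
proof -
  note Df = holomorphic_DERIVs[OF f T] note Dg = holomorphic_DERIVs[OF g T]
  have V: "has_vderiv \<gamma> (vderiv 1 \<gamma> t) t" "has_vderiv (vderiv 1 \<gamma>) (vderiv 2 \<gamma> t) t"
    "has_vderiv (vderiv 2 \<gamma>) (vderiv 3 \<gamma> t) t" "has_vderiv (vderiv 3 \<gamma>) (vderiv 4 \<gamma> t) t" if "t \<in> T" for t
    using has_vderiv_vderiv[OF hol T that, of 0] has_vderiv_vderiv[OF hol T that, of 1]
      has_vderiv_vderiv[OF hol T that, of 2] has_vderiv_vderiv[OF hol T that, of 3] by (simp_all add: eval_nat_numeral)
  have step: "w = w'" if "t \<in> T" "\<And>s. s \<in> T \<Longrightarrow> u *v \<alpha> s = \<beta> s" "has_vderiv \<alpha> a t" "has_vderiv \<beta> w' t" "u *v a = w" for \<alpha> \<beta> a w w' t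
    using has_vderiv_unique[OF has_vderiv_matrix[OF that(3)] has_vderiv_transform[OF that(4) T that(1,2)]] that(5) by simp
  have 1: "u *v vderiv 1 \<gamma> t = (deriv ^^ 1) f t *s \<gamma> t + (f t + (deriv ^^ 1) g t) *s vderiv 1 \<gamma> t + g t *s vderiv 2 \<gamma> t" if "t \<in> T" for t
  proof (rule step[OF that eq[rule_format] V(1)[OF that] _ refl])
    have "has_vderiv (\<lambda>s. f s *s \<gamma> s + g s *s vderiv 1 \<gamma> s)
       (((deriv ^^ 1) f t *s \<gamma> t + f t *s vderiv 1 \<gamma> t) + ((deriv ^^ 1) g t *s vderiv 1 \<gamma> t + g t *s vderiv 2 \<gamma> t)) t"
      by (intro has_vderiv_add has_vderiv_scale Df Dg V that)
    then show "has_vderiv (\<lambda>s. f s *s \<gamma> s + g s *s vderiv 1 \<gamma> s)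
       ((deriv ^^ 1) f t *s \<gamma> t + (f t + (deriv ^^ 1) g t) *s vderiv 1 \<gamma> t + g t *s vderiv 2 \<gamma> t) t"
      by (rule back_subst[of "\<lambda>x. has_vderiv _ x t"]) (simp add: vec_eq_iff algebra_simps)
  qed
  have 2: "u *v vderiv 2 \<gamma> t = (deriv ^^ 2) f t *s \<gamma> t + (2 * (deriv ^^ 1) f t + (deriv ^^ 2) g t) *s vderiv 1 \<gamma> t +
       (f t + 2 * (deriv ^^ 1) g t) *s vderiv 2 \<gamma> t + g t *s vderiv 3 \<gamma> t" if "t \<in> T" for t
  proof (rule step[OF that 1 V(2)[OF that] _ refl], assumption)
    have "has_vderiv (\<lambda>t. (deriv ^^ 1) f t *s \<gamma> t + (f t + (deriv ^^ 1) g t) *s vderiv 1 \<gamma> t + g t *s vderiv 2 \<gamma> t)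
       (((deriv ^^ 2) f t *s \<gamma> t + (deriv ^^ 1) f t *s vderiv 1 \<gamma> t) +
        (((deriv ^^ 1) f t + (deriv ^^ 2) g t) *s vderiv 1 \<gamma> t + (f t + (deriv ^^ 1) g t) *s vderiv 2 \<gamma> t) +
        ((deriv ^^ 1) g t *s vderiv 2 \<gamma> t + g t *s vderiv 3 \<gamma> t)) t"
      by (intro has_vderiv_add has_vderiv_scale DERIV_add Df Dg V that)
    then show "has_vderiv (\<lambda>t. (deriv ^^ 1) f t *s \<gamma> t + (f t + (deriv ^^ 1) g t) *s vderiv 1 \<gamma> t + g t *s vderiv 2 \<gamma> t)
       ((deriv ^^ 2) f t *s \<gamma> t + (2 * (deriv ^^ 1) f t + (deriv ^^ 2) g t) *s vderiv 1 \<gamma> t +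
       (f t + 2 * (deriv ^^ 1) g t) *s vderiv 2 \<gamma> t + g t *s vderiv 3 \<gamma> t) t"
      by (rule back_subst[of "\<lambda>x. has_vderiv _ x t"]) (simp add: vec_eq_iff algebra_simps del: funpow.simps)
  qed
  have 3: "u *v vderiv 3 \<gamma> t = (deriv ^^ 3) f t *s \<gamma> t + (3 * (deriv ^^ 2) f t + (deriv ^^ 3) g t) *s vderiv 1 \<gamma> t +
       (3 * (deriv ^^ 1) f t + 3 * (deriv ^^ 2) g t) *s vderiv 2 \<gamma> t + (f t + 3 * (deriv ^^ 1) g t) *s vderiv 3 \<gamma> t + g t *s vderiv 4 \<gamma> t"
    if "t \<in> T" for t
  proof (rule step[OF that 2 V(3)[OF that] _ refl], assumption)
    have "has_vderiv (\<lambda>t. (deriv ^^ 2) f t *s \<gamma> t + (2 * (deriv ^^ 1) f t + (deriv ^^ 2) g t) *s vderiv 1 \<gamma> t +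
       (f t + 2 * (deriv ^^ 1) g t) *s vderiv 2 \<gamma> t + g t *s vderiv 3 \<gamma> t)
       (((deriv ^^ 3) f t *s \<gamma> t + (deriv ^^ 2) f t *s vderiv 1 \<gamma> t) +
        ((2 * (deriv ^^ 2) f t + (deriv ^^ 3) g t) *s vderiv 1 \<gamma> t + (2 * (deriv ^^ 1) f t + (deriv ^^ 2) g t) *s vderiv 2 \<gamma> t) +
        (((deriv ^^ 1) f t + 2 * (deriv ^^ 2) g t) *s vderiv 2 \<gamma> t + (f t + 2 * (deriv ^^ 1) g t) *s vderiv 3 \<gamma> t) +
        ((deriv ^^ 1) g t *s vderiv 3 \<gamma> t + g t *s vderiv 4 \<gamma> t)) t"
      by (intro has_vderiv_add has_vderiv_scale DERIV_add DERIV_cmult Df Dg V that)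
    then show "has_vderiv (\<lambda>t. (deriv ^^ 2) f t *s \<gamma> t + (2 * (deriv ^^ 1) f t + (deriv ^^ 2) g t) *s vderiv 1 \<gamma> t +
       (f t + 2 * (deriv ^^ 1) g t) *s vderiv 2 \<gamma> t + g t *s vderiv 3 \<gamma> t)
       ((deriv ^^ 3) f t *s \<gamma> t + (3 * (deriv ^^ 2) f t + (deriv ^^ 3) g t) *s vderiv 1 \<gamma> t +
       (3 * (deriv ^^ 1) f t + 3 * (deriv ^^ 2) g t) *s vderiv 2 \<gamma> t + (f t + 3 * (deriv ^^ 1) g t) *s vderiv 3 \<gamma> t + g t *s vderiv 4 \<gamma> t) t"
      by (rule back_subst[of "\<lambda>x. has_vderiv _ x t"]) (simp add: vec_eq_iff algebra_simps del: funpow.simps)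
  qed
  show "u *v vderiv 1 \<gamma> t = (deriv ^^ 1) f t *s \<gamma> t + (f t + (deriv ^^ 1) g t) *s vderiv 1 \<gamma> t + g t *s vderiv 2 \<gamma> t"
    "u *v vderiv 2 \<gamma> t = (deriv ^^ 2) f t *s \<gamma> t + (2 * (deriv ^^ 1) f t + (deriv ^^ 2) g t) *s vderiv 1 \<gamma> t +
       (f t + 2 * (deriv ^^ 1) g t) *s vderiv 2 \<gamma> t + g t *s vderiv 3 \<gamma> t"
    "u *v vderiv 3 \<gamma> t = (deriv ^^ 3) f t *s \<gamma> t + (3 * (deriv ^^ 2) f t + (deriv ^^ 3) g t) *s vderiv 1 \<gamma> t +
       (3 * (deriv ^^ 1) f t + 3 * (deriv ^^ 2) g t) *s vderiv 2 \<gamma> t + (f t + 3 * (deriv ^^ 1) g t) *s vderiv 3 \<gamma> t + g t *s vderiv 4 \<gamma> t"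
    using 1[OF t] 2[OF t] 3[OF t] by blast+
qed

text \<open>The operator u - a as a map of vectors, so that products of such factors are
  compositions that can be reordered by \<open>shift_commute\<close>.\<close>

definition shift :: "cmat \<Rightarrow> complex \<Rightarrow> cvec \<Rightarrow> cvec" where
  "shift u a v = u *v v - a *s v"

lemma shift_linear: "shift u a (v + w) = shift u a v + shift u a w" "shift u a (c *s v) = c *s shift u a v"
  by (simp_all add: shift_def matrix_vector_right_distrib vector_scalar_commute vec_eq_iff algebra_simps)

lemma shift_commute: "shift u a (shift u b v) = shift u b (shift u a v)"
  by (simp add: shift_def matrix_vector_mult_diff_distrib vector_scalar_commute vec_eq_iff algebra_simps)

lemma shift_zero [simp]: "shift u a 0 = 0" by (simp add: shift_def)

text \<open>Cayley-Hamilton for a triangular matrix: each factor moves one step down the flag, and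
  the factors commute.\<close>

lemma flag_annihilated:
  assumes b: "basis4 e0 e1 e2 e3"
    and u: "u *v e0 = a0 *s e0" "u *v e1 = b0 *s e0 + a1 *s e1" "u *v e2 = c0 *s e0 + c1 *s e1 + a2 *s e2"
      "u *v e3 = d0 *s e0 + d1 *s e1 + d2 *s e2 + a3 *s e3"
  shows "shift u a0 (shift u a1 (shift u a2 (shift u a3 v))) = 0"
proof -
  have z0: "shift u a0 e0 = 0" unfolding shift_def u by (simp add: vec_eq_iff)
  have z1: "shift u a1 e1 = b0 *s e0" unfolding shift_def u by (simp add: vec_eq_iff)
  have z2: "shift u a2 e2 = c0 *s e0 + c1 *s e1" unfolding shift_def u by (simp add: vec_eq_iff)
  have z3: "shift u a3 e3 = d0 *s e0 + d1 *s e1 + d2 *s e2" unfolding shift_def u by (simp add: vec_eq_iff)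
  have y1: "shift u a0 (shift u a1 e0) = 0" "shift u a0 (shift u a1 e1) = 0"
    unfolding shift_commute[of u a0 a1] z0 by (simp_all add: shift_commute[of u a1 a0] z1 shift_linear z0)
  have y0: "shift u a0 (shift u a1 (shift u a e0)) = 0" "shift u a0 (shift u a1 (shift u a e1)) = 0" for a
    using y1 by (metis shift_commute shift_zero)+
  have y2: "shift u a0 (shift u a1 (shift u a2 e2)) = 0" unfolding z2 shift_linear y1 by simp
  have x2: "shift u a0 (shift u a1 (shift u a2 (shift u a3 e2))) = 0" using y2 by (metis shift_commute shift_zero)
  have x0: "shift u a0 (shift u a1 (shift u a2 (shift u a3 e0))) = 0" "shift u a0 (shift u a1 (shift u a2 (shift u a3 e1))) = 0"
    using y0 by (metis shift_commute shift_zero)+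
  have x3: "shift u a0 (shift u a1 (shift u a2 (shift u a3 e3))) = 0" unfolding z3 shift_linear y0 y2 by simp
  obtain k0 k1 k2 k3 where v: "v = k0 *s e0 + k1 *s e1 + k2 *s e2 + k3 *s e3" using basis4_span[OF b] .
  show ?thesis unfolding v shift_linear x0 x2 x3 by simp
qed

text \<open>Where the field does not vanish, \<open>\<gamma>\<close> is a cyclic vector.\<close>

lemma cyclic_shift_nonzero:
  assumes hol: "vholomorphic_on \<gamma> T" and T: "open T" and f: "f holomorphic_on T" and g: "g holomorphic_on T"
    and eq: "\<forall>t\<in>T. u *v \<gamma> t = f t *s \<gamma> t + g t *s vderiv 1 \<gamma> t" and t: "t \<in> T" and nd: "nondeg \<gamma> t" and g0: "g t \<noteq> 0"
  shows "shift u a (shift u b (shift u c (\<gamma> t))) \<noteq> 0"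
proof -
  note J = field_on_jets[OF hol T f g eq t]
  define f1 f2 g1 g2 where defs: "f1 = (deriv ^^ 1) f t" "f2 = (deriv ^^ 2) f t" "g1 = (deriv ^^ 1) g t" "g2 = (deriv ^^ 2) g t"
  have s0: "shift u k (\<gamma> t) = (f t - k) *s \<gamma> t + g t *s vderiv 1 \<gamma> t" for k
    unfolding shift_def eq[rule_format, OF t] by (simp add: vec_eq_iff algebra_simps)
  have s1: "shift u k (vderiv 1 \<gamma> t) = f1 *s \<gamma> t + (f t + g1 - k) *s vderiv 1 \<gamma> t + g t *s vderiv 2 \<gamma> t" for k
    unfolding shift_def J(1) defs[symmetric] by (simp add: vec_eq_iff algebra_simps)
  have s2: "shift u k (vderiv 2 \<gamma> t) = f2 *s \<gamma> t + (2 * f1 + g2) *s vderiv 1 \<gamma> t + (f t + 2 * g1 - k) *s vderiv 2 \<gamma> t + g t *s vderiv 3 \<gamma> t" for k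
    unfolding shift_def J(2) defs[symmetric] by (simp add: vec_eq_iff algebra_simps)
  define A where "A = (f t - c) * (f t - b) + g t * f1"
  define B where "B = (f t - c) * g t + g t * (f t + g1 - b)"
  have w2: "shift u b (shift u c (\<gamma> t)) = A *s \<gamma> t + B *s vderiv 1 \<gamma> t + (g t)\<^sup>2 *s vderiv 2 \<gamma> t"
    unfolding s0[of c] shift_linear s0 s1 A_def B_def by (simp add: vec_eq_iff algebra_simps power2_eq_square)
  \<comment> \<open>Every application of u raises the order by one with factor g, so the coefficient
    of \<gamma>''' is g^3 and does not vanish.\<close>
  have "shift u a (shift u b (shift u c (\<gamma> t))) = (A * (f t - a) + B * f1 + (g t)\<^sup>2 * f2) *s \<gamma> t +
     (A * g t + B * (f t + g1 - a) + (g t)\<^sup>2 * (2 * f1 + g2)) *s vderiv 1 \<gamma> t +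
     (B * g t + (g t)\<^sup>2 * (f t + 2 * g1 - a)) *s vderiv 2 \<gamma> t + (g t) ^ 3 *s vderiv 3 \<gamma> t"
    unfolding w2 unfolding shift_linear s0 s1 s2 by (simp add: vec_eq_iff algebra_simps power2_eq_square power3_eq_cube)
  then show ?thesis using nd g0 unfolding nondeg_def basis4_def by (metis power_not_zero)
qed

lemma fdot_axis_left: "fdot (axis i 1) v = v $ i"
  using fdot_axis[of v i] by (simp add: fdot_def mult.commute)

lemma basis4_dual:
  assumes "basis4 \<phi>0 \<phi>1 \<phi>2 \<phi>3"
  shows "\<exists>r0 r1 r2 r3. \<forall>v. v = fdot \<phi>0 v *s r0 + fdot \<phi>1 v *s r1 + fdot \<phi>2 v *s r2 + fdot \<phi>3 v *s r3"
proof -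
  let ?M = "transpose (cols4 \<phi>0 \<phi>1 \<phi>2 \<phi>3)"
  have "invertible ?M" using assms by (simp add: basis4_invertible invertible_det_nz det_transpose)
  then obtain R where R: "R ** ?M = mat 1" unfolding invertible_def by blast
  have M: "?M *v v = vector [fdot \<phi>0 v, fdot \<phi>1 v, fdot \<phi>2 v, fdot \<phi>3 v]" for v
    by (simp add: vec_eq_iff forall_4 matrix_vector_mult_def fdot_def transpose_def cols4_def)
  have "v = R *v (?M *v v)" for v by (simp only: matrix_vector_mul_assoc R matrix_vector_mul_lid)
  then have *: "v = R *v vector [fdot \<phi>0 v, fdot \<phi>1 v, fdot \<phi>2 v, fdot \<phi>3 v]" for v unfolding M .
  have e: "vector [a, b, c, d] = a *s axis 1 1 + b *s axis 2 1 + c *s axis 3 1 + d *s (axis 4 1 :: cvec)" for a b c d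
    using vec4_axis[of "vector [a, b, c, d]"] by simp
  have "v = R *v (fdot \<phi>0 v *s axis 1 1 + fdot \<phi>1 v *s axis 2 1 + fdot \<phi>2 v *s axis 3 1 + fdot \<phi>3 v *s axis 4 1)" for v
    unfolding e[symmetric] by (rule *)
  then show ?thesis unfolding matrix_vector_right_distrib vector_scalar_commute by blast
qed

lemma ball_subset_nonzero:
  assumes "g holomorphic_on T" "open T" "t \<in> T" "g t \<noteq> (0::complex)"
  shows "\<exists>d>0. ball t d \<subseteq> T \<and> (\<forall>s\<in>ball t d. g s \<noteq> 0)"
proof -
  have "open {t\<in>T. g t \<noteq> 0}" using open_nonzero[OF holomorphic_on_imp_continuous_on[OF assms(1)] assms(2)] .
  moreover have "t \<in> {t\<in>T. g t \<noteq> 0}" using assms(3,4) by simp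
  ultimately obtain d where "d > 0" "ball t d \<subseteq> {t\<in>T. g t \<noteq> 0}" by (meson open_contains_ball)
  then show ?thesis by blast
qed

lemma zero_deriv_const_ball:
  assumes "\<And>t. t \<in> ball (a::complex) d \<Longrightarrow> (f has_field_derivative 0) (at t)" "d > 0"
  shows "\<exists>c. \<forall>t\<in>ball a d. f t = c"
  by (rule has_field_derivative_zero_constant[OF convex_ball]) (use assms in \<open>auto intro: has_field_derivative_at_within\<close>)

text \<open>At a simple zero of the field, \<open>u\<close> is diagonalizable with eigenvalues in arithmetic progression;
  the ratios of the eigencoordinates are powers of a single one.\<close>

lemma simple_zero_cubic:
  assumes hol: "vholomorphic_on \<gamma> (ball 0 e)" and e: "e > 0" and nd: "\<forall>t\<in>ball 0 e. nondeg \<gamma> t"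
    and f: "f holomorphic_on ball 0 e" and g: "g holomorphic_on ball 0 e"
    and eq: "\<forall>t\<in>ball 0 e. u *v \<gamma> t = f t *s \<gamma> t + g t *s vderiv 1 \<gamma> t" and g0: "g 0 = 0" and g1: "(deriv ^^ 1) g 0 \<noteq> 0"
    and t1: "t1 \<in> ball 0 e" "g t1 \<noteq> 0"
  shows "\<exists>d y s q0 q1 q2 q3. 0 < d \<and> d \<le> e \<and> y holomorphic_on ball 0 d \<and> y 0 \<noteq> 0 \<and> s holomorphic_on ball 0 d \<and> s 0 = 0 \<and>
     (\<forall>t\<in>ball 0 d. \<gamma> t = y t *s (q0 + s t *s q1 + (s t)\<^sup>2 *s q2 + (s t) ^ 3 *s q3))"
proof -
  have 0: "0 \<in> ball (0::complex) e" using e by simp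
  define \<mu> where "\<mu> = (deriv ^^ 1) g 0"
  \<comment> \<open>The diagonal of u in the osculating frame at the zero: four distinct
    eigenvalues, since g' is nonzero there.\<close>
  define \<kappa> where "\<kappa> k = f 0 + of_nat k * \<mu>" for k :: nat
  note J = field_on_jets[OF hol open_ball f g eq 0, unfolded g0]
  have u0: "u *v \<gamma> 0 = \<kappa> 0 *s \<gamma> 0" using eq[rule_format, OF 0] by (simp add: g0 \<kappa>_def)
  have u1: "u *v vderiv 1 \<gamma> 0 = (deriv ^^ 1) f 0 *s \<gamma> 0 + \<kappa> 1 *s vderiv 1 \<gamma> 0"
    unfolding J(1) by (simp add: \<kappa>_def \<mu>_def del: funpow.simps)
  have u2: "u *v vderiv 2 \<gamma> 0 = (deriv ^^ 2) f 0 *s \<gamma> 0 + (2 * (deriv ^^ 1) f 0 + (deriv ^^ 2) g 0) *s vderiv 1 \<gamma> 0 + \<kappa> 2 *s vderiv 2 \<gamma> 0"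
    unfolding J(2) by (simp add: \<kappa>_def \<mu>_def del: funpow.simps)
  have u3: "u *v vderiv 3 \<gamma> 0 = (deriv ^^ 3) f 0 *s \<gamma> 0 + (3 * (deriv ^^ 2) f 0 + (deriv ^^ 3) g 0) *s vderiv 1 \<gamma> 0 +
       (3 * (deriv ^^ 1) f 0 + 3 * (deriv ^^ 2) g 0) *s vderiv 2 \<gamma> 0 + \<kappa> 3 *s vderiv 3 \<gamma> 0"
    unfolding J(3) by (simp add: \<kappa>_def \<mu>_def del: funpow.simps)
  have X: "shift u (\<kappa> 0) (shift u (\<kappa> 1) (shift u (\<kappa> 2) (shift u (\<kappa> 3) v))) = 0" for v
    by (rule flag_annihilated[OF nd[rule_format, OF 0, unfolded nondeg_def] u0 u1 u2 u3])
  have cyc: "\<exists>i. shift u a (shift u b (shift u c (\<gamma> t1))) $ i \<noteq> 0" for a b c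
    using cyclic_shift_nonzero[OF hol open_ball f g eq t1(1) nd[rule_format, OF t1(1)] t1(2), of a b c] by (simp add: vec_eq_iff)
  \<comment> \<open>The product of the three factors other than u - d is nonzero, because it does
    not kill the cyclic vector at \<open>t1\<close>. Any nonzero row of it is a left eigenvector of
    u with eigenvalue d.\<close>
  have eig: "\<exists>\<phi>. \<phi> \<noteq> 0 \<and> (\<forall>v. fdot \<phi> (u *v v) = d * fdot \<phi> v)"
    if z: "\<And>v. shift u a (shift u b (shift u c (shift u d v))) = 0" for a b c d
  proof -
    obtain i where i: "shift u a (shift u b (shift u c (\<gamma> t1))) $ i \<noteq> 0" using cyc by blast
    define M where "M = (u - mat_scale a (mat 1)) ** (u - mat_scale b (mat 1)) ** (u - mat_scale c (mat 1))"
    have M: "M *v v = shift u a (shift u b (shift u c v))" for v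
      unfolding M_def shift_def by (simp add: matrix_vector_mul_assoc[symmetric] matrix_vector_mult_diff_rdistrib mat_scale_mult)
    define \<phi> where "\<phi> = axis i 1 v* M"
    have \<phi>: "fdot \<phi> v = shift u a (shift u b (shift u c v)) $ i" for v
      unfolding \<phi>_def fdot_matrix[symmetric] M by (rule fdot_axis_left)
    have "\<phi> \<noteq> 0" using i \<phi>[of "\<gamma> t1"] by auto
    moreover have "fdot \<phi> (u *v v) = d * fdot \<phi> v" for v
    proof -
      have "fdot \<phi> (shift u d v) = 0" unfolding \<phi> z by simp
      then show ?thesis unfolding shift_def fdot_diff fdot_scale by simp
    qed
    ultimately show ?thesis by blast
  qed
  obtain \<phi>3 where \<phi>3: "\<phi>3 \<noteq> 0" "\<And>v. fdot \<phi>3 (u *v v) = \<kappa> 3 * fdot \<phi>3 v" using eig[OF X] by blast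
  obtain \<phi>2 where \<phi>2: "\<phi>2 \<noteq> 0" "\<And>v. fdot \<phi>2 (u *v v) = \<kappa> 2 * fdot \<phi>2 v"
    using eig[of "\<kappa> 0" "\<kappa> 1" "\<kappa> 3" "\<kappa> 2"] X shift_commute[of u "\<kappa> 3" "\<kappa> 2"] by auto
  obtain \<phi>1 where \<phi>1: "\<phi>1 \<noteq> 0" "\<And>v. fdot \<phi>1 (u *v v) = \<kappa> 1 * fdot \<phi>1 v"
    using eig[of "\<kappa> 0" "\<kappa> 2" "\<kappa> 3" "\<kappa> 1"] X shift_commute[of u "\<kappa> 3" "\<kappa> 1"] shift_commute[of u "\<kappa> 2" "\<kappa> 1"] by auto
  obtain \<phi>0 where \<phi>0: "\<phi>0 \<noteq> 0" "\<And>v. fdot \<phi>0 (u *v v) = \<kappa> 0 * fdot \<phi>0 v"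
    using eig[of "\<kappa> 1" "\<kappa> 2" "\<kappa> 3" "\<kappa> 0"] X shift_commute[of u "\<kappa> 3" "\<kappa> 0"] shift_commute[of u "\<kappa> 2" "\<kappa> 0"]
      shift_commute[of u "\<kappa> 1" "\<kappa> 0"] by auto
  have \<mu>: "\<mu> \<noteq> 0" using g1 by (simp only: \<mu>_def not_False_eq_True)
  have sh: "fdot \<phi>0 (shift u a v) = (\<kappa> 0 - a) * fdot \<phi>0 v" "fdot \<phi>1 (shift u a v) = (\<kappa> 1 - a) * fdot \<phi>1 v"
    "fdot \<phi>2 (shift u a v) = (\<kappa> 2 - a) * fdot \<phi>2 v" "fdot \<phi>3 (shift u a v) = (\<kappa> 3 - a) * fdot \<phi>3 v" for a v
    unfolding shift_def fdot_diff fdot_scale \<phi>0(2) \<phi>1(2) \<phi>2(2) \<phi>3(2) by (simp_all add: algebra_simps)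
  have basis: "basis4 \<phi>0 \<phi>1 \<phi>2 \<phi>3"
    unfolding basis4_def
  proof (intro allI impI)
    fix a b c d assume "a *s \<phi>0 + b *s \<phi>1 + c *s \<phi>2 + d *s \<phi>3 = 0"
    then have z: "a * fdot \<phi>0 v + b * fdot \<phi>1 v + c * fdot \<phi>2 v + d * fdot \<phi>3 v = 0" for v
      by (metis fdot_add_left fdot_scale_left fdot_zero(2))
    have nz: "\<exists>v. fdot \<phi> v \<noteq> 0" if "\<phi> \<noteq> 0" for \<phi> using that fdot_eqI[of \<phi> 0] by auto
    have d0: "\<kappa> 0 - \<kappa> 1 = - \<mu>" "\<kappa> 0 - \<kappa> 2 = - 2 * \<mu>" "\<kappa> 0 - \<kappa> 3 = - 3 * \<mu>" "\<kappa> 1 - \<kappa> 0 = \<mu>" "\<kappa> 1 - \<kappa> 2 = - \<mu>" "\<kappa> 1 - \<kappa> 3 = - 2 * \<mu>"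
      "\<kappa> 2 - \<kappa> 0 = 2 * \<mu>" "\<kappa> 2 - \<kappa> 1 = \<mu>" "\<kappa> 2 - \<kappa> 3 = - \<mu>" "\<kappa> 3 - \<kappa> 0 = 3 * \<mu>" "\<kappa> 3 - \<kappa> 1 = 2 * \<mu>" "\<kappa> 3 - \<kappa> 2 = \<mu>"
      by (simp_all add: \<kappa>_def algebra_simps)
    have "a * fdot \<phi>0 v = 0" for v using z[of "shift u (\<kappa> 1) (shift u (\<kappa> 2) (shift u (\<kappa> 3) v))"] unfolding sh d0 using \<mu> by simp
    moreover have "b * fdot \<phi>1 v = 0" for v using z[of "shift u (\<kappa> 0) (shift u (\<kappa> 2) (shift u (\<kappa> 3) v))"] unfolding sh d0 using \<mu> by simp
    moreover have "c * fdot \<phi>2 v = 0" for v using z[of "shift u (\<kappa> 0) (shift u (\<kappa> 1) (shift u (\<kappa> 3) v))"] unfolding sh d0 using \<mu> by simp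
    moreover have "d * fdot \<phi>3 v = 0" for v using z[of "shift u (\<kappa> 0) (shift u (\<kappa> 1) (shift u (\<kappa> 2) v))"] unfolding sh d0 using \<mu> by simp
    ultimately show "a = 0 \<and> b = 0 \<and> c = 0 \<and> d = 0"
      using nz[OF \<phi>0(1)] nz[OF \<phi>1(1)] nz[OF \<phi>2(1)] nz[OF \<phi>3(1)] by (metis mult_eq_0_iff)
  qed
  obtain r0 r1 r2 r3 where r: "\<forall>v. v = fdot \<phi>0 v *s r0 + fdot \<phi>1 v *s r1 + fdot \<phi>2 v *s r2 + fdot \<phi>3 v *s r3"
    using basis4_dual[OF basis] by blast
  have yh: "(\<lambda>t. fdot \<phi> (\<gamma> t)) holomorphic_on ball 0 e" for \<phi> using holomorphic_fdot[OF hol] .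
  have Dy: "((\<lambda>t. fdot \<phi> (\<gamma> t)) has_field_derivative fdot \<phi> (vderiv 1 \<gamma> t)) (at t)" if "t \<in> ball 0 e" for \<phi> t
    by (rule has_vderiv_fdot[OF has_vderiv_1[OF hol open_ball that]])
  have gy: "g t * fdot \<phi> (vderiv 1 \<gamma> t) = (k - f t) * fdot \<phi> (\<gamma> t)"
    if "\<And>v. fdot \<phi> (u *v v) = k * fdot \<phi> v" "t \<in> ball 0 e" for \<phi> k t
    using that(1)[of "\<gamma> t"] unfolding eq[rule_format, OF that(2)] fdot_add fdot_scale by (simp add: algebra_simps)
  have z0: "fdot \<phi>1 (\<gamma> 0) = 0" "fdot \<phi>2 (\<gamma> 0) = 0" "fdot \<phi>3 (\<gamma> 0) = 0"
    using gy[OF \<phi>1(2) 0] gy[OF \<phi>2(2) 0] gy[OF \<phi>3(2) 0] \<mu> unfolding g0 by (simp_all add: \<kappa>_def)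
  have "\<gamma> 0 \<noteq> 0"
  proof
    assume "\<gamma> 0 = 0"
    then have "1 *s \<gamma> 0 + 0 *s vderiv 1 \<gamma> 0 = 0" by simp
    then show False using nondeg_lin_indep2[OF nd[rule_format, OF 0]] unfolding lin_indep2_def by (metis zero_neq_one)
  qed
  then have y00: "fdot \<phi>0 (\<gamma> 0) \<noteq> 0" using r[rule_format, of "\<gamma> 0"] unfolding z0 by auto
  obtain d where d: "d > 0" "ball (0::complex) d \<subseteq> ball 0 e" "\<forall>t\<in>ball 0 d. fdot \<phi>0 (\<gamma> t) \<noteq> 0"
    using ball_subset_nonzero[OF yh open_ball 0 y00] by blast
  define y where "y t = fdot \<phi>0 (\<gamma> t)" for t
  define S where "S \<phi> t = fdot \<phi> (\<gamma> t) / y t" for \<phi> t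
  have yn: "y t \<noteq> 0" "t \<in> ball 0 e" if "t \<in> ball 0 d" for t using d that unfolding y_def by auto
  have Sh: "S \<phi> holomorphic_on ball 0 d" for \<phi>
    unfolding S_def y_def using d yh holomorphic_on_subset by (intro holomorphic_intros) blast+
  have DS: "\<exists>D. (S \<phi> has_field_derivative D) (at t) \<and> g t * D = (k - \<kappa> 0) * S \<phi> t"
    \<comment> \<open>Along the field an eigencoordinate has logarithmic rate k, up to the common f
      that cancels in the quotient by y.\<close>
    if k: "\<And>v. fdot \<phi> (u *v v) = k * fdot \<phi> v" and t: "t \<in> ball 0 d" for \<phi> k t
  proof -
    have "(S \<phi> has_field_derivative (fdot \<phi> (vderiv 1 \<gamma> t) * y t - fdot \<phi> (\<gamma> t) * fdot \<phi>0 (vderiv 1 \<gamma> t)) / (y t * y t)) (at t)"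
      unfolding S_def y_def using yn[OF t] unfolding y_def by (intro DERIV_divide Dy) auto
    moreover have "g t * ((fdot \<phi> (vderiv 1 \<gamma> t) * y t - fdot \<phi> (\<gamma> t) * fdot \<phi>0 (vderiv 1 \<gamma> t)) / (y t * y t)) =
       ((g t * fdot \<phi> (vderiv 1 \<gamma> t)) * y t - fdot \<phi> (\<gamma> t) * (g t * fdot \<phi>0 (vderiv 1 \<gamma> t))) / (y t * y t)"
      by (simp add: algebra_simps)
    moreover have "\<dots> = (k - \<kappa> 0) * S \<phi> t"
      unfolding gy[OF k yn(2)[OF t]] gy[OF \<phi>0(2) yn(2)[OF t]] S_def y_def[symmetric] using yn(1)[OF t] by (simp add: field_simps)
    ultimately show ?thesis by metis
  qed
  define s where "s = S \<phi>1"
  have 0: "0 \<in> ball (0::complex) d" using d(1) by simp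
  have s0: "s 0 = 0" unfolding s_def S_def z0 by simp
  \<comment> \<open>The eigenvalues being in arithmetic progression, this quotient grows k times as
    fast as s, so its quotient by s^k is constant wherever g and s do not vanish; the identity
    theorem extends the relation to the zero.\<close>
  have pw: "\<exists>c. \<forall>t\<in>ball 0 d. S \<phi> t = c * s t ^ k" if k: "\<And>v. fdot \<phi> (u *v v) = \<kappa> k * fdot \<phi> v" "k > 0" for \<phi> k
  proof -
    \<comment> \<open>Otherwise g s' = \<mu> s would give s = 0, and a nonzero functional would
      vanish on the curve.\<close>
    have "\<exists>t\<in>ball 0 d. g t * s t \<noteq> 0"
    proof (rule ccontr)
      assume "\<not> ?thesis"
      then have z: "g t * s t = 0" if "t \<in> ball 0 d" for t using that by blast
      have "s t = 0" if t: "t \<in> ball 0 d" for t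
      proof -
        obtain D where D: "(s has_field_derivative D) (at t)" "g t * D = (\<kappa> 1 - \<kappa> 0) * s t" using DS[OF \<phi>1(2) t] unfolding s_def by blast
        have "g t * D * s t = 0" using z[OF t] by auto
        then have "(\<kappa> 1 - \<kappa> 0) * s t * s t = 0" unfolding D(2) .
        then show ?thesis using \<mu> by (simp add: \<kappa>_def)
      qed
      then have "fdot \<phi>1 (\<gamma> t) = 0" if "t \<in> ball 0 d" for t using yn[OF that] that unfolding s_def S_def by auto
      then have "\<phi>1 = 0"
        by (intro nondeg_functional[OF _ open_ball 0 _ vholomorphic_subset[OF hol d(2)]]) (use nd e in auto)
      then show False using \<phi>1(1) by blast
    qed
    then obtain t2 where t2: "t2 \<in> ball 0 d" "g t2 * s t2 \<noteq> 0" by blast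
    have gh: "g holomorphic_on ball 0 d" using g d(2) holomorphic_on_subset by blast
    have sh: "s holomorphic_on ball 0 d" unfolding s_def by (rule Sh)
    obtain d2 where d2: "d2 > 0" "ball t2 d2 \<subseteq> ball 0 d" "\<forall>t\<in>ball t2 d2. g t * s t \<noteq> 0"
      using ball_subset_nonzero[OF holomorphic_on_mult[OF gh sh] open_ball t2] by blast
    have "((\<lambda>t. S \<phi> t / s t ^ k) has_field_derivative 0) (at t)" if tt: "t \<in> ball t2 d2" for t
    proof -
      have t: "t \<in> ball 0 d" "g t \<noteq> 0" "s t \<noteq> 0" using d2(2,3) tt by auto
      obtain D where D: "(s has_field_derivative D) (at t)" "g t * D = (\<kappa> 1 - \<kappa> 0) * s t" using DS[OF \<phi>1(2) t(1)] unfolding s_def by blast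
      obtain D' where D': "(S \<phi> has_field_derivative D') (at t)" "g t * D' = (\<kappa> k - \<kappa> 0) * S \<phi> t" using DS[OF k(1) t(1)] by blast
      have d: "D = \<mu> * s t / g t" "D' = of_nat k * \<mu> * S \<phi> t / g t" using D(2) D'(2) t(2) by (simp_all add: \<kappa>_def field_simps)
      obtain m where m: "k = Suc m" using k(2) by (cases k) auto
      have "((\<lambda>t. S \<phi> t / s t ^ k) has_field_derivative (D' * s t ^ k - S \<phi> t * (of_nat k * (D * s t ^ m))) / (s t ^ k * s t ^ k)) (at t)"
        using DERIV_divide[OF D'(1) DERIV_power[OF D(1), of k]] t(3) m by simp
      moreover have "D' * s t ^ k - S \<phi> t * (of_nat k * (D * s t ^ m)) = 0"
        unfolding d m by (simp add: field_simps)
      ultimately show ?thesis by simp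
    qed
    then obtain c where c: "\<forall>t\<in>ball t2 d2. S \<phi> t / s t ^ k = c" 
      using zero_deriv_const_ball[of t2 d2 "\<lambda>t. S \<phi> t / s t ^ k"] d2(1) by blast
    have "S \<phi> t - c * s t ^ k = 0" if "t \<in> ball 0 d" for t
    proof (rule holomorphic_zero_propagates[OF _ open_ball connected_ball d2(1,2) _ that])
      show "(\<lambda>t. S \<phi> t - c * s t ^ k) holomorphic_on ball 0 d" using Sh sh by (intro holomorphic_intros)
      show "S \<phi> t - c * s t ^ k = 0" if "t \<in> ball t2 d2" for t using c d2(3) that by (auto simp: field_simps)
    qed
    then show ?thesis by (intro exI[of _ c]) simp
  qed
  obtain c2 where c2: "\<forall>t\<in>ball 0 d. S \<phi>2 t = c2 * (s t)\<^sup>2" using pw[OF \<phi>2(2)] by auto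
  obtain c3 where c3: "\<forall>t\<in>ball 0 d. S \<phi>3 t = c3 * s t ^ 3" using pw[OF \<phi>3(2)] by auto
  have "\<gamma> t = y t *s (r0 + s t *s r1 + (s t)\<^sup>2 *s (c2 *s r2) + (s t) ^ 3 *s (c3 *s r3))" if t: "t \<in> ball 0 d" for t
  proof -
    have F: "fdot \<phi> (\<gamma> t) = y t * S \<phi> t" for \<phi> unfolding S_def using yn(1)[OF t] by simp
    have "\<gamma> t = fdot \<phi>0 (\<gamma> t) *s r0 + fdot \<phi>1 (\<gamma> t) *s r1 + fdot \<phi>2 (\<gamma> t) *s r2 + fdot \<phi>3 (\<gamma> t) *s r3" using r by blast
    also have "\<dots> = y t *s r0 + (y t * s t) *s r1 + (y t * (c2 * (s t)\<^sup>2)) *s r2 + (y t * (c3 * s t ^ 3)) *s r3"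
      unfolding F[of \<phi>1] F[of \<phi>2] F[of \<phi>3] using c2 c3 t by (simp add: y_def s_def)
    also have "\<dots> = y t *s (r0 + s t *s r1 + (s t)\<^sup>2 *s (c2 *s r2) + (s t) ^ 3 *s (c3 *s r3))"
      by (simp add: vec_eq_iff algebra_simps)
    finally show ?thesis .
  qed
  moreover have "d \<le> e" using d(1,2) e by (simp add: ball_subset_ball_iff)
  moreover have "y holomorphic_on ball 0 d" unfolding y_def using yh d(2) holomorphic_on_subset by blast
  ultimately show ?thesis using d(1) yn(1)[OF 0] Sh[of \<phi>1] s0 unfolding s_def[symmetric] by blast
qed

text \<open>At a multiple zero of the field, \<open>u - f 0\<close> is a full nilpotent block. With \<open>h = y\<^sub>1 / y\<^sub>0\<close> the time
  parameter of the flow, the coordinates in a Jordan basis are \<open>1, h, h\<^sup>2/2, h\<^sup>3/6\<close> up to a common factor,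
  and \<open>1/h\<close> extends to the zero.\<close>

lemma multiple_zero_cubic:
  assumes hol: "vholomorphic_on \<gamma> (ball 0 e)" and e: "e > 0" and nd: "\<forall>t\<in>ball 0 e. nondeg \<gamma> t"
    and f: "f holomorphic_on ball 0 e" and g: "g holomorphic_on ball 0 e"
    and eq: "\<forall>t\<in>ball 0 e. u *v \<gamma> t = f t *s \<gamma> t + g t *s vderiv 1 \<gamma> t" and g0: "g 0 = 0"
    and nil: "\<And>v. shift u k (shift u k (shift u k (shift u k v))) = 0"
    and t1: "t1 \<in> ball 0 e" "g t1 \<noteq> 0"
  shows "\<exists>d y s q0 q1 q2 q3. 0 < d \<and> d \<le> e \<and> y holomorphic_on ball 0 d \<and> y 0 \<noteq> 0 \<and> s holomorphic_on ball 0 d \<and> s 0 = 0 \<and>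
     (\<forall>t\<in>ball 0 d. \<gamma> t = y t *s (q0 + s t *s q1 + (s t)\<^sup>2 *s q2 + (s t) ^ 3 *s q3))"
proof -
  have 0: "0 \<in> ball (0::complex) e" using e by simp
  define N where "N = u - mat_scale k (mat 1)"
  have N: "N *v v = shift u k v" for v
    unfolding N_def shift_def by (simp add: matrix_vector_mult_diff_rdistrib mat_scale_mult)
  obtain i where i: "shift u k (shift u k (shift u k (\<gamma> t1))) $ i \<noteq> 0"
    using cyclic_shift_nonzero[OF hol open_ball f g eq t1(1) nd[rule_format, OF t1(1)] t1(2), of k k k] by (auto simp: vec_eq_iff)
  \<comment> \<open>The coordinate is chosen so that the third power of N does not vanish in it on
    the cyclic vector; the successive covectors then form a full Jordan chain.\<close>
  define \<phi>3 where "\<phi>3 = (axis i 1 :: cvec)"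
  define \<phi>2 where "\<phi>2 = \<phi>3 v* N"
  define \<phi>1 where "\<phi>1 = \<phi>2 v* N"
  define \<phi>0 where "\<phi>0 = \<phi>1 v* N"
  have \<phi>: "fdot \<phi>3 (shift u k v) = fdot \<phi>2 v" "fdot \<phi>2 (shift u k v) = fdot \<phi>1 v" "fdot \<phi>1 (shift u k v) = fdot \<phi>0 v" for v
    unfolding \<phi>0_def \<phi>1_def \<phi>2_def fdot_matrix[symmetric] N by simp_all
  have \<phi>0: "fdot \<phi>0 (shift u k v) = 0" for v
    unfolding \<phi>[symmetric] nil by simp
  have \<phi>0n: "fdot \<phi>0 (\<gamma> t1) \<noteq> 0"
    unfolding \<phi>[symmetric] using i unfolding \<phi>3_def fdot_axis_left .
  have basis: "basis4 \<phi>0 \<phi>1 \<phi>2 \<phi>3"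
    unfolding basis4_def
  proof (intro allI impI)
    fix a b c d assume "a *s \<phi>0 + b *s \<phi>1 + c *s \<phi>2 + d *s \<phi>3 = 0"
    then have z: "a * fdot \<phi>0 v + b * fdot \<phi>1 v + c * fdot \<phi>2 v + d * fdot \<phi>3 v = 0" for v
      by (metis fdot_add_left fdot_scale_left fdot_zero(2))
    have d: "d = 0" using z[of "shift u k (shift u k (shift u k (\<gamma> t1)))"] \<phi>0n unfolding \<phi> \<phi>0 by simp
    have c: "c = 0" using z[of "shift u k (shift u k (\<gamma> t1))"] \<phi>0n unfolding \<phi> \<phi>0 d by simp
    have b: "b = 0" using z[of "shift u k (\<gamma> t1)"] \<phi>0n unfolding \<phi> \<phi>0 d c by simp
    have a: "a = 0" using z[of "\<gamma> t1"] \<phi>0n unfolding d c b by simp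
    show "a = 0 \<and> b = 0 \<and> c = 0 \<and> d = 0" using a b c d by blast
  qed
  define F where "F t = f t - k" for t
  have Dy: "((\<lambda>t. fdot \<phi> (\<gamma> t)) has_field_derivative fdot \<phi> (vderiv 1 \<gamma> t)) (at t)" if "t \<in> ball 0 e" for \<phi> t
    by (rule has_vderiv_fdot[OF has_vderiv_1[OF hol open_ball that]])
  have yh: "(\<lambda>t. fdot \<phi> (\<gamma> t)) holomorphic_on ball 0 e" for \<phi> using holomorphic_fdot[OF hol] .
  define y0 y1 y2 y3 where ydef: "y0 t = fdot \<phi>0 (\<gamma> t)" "y1 t = fdot \<phi>1 (\<gamma> t)" "y2 t = fdot \<phi>2 (\<gamma> t)" "y3 t = fdot \<phi>3 (\<gamma> t)" for t
  define z0 z1 z2 z3 where zdef: "z0 t = fdot \<phi>0 (vderiv 1 \<gamma> t)" "z1 t = fdot \<phi>1 (vderiv 1 \<gamma> t)" "z2 t = fdot \<phi>2 (vderiv 1 \<gamma> t)"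
    "z3 t = fdot \<phi>3 (vderiv 1 \<gamma> t)" for t
  have yholo: "y0 holomorphic_on ball 0 e" "y1 holomorphic_on ball 0 e" "y2 holomorphic_on ball 0 e" "y3 holomorphic_on ball 0 e"
    unfolding ydef[abs_def] by (rule yh)+
  have D: "(y0 has_field_derivative z0 t) (at t)" "(y1 has_field_derivative z1 t) (at t)" "(y2 has_field_derivative z2 t) (at t)"
     "(y3 has_field_derivative z3 t) (at t)" if "t \<in> ball 0 e" for t
    using Dy[OF that] unfolding ydef[abs_def] zdef by blast+
  have sh: "shift u k (\<gamma> t) = F t *s \<gamma> t + g t *s vderiv 1 \<gamma> t" if "t \<in> ball 0 e" for t
    unfolding shift_def eq[rule_format, OF that] F_def by (simp add: vec_eq_iff algebra_simps)
  have gz: "g t * z0 t = - F t * y0 t" "g t * z1 t = y0 t - F t * y1 t" "g t * z2 t = y1 t - F t * y2 t" "g t * z3 t = y2 t - F t * y3 t"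
    if "t \<in> ball 0 e" for t
    using \<phi>0[of "\<gamma> t"] \<phi>[of "\<gamma> t"] unfolding sh[OF that] fdot_add fdot_scale ydef[symmetric] zdef[symmetric]
    by (simp_all add: algebra_simps eq_neg_iff_add_eq_0)
  have t1': "g t1 * y0 t1 \<noteq> 0" using t1(2) \<phi>0n by (simp add: ydef)
  obtain d1 where d1: "d1 > 0" "ball t1 d1 \<subseteq> ball 0 e" "\<forall>t\<in>ball t1 d1. g t * y0 t \<noteq> 0"
    using ball_subset_nonzero[OF holomorphic_on_mult[OF g yholo(1)] open_ball t1(1) t1'] by blast
  have V: "t \<in> ball 0 e" "g t \<noteq> 0" "y0 t \<noteq> 0" if "t \<in> ball t1 d1" for t using d1 that by auto
  define h where "h t = y1 t / y0 t" for t
  \<comment> \<open>Dividing by y0, which itself satisfies g y0' = - F y0, removes the term with F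
    from the equation of any other coordinate.\<close>
  have quot: "((\<lambda>t. w t / y0 t) has_field_derivative x / y0 t / g t) (at t)"
    if "(w has_field_derivative w') (at t)" "g t * w' = x - F t * w t" "t \<in> ball t1 d1" for w w' x t
  proof -
    have w': "w' = (x - F t * w t) / g t" using that(2) V(2)[OF that(3)] by (simp add: field_simps)
    have z: "z0 t = - F t * y0 t / g t" using gz(1)[OF V(1)[OF that(3)]] V(2)[OF that(3)] by (simp add: field_simps)
    have "((\<lambda>t. w t / y0 t) has_field_derivative (w' * y0 t - w t * z0 t) / (y0 t * y0 t)) (at t)"
      by (rule DERIV_divide[OF that(1) D(1)[OF V(1)[OF that(3)]] V(3)[OF that(3)]])
    moreover have "(w' * y0 t - w t * z0 t) / (y0 t * y0 t) = x / y0 t / g t"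
      unfolding w' z using V(2,3)[OF that(3)] by (simp add: field_simps)
    ultimately show ?thesis by simp
  qed
  have Dh: "(h has_field_derivative 1 / g t) (at t)" if "t \<in> ball t1 d1" for t
    using quot[OF D(2)[OF V(1)[OF that]] gz(2)[OF V(1)[OF that]] that] V(3)[OF that] unfolding h_def[abs_def] by simp
  have D2: "((\<lambda>t. y2 t / y0 t) has_field_derivative h t / g t) (at t)" if "t \<in> ball t1 d1" for t
    using quot[OF D(3)[OF V(1)[OF that]] gz(3)[OF V(1)[OF that]] that] unfolding h_def .
  have D3: "((\<lambda>t. y3 t / y0 t) has_field_derivative y2 t / y0 t / g t) (at t)" if "t \<in> ball t1 d1" for t
    using quot[OF D(4)[OF V(1)[OF that]] gz(4)[OF V(1)[OF that]] that] .
  have "((\<lambda>t. y2 t / y0 t - (h t)\<^sup>2 / 2) has_field_derivative 0) (at t)" if "t \<in> ball t1 d1" for t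
    by (rule derivative_eq_intros D2[OF that] Dh[OF that] refl | simp)+
  then obtain c2 where c2: "\<forall>t\<in>ball t1 d1. y2 t / y0 t - (h t)\<^sup>2 / 2 = c2"
    using zero_deriv_const_ball[of t1 d1 "\<lambda>t. y2 t / y0 t - (h t)\<^sup>2 / 2"] d1(1) by blast
  have "((\<lambda>t. y3 t / y0 t - (h t) ^ 3 / 6 - c2 * h t) has_field_derivative 0) (at t)" if "t \<in> ball t1 d1" for t
  proof -
    have e2: "y2 t / y0 t = (h t)\<^sup>2 / 2 + c2" using c2[rule_format, OF that] by (simp add: algebra_simps)
    have h3: "((\<lambda>t. (h t) ^ 3 / 6) has_field_derivative (h t)\<^sup>2 / 2 / g t) (at t)"
      by (rule derivative_eq_intros Dh[OF that] refl | simp)+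
    have "y2 t / y0 t / g t - (h t)\<^sup>2 / 2 / g t - c2 * (1 / g t) = 0" unfolding e2 by (simp add: add_divide_distrib)
    then show ?thesis using DERIV_diff[OF DERIV_diff[OF D3[OF that] h3] DERIV_cmult[OF Dh[OF that], of c2]] by (simp only:)
  qed
  then obtain c3 where c3: "\<forall>t\<in>ball t1 d1. y3 t / y0 t - (h t) ^ 3 / 6 - c2 * h t = c3"
    using zero_deriv_const_ball[of t1 d1 "\<lambda>t. y3 t / y0 t - (h t) ^ 3 / 6 - c2 * h t"] d1(1) by blast
  \<comment> \<open>The integration constants are absorbed by changing the Jordan basis of
    covectors.\<close>
  define Y2 where "Y2 t = y2 t - c2 * y0 t" for t
  define Y3 where "Y3 t = y3 t - c2 * y1 t - c3 * y0 t" for t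
  have YV: "y1 t = y0 t * h t" "Y2 t = y0 t * (h t)\<^sup>2 / 2" "Y3 t = y0 t * (h t) ^ 3 / 6" if "t \<in> ball t1 d1" for t
  proof -
    show 1: "y1 t = y0 t * h t" unfolding h_def using V(3)[OF that] by simp
    have "y2 t = y0 t * ((h t)\<^sup>2 / 2 + c2)" using c2[rule_format, OF that] V(3)[OF that] by (simp add: field_simps)
    then show "Y2 t = y0 t * (h t)\<^sup>2 / 2" unfolding Y2_def by (simp add: algebra_simps)
    have "y3 t = y0 t * ((h t) ^ 3 / 6 + c2 * h t + c3)" using c3[rule_format, OF that] V(3)[OF that] by (simp add: field_simps)
    then show "Y3 t = y0 t * (h t) ^ 3 / 6" unfolding Y3_def 1 by (simp add: algebra_simps)
  qed
  have Yh: "Y2 holomorphic_on ball 0 e" "Y3 holomorphic_on ball 0 e"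
    unfolding Y2_def Y3_def using yholo by (auto intro!: holomorphic_intros)
  note vanish = holomorphic_zero_propagates[OF _ open_ball connected_ball d1(1,2)]
  have R1: "(y1 t)\<^sup>2 - 2 * y0 t * Y2 t = 0" if "t \<in> ball 0 e" for t
  proof (rule vanish[OF _ _ that])
    show "(\<lambda>t. (y1 t)\<^sup>2 - 2 * y0 t * Y2 t) holomorphic_on ball 0 e" by (intro holomorphic_intros yholo Yh)
    show "(y1 t)\<^sup>2 - 2 * y0 t * Y2 t = 0" if "t \<in> ball t1 d1" for t
      unfolding YV[OF that] by (simp add: power2_eq_square power3_eq_cube)
  qed
  have R2: "y1 t * Y2 t - 3 * y0 t * Y3 t = 0" if "t \<in> ball 0 e" for t
  proof (rule vanish[OF _ _ that])
    show "(\<lambda>t. y1 t * Y2 t - 3 * y0 t * Y3 t) holomorphic_on ball 0 e" by (intro holomorphic_intros yholo Yh)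
    show "y1 t * Y2 t - 3 * y0 t * Y3 t = 0" if "t \<in> ball t1 d1" for t
      unfolding YV[OF that] by (simp add: power2_eq_square power3_eq_cube)
  qed
  have R3: "2 * (Y2 t)\<^sup>2 - 3 * y1 t * Y3 t = 0" if "t \<in> ball 0 e" for t
  proof (rule vanish[OF _ _ that])
    show "(\<lambda>t. 2 * (Y2 t)\<^sup>2 - 3 * y1 t * Y3 t) holomorphic_on ball 0 e" by (intro holomorphic_intros yholo Yh)
    show "2 * (Y2 t)\<^sup>2 - 3 * y1 t * Y3 t = 0" if "t \<in> ball t1 d1" for t
      unfolding YV[OF that] by (simp add: power2_eq_square power3_eq_cube)
  qed
  \<comment> \<open>The combination on the right has a factor g, so y0 vanishes at the zero of the
    field; the three relations then leave Y3 as the only coordinate that can be nonzero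
    there.\<close>
  have "y0 0 * y0 0 = (g 0 * z1 0) * y0 0 - y1 0 * (g 0 * z0 0)"
    unfolding gz(1)[OF 0] gz(2)[OF 0] by (simp add: algebra_simps)
  then have y00: "y0 0 = 0" unfolding g0 by simp
  have y10: "y1 0 = 0" using R1[OF 0] unfolding y00 by simp
  have Y20: "Y2 0 = 0" using R3[OF 0] unfolding y10 by simp
  have "basis4 (1 *s \<phi>0) (0 *s \<phi>0 + 1 *s \<phi>1) ((- c2) *s \<phi>0 + 0 *s \<phi>1 + 1 *s \<phi>2) ((- c3) *s \<phi>0 + (- c2) *s \<phi>1 + 0 *s \<phi>2 + 1 *s \<phi>3)"
    by (rule basis4_triangular[OF basis]) simp_all
  then obtain r0 r1 r2 r3 where r: "\<forall>v. v = fdot (1 *s \<phi>0) v *s r0 + fdot (0 *s \<phi>0 + 1 *s \<phi>1) v *s r1 +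
     fdot ((- c2) *s \<phi>0 + 0 *s \<phi>1 + 1 *s \<phi>2) v *s r2 + fdot ((- c3) *s \<phi>0 + (- c2) *s \<phi>1 + 0 *s \<phi>2 + 1 *s \<phi>3) v *s r3"
    using basis4_dual by blast
  have \<gamma>: "\<gamma> t = y0 t *s r0 + y1 t *s r1 + Y2 t *s r2 + Y3 t *s r3" for t
    using r[rule_format, of "\<gamma> t"] unfolding fdot_add_left fdot_scale_left ydef[symmetric] Y2_def Y3_def
    by (simp add: algebra_simps)
  have Y30: "Y3 0 \<noteq> 0"
  proof
    assume "Y3 0 = 0"
    then have "\<gamma> 0 = 0" using \<gamma>[of 0] y00 y10 Y20 by simp
    then have "1 *s \<gamma> 0 + 0 *s vderiv 1 \<gamma> 0 = 0" by simp
    then show False using nondeg_lin_indep2[OF nd[rule_format, OF 0]] unfolding lin_indep2_def by (metis zero_neq_one)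
  qed
  obtain d where d: "d > 0" "ball (0::complex) d \<subseteq> ball 0 e" "\<forall>t\<in>ball 0 d. Y3 t \<noteq> 0"
    using ball_subset_nonzero[OF Yh(2) open_ball 0 Y30] by blast
  \<comment> \<open>On the disc around \<open>t1\<close> this is (h^2/2) / (3 h^3/6) = 1/h.\<close>
  define s where "s t = Y2 t / (3 * Y3 t)" for t
  have sub: "Y2 holomorphic_on ball 0 d" "Y3 holomorphic_on ball 0 d" using Yh d(2) holomorphic_on_subset by blast+
  have sh: "s holomorphic_on ball 0 d" unfolding s_def using sub d(3) by (intro holomorphic_intros) auto
  have "\<gamma> t = Y3 t *s (r3 + s t *s (3 *s r2) + (s t)\<^sup>2 *s (6 *s r1) + (s t) ^ 3 *s (6 *s r0))" if t: "t \<in> ball 0 d" for t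
  proof -
    have te: "t \<in> ball 0 e" and Y3: "Y3 t \<noteq> 0" using d(2,3) t by auto
    have Y2: "Y2 t = 3 * s t * Y3 t" unfolding s_def using Y3 by simp
    have "3 * Y3 t * (y1 t - 6 * (s t)\<^sup>2 * Y3 t) = - (2 * (3 * s t * Y3 t)\<^sup>2 - 3 * y1 t * Y3 t)"
      by (simp add: algebra_simps power2_eq_square)
    then have "3 * Y3 t * (y1 t - 6 * (s t)\<^sup>2 * Y3 t) = 0"
      using R3[OF te] unfolding Y2 by (simp only: neg_equal_0_iff_equal)
    then have y1: "y1 t = 6 * (s t)\<^sup>2 * Y3 t" using Y3 by simp
    have "3 * Y3 t * (y0 t - 6 * (s t) ^ 3 * Y3 t) = - (6 * (s t)\<^sup>2 * Y3 t * (3 * s t * Y3 t) - 3 * y0 t * Y3 t)"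
      by (simp add: algebra_simps power2_eq_square power3_eq_cube)
    then have "3 * Y3 t * (y0 t - 6 * (s t) ^ 3 * Y3 t) = 0"
      using R2[OF te] unfolding Y2 y1 by (simp only: neg_equal_0_iff_equal)
    then have y0: "y0 t = 6 * (s t) ^ 3 * Y3 t" using Y3 by simp
    show ?thesis unfolding \<gamma>[of t] y0 y1 Y2 by (simp add: vec_eq_iff algebra_simps)
  qed
  moreover have "d \<le> e" using d(1,2) e by (simp add: ball_subset_ball_iff)
  moreover have "s 0 = 0" unfolding s_def Y20 by simp
  ultimately show ?thesis using d(1) sub(2) Y30 sh by blast
qed

text \<open>Dimension at least two supplies an automorphism that is not a scalar. The order of
  vanishing of its coefficient g at the base point decides between the flow argument, the simple
  zero and the multiple zero.\<close>

lemma homogeneous_ode_germ: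
  assumes "(Z, z) \<in> homogeneous_germs"
  shows "\<exists>r \<gamma> e. ode_germ (1 + r\<^sup>2) (- r\<^sup>2) Z z \<gamma> e"
proof -
  obtain \<sigma> where nda: "nondegenerate_at Z z" and leg: "legendrian \<sigma> Z" and dim: "2 \<le> mat_dim (aut \<sigma> Z)"
    using assms unfolding homogeneous_germs_def homogeneous_def by auto
  have cur: "curve Z" and \<sigma>: "symplectic_form \<sigma>" using leg unfolding legendrian_def by blast+
  note cone = curveD(1)[OF cur]
  have zZ: "z \<in> Z" using nda unfolding nondegenerate_at_def by blast
  obtain \<alpha> T t0 c where ch: "chart Z \<alpha> T" "t0 \<in> T" "c \<noteq> 0" "z = c *s \<alpha> t0" by (rule curve_chart[OF cur zZ])
  note chD = chartD[OF ch(1)]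
  obtain e0 where e0: "e0 > 0" "ball t0 e0 \<subseteq> T" using chD(1) ch(2) by (meson open_contains_ball)
  define \<gamma> where "\<gamma> s = c *s \<alpha> (t0 + s)" for s
  have im: "(\<lambda>s. t0 + s) ` ball 0 e0 \<subseteq> T" using e0(2) by (auto simp: dist_norm subset_iff)
  have dl: "deriv (\<lambda>s. t0 + s) s \<noteq> 0" for s :: complex
    using DERIV_imp_deriv[of "\<lambda>s. t0 + s" 1 s] by (auto intro!: derivative_eq_intros)
  have h: "(\<lambda>_. c) holomorphic_on ball 0 e0" "(\<lambda>s. t0 + s) holomorphic_on ball 0 e0" by (intro holomorphic_intros)+
  have chg: "chart Z \<gamma> (ball 0 e0)"
    unfolding \<gamma>_def by (rule chart_reparam[OF ch(1) cone open_ball h im]) (use ch(3) dl in auto)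
  have 0: "0 \<in> ball (0::complex) e0" using e0 by simp
  have z: "\<gamma> 0 = z" by (simp add: \<gamma>_def ch(4))
  have nd0: "nondeg \<gamma> 0" using nondegenerate_at_chart[OF chg cone 0, of 1] nda z by simp
  obtain e1 where e1: "e1 > 0" "ball (0::complex) e1 \<subseteq> ball 0 e0" "\<And>t. t \<in> ball 0 e1 \<Longrightarrow> nondeg \<gamma> t"
    using nondeg_near[OF nd0 chartD(2)[OF chg] open_ball 0] by blast
  have ch1: "chart Z \<gamma> (ball 0 e1)" using chart_subset[OF chg open_ball e1(2)] .
  have 0: "0 \<in> ball (0::complex) e1" using e1 by simp
  obtain e where e: "e > 0" "ball (0::complex) e \<subseteq> ball 0 e1"
    and dec: "\<forall>u V. open V \<longrightarrow> V \<noteq> {} \<longrightarrow> V \<subseteq> ball 0 e \<longrightarrow> (\<forall>t\<in>V. u *v \<gamma> t \<in> tangent Z (\<gamma> t)) \<longrightarrow>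
       (\<exists>f g. f holomorphic_on ball 0 e \<and> g holomorphic_on ball 0 e \<and>
         (\<forall>t\<in>ball 0 e. u *v \<gamma> t = f t *s \<gamma> t + g t *s vderiv 1 \<gamma> t))"
    using tangent_decomposition[OF ch1 cone 0] by blast
  have che: "chart Z \<gamma> (ball 0 e)" using chart_subset[OF ch1 open_ball e(2)] .
  have nd: "\<forall>t\<in>ball 0 e. nondeg \<gamma> t" using e1(3) e(2) by blast
  have 0: "0 \<in> ball (0::complex) e" using e by simp
  note hol = chartD(2)[OF che]
  have "\<not> aut \<sigma> Z \<subseteq> mats.span {mat 1}" using mat_dim_le[of "aut \<sigma> Z" "{mat 1}"] dim by auto
  then obtain u0 where u0: "u0 \<in> aut \<sigma> Z" "u0 \<notin> mats.span {mat 1}" by blast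
  obtain c0 where c0: "\<And>v w. \<sigma> (u0 *v v) w + \<sigma> v (u0 *v w) = c0 * \<sigma> v w" using u0(1) unfolding aut_def csp_def by blast
  note D = alternating_formD[OF symplectic_alternating[OF \<sigma>]]
  \<comment> \<open>Subtracting half the scale factor makes u infinitesimally symplectic. It alters
    f by a constant, leaves g unchanged, and u stays non-scalar.\<close>
  define u where "u = u0 + mat_scale (- c0 / 2) (mat 1)"
  have uv: "u *v v = u0 *v v + (- c0 / 2) *s v" for v
    by (simp only: u_def matrix_vector_mult_add_rdistrib mat_scale_mult matrix_vector_mul_lid)
  have usp: "\<sigma> (u *v v) w + \<sigma> v (u *v w) = 0" for v w
    using c0[of v w] unfolding uv D by (simp add: algebra_simps)
  have ns: "u \<noteq> mat_scale k (mat 1)" for k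
  proof
    assume "u = mat_scale k (mat 1)"
    then have "u0 = mat_scale (k + c0 / 2) (mat 1)" unfolding u_def
      by (simp add: vec_eq_iff mat_scale_def algebra_simps)
    then show False using u0(2) by (simp add: mats.span_scale mats.span_base)
  qed
  have "\<exists>f g. f holomorphic_on ball 0 e \<and> g holomorphic_on ball 0 e \<and>
         (\<forall>t\<in>ball 0 e. u0 *v \<gamma> t = f t *s \<gamma> t + g t *s vderiv 1 \<gamma> t)"
  proof (rule dec[rule_format, OF open_ball])
    show "u0 *v \<gamma> t \<in> tangent Z (\<gamma> t)" if "t \<in> ball 0 e" for t
      using u0(1) chart_in[OF che that] unfolding aut_def by blast
  qed (use e in auto)
  then obtain f0 g where fg: "f0 holomorphic_on ball 0 e" "g holomorphic_on ball 0 e"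
    "\<forall>t\<in>ball 0 e. u0 *v \<gamma> t = f0 t *s \<gamma> t + g t *s vderiv 1 \<gamma> t" by blast
  define f where "f t = f0 t - c0 / 2" for t
  have f: "f holomorphic_on ball 0 e" unfolding f_def using fg(1) by (intro holomorphic_intros)
  note g = fg(2)
  have eq: "\<forall>t\<in>ball 0 e. u *v \<gamma> t = f t *s \<gamma> t + g t *s vderiv 1 \<gamma> t"
    using fg(3) unfolding uv f_def by (simp add: vec_eq_iff algebra_simps)
  have "\<exists>p q \<delta> d. ode_germ p q Z (\<gamma> 0) \<delta> d"
  proof (cases "g 0 = 0")
    case False
    show ?thesis by (rule regular_point_ode_germ[OF \<sigma> usp cone che e(1) nd0 f g eq False])
  next
    case g0: True
    note J = field_on_jets[OF hol open_ball f g eq 0, unfolded g0]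
    have nil: "shift u (f 0) (shift u (f 0) (shift u (f 0) (shift u (f 0) v))) = 0" if g1: "(deriv ^^ 1) g 0 = 0" for v
    proof (rule flag_annihilated[OF nd0[unfolded nondeg_def]])
      show "u *v \<gamma> 0 = f 0 *s \<gamma> 0" using eq[rule_format, OF 0] g0 by simp
      show "u *v vderiv 1 \<gamma> 0 = (deriv ^^ 1) f 0 *s \<gamma> 0 + f 0 *s vderiv 1 \<gamma> 0" unfolding J(1) g1 by simp
      show "u *v vderiv 2 \<gamma> 0 = (deriv ^^ 2) f 0 *s \<gamma> 0 + (2 * (deriv ^^ 1) f 0 + (deriv ^^ 2) g 0) *s vderiv 1 \<gamma> 0 + f 0 *s vderiv 2 \<gamma> 0"
        unfolding J(2) g1 by simp
      show "u *v vderiv 3 \<gamma> 0 = (deriv ^^ 3) f 0 *s \<gamma> 0 + (3 * (deriv ^^ 2) f 0 + (deriv ^^ 3) g 0) *s vderiv 1 \<gamma> 0 +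
         (3 * (deriv ^^ 1) f 0 + 3 * (deriv ^^ 2) g 0) *s vderiv 2 \<gamma> 0 + f 0 *s vderiv 3 \<gamma> 0"
        unfolding J(3) g1 by simp
    qed
    \<comment> \<open>If g vanished identically, every \<gamma> t would be an eigenvector with
      eigenvalue f t. Nilpotency of u - f 0 forces f to be constant, so u would be a scalar on a
      spanning curve.\<close>
    have "\<exists>t1\<in>ball 0 e. g t1 \<noteq> 0"
    proof (rule ccontr)
      assume "\<not> ?thesis"
      then have gz: "g t = 0" if "t \<in> ball 0 e" for t using that by blast
      have g1: "(deriv ^^ 1) g 0 = 0"
        by (rule DERIV_eq_on_open[OF open_ball 0 gz holomorphic_DERIVs(1)[OF g open_ball 0] DERIV_const])
      have u\<gamma>: "u *v \<gamma> t = f t *s \<gamma> t" if "t \<in> ball 0 e" for t using eq gz that by simp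
      have sh: "shift u (f 0) (\<gamma> t) = (f t - f 0) *s \<gamma> t" if "t \<in> ball 0 e" for t
        unfolding shift_def u\<gamma>[OF that] by (simp add: vec_eq_iff algebra_simps)
      have "f t = f 0" if t: "t \<in> ball 0 e" for t
      proof -
        have "((f t - f 0) ^ 4) *s \<gamma> t + 0 *s vderiv 1 \<gamma> t = 0"
          using nil[OF g1, of "\<gamma> t"] unfolding sh[OF t] shift_linear by (simp add: power4_eq_xxxx)
        then have "(f t - f 0) ^ 4 = 0" using nondeg_lin_indep2[OF nd[rule_format, OF t]] unfolding lin_indep2_def by blast
        then show ?thesis by simp
      qed
      then have "u = mat_scale (f 0) (mat 1)"
        by (intro matrix_eq_on_curve[OF hol open_ball 0 nd0]) (simp add: u\<gamma> mat_scale_mult)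
      then show False using ns by blast
    qed
    then obtain t1 where t1: "t1 \<in> ball 0 e" "g t1 \<noteq> 0" by blast
    have "\<exists>d y s q0 q1 q2 q3. 0 < d \<and> d \<le> e \<and> y holomorphic_on ball 0 d \<and> y 0 \<noteq> 0 \<and> s holomorphic_on ball 0 d \<and> s 0 = 0 \<and>
       (\<forall>t\<in>ball 0 d. \<gamma> t = y t *s (q0 + s t *s q1 + (s t)\<^sup>2 *s q2 + (s t) ^ 3 *s q3))"
    proof (cases "(deriv ^^ 1) g 0 = 0")
      case True
      show ?thesis by (rule multiple_zero_cubic[OF hol e(1) nd f g eq g0 nil[OF True] t1])
    next
      case False
      show ?thesis by (rule simple_zero_cubic[OF hol e(1) nd f g eq g0 False t1])
    qed
    then obtain d y s q0 q1 q2 q3 where d: "0 < d" "d \<le> e" and ys: "y holomorphic_on ball 0 d" "y 0 \<noteq> 0" "s holomorphic_on ball 0 d" "s 0 = 0"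
      "\<forall>t\<in>ball 0 d. \<gamma> t = y t *s (q0 + s t *s q1 + (s t)\<^sup>2 *s q2 + (s t) ^ 3 *s q3)"
      by (elim exE conjE)
    have "chart Z \<gamma> (ball 0 d)" using chart_subset[OF che open_ball subset_ball[OF d(2)]] .
    from cubic_ode_germ[OF cone this d(1) nd0 ys] show ?thesis by blast
  qed
  then show ?thesis unfolding z using ode_germ_normalize by blast
qed

section \<open>The classes and their invariants\<close>

lemma L_class_ode_germ:
  assumes "(Z, z) \<in> L_class r"
  shows "\<exists>\<gamma> e. ode_germ (1 + r\<^sup>2) (- r\<^sup>2) Z z \<gamma> e"
proof -
  have hom: "(Z, z) \<in> homogeneous_germs" and eq: "proj_equiv (model_germ r) (Z, z)"
    using assms unfolding L_class_def by auto
  have "is_cone Z"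
    using hom curveD(1) unfolding homogeneous_germs_def homogeneous_def legendrian_def by blast
  then show ?thesis
    using ode_germ_transport[OF model_ode_germ eq[unfolded model_germ_eq]] by metis
qed

lemma L_classI:
  assumes "(Z, z) \<in> homogeneous_germs" "ode_germ (1 + r\<^sup>2) (- r\<^sup>2) Z z \<gamma> e"
  shows "(Z, z) \<in> L_class r"
  using assms ode_germ_proj_equiv[OF model_ode_germ assms(2)] unfolding L_class_def model_germ_eq by simp

text \<open>If the model germ for r admits a parameter in which it satisfies the equation of s, it
  is equivalent to the model germ for s, and the classes agree by symmetry and transitivity.\<close>

lemma L_class_eqI:
  assumes "ode_germ (1 + s\<^sup>2) (- s\<^sup>2) (cone_over (model_curve r) (ball 0 1)) base_vec \<gamma> e"
  shows "L_class r = L_class s"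
proof -
  have eq: "proj_equiv (model_germ s) (model_germ r)"
    unfolding model_germ_eq by (rule ode_germ_proj_equiv[OF model_ode_germ assms])
  then have eq': "proj_equiv (model_germ r) (model_germ s)" unfolding model_germ_eq by (rule proj_equiv_sym)
  have "proj_equiv (model_germ r) (Z, z) \<longleftrightarrow> proj_equiv (model_germ s) (Z, z)" for Z z
    using eq eq' unfolding model_germ_eq by (blast intro: proj_equiv_trans)
  then show ?thesis unfolding L_class_def by auto
qed

lemma L_class_square:
  assumes "r\<^sup>2 = s\<^sup>2"
  shows "L_class r = L_class s"
  using L_class_eqI[of s r] model_ode_germ[of r] unfolding assms by blast

text \<open>Rescaling the parameter by r divides the exponents 1, -1, r, -r by r, which gives those
  of 1/r.\<close>

lemma L_class_inverse:
  assumes "r \<noteq> 0"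
  shows "L_class r = L_class (1 / r)"
proof -
  have "(1 + r\<^sup>2) / r\<^sup>2 = 1 + (1 / r)\<^sup>2" "- r\<^sup>2 / r ^ 4 = - (1 / r)\<^sup>2"
    using assms by (simp_all add: field_simps power2_eq_square power4_eq_xxxx)
  with ode_germ_scale[OF model_ode_germ assms, of r] show ?thesis by (intro L_class_eqI) (simp only:)
qed

lemma model_in_L_class: "model_germ r \<in> L_class r"
  using model_homogeneous[of r] proj_equiv_refl unfolding L_class_def model_germ_eq by simp

lemma discriminant_factor: "9 * (1 + r\<^sup>2)\<^sup>2 + 100 * (- r\<^sup>2) = (r\<^sup>2 - 9) * (9 * r\<^sup>2 - 1)" for r :: complex
  by (simp add: power2_eq_square algebra_simps)

lemma discriminant_zero_iff: "9 * (1 + r\<^sup>2)\<^sup>2 + 100 * (- r\<^sup>2) = 0 \<longleftrightarrow> r\<^sup>2 = 9 \<or> r\<^sup>2 = 1 / 9" for r :: complex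
proof -
  have "9 * x - 1 = 0 \<longleftrightarrow> x = 1 / 9" for x :: complex
    by (simp add: eq_divide_eq mult.commute)
  then show ?thesis unfolding discriminant_factor mult_eq_0_iff by (simp only: right_minus_eq)
qed

text \<open>Both values name the class of r = 3, so one computation with the pair (10, -9) covers
  them.\<close>

lemma L_class_special:
  assumes "(Z, z) \<in> L_class r" "r\<^sup>2 = 9 \<or> r\<^sup>2 = 1 / 9"
  shows "connected Z \<Longrightarrow> legendrian \<sigma> Z \<Longrightarrow> mat_dim (aut \<sigma> Z) = 4" "rel_inv_zero (Z, z)"
proof -
  have "L_class r = L_class 3"
  proof (cases "r\<^sup>2 = 9")
    case True
    then show ?thesis by (intro L_class_square) simp
  next
    case False
    then have "r\<^sup>2 = (1 / 3)\<^sup>2" using assms(2) by (simp add: power_divide)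
    then have "L_class r = L_class (1 / 3)" by (rule L_class_square)
    then show ?thesis using L_class_inverse[of 3] by simp
  qed
  then obtain \<gamma> e where "ode_germ (1 + 3\<^sup>2) (- (3\<^sup>2)) Z z \<gamma> e" using L_class_ode_germ[of Z z 3] assms(1) by blast
  then have og: "ode_germ 10 (- 9) Z z \<gamma> e" by simp
  show "connected Z \<Longrightarrow> legendrian \<sigma> Z \<Longrightarrow> mat_dim (aut \<sigma> Z) = 4" by (rule aut_twisted_cubic[OF og])
  show "rel_inv_zero (Z, z)" by (rule rel_inv_zeroI[OF og]) simp
qed

text \<open>Two forms for which the curve is Legendrian are proportional. Applied in both
  directions, this makes \<open>aut\<close> independent of the form.\<close>

lemma legendrian_form_unique:
  assumes og: "ode_germ p q Z z \<gamma> e" and leg: "legendrian \<sigma> Z" "legendrian \<tau> Z"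
  shows "csp \<sigma> \<subseteq> csp \<tau>"
proof -
  note g = ode_germD[OF og]
  have s: "symplectic_form \<sigma>" "symplectic_form \<tau>" using leg unfolding legendrian_def by blast+
  have 0: "0 \<in> ball (0::complex) e" using g(1) by simp
  obtain c where c: "\<forall>v w. \<tau> v w = c * \<sigma> v w"
    using const_ode_form_unique[OF s(1) symplectic_alternating[OF s(2)] g(5,7) open_ball
        legendrian_chart[OF leg(1) g(3)] legendrian_chart[OF leg(2) g(3)] 0 g(6)] by blast
  show ?thesis
  proof
    fix u assume "u \<in> csp \<sigma>"
    then obtain k where "\<forall>v w. \<sigma> (u *v v) w + \<sigma> v (u *v w) = k * \<sigma> v w" unfolding csp_def by blast
    then have "\<tau> (u *v v) w + \<tau> v (u *v w) = k * \<tau> v w" for v w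
      unfolding c[rule_format] distrib_left[symmetric] by (simp only: mult.left_commute)
    then show "u \<in> csp \<tau>" unfolding csp_def by blast
  qed
qed

text \<open>The upper bound comes from the determining equations and holds for every form. The lower
  bound is part of homogeneity but concerns some form \<tau>, and is transferred to \<sigma> by
  uniqueness of the form.\<close>

lemma L_class_generic:
  assumes "(Z, z) \<in> L_class r" "r\<^sup>2 \<noteq> 9" "r\<^sup>2 \<noteq> 1 / 9"
  shows "legendrian \<sigma> Z \<Longrightarrow> mat_dim (aut \<sigma> Z) = 2" "rel_inv_nonzero (Z, z)"
    "abs_inv_is (Z, z) ((r\<^sup>2 + 1)\<^sup>2 / ((r\<^sup>2 - 9) * (9 * r\<^sup>2 - 1)))"
proof -
  obtain \<gamma> e where og: "ode_germ (1 + r\<^sup>2) (- r\<^sup>2) Z z \<gamma> e" using L_class_ode_germ[OF assms(1)] by blast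
  have K: "9 * (1 + r\<^sup>2)\<^sup>2 + 100 * (- r\<^sup>2) \<noteq> 0" unfolding discriminant_zero_iff using assms(2,3) by blast
  show "rel_inv_nonzero (Z, z)" by (rule rel_inv_nonzeroI[OF og K])
  show "abs_inv_is (Z, z) ((r\<^sup>2 + 1)\<^sup>2 / ((r\<^sup>2 - 9) * (9 * r\<^sup>2 - 1)))"
    using abs_inv_isI[OF og K] unfolding discriminant_factor by (simp only: add.commute)
  assume leg: "legendrian \<sigma> Z"
  obtain \<tau> where \<tau>: "legendrian \<tau> Z" "2 \<le> mat_dim (aut \<tau> Z)"
    using assms(1) unfolding L_class_def homogeneous_germs_def homogeneous_def by blast
  have "csp \<sigma> = csp \<tau>" using legendrian_form_unique[OF og] leg \<tau>(1) by blast
  then have "aut \<sigma> Z = aut \<tau> Z" unfolding aut_def by simp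
  then show "mat_dim (aut \<sigma> Z) = 2" using \<tau>(2) mat_dim_aut_le_2[OF og K, of \<sigma>] by simp
qed

text \<open>The predicates on invariants quantify over all Laguerre-Forsyth forms; a form that
  exists and a point where it is nonzero are what make the value well determined.\<close>

lemma abs_inv_unique:
  assumes "laguerre_forsyth g \<noteq> {}" "rel_inv_nonzero g" "abs_inv_is g v" "abs_inv_is g w"
  shows "v = w"
  using assms unfolding rel_inv_nonzero_def abs_inv_is_def by fastforce

text \<open>The model germ for r lies in both classes, so its invariants can be computed in two
  ways. Vanishing of q separates the twisted cubic; otherwise the two values of the absolute
  invariant must agree.\<close>

lemma L_class_eq_imp:
  assumes eq: "L_class r = L_class s" and ne: "r\<^sup>2 \<noteq> s\<^sup>2"
  shows "r\<^sup>2 * s\<^sup>2 = 1"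
proof -
  let ?Z = "cone_over (model_curve r) (ball 0 1)"
  have mr: "(?Z, base_vec) \<in> L_class r" using model_in_L_class[of r] unfolding model_germ_eq .
  then have ms: "(?Z, base_vec) \<in> L_class s" unfolding eq .
  have LF: "laguerre_forsyth (?Z, base_vec) \<noteq> {}" by (rule laguerre_forsyth_nonempty[OF model_ode_germ])
  then have excl: "\<not> (rel_inv_zero (?Z, base_vec) \<and> rel_inv_nonzero (?Z, base_vec))"
    unfolding rel_inv_zero_def rel_inv_nonzero_def by fastforce
  show ?thesis
  proof (cases "r\<^sup>2 = 9 \<or> r\<^sup>2 = 1 / 9")
    case True
    then have "rel_inv_zero (?Z, base_vec)" using L_class_special(2)[OF mr] by blast
    then have "s\<^sup>2 = 9 \<or> s\<^sup>2 = 1 / 9" using L_class_generic(2)[OF ms] excl by blast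
    then have "r\<^sup>2 = 9 \<and> s\<^sup>2 = 1 / 9 \<or> r\<^sup>2 = 1 / 9 \<and> s\<^sup>2 = 9" using True ne by metis
    then show ?thesis by (elim disjE conjE) (simp_all only:, simp_all)
  next
    case False
    then have nz: "rel_inv_nonzero (?Z, base_vec)" using L_class_generic(2)[OF mr] by blast
    then have S: "s\<^sup>2 \<noteq> 9" "s\<^sup>2 \<noteq> 1 / 9" using L_class_special(2)[OF ms] excl by blast+
    have "(r\<^sup>2 + 1)\<^sup>2 / ((r\<^sup>2 - 9) * (9 * r\<^sup>2 - 1)) = (s\<^sup>2 + 1)\<^sup>2 / ((s\<^sup>2 - 9) * (9 * s\<^sup>2 - 1))"
      using abs_inv_unique[OF LF nz] L_class_generic(3)[OF mr] L_class_generic(3)[OF ms S] False by blast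
    moreover have denom: "(r\<^sup>2 - 9) * (9 * r\<^sup>2 - 1) \<noteq> 0" "(s\<^sup>2 - 9) * (9 * s\<^sup>2 - 1) \<noteq> 0"
      using False S discriminant_zero_iff[of r] discriminant_zero_iff[of s] unfolding discriminant_factor by blast+
    ultimately have "(r\<^sup>2 + 1)\<^sup>2 * ((s\<^sup>2 - 9) * (9 * s\<^sup>2 - 1)) = (s\<^sup>2 + 1)\<^sup>2 * ((r\<^sup>2 - 9) * (9 * r\<^sup>2 - 1))"
      unfolding frac_eq_eq[OF denom] by blast
    \<comment> \<open>With (a - 9)(9a - 1) = 9 (a + 1)^2 - 100 a the terms with factor 9 cancel, and
      100 (a (b + 1)^2 - b (a + 1)^2) factors as stated.\<close>
    moreover have "(a + 1)\<^sup>2 * ((b - 9) * (9 * b - 1)) - (b + 1)\<^sup>2 * ((a - 9) * (9 * a - 1)) = 100 * (b - a) * (a * b - 1)" for a b :: complex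
      by (simp add: power2_eq_square algebra_simps)
    ultimately have "100 * (s\<^sup>2 - r\<^sup>2) * (r\<^sup>2 * s\<^sup>2 - 1) = 0" by (metis diff_self)
    then show ?thesis using ne by simp
  qed
qed

theorem theorem2p8:
  shows
    "(\<forall>r. model_germ r \<in> homogeneous_germs) \<and>
     (\<forall>r s. r\<^sup>2 = s\<^sup>2 \<longrightarrow> L_class r = L_class s) \<and>
     (\<forall>r. r \<noteq> 0 \<longrightarrow> L_class r = L_class (1 / r)) \<and>
     (\<forall>g \<in> homogeneous_germs. \<exists>r. g \<in> L_class r) \<and>
     (\<forall>g \<in> homogeneous_germs. laguerre_forsyth g \<noteq> {}) \<and>
     (\<forall>r. r\<^sup>2 = 9 \<or> r\<^sup>2 = 1 / 9 \<longrightarrow>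
        (\<forall>(Z, z) \<in> L_class r.
           (\<forall>\<sigma>. connected Z \<and> legendrian \<sigma> Z \<longrightarrow> mat_dim (aut \<sigma> Z) = 4) \<and>
           rel_inv_zero (Z, z))) \<and>
     (\<forall>r. r\<^sup>2 \<notin> {0, 1 / 9, 1, 9} \<longrightarrow>
        (\<forall>(Z, z) \<in> L_class r.
           (\<forall>\<sigma>. legendrian \<sigma> Z \<longrightarrow> mat_dim (aut \<sigma> Z) = 2) \<and>
           rel_inv_nonzero (Z, z) \<and>
           abs_inv_is (Z, z) ((r\<^sup>2 + 1)\<^sup>2 / ((r\<^sup>2 - 9) * (9 * r\<^sup>2 - 1))))) \<and>
     (\<forall>r. r\<^sup>2 = 1 \<longrightarrow>
        (\<forall>(Z, z) \<in> L_class r.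
           (\<forall>\<sigma>. legendrian \<sigma> Z \<longrightarrow> mat_dim (aut \<sigma> Z) = 2) \<and>
           rel_inv_nonzero (Z, z) \<and>
           abs_inv_is (Z, z) (- 1 / 16))) \<and>
     (\<forall>r. r\<^sup>2 = 0 \<longrightarrow>
        (\<forall>(Z, z) \<in> L_class r.
           (\<forall>\<sigma>. legendrian \<sigma> Z \<longrightarrow> mat_dim (aut \<sigma> Z) = 2) \<and>
           rel_inv_nonzero (Z, z) \<and>
           abs_inv_is (Z, z) (1 / 9))) \<and>
     (\<forall>r s. r\<^sup>2 \<noteq> s\<^sup>2 \<longrightarrow> (L_class r = L_class s \<longleftrightarrow> r\<^sup>2 * s\<^sup>2 = 1))"
proof (intro conjI allI ballI impI)
  show "model_germ r \<in> homogeneous_germs" for r by (rule model_homogeneous)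
  show "L_class r = L_class s" if "r\<^sup>2 = s\<^sup>2" for r s by (rule L_class_square[OF that])
  show "L_class r = L_class (1 / r)" if "r \<noteq> 0" for r by (rule L_class_inverse[OF that])
  show "\<exists>r. g \<in> L_class r" "laguerre_forsyth g \<noteq> {}" if hg: "g \<in> homogeneous_germs" for g
  proof -
    obtain Z z where g: "g = (Z, z)" by fastforce
    obtain r \<gamma> e where og: "ode_germ (1 + r\<^sup>2) (- r\<^sup>2) Z z \<gamma> e"
      using homogeneous_ode_germ hg unfolding g by blast
    show "\<exists>r. g \<in> L_class r" using L_classI[OF _ og] hg unfolding g by blast
    show "laguerre_forsyth g \<noteq> {}" unfolding g by (rule laguerre_forsyth_nonempty[OF og])
  qed
  show "case x of (Z, z) \<Rightarrow> (\<forall>\<sigma>. connected Z \<and> legendrian \<sigma> Z \<longrightarrow> mat_dim (aut \<sigma> Z) = 4) \<and> rel_inv_zero (Z, z)"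
    if "r\<^sup>2 = 9 \<or> r\<^sup>2 = 1 / 9" "x \<in> L_class r" for r x
    using L_class_special[OF _ that(1)] that(2) by (cases x) auto
  \<comment> \<open>The values r^2 = 0 and r^2 = 1 are covered as well: the formula gives
    1/((-9)(-1)) = 1/9 and 4/((-8) 8) = -1/16.\<close>
  have gen: "case x of (Z, z) \<Rightarrow> (\<forall>\<sigma>. legendrian \<sigma> Z \<longrightarrow> mat_dim (aut \<sigma> Z) = 2) \<and>
      rel_inv_nonzero (Z, z) \<and> abs_inv_is (Z, z) ((r\<^sup>2 + 1)\<^sup>2 / ((r\<^sup>2 - 9) * (9 * r\<^sup>2 - 1)))"
    if "r\<^sup>2 \<noteq> 9" "r\<^sup>2 \<noteq> 1 / 9" "x \<in> L_class r" for r x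
    using L_class_generic[OF _ that(1,2)] that(3) by (cases x) auto
  show "case x of (Z, z) \<Rightarrow> (\<forall>\<sigma>. legendrian \<sigma> Z \<longrightarrow> mat_dim (aut \<sigma> Z) = 2) \<and>
      rel_inv_nonzero (Z, z) \<and> abs_inv_is (Z, z) ((r\<^sup>2 + 1)\<^sup>2 / ((r\<^sup>2 - 9) * (9 * r\<^sup>2 - 1)))"
    if "r\<^sup>2 \<notin> {0, 1 / 9, 1, 9}" "x \<in> L_class r" for r x
    using that by (intro gen) auto
  show "case x of (Z, z) \<Rightarrow> (\<forall>\<sigma>. legendrian \<sigma> Z \<longrightarrow> mat_dim (aut \<sigma> Z) = 2) \<and>
      rel_inv_nonzero (Z, z) \<and> abs_inv_is (Z, z) (- 1 / 16)" if "r\<^sup>2 = 1" "x \<in> L_class r" for r x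
    using gen[OF _ _ that(2)] unfolding that(1) by simp
  show "case x of (Z, z) \<Rightarrow> (\<forall>\<sigma>. legendrian \<sigma> Z \<longrightarrow> mat_dim (aut \<sigma> Z) = 2) \<and>
      rel_inv_nonzero (Z, z) \<and> abs_inv_is (Z, z) (1 / 9)" if "r\<^sup>2 = 0" "x \<in> L_class r" for r x
    using gen[OF _ _ that(2)] unfolding that(1) by simp
  show "L_class r = L_class s \<longleftrightarrow> r\<^sup>2 * s\<^sup>2 = 1" if "r\<^sup>2 \<noteq> s\<^sup>2" for r s
  proof
    assume "L_class r = L_class s"
    then show "r\<^sup>2 * s\<^sup>2 = 1" using that by (rule L_class_eq_imp)
  next
    assume rs: "r\<^sup>2 * s\<^sup>2 = 1"
    then have r: "r \<noteq> 0" by auto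
    then have "s\<^sup>2 = (1 / r)\<^sup>2" using rs by (simp add: power_divide field_simps)
    then show "L_class r = L_class s" using L_class_inverse[OF r] L_class_square by metis
  qed
qed

end
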